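(* Let $\alpha>0$, $\beta\ge0$, $\gamma,\delta,\nu>0$, and let $\vec f\in H^{\frac\beta2}(\mathbb{R}^3)$ be a divergence-free external force. Then there exists at least one solution $\vec U\in H^{\frac{\alpha+\beta}2}(\mathbb{R}^3)$ of the stationary equation $$\nu(-\Delta)^{\frac\alpha2}\vec U+(I_d-\delta^2\Delta)^{-\frac\beta2}\mathbb{P}\,\mathrm{div}(\vec U\otimes\vec U)=\vec f-\gamma\vec U,\qquad\mathrm{div}(\vec U)=0,$$ which satisfies the energy estimate $$\|\vec U\|_{H^{\frac{\alpha+\beta}2}}\le\frac{\mathbf b}{\mathbf a\,\mathbf c}\,\|\vec f\|_{H^{\frac\beta2}} .$$
   Context: All function spaces are spaces of $\mathbb{R}^3$-valued functions on $\mathbb{R}^3$. $\mathbb{P}(\vec\varphi)=\vec\varphi-\vec\nabla\frac1\Delta(\mathrm{div}\,\vec\varphi)$ is the Leray projector; fractional operators are Fourier multipliers. Solutions are understood in the weak (distributional) sense. Constants: $\mathbf a=\min(1,\delta^\beta)$, $\mathbf b=\max(1,\delta^\beta)$, $\mathbf c=m_\alpha\min(\gamma,\nu)$ with $m_\alpha=\inf_{\xi\in\mathbb{R}^3}\frac{1+|\xi|^\alpha}{(1+|\xi|^2)^{\alpha/2}}$ (a finite positive number). *)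

theory Defs
  imports "HOL-Analysis.Analysis"
begin

text \<open>
  Tempered distributions on R^3 are represented by functionals on functions R^3 to C that are
  only ever compared on Schwartz functions. All operators on distributions act by duality on the
  test function.
\<close>

subsection \<open>Schwartz functions and Fourier multipliers\<close>

definition partial :: "3 \<Rightarrow> (real^3 \<Rightarrow> complex) \<Rightarrow> real^3 \<Rightarrow> complex" where
  "partial i \<phi> = (\<lambda>x. frechet_derivative \<phi> (at x) (axis i 1))"

definition schwartz :: "(real^3 \<Rightarrow> complex) \<Rightarrow> bool" where
  "schwartz \<phi> \<longleftrightarrow> (\<forall>is. (\<forall>x. foldr partial is \<phi> differentiable at x) \<and>
     (\<forall>k::nat. bounded (range (\<lambda>x. norm x ^ k *\<^sub>R foldr partial is \<phi> x))))"

definition fourier :: "(real^3 \<Rightarrow> complex) \<Rightarrow> real^3 \<Rightarrow> complex" where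
  "fourier \<phi> = (\<lambda>\<xi>. LINT x|lebesgue. exp (- \<i> * of_real (x \<bullet> \<xi>)) * \<phi> x)"

definition fourier_multiplier ::
    "(real^3 \<Rightarrow> real) \<Rightarrow> (real^3 \<Rightarrow> complex) \<Rightarrow> real^3 \<Rightarrow> complex" where
  "fourier_multiplier m \<phi> = (\<lambda>x. of_real (1 / (2 * pi) ^ 3) *
     (LINT \<xi>|lebesgue. exp (\<i> * of_real (x \<bullet> \<xi>)) * of_real (m \<xi>) * fourier \<phi> \<xi>))"

subsection \<open>Square-integrable vector fields and Sobolev spaces\<close>

definition in_L2 :: "(real^3 \<Rightarrow> 'a::euclidean_space) \<Rightarrow> bool" where
  "in_L2 u \<longleftrightarrow> u \<in> borel_measurable lebesgue \<and> integrable lebesgue (\<lambda>x. (norm (u x))\<^sup>2)"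

definition L2_norm :: "(real^3 \<Rightarrow> 'a::euclidean_space) \<Rightarrow> real" where
  "L2_norm u = sqrt (LINT x|lebesgue. (norm (u x))\<^sup>2)"

text \<open>
  The Fourier transform of a square-integrable field (which need not be integrable) is determined,
  up to null sets, by duality with Schwartz functions; it exists by Plancherel's theorem.
\<close>

definition is_fourier_L2 :: "(real^3 \<Rightarrow> real^3) \<Rightarrow> (real^3 \<Rightarrow> complex^3) \<Rightarrow> bool" where
  "is_fourier_L2 u g \<longleftrightarrow> in_L2 u \<and> in_L2 g \<and>
     (\<forall>i \<phi>. schwartz \<phi> \<longrightarrow>
        (LINT \<xi>|lebesgue. g \<xi> $ i * \<phi> \<xi>) = (LINT x|lebesgue. of_real (u x $ i) * fourier \<phi> x))"

definition fourier_L2 :: "(real^3 \<Rightarrow> real^3) \<Rightarrow> real^3 \<Rightarrow> complex^3" where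
  "fourier_L2 u = (SOME g. is_fourier_L2 u g)"

definition bessel_weight :: "real \<Rightarrow> (real^3 \<Rightarrow> complex^3) \<Rightarrow> real^3 \<Rightarrow> complex^3" where
  "bessel_weight s g = (\<lambda>\<xi>. (1 + (norm \<xi>)\<^sup>2) powr (s / 2) *\<^sub>R g \<xi>)"

text \<open>
  The space of order s for nonnegative s, as a subspace of the square-integrable fields. The
  constant in the norm makes the order-zero norm equal to the norm of square-integrable fields.
\<close>

definition sobolev :: "real \<Rightarrow> (real^3 \<Rightarrow> real^3) \<Rightarrow> bool" where
  "sobolev s u \<longleftrightarrow> in_L2 u \<and> (\<exists>g. is_fourier_L2 u g \<and> in_L2 (bessel_weight s g))"

definition sobolev_norm :: "real \<Rightarrow> (real^3 \<Rightarrow> real^3) \<Rightarrow> real" where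
  "sobolev_norm s u = (2 * pi) powr (- 3 / 2) * L2_norm (bessel_weight s (fourier_L2 u))"

subsection \<open>Distributions\<close>

type_synonym distr = "(real^3 \<Rightarrow> complex) \<Rightarrow> complex"

definition distr_of :: "(real^3 \<Rightarrow> real) \<Rightarrow> distr" where
  "distr_of u = (\<lambda>\<phi>. LINT x|lebesgue. of_real (u x) * \<phi> x)"

definition vdistr_of :: "(real^3 \<Rightarrow> real^3) \<Rightarrow> distr^3" where
  "vdistr_of u = (\<chi> i. distr_of (\<lambda>x. u x $ i))"

definition tensor_distr :: "(real^3 \<Rightarrow> real^3) \<Rightarrow> (real^3 \<Rightarrow> real^3) \<Rightarrow> distr^3^3" where
  "tensor_distr u v = (\<chi> i j. distr_of (\<lambda>x. u x $ i * v x $ j))"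

definition partial_distr :: "3 \<Rightarrow> distr \<Rightarrow> distr" where
  "partial_distr i T = (\<lambda>\<phi>. - T (partial i \<phi>))"

definition grad_distr :: "distr \<Rightarrow> distr^3" where
  "grad_distr T = (\<chi> i. partial_distr i T)"

definition div_distr :: "distr^3 \<Rightarrow> distr" where
  "div_distr T = (\<lambda>\<phi>. \<Sum>i\<in>UNIV. partial_distr i (T $ i) \<phi>)"

definition tensor_div_distr :: "distr^3^3 \<Rightarrow> distr^3" where
  "tensor_div_distr T = (\<chi> i. div_distr (T $ i))"

text \<open>
  The transpose of the multiplier with symbol \<open>m\<close> is the multiplier with the reflected symbol.
  The functional \<open>T\<close> is evaluated at a function that is not a Schwartz function when \<open>m\<close> is singular
  at the origin. In the equation below this is harmless: the singular multipliers are applied to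
  Schwartz functions only, so all Fourier integrals converge absolutely, and the results are
  square-integrable where they are paired with U and smooth and bounded with all their derivatives
  where they are paired with the integrable entries of the tensor product.
\<close>

definition multiplier_distr :: "(real^3 \<Rightarrow> real) \<Rightarrow> distr \<Rightarrow> distr" where
  "multiplier_distr m T = (\<lambda>\<phi>. T (fourier_multiplier (\<lambda>\<xi>. m (- \<xi>)) \<phi>))"

definition frac_laplacian :: "real \<Rightarrow> distr^3 \<Rightarrow> distr^3" \<comment> \<open>\<open>(-\<Delta>)\<close> to the power \<open>s\<close>\<close> where
  "frac_laplacian s T = (\<chi> i. multiplier_distr (\<lambda>\<xi>. norm \<xi> powr (2 * s)) (T $ i))"

definition bessel_op :: "real \<Rightarrow> real \<Rightarrow> distr^3 \<Rightarrow> distr^3"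
    \<comment> \<open>\<open>I - \<delta>\<^sup>2 \<Delta>\<close> to the power \<open>s\<close>\<close> where
  "bessel_op \<delta> s T = (\<chi> i. multiplier_distr (\<lambda>\<xi>. (1 + \<delta>\<^sup>2 * (norm \<xi>)\<^sup>2) powr s) (T $ i))"

definition inv_laplacian :: "distr \<Rightarrow> distr" where
  "inv_laplacian T = multiplier_distr (\<lambda>\<xi>. - 1 / (norm \<xi>)\<^sup>2) T"

definition leray :: "distr^3 \<Rightarrow> distr^3" where
  "leray T = (\<chi> i. (\<lambda>\<phi>. (T $ i) \<phi> - (grad_distr (inv_laplacian (div_distr T)) $ i) \<phi>))"

definition divergence_free :: "(real^3 \<Rightarrow> real^3) \<Rightarrow> bool" where
  "divergence_free u \<longleftrightarrow> (\<forall>\<phi>. schwartz \<phi> \<longrightarrow> div_distr (vdistr_of u) \<phi> = 0)"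

definition stationary_equation ::
    "real \<Rightarrow> real \<Rightarrow> real \<Rightarrow> real \<Rightarrow> real \<Rightarrow> (real^3 \<Rightarrow> real^3) \<Rightarrow> (real^3 \<Rightarrow> real^3) \<Rightarrow> bool" where
  "stationary_equation \<alpha> \<beta> \<gamma> \<delta> \<nu> f U \<longleftrightarrow>
     (\<forall>i \<phi>. schwartz \<phi> \<longrightarrow>
        of_real \<nu> * (frac_laplacian (\<alpha> / 2) (vdistr_of U) $ i) \<phi>
        + (bessel_op \<delta> (- \<beta> / 2) (leray (tensor_div_distr (tensor_distr U U))) $ i) \<phi>
        = (vdistr_of f $ i) \<phi> - of_real \<gamma> * (vdistr_of U $ i) \<phi>)"

definition m_const :: "real \<Rightarrow> real" where
  "m_const \<alpha> = (INF \<xi>::real^3. (1 + norm \<xi> powr \<alpha>) / (1 + (norm \<xi>)\<^sup>2) powr (\<alpha> / 2))"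

end

theory Submission
  imports Defs "HOL-Probability.Probability" "HOL-Library.Diagonal_Subsequence"
begin

text \<open>
  Apply \<open>1 - \<delta>\<^sup>2 \<Delta>\<close> to the power \<open>\<beta>/2\<close> to the equation: the nonlinearity becomes the bare projected
  convection term, which is orthogonal to \<open>U\<close>, and testing with \<open>U\<close> gives the energy bound. The
  Galerkin systems spanned by finitely many rapidly decreasing solenoidal fields inherit this
  cancellation, hence are solvable by Brouwer's theorem with the same bound. A weak limit is taken on
  the Fourier side; since \<open>\<alpha> + \<beta> > 0\<close>, bounded sets of the energy space are locally precompact in
  square norm, which passes the quadratic term to the limit. The test fields are the solenoidal
  projections of \<open>exp(-|\<xi>|\<^sup>2 + i q \<cdot> \<xi>)\<close> for a countable dense set of \<open>q\<close>, so injectivity of the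
  Fourier transform turns the limit equation into a pointwise identity between Fourier transforms.
\<close>

section \<open>Integration on Euclidean space\<close>

text \<open>When \<alpha> + \<beta> is small the solution is barely better than square-integrable,
  so its tensor square is merely integrable. Hence the derivative in the convection term always
  falls on the test field, and the cancellation is used only for the finite-dimensional
  approximations, which are smooth; the limit inherits the energy bound because norms are weakly
  lower semicontinuous. On the other hand the transform of an integrable function is bounded, so it
  may be multiplied by the Leray symbol although that symbol jumps at the origin. Because of this
  jump the projected test fields are not Schwartz functions: the working class on the Fourier side
  is rapid decrease without smoothness.

  The constants come from the symbol (1 + \<delta>^2 |\<xi>|^2)^(\<beta>/2) (\<nu> |\<xi>|^\<alpha>
  + \<gamma>) of the transformed linear part. Replacing \<delta> by 1 in the first factor costs a
  from below in the quadratic form and b from above in the force; the second factor is at least c (1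
  + |\<xi>|^2)^(\<alpha>/2). Dividing gives b / (a c).\<close>

lemma
  fixes f :: "'a::euclidean_space \<Rightarrow> real \<Rightarrow> 'c::{real_normed_field,banach,second_countable_topology}"
  assumes f: "\<And>b. b \<in> Basis \<Longrightarrow> integrable lborel (f b)"
  shows integrable_lborel_prod_Basis: "integrable lborel (\<lambda>x::'a. \<Prod>b\<in>Basis. f b (x \<bullet> b))"
    and integral_lborel_prod_Basis:
      "(LINT x|lborel. (\<Prod>b\<in>Basis. f b (x \<bullet> b))) = (\<Prod>b\<in>Basis. LINT s|lborel. f b s)"
proof -
  interpret product_sigma_finite "\<lambda>_::'a. lborel :: real measure" ..
  have fm: "f b \<in> borel_measurable borel" if "b \<in> Basis" for b
    using borel_measurable_integrable[OF f[OF that]] by simp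
  have m: "(\<lambda>x::'a. \<Prod>b\<in>Basis. f b (x \<bullet> b)) \<in> borel_measurable borel"
    by (intro borel_measurable_prod measurable_compose[OF _ fm]) auto
  have e: "(\<Prod>b\<in>Basis. f b ((\<Sum>b\<in>Basis. g b *\<^sub>R b) \<bullet> b)) = (\<Prod>b\<in>Basis. f b (g b))" for g :: "'a \<Rightarrow> real"
    by (intro prod.cong refl) simp
  show "integrable lborel (\<lambda>x::'a. \<Prod>b\<in>Basis. f b (x \<bullet> b))"
    unfolding lborel_eq[where 'a='a]
    by (subst integrable_distr_eq[OF _ m]) (auto simp: e intro!: product_integrable_prod f)
  show "(LINT x|lborel. (\<Prod>b\<in>Basis. f b (x \<bullet> b))) = (\<Prod>b\<in>Basis. LINT s|lborel. f b s)"
    unfolding lborel_eq[where 'a='a]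
    by (subst integral_distr[OF _ m]) (auto simp: e intro!: product_integral_prod f)
qed

text \<open>Measurability of \<open>f\<close> is not assumed: a composite with an invertible affine
  map is measurable only if \<open>f\<close> is, and where integrability fails both integrals are 0
  by convention.\<close>

lemma
  fixes f :: "'a::euclidean_space \<Rightarrow> 'b::{banach,second_countable_topology}"
  assumes "c \<noteq> 0"
  shows integrable_lborel_affine_iff: "integrable lborel (\<lambda>x. f (t + c *\<^sub>R x)) \<longleftrightarrow> integrable lborel f"
    and integral_lborel_affine: "(LINT x|lborel. f (t + c *\<^sub>R x)) = (LINT x|lborel. f x) /\<^sub>R \<bar>c\<bar> ^ DIM('a)"
proof -
  have m: "f \<in> borel_measurable borel" if "(\<lambda>x. f (t + c *\<^sub>R x)) \<in> borel_measurable borel"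
  proof -
    have "(\<lambda>y. (\<lambda>x. f (t + c *\<^sub>R x)) ((y - t) /\<^sub>R c)) \<in> borel_measurable borel"
      by (rule measurable_compose[OF _ that]) simp
    then show ?thesis using assms by simp
  qed
  have m': "(\<lambda>x. f (t + c *\<^sub>R x)) \<in> borel_measurable borel" if "f \<in> borel_measurable borel"
    by (rule measurable_compose[OF _ that]) simp
  have L: "integrable lborel f \<longleftrightarrow> integrable lborel (\<lambda>x. f (t + c *\<^sub>R x))"
          "(LINT x|lborel. f x) = \<bar>c\<bar> ^ DIM('a) *\<^sub>R (LINT x|lborel. f (t + c *\<^sub>R x))"
    if f[measurable]: "f \<in> borel_measurable borel"
  proof -
    have "integrable lborel f \<longleftrightarrow> integrable (density (distr lborel borel (\<lambda>x. t + c *\<^sub>R x)) (\<lambda>_. \<bar>c\<bar> ^ DIM('a))) f"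
      using lborel_affine[OF assms, of t] by simp
    also have "\<dots> \<longleftrightarrow> integrable lborel (\<lambda>x. \<bar>c\<bar> ^ DIM('a) *\<^sub>R f (t + c *\<^sub>R x))"
      by (subst integrable_density) (auto simp: integrable_distr_eq)
    also have "\<dots> \<longleftrightarrow> integrable lborel (\<lambda>x. f (t + c *\<^sub>R x))"
    proof
      assume i: "integrable lborel (\<lambda>x. \<bar>c\<bar> ^ DIM('a) *\<^sub>R f (t + c *\<^sub>R x))"
      have eq: "f (t + c *\<^sub>R x) = inverse (\<bar>c\<bar> ^ DIM('a)) *\<^sub>R \<bar>c\<bar> ^ DIM('a) *\<^sub>R f (t + c *\<^sub>R x)" for x
        using assms by simp
      show "integrable lborel (\<lambda>x. f (t + c *\<^sub>R x))"
        by (subst eq) (rule integrable_scaleR_right[OF i])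
    qed (rule integrable_scaleR_right)
    finally show "integrable lborel f \<longleftrightarrow> integrable lborel (\<lambda>x. f (t + c *\<^sub>R x))" .
    have "(LINT x|lborel. f x) = (LINT x|density (distr lborel borel (\<lambda>x. t + c *\<^sub>R x)) (\<lambda>_. \<bar>c\<bar> ^ DIM('a)). f x)"
      using lborel_affine[OF assms, of t] by simp
    also have "\<dots> = (LINT x|lborel. \<bar>c\<bar> ^ DIM('a) *\<^sub>R f (t + c *\<^sub>R x))"
      by (subst integral_density) (auto simp: integral_distr)
    finally show "(LINT x|lborel. f x) = \<bar>c\<bar> ^ DIM('a) *\<^sub>R (LINT x|lborel. f (t + c *\<^sub>R x))"
      by simp
  qed
  show i: "integrable lborel (\<lambda>x. f (t + c *\<^sub>R x)) \<longleftrightarrow> integrable lborel f"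
  proof (cases "f \<in> borel_measurable borel")
    case True
    then show ?thesis using L(1) by simp
  next
    case False
    then have "f \<notin> borel_measurable lborel" by simp
    moreover have "(\<lambda>x. f (t + c *\<^sub>R x)) \<notin> borel_measurable lborel"
    proof
      assume "(\<lambda>x. f (t + c *\<^sub>R x)) \<in> borel_measurable lborel"
      then have "(\<lambda>x. f (t + c *\<^sub>R x)) \<in> borel_measurable borel" by simp
      with m False show False by blast
    qed
    ultimately show ?thesis using borel_measurable_integrable by blast
  qed
  show "(LINT x|lborel. f (t + c *\<^sub>R x)) = (LINT x|lborel. f x) /\<^sub>R \<bar>c\<bar> ^ DIM('a)"
  proof (cases "f \<in> borel_measurable borel")
    case True
    have "\<bar>c\<bar> ^ DIM('a) \<noteq> 0" using assms by simp
    then show ?thesis by (subst L(2)[OF True]) (simp only: scaleR_scaleR, simp)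
  next
    case False
    then have n: "\<not> integrable lborel f" using borel_measurable_integrable[of lborel f] by auto
    then have n': "\<not> integrable lborel (\<lambda>x. f (t + c *\<^sub>R x))" using i by blast
    show ?thesis unfolding not_integrable_integral_eq[OF n] not_integrable_integral_eq[OF n'] by simp
  qed
qed

lemma
  fixes f :: "'a::euclidean_space \<Rightarrow> 'b::{banach,second_countable_topology}"
  shows integrable_lborel_translate_iff: "integrable lborel (\<lambda>x. f (t + x)) \<longleftrightarrow> integrable lborel f"
    and integral_lborel_translate: "(LINT x|lborel. f (t + x)) = (LINT x|lborel. f x)"
    and integrable_lborel_reflect_iff: "integrable lborel (\<lambda>x. f (- x)) \<longleftrightarrow> integrable lborel f"
    and integral_lborel_reflect: "(LINT x|lborel. f (- x)) = (LINT x|lborel. f x)"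
  using integrable_lborel_affine_iff[of 1 f t] integral_lborel_affine[of 1 f t]
        integrable_lborel_affine_iff[of "-1" f 0] integral_lborel_affine[of "-1" f 0]
  by simp_all

lemma integrable_inverse_square_real: "integrable lborel (\<lambda>s::real. 1 / (1 + s\<^sup>2))"
proof -
  have "set_integrable lborel (einterval (-\<infinity>) \<infinity>) (\<lambda>s::real. inverse (1 + s\<^sup>2))"
    by (rule integrable_inverse_1_plus_square)
  then show ?thesis by (simp add: set_integrable_def inverse_eq_divide)
qed

section \<open>The Gaussian and the heat kernel\<close>

definition gauss :: "real \<Rightarrow> 'a::euclidean_space \<Rightarrow> real" where
  "gauss t x = exp (- t * (norm x)\<^sup>2 / 2)"

text \<open>The normal density with variance \<open>t\<close> in each coordinate. It is the
  transform of \<open>gauss t\<close> up to (2 pi)^n (\<open>ift_gauss\<close>), so damping by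
  \<open>gauss t\<close> on one side is averaging with \<open>heat t\<close> on the other.\<close>

definition heat :: "real \<Rightarrow> 'a::euclidean_space \<Rightarrow> real" where
  "heat t x = (1 / sqrt (2 * pi * t)) ^ DIM('a) * exp (- (norm x)\<^sup>2 / (2 * t))"

text \<open>The inverse transform without its factor \<open>(2\<pi>)\<^sup>-\<^sup>n\<close>, so that \<open>fourier \<phi> \<xi> = ift \<phi> (-\<xi>)\<close>.\<close>

definition ift :: "('a::euclidean_space \<Rightarrow> complex) \<Rightarrow> 'a \<Rightarrow> complex" where
  "ift g x = (LINT \<xi>|lborel. cis (x \<bullet> \<xi>) * g \<xi>)"

lemma norm_cis_mult [simp]: "cmod (cis t * z) = cmod z"
  by (simp add: norm_mult)

lemma cis_borel_measurable [measurable]: "f \<in> borel_measurable M \<Longrightarrow> (\<lambda>x. cis (f x)) \<in> borel_measurable M"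
  by (rule borel_measurable_continuous_on[where f=cis]) (auto intro!: continuous_intros simp: cis_conv_exp)

lemma borel_measurable_cnj:
  assumes "f \<in> borel_measurable M" shows "(\<lambda>x. cnj (f x)) \<in> borel_measurable M"
  by (rule measurable_compose[OF assms borel_measurable_continuous_onI[OF continuous_on_cnj[OF continuous_on_id]]])

lemma norm_squared_eq_sum_Basis: "(norm (x::'a::euclidean_space))\<^sup>2 = (\<Sum>b\<in>Basis. (x \<bullet> b)\<^sup>2)"
  unfolding power2_norm_eq_inner by (subst euclidean_inner) (simp add: power2_eq_square)

lemma gauss_pos [simp]: "gauss t x > 0" by (simp add: gauss_def)
lemma gauss_nonneg [simp]: "gauss t x \<ge> 0" by (simp add: gauss_def)
lemma gauss_le_1 [simp]: "t \<ge> 0 \<Longrightarrow> gauss t x \<le> 1" by (simp add: gauss_def)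
lemma gauss_minus [simp]: "gauss t (- x) = gauss t x" by (simp add: gauss_def)
lemma gauss_measurable [measurable]: "gauss t \<in> borel_measurable borel"
  unfolding gauss_def[abs_def] by measurable
lemma heat_nonneg [simp]: "t > 0 \<Longrightarrow> heat t x \<ge> 0" by (simp add: heat_def)
lemma heat_measurable [measurable]: "heat t \<in> borel_measurable borel"
  unfolding heat_def[abs_def] by measurable

lemma gauss_eq_prod: "gauss t x = (\<Prod>b\<in>Basis. exp (- t * (x \<bullet> b)\<^sup>2 / 2))"
  unfolding gauss_def norm_squared_eq_sum_Basis exp_sum[OF finite_Basis, symmetric]
  by (simp add: sum_distrib_left sum_divide_distrib sum_negf)

text \<open>The substitution of s / sqrt t for s reduces both claims to the characteristic function
  of the standard normal law.\<close>

lemma fourier_gauss_real: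
  fixes y t :: real
  assumes "t > 0"
  shows "integrable lborel (\<lambda>s. cis (y * s) * of_real (exp (- t * s\<^sup>2 / 2)))" (is ?A)
    and "(LINT s|lborel. cis (y * s) * of_real (exp (- t * s\<^sup>2 / 2)))
          = of_real (sqrt (2 * pi / t) * exp (- y\<^sup>2 / (2 * t)))" (is ?B)
proof -
  let ?g = "\<lambda>s. cis (y * s) * of_real (exp (- t * s\<^sup>2 / 2))"
  let ?y = "y / sqrt t"
  have pt: "sqrt t > 0" using assms by simp
  have int1: "integrable lborel (\<lambda>s. std_normal_density s *\<^sub>R cis (?y * s))"
    by (rule Bochner_Integration.integrable_bound[of _ std_normal_density]) (auto simp: norm_mult)
  have eq: "?g (0 + (1 / sqrt t) * s) = of_real (sqrt (2 * pi)) * (std_normal_density s *\<^sub>R cis (?y * s))" for s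
    using assms by (simp add: std_normal_density_def scaleR_conv_of_real power_divide)
  have i2: "integrable lborel (\<lambda>s. ?g (0 + (1 / sqrt t) * s))"
    unfolding eq by (intro integrable_mult_right int1)
  then show ?A
    using pt by (subst (asm) lborel_integrable_real_affine_iff) auto
  have "char std_normal_distribution ?y = (LINT s|lborel. std_normal_density s *\<^sub>R cis (?y * s))"
    unfolding char_def by (subst integral_density) (auto simp: cis_conv_exp mult_ac)
  then have c: "(LINT s|lborel. std_normal_density s *\<^sub>R cis (?y * s)) = of_real (exp (- (?y\<^sup>2) / 2))"
    by (simp add: char_std_normal_distribution)
  have "(LINT s|lborel. ?g s) = \<bar>1 / sqrt t\<bar> *\<^sub>R (LINT s|lborel. ?g (0 + (1 / sqrt t) * s))"
    using pt by (intro lborel_integral_real_affine) auto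
  also have "\<dots> = of_real ((1 / sqrt t) * sqrt (2 * pi) * exp (- (?y\<^sup>2) / 2))"
    unfolding eq using pt by (simp only: integral_mult_right_zero c) (simp add: scaleR_conv_of_real)
  also have "(1 / sqrt t) * sqrt (2 * pi) * exp (- (?y\<^sup>2) / 2) = sqrt (2 * pi / t) * exp (- y\<^sup>2 / (2 * t))"
    using assms by (simp add: real_sqrt_divide power_divide)
  finally show ?B .
qed

lemma
  fixes y :: "'a::euclidean_space"
  assumes t: "t > 0"
  shows integrable_cis_gauss: "integrable lborel (\<lambda>x. cis (y \<bullet> x) * of_real (gauss t x))" (is ?A)
    and ift_gauss: "ift (\<lambda>x. of_real (gauss t x)) y = of_real ((2 * pi) ^ DIM('a) * heat t y)" (is ?B)
proof -
  let ?f = "\<lambda>b s. cis ((y \<bullet> b) * s) * of_real (exp (- t * s\<^sup>2 / 2)) :: complex"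
  have cis_sum: "cis (\<Sum>b\<in>B. h b) = (\<Prod>b\<in>B. cis (h b))" if "finite B" for h and B :: "'a set"
    using that by induction (auto simp: cis_mult[symmetric])
  have e: "cis (y \<bullet> x) * of_real (gauss t x) = (\<Prod>b\<in>Basis. ?f b (x \<bullet> b))" for x
    by (subst euclidean_inner) (simp add: cis_sum gauss_eq_prod prod.distrib)
  show ?A
    unfolding e by (intro integrable_lborel_prod_Basis fourier_gauss_real t)
  have "ift (\<lambda>x. of_real (gauss t x)) y = (\<Prod>b\<in>(Basis::'a set). of_real (sqrt (2 * pi / t) * exp (- (y \<bullet> b)\<^sup>2 / (2 * t))))"
    unfolding ift_def e
    by (subst integral_lborel_prod_Basis) (auto intro!: fourier_gauss_real t simp only: fourier_gauss_real(2)[OF t])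
  also have "\<dots> = of_real (\<Prod>b\<in>(Basis::'a set). sqrt (2 * pi / t) * exp (- (y \<bullet> b)\<^sup>2 / (2 * t)))"
    by simp
  also have "(\<Prod>b\<in>(Basis::'a set). sqrt (2 * pi / t) * exp (- (y \<bullet> b)\<^sup>2 / (2 * t)))
     = sqrt (2 * pi / t) ^ DIM('a) * exp (- (norm y)\<^sup>2 / (2 * t))"
    by (simp add: prod.distrib norm_squared_eq_sum_Basis flip: exp_sum)
       (simp add: sum_divide_distrib sum_negf)
  also have "sqrt (2 * pi / t) = (2 * pi) * (1 / sqrt (2 * pi * t))"
    using t by (simp add: real_sqrt_divide real_sqrt_mult field_simps)
  finally show ?B
    by (simp add: heat_def power_mult_distrib power_divide)
qed

lemma integrable_gauss: "t > 0 \<Longrightarrow> integrable lborel (gauss t :: 'a::euclidean_space \<Rightarrow> real)"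
  using integrable_norm[OF integrable_cis_gauss[of t "0::'a"]] by (simp add: norm_mult)

lemma heat_eq_gauss: "t > 0 \<Longrightarrow> heat t (x::'a::euclidean_space) = (1 / sqrt (2 * pi * t)) ^ DIM('a) * gauss (1/t) x"
  by (simp add: heat_def gauss_def)

lemma integrable_heat: "t > 0 \<Longrightarrow> integrable lborel (heat t :: 'a::euclidean_space \<Rightarrow> real)"
  by (rule Bochner_Integration.integrable_cong[THEN iffD2, OF refl heat_eq_gauss])
    (auto intro!: integrable_mult_right integrable_gauss)

text \<open>\<open>heat t\<close> is a multiple of \<open>gauss (1/t)\<close>, whose integral is its
  transform at the frequency 0, given by \<open>ift_gauss\<close>.\<close>

lemma integral_heat:
  assumes t: "t > 0" shows "(LINT x|lborel. heat t (x::'a::euclidean_space)) = 1"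
proof -
  have "complex_of_real (LINT x|lborel. gauss (1/t) (x::'a)) = ift (\<lambda>x. of_real (gauss (1/t) x)) (0::'a)"
    by (simp add: ift_def)
  also have "\<dots> = of_real ((2 * pi) ^ DIM('a) * heat (1/t) (0::'a))"
    using t by (intro ift_gauss) simp
  finally have "(LINT x|lborel. gauss (1/t) (x::'a)) = (2 * pi) ^ DIM('a) * heat (1/t) (0::'a)"
    using of_real_eq_iff by blast
  also have "\<dots> = (sqrt (2 * pi * t)) ^ DIM('a)"
  proof -
    have "2 * pi * (1 / sqrt (2 * pi * (1 / t))) = sqrt (2 * pi * t)"
      using t by (simp add: real_sqrt_divide real_sqrt_mult field_simps)
    moreover have "(2 * pi) ^ DIM('a) * heat (1/t) (0::'a) = (2 * pi * (1 / sqrt (2 * pi * (1 / t)))) ^ DIM('a)"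
      by (subst power_mult_distrib) (simp add: heat_def)
    ultimately show ?thesis by simp
  qed
  finally show ?thesis
    using t by (simp only: heat_eq_gauss[OF t] integral_mult_right_zero power_mult_distrib[symmetric]) simp
qed

lemma heat_scale:
  assumes t: "t > 0" shows "heat t (sqrt t *\<^sub>R z) = heat 1 (z::'a::euclidean_space) / sqrt t ^ DIM('a)"
proof -
  have "(norm (sqrt t *\<^sub>R z))\<^sup>2 / (2 * t) = (norm z)\<^sup>2 / (2 * 1)"
    using t by (simp add: power_mult_distrib)
  moreover have "(1 / sqrt (2 * pi * t)) ^ DIM('a) = (1 / sqrt (2 * pi * 1)) ^ DIM('a) / sqrt t ^ DIM('a)"
    by (subst power_divide[symmetric]) (simp add: real_sqrt_mult)
  ultimately show ?thesis
    unfolding heat_def minus_divide_left[symmetric] by simp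
qed

section \<open>The Fourier transform of integrable functions\<close>

lemma integrable_cis_mult:
  assumes "integrable lborel g"
  shows "integrable lborel (\<lambda>\<xi>. cis (x \<bullet> \<xi>) * g \<xi>)"
  by (rule Bochner_Integration.integrable_bound[OF assms]) (use assms in \<open>auto dest: borel_measurable_integrable\<close>)

lemma norm_ift_le: "cmod (ift g x) \<le> (LINT \<xi>|lborel. cmod (g \<xi>))"
  unfolding ift_def by (rule order_trans[OF integral_norm_bound]) simp

lemma continuous_ift:
  assumes "integrable lborel g"
  shows "continuous_on S (ift g)"
proof -
  have "isCont (ift g) x" for x
    unfolding continuous_at_sequentially comp_def
  proof safe
    fix u assume u: "u \<longlonglongrightarrow> x"
    have [measurable]: "g \<in> borel_measurable borel" using assms by (auto dest: borel_measurable_integrable)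
    show "(\<lambda>n. ift g (u n)) \<longlonglongrightarrow> ift g x"
      unfolding ift_def
    proof (rule integral_dominated_convergence[where w="\<lambda>\<xi>. cmod (g \<xi>)"])
      show "AE \<xi> in lborel. (\<lambda>n. cis (u n \<bullet> \<xi>) * g \<xi>) \<longlonglongrightarrow> cis (x \<bullet> \<xi>) * g \<xi>"
        unfolding cis_conv_exp by (intro AE_I2 tendsto_intros u)
    qed (use assms in auto)
  qed
  then show ?thesis by (simp add: continuous_at_imp_continuous_on)
qed

lemma ift_measurable [measurable]:
  assumes "integrable lborel g"
  shows "ift g \<in> borel_measurable borel"
  using continuous_ift[OF assms] by (rule borel_measurable_continuous_onI)

lemma ift_add: "integrable lborel g \<Longrightarrow> integrable lborel h \<Longrightarrow> ift (\<lambda>\<xi>. g \<xi> + h \<xi>) x = ift g x + ift h x"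
  unfolding ift_def by (simp add: distrib_left integrable_cis_mult)

lemma ift_diff: "integrable lborel g \<Longrightarrow> integrable lborel h \<Longrightarrow> ift (\<lambda>\<xi>. g \<xi> - h \<xi>) x = ift g x - ift h x"
  unfolding ift_def by (simp add: right_diff_distrib integrable_cis_mult)

lemma ift_cmult: "ift (\<lambda>\<xi>. a * g \<xi>) x = a * ift g x"
proof -
  have "cis (x \<bullet> \<xi>) * (a * g \<xi>) = a * (cis (x \<bullet> \<xi>) * g \<xi>)" for \<xi> by (simp add: mult_ac)
  then show ?thesis unfolding ift_def by (simp only: integral_mult_right_zero)
qed

lemma ift_sum: "(\<And>i. i \<in> I \<Longrightarrow> integrable lborel (g i)) \<Longrightarrow> ift (\<lambda>\<xi>. \<Sum>i\<in>I. g i \<xi>) x = (\<Sum>i\<in>I. ift (g i) x)"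
  unfolding ift_def by (simp add: sum_distrib_left integrable_cis_mult)

lemma ift_cnj: "ift (\<lambda>\<xi>. cnj (g \<xi>)) x = cnj (ift g (- x))"
proof -
  have "cis (x \<bullet> \<xi>) * cnj (g \<xi>) = cnj (cis ((- x) \<bullet> \<xi>) * g \<xi>)" for \<xi> by (simp add: cis_cnj)
  then show ?thesis unfolding ift_def by (simp only: Bochner_Integration.integral_cnj)
qed

lemma ift_reflect: "ift (\<lambda>\<xi>. g (- \<xi>)) x = ift g (- x)"
  unfolding ift_def using integral_lborel_reflect[of "\<lambda>\<xi>. cis (x \<bullet> (-\<xi>)) * g \<xi>"] by simp

lemma lborel_pair_integrable_kernel:
  fixes g h :: "'a::euclidean_space \<Rightarrow> complex"
  assumes g: "integrable lborel g" and h: "integrable lborel h"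
  shows "integrable (lborel \<Otimes>\<^sub>M lborel) (\<lambda>(x, \<xi>). cis (x \<bullet> \<xi>) * g \<xi> * h x)"
proof -
  have [measurable]: "g \<in> borel_measurable borel" "h \<in> borel_measurable borel"
    using g h by (auto dest: borel_measurable_integrable)
  show ?thesis
  proof (rule lborel_pair.Fubini_integrable)
    show "integrable lborel (\<lambda>x. LINT \<xi>|lborel. norm (case (x, \<xi>) of (x, \<xi>) \<Rightarrow> cis (x \<bullet> \<xi>) * g \<xi> * h x))"
      using h by (simp add: norm_mult)
    show "AE x in lborel. integrable lborel (\<lambda>\<xi>. case (x, \<xi>) of (x, \<xi>) \<Rightarrow> cis (x \<bullet> \<xi>) * g \<xi> * h x)"
      using integrable_cis_mult[OF g] by simp
  qed measurable
qed

text \<open>The kernel is symmetric in x and \<xi>, so Fubini's theorem moves the transform from one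
  factor to the other.\<close>

lemma ift_mult_formula:
  assumes g: "integrable lborel g" and h: "integrable lborel h"
  shows "(LINT x|lborel. ift g x * h x) = (LINT \<xi>|lborel. g \<xi> * ift h \<xi>)"
proof -
  have "(LINT \<xi>|lborel. LINT x|lborel. cis (x \<bullet> \<xi>) * g \<xi> * h x) = (LINT x|lborel. LINT \<xi>|lborel. cis (x \<bullet> \<xi>) * g \<xi> * h x)"
    by (rule lborel_pair.Fubini_integral[OF lborel_pair_integrable_kernel[OF g h]])
  moreover have "(LINT x|lborel. cis (x \<bullet> \<xi>) * g \<xi> * h x) = g \<xi> * ift h \<xi>" for \<xi>
  proof -
    have "cis (x \<bullet> \<xi>) * g \<xi> * h x = g \<xi> * (cis (\<xi> \<bullet> x) * h x)" for x by (simp add: inner_commute mult_ac)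
    then show ?thesis unfolding ift_def by (simp only: integral_mult_right_zero)
  qed
  moreover have "(LINT \<xi>|lborel. cis (x \<bullet> \<xi>) * g \<xi> * h x) = ift g x * h x" for x
    unfolding ift_def by simp
  ultimately show ?thesis by (simp only:)
qed

section \<open>Gaussian regularisation: inversion, Plancherel inequality, Parseval identity\<close>

lemma heat_approximation:
  fixes h :: "'a::euclidean_space \<Rightarrow> 'b::{banach,second_countable_topology}"
  assumes c: "continuous_on UNIV h" and b: "\<And>x. norm (h x) \<le> B" and t: "\<And>n. t n > 0" "t \<longlonglongrightarrow> 0"
  shows "(\<lambda>n. LINT y|lborel. heat (t n) y *\<^sub>R h (x + y)) \<longlonglongrightarrow> h x"
proof -
  have [measurable]: "h \<in> borel_measurable borel" using c by (rule borel_measurable_continuous_onI)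
  \<comment> \<open>Scaling moves the time from the kernel into the argument of \<open>h\<close>, so
    one fixed majorant \<open>heat 1 z * B\<close> serves all n.\<close>
  have e: "(LINT y|lborel. heat (t n) y *\<^sub>R h (x + y)) = (LINT z|lborel. heat 1 z *\<^sub>R h (x + sqrt (t n) *\<^sub>R z))" for n
  proof -
    let ?F = "\<lambda>y. heat (t n) y *\<^sub>R h (x + y)" and ?s = "sqrt (t n) ^ DIM('a)"
    have s: "sqrt (t n) \<noteq> 0" "?s \<noteq> 0" using t(1)[of n] by auto
    have "(LINT z|lborel. ?F (0 + sqrt (t n) *\<^sub>R z)) = (LINT y|lborel. ?F y) /\<^sub>R \<bar>sqrt (t n)\<bar> ^ DIM('a)"
      by (rule integral_lborel_affine[OF s(1)])
    then have "(LINT y|lborel. ?F y) = ?s *\<^sub>R (LINT z|lborel. ?F (sqrt (t n) *\<^sub>R z))"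
      using s t(1)[of n] by (simp add: less_imp_le)
    also have "\<dots> = (LINT z|lborel. ?s *\<^sub>R ?F (sqrt (t n) *\<^sub>R z))"
      by (rule Bochner_Integration.integral_scaleR_right[symmetric])
    also have "\<dots> = (LINT z|lborel. heat 1 z *\<^sub>R h (x + sqrt (t n) *\<^sub>R z))"
      using s(2) by (simp add: heat_scale[OF t(1)])
    finally show ?thesis .
  qed
  have "(\<lambda>n. LINT z|lborel. heat 1 z *\<^sub>R h (x + sqrt (t n) *\<^sub>R z)) \<longlonglongrightarrow> (LINT z::'a|lborel. heat 1 z *\<^sub>R h x)"
  proof (rule integral_dominated_convergence[where w="\<lambda>z::'a. heat 1 z * B"])
    show "AE z in lborel. (\<lambda>n. heat 1 z *\<^sub>R h (x + sqrt (t n) *\<^sub>R z)) \<longlonglongrightarrow> heat 1 z *\<^sub>R h x"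
    proof (intro AE_I2 tendsto_intros)
      fix z
      have "(\<lambda>n. x + sqrt (t n) *\<^sub>R z) \<longlonglongrightarrow> x + sqrt 0 *\<^sub>R z" by (intro tendsto_intros t)
      then show "(\<lambda>n. h (x + sqrt (t n) *\<^sub>R z)) \<longlonglongrightarrow> h x"
        using c by (auto simp: continuous_on_eq_continuous_at continuous_at_sequentially o_def)
    qed
    show "AE z in lborel. norm (heat 1 z *\<^sub>R h (x + sqrt (t n) *\<^sub>R z)) \<le> heat 1 z * B" for n
      by (intro AE_I2) (auto intro!: mult_left_mono b)
    show "integrable lborel (\<lambda>z::'a. heat 1 z * B)" by (simp add: integrable_heat)
  qed measurable
  then show ?thesis by (simp add: e integral_heat integrable_heat)
qed

text \<open>This is the multiplication formula for a modulated Gaussian, whose transform is a heat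
  kernel centred at \<xi>: inverting the damped transform yields an average of \<open>g\<close>
  around \<xi>.\<close>

lemma ift_heat_identity:
  fixes g :: "'a::euclidean_space \<Rightarrow> complex"
  assumes g: "integrable lborel g" and t: "t > 0"
  shows "(LINT x|lborel. ift g x * (cis (- (x \<bullet> \<xi>)) * of_real (gauss t x)))
    = complex_of_real ((2 * pi) ^ DIM('a)) * (LINT y|lborel. heat t y *\<^sub>R g (\<xi> + y))"
proof -
  let ?h = "\<lambda>x. cis (- (x \<bullet> \<xi>)) * of_real (gauss t x)"
  have i: "integrable lborel ?h"
    using integrable_cis_gauss[OF t, of "-\<xi>"] by (simp add: inner_commute)
  have "cis (\<eta> \<bullet> x) * ?h x = cis ((\<eta> - \<xi>) \<bullet> x) * of_real (gauss t x)" for \<eta> x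
    by (simp add: cis_mult inner_diff_left inner_commute[of x \<xi>] flip: mult.assoc)
  then have "ift ?h \<eta> = ift (\<lambda>x. of_real (gauss t x)) (\<eta> - \<xi>)" for \<eta>
    unfolding ift_def by (simp only:)
  then have e: "ift ?h \<eta> = of_real ((2 * pi) ^ DIM('a) * heat t (\<eta> - \<xi>))" for \<eta>
    by (simp only: ift_gauss[OF t])
  have "(LINT x|lborel. ift g x * ?h x) = (LINT \<eta>|lborel. g \<eta> * ift ?h \<eta>)"
    by (rule ift_mult_formula[OF g i])
  also have "\<dots> = (LINT \<eta>|lborel. (2 * pi) ^ DIM('a) * (heat t (\<eta> - \<xi>) *\<^sub>R g \<eta>))"
    unfolding e by (intro Bochner_Integration.integral_cong refl) (simp add: scaleR_conv_of_real mult_ac)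
  also have "\<dots> = (2 * pi) ^ DIM('a) * (LINT \<eta>|lborel. heat t (\<eta> - \<xi>) *\<^sub>R g \<eta>)"
    by (simp only: integral_mult_right_zero)
  also have "(LINT \<eta>|lborel. heat t (\<eta> - \<xi>) *\<^sub>R g \<eta>) = (LINT y|lborel. heat t y *\<^sub>R g (\<xi> + y))"
    using integral_lborel_translate[of "\<lambda>\<eta>. heat t (\<eta> - \<xi>) *\<^sub>R g \<eta>" \<xi>] by simp
  finally show ?thesis .
qed

text \<open>One sequence of positive numbers tending to 0 serves as times of the heat kernel and,
  later, as tolerances of the Galerkin systems.\<close>

definition gstep :: "nat \<Rightarrow> real" where "gstep n = 1 / Suc n"

lemma gstep: "gstep n > 0" "gstep \<longlonglongrightarrow> 0"
  unfolding gstep_def using LIMSEQ_inverse_real_of_nat by (auto simp: inverse_eq_divide)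

lemma gauss_gstep_tendsto: "(\<lambda>n. gauss (gstep n) x) \<longlonglongrightarrow> 1"
proof -
  have "(\<lambda>n. gauss (gstep n) x) \<longlonglongrightarrow> exp (- 0 * (norm x)\<^sup>2 / 2)"
    unfolding gauss_def by (intro tendsto_intros gstep)  simp
  then show ?thesis by simp
qed

text \<open>Let the time tend to 0 in \<open>ift_heat_identity\<close>: the left side converges
  because \<open>ift g\<close> is integrable, the right side because \<open>g\<close> is bounded and
  continuous.\<close>

theorem ift_inversion:
  fixes g :: "'a::euclidean_space \<Rightarrow> complex"
  assumes g: "integrable lborel g" and c: "continuous_on UNIV g" and b: "\<And>x. cmod (g x) \<le> B"
    and i: "integrable lborel (ift g)"
  shows "ift (ift g) (- \<xi>) = (2 * pi) ^ DIM('a) * g \<xi>"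
proof -
  have "(\<lambda>n. LINT x|lborel. ift g x * (cis (- (x \<bullet> \<xi>)) * of_real (gauss (gstep n) x)))
     \<longlonglongrightarrow> (LINT x|lborel. ift g x * (cis (- (x \<bullet> \<xi>)) * of_real 1))"
  proof (rule integral_dominated_convergence[where w="\<lambda>x. cmod (ift g x)"])
    show "AE x in lborel. cmod (ift g x * (cis (- (x \<bullet> \<xi>)) * of_real (gauss (gstep n) x))) \<le> cmod (ift g x)" for n
      using gstep(1)[of n] by (intro AE_I2) (simp add: norm_mult mult_left_le)
    show "AE x in lborel. (\<lambda>n. ift g x * (cis (- (x \<bullet> \<xi>)) * of_real (gauss (gstep n) x)))
       \<longlonglongrightarrow> ift g x * (cis (- (x \<bullet> \<xi>)) * of_real 1)"
      by (intro AE_I2 tendsto_intros gauss_gstep_tendsto)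
  qed (use i ift_measurable[OF g] in auto)
  moreover have "(LINT x|lborel. ift g x * (cis (- (x \<bullet> \<xi>)) * of_real 1)) = ift (ift g) (- \<xi>)"
    unfolding ift_def by (simp add: inner_commute mult.commute)
  moreover have "(\<lambda>n. (2 * pi) ^ DIM('a) * (LINT y|lborel. heat (gstep n) y *\<^sub>R g (\<xi> + y)))
     \<longlonglongrightarrow> (2 * pi) ^ DIM('a) * g \<xi>"
    by (intro tendsto_intros heat_approximation[OF c b] gstep)
  ultimately show ?thesis
    unfolding ift_heat_identity[OF g gstep(1)] by (simp add: LIMSEQ_unique)
qed

text \<open>The Gaussian makes the product of two bounded transforms integrable, so nothing beyond
  integrability of \<open>v\<close> and \<open>h\<close> is required. Plancherel's inequality,
  Parseval's identity and injectivity all start from this formula.\<close>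

lemma ift_heat_pairing:
  fixes v h :: "'a::euclidean_space \<Rightarrow> complex"
  assumes v: "integrable lborel v" and h: "integrable lborel h" and t: "t > 0"
  shows "integrable lborel (\<lambda>x. ift v x * (ift h (- x) * of_real (gauss t x)))"
    and "(LINT x|lborel. ift v x * (ift h (- x) * of_real (gauss t x)))
    = (2 * pi) ^ DIM('a) * (LINT \<xi>|lborel. v \<xi> * (LINT y|lborel. heat t y *\<^sub>R h (\<xi> + y)))"
proof -
  let ?k = "\<lambda>x. ift h (- x) * of_real (gauss t x)"
  note [measurable] = ift_measurable[OF v] ift_measurable[OF h]
  have k: "integrable lborel ?k"
  proof (rule Bochner_Integration.integrable_bound[of _ "\<lambda>x. (LINT \<xi>|lborel. cmod (h \<xi>)) * gauss t x"])
    show "AE x in lborel. norm (?k x) \<le> norm ((LINT \<xi>|lborel. cmod (h \<xi>)) * gauss t x)"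
      by (intro AE_I2) (simp add: norm_mult mult_right_mono norm_ift_le)
  qed (auto simp: integrable_gauss t)
  show "integrable lborel (\<lambda>x. ift v x * ?k x)"
  proof (rule Bochner_Integration.integrable_bound[of _ "\<lambda>x. (LINT \<xi>|lborel. cmod (v \<xi>)) * cmod (?k x)"])
    show "AE x in lborel. norm (ift v x * ?k x) \<le> norm ((LINT \<xi>|lborel. cmod (v \<xi>)) * cmod (?k x))"
      by (intro AE_I2) (simp add: norm_mult mult_right_mono norm_ift_le)
  qed (use k in auto)
  have "ift ?k \<xi> = (2 * pi) ^ DIM('a) * (LINT y|lborel. heat t y *\<^sub>R h (\<xi> + y))" for \<xi>
    unfolding ift_heat_identity[OF h t, symmetric] ift_def[of ?k]
    using integral_lborel_reflect[of "\<lambda>x. ift h x * (cis (- (x \<bullet> \<xi>)) * of_real (gauss t x))"]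
    by (simp add: inner_commute mult_ac)
  then show "(LINT x|lborel. ift v x * ?k x) = (2 * pi) ^ DIM('a) * (LINT \<xi>|lborel. v \<xi> * (LINT y|lborel. heat t y *\<^sub>R h (\<xi> + y)))"
    unfolding ift_mult_formula[OF v k] by (simp only: mult.left_commute[of "v _"] integral_mult_right_zero)
qed

lemma convolution_integrable:
  fixes k p :: "'a::euclidean_space \<Rightarrow> real"
  assumes k: "integrable lborel k" and p: "integrable lborel p"
  shows "integrable (lborel \<Otimes>\<^sub>M lborel) (\<lambda>(y, \<xi>). k y * p (\<xi> + y))"
    and "integrable lborel (\<lambda>\<xi>. LINT y|lborel. k y * p (\<xi> + y))"
    and "(LINT \<xi>|lborel. LINT y|lborel. k y * p (\<xi> + y)) = (LINT y|lborel. k y) * (LINT \<xi>|lborel. p \<xi>)"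
proof -
  have [measurable]: "k \<in> borel_measurable borel" "p \<in> borel_measurable borel"
    using k p by (auto dest: borel_measurable_integrable)
  have t: "integrable lborel (\<lambda>\<xi>. q (\<xi> + y)) \<longleftrightarrow> integrable lborel q"
      "(LINT \<xi>|lborel. q (\<xi> + y)) = (LINT \<xi>|lborel. q \<xi>)" for q :: "'a \<Rightarrow> real" and y
    using integrable_lborel_translate_iff[of q y] integral_lborel_translate[of q y] by (simp_all add: add.commute)
  show i: "integrable (lborel \<Otimes>\<^sub>M lborel) (\<lambda>(y, \<xi>). k y * p (\<xi> + y))"
  proof (rule lborel_pair.Fubini_integrable)
    show "integrable lborel (\<lambda>y. LINT \<xi>|lborel. norm (case (y, \<xi>) of (y, \<xi>) \<Rightarrow> k y * p (\<xi> + y)))"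
      using k t(2)[of "\<lambda>x. \<bar>p x\<bar>"] by (simp add: abs_mult)
    show "AE y in lborel. integrable lborel (\<lambda>\<xi>. case (y, \<xi>) of (y, \<xi>) \<Rightarrow> k y * p (\<xi> + y))"
      using p t(1)[of p] by simp
  qed measurable
  show "integrable lborel (\<lambda>\<xi>. LINT y|lborel. k y * p (\<xi> + y))"
    using lborel_pair.integrable_snd[OF i] by simp
  have "(LINT \<xi>|lborel. LINT y|lborel. k y * p (\<xi> + y)) = (LINT y|lborel. LINT \<xi>|lborel. k y * p (\<xi> + y))"
    by (rule lborel_pair.Fubini_integral[OF i])
  also have "\<dots> = (LINT y|lborel. k y) * (LINT \<xi>|lborel. p \<xi>)"
    using t(2)[of p] by simp
  finally show "(LINT \<xi>|lborel. LINT y|lborel. k y * p (\<xi> + y)) = (LINT y|lborel. k y) * (LINT \<xi>|lborel. p \<xi>)" .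
qed

text \<open>Only the inequality of Plancherel's theorem is needed, and it holds for every integrable and
  square-integrable function without approximation by nicer ones.\<close>

theorem ift_square_integrable:
  fixes v :: "'a::euclidean_space \<Rightarrow> complex"
  assumes v: "integrable lborel v" and v2: "integrable lborel (\<lambda>\<xi>. (cmod (v \<xi>))\<^sup>2)"
  shows "integrable lborel (\<lambda>x. (cmod (ift v x))\<^sup>2)"
    and "(LINT x|lborel. (cmod (ift v x))\<^sup>2) \<le> (2 * pi) ^ DIM('a) * (LINT \<xi>|lborel. (cmod (v \<xi>))\<^sup>2)"
proof -
  note [measurable] = ift_measurable[OF v]
  have vm[measurable]: "v \<in> borel_measurable borel" using v by (auto dest: borel_measurable_integrable)
  let ?C = "(2 * pi) ^ DIM('a)" and ?N = "LINT \<xi>|lborel. (cmod (v \<xi>))\<^sup>2"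
  have N: "?N \<ge> 0" by simp
  have bound: "integrable lborel (\<lambda>x. (cmod (ift v x))\<^sup>2 * gauss t x)"
      "(LINT x|lborel. (cmod (ift v x))\<^sup>2 * gauss t x) \<le> ?C * ?N" if t: "t > 0" for t
  proof -
    \<comment> \<open>With the conjugate of \<open>v\<close> as second function the pairing becomes
      the damped integral of |ift v|^2, a nonnegative number.\<close>
    let ?h = "\<lambda>\<xi>. cnj (v \<xi>)"
    have h: "integrable lborel ?h" using v by simp
    have e: "ift v x * (ift ?h (- x) * of_real (gauss t x)) = of_real ((cmod (ift v x))\<^sup>2 * gauss t x)" for x
      by (simp add: ift_cnj complex_norm_square mult_ac del: of_real_power)
    show i: "integrable lborel (\<lambda>x. (cmod (ift v x))\<^sup>2 * gauss t x)"
      using ift_heat_pairing(1)[OF v h t] unfolding e complex_of_real_integrable_eq .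
    have hb: "heat t y \<le> heat t (0::'a)" for y :: 'a
      using t by (simp add: heat_def mult_left_le)
    \<comment> \<open>The inequality 2ab \<le> a^2 + b^2 is applied under the average. Since the
      heat kernel has mass 1, each of the two halves integrates to \<open>?N / 2\<close>.\<close>
    have pw: "cmod (v \<xi> * (LINT y|lborel. heat t y *\<^sub>R ?h (\<xi> + y)))
       \<le> (cmod (v \<xi>))\<^sup>2 / 2 + (LINT y|lborel. heat t y * (cmod (v (\<xi> + y)))\<^sup>2) / 2" for \<xi>
    proof -
      have i2: "integrable lborel (\<lambda>y. heat t y * (cmod (v (\<xi> + y)))\<^sup>2)"
      proof (rule Bochner_Integration.integrable_bound[of _ "\<lambda>y. heat t (0::'a) * (cmod (v (\<xi> + y)))\<^sup>2"])
        show "integrable lborel (\<lambda>y. heat t (0::'a) * (cmod (v (\<xi> + y)))\<^sup>2)"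
          using v2 integrable_lborel_translate_iff[of "\<lambda>y. (cmod (v y))\<^sup>2" \<xi>] by simp
        show "AE y in lborel. norm (heat t y * (cmod (v (\<xi> + y)))\<^sup>2) \<le> norm (heat t (0::'a) * (cmod (v (\<xi> + y)))\<^sup>2)"
          using t by (intro AE_I2) (simp add: abs_mult mult_right_mono hb)
      qed measurable
      have "cmod (v \<xi> * (LINT y|lborel. heat t y *\<^sub>R ?h (\<xi> + y))) = cmod (LINT y|lborel. v \<xi> * (heat t y *\<^sub>R ?h (\<xi> + y)))"
        by (simp only: integral_mult_right_zero)
      also have "\<dots> \<le> (LINT y|lborel. heat t y * ((cmod (v \<xi>))\<^sup>2 / 2) + heat t y * (cmod (v (\<xi> + y)))\<^sup>2 / 2)"
      proof (rule order_trans[OF integral_norm_bound], rule integral_mono')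
        show "integrable lborel (\<lambda>y. heat t y * ((cmod (v \<xi>))\<^sup>2 / 2) + heat t y * (cmod (v (\<xi> + y)))\<^sup>2 / 2)"
          using i2 t by (simp add: integrable_heat)
        fix y
        have "cmod (v \<xi>) * cmod (v (\<xi> + y)) \<le> (cmod (v \<xi>))\<^sup>2 / 2 + (cmod (v (\<xi> + y)))\<^sup>2 / 2"
          using sum_squares_bound[of "cmod (v \<xi>)" "cmod (v (\<xi> + y))"] by simp
        then have "heat t y * (cmod (v \<xi>) * cmod (v (\<xi> + y))) \<le> heat t y * ((cmod (v \<xi>))\<^sup>2 / 2 + (cmod (v (\<xi> + y)))\<^sup>2 / 2)"
          using t by (intro mult_left_mono) auto
        then show "norm (v \<xi> * (heat t y *\<^sub>R ?h (\<xi> + y))) \<le> heat t y * ((cmod (v \<xi>))\<^sup>2 / 2) + heat t y * (cmod (v (\<xi> + y)))\<^sup>2 / 2"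
          using t by (simp add: norm_mult mult_ac distrib_left)
      qed (use t in auto)
      also have "\<dots> = (cmod (v \<xi>))\<^sup>2 / 2 + (LINT y|lborel. heat t y * (cmod (v (\<xi> + y)))\<^sup>2) / 2"
        using i2 t by (simp add: integrable_heat integral_heat)
      finally show ?thesis .
    qed
    have "of_real (LINT x|lborel. (cmod (ift v x))\<^sup>2 * gauss t x)
        = ?C * (LINT \<xi>|lborel. v \<xi> * (LINT y|lborel. heat t y *\<^sub>R ?h (\<xi> + y)))"
      using ift_heat_pairing(2)[OF v h t] unfolding e integral_complex_of_real .
    then have "(LINT x|lborel. (cmod (ift v x))\<^sup>2 * gauss t x) \<le> cmod (?C * (LINT \<xi>|lborel. v \<xi> * (LINT y|lborel. heat t y *\<^sub>R ?h (\<xi> + y))))"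
      by (metis abs_ge_self norm_of_real)
    also have "\<dots> = ?C * cmod (LINT \<xi>|lborel. v \<xi> * (LINT y|lborel. heat t y *\<^sub>R ?h (\<xi> + y)))"
      by (simp add: norm_mult norm_power)
    also have "cmod (LINT \<xi>|lborel. v \<xi> * (LINT y|lborel. heat t y *\<^sub>R ?h (\<xi> + y)))
       \<le> (LINT \<xi>|lborel. (cmod (v \<xi>))\<^sup>2 / 2 + (LINT y|lborel. heat t y * (cmod (v (\<xi> + y)))\<^sup>2) / 2)"
      by (rule order_trans[OF integral_norm_bound], rule integral_mono'[OF _ pw])
         (use v2 convolution_integrable(2)[OF integrable_heat[OF t] v2] t in \<open>auto intro!: Bochner_Integration.integral_nonneg\<close>)
    also have "\<dots> = ?N"
      using v2 convolution_integrable(2,3)[OF integrable_heat[OF t] v2] t by (simp add: integral_heat)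
    finally show "(LINT x|lborel. (cmod (ift v x))\<^sup>2 * gauss t x) \<le> ?C * ?N"
      by simp
  qed
  \<comment> \<open>The bound does not depend on the time, so Fatou's lemma removes the Gaussian and
    yields integrability and the estimate together.\<close>
  have "(\<integral>\<^sup>+x. ennreal ((cmod (ift v x))\<^sup>2) \<partial>lborel)
      = (\<integral>\<^sup>+x. liminf (\<lambda>n. ennreal ((cmod (ift v x))\<^sup>2 * gauss (gstep n) x)) \<partial>lborel)"
  proof (intro nn_integral_cong)
    fix x
    have "(\<lambda>n. ennreal ((cmod (ift v x))\<^sup>2 * gauss (gstep n) x)) \<longlonglongrightarrow> ennreal ((cmod (ift v x))\<^sup>2 * 1)"
      by (intro tendsto_ennrealI tendsto_intros gauss_gstep_tendsto)
    then show "ennreal ((cmod (ift v x))\<^sup>2) = liminf (\<lambda>n. ennreal ((cmod (ift v x))\<^sup>2 * gauss (gstep n) x))"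
      using lim_imp_Liminf[OF sequentially_bot, of "\<lambda>n. ennreal ((cmod (ift v x))\<^sup>2 * gauss (gstep n) x)" "ennreal ((cmod (ift v x))\<^sup>2)"]
      by simp
  qed
  also have "\<dots> \<le> liminf (\<lambda>n. \<integral>\<^sup>+x. ennreal ((cmod (ift v x))\<^sup>2 * gauss (gstep n) x) \<partial>lborel)"
    by (rule nn_integral_liminf) measurable
  also have "\<dots> \<le> liminf (\<lambda>n. ennreal (?C * ?N))"
  proof (intro Liminf_mono eventuallyI)
    fix n
    show "(\<integral>\<^sup>+x. ennreal ((cmod (ift v x))\<^sup>2 * gauss (gstep n) x) \<partial>lborel) \<le> ennreal (?C * ?N)"
      by (subst nn_integral_eq_integral[OF bound(1)[OF gstep(1)]])
        (use bound(2)[OF gstep(1)] gstep(1)[of n] in \<open>simp_all only: ennreal_leI AE_I2, simp\<close>)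
  qed
  also have "\<dots> = ennreal (?C * ?N)" by (simp add: Liminf_const)
  finally have *: "(\<integral>\<^sup>+x. ennreal ((cmod (ift v x))\<^sup>2) \<partial>lborel) \<le> ennreal (?C * ?N)" .
  show i: "integrable lborel (\<lambda>x. (cmod (ift v x))\<^sup>2)"
    by (rule integrableI_bounded) (use * in \<open>auto intro: le_less_trans\<close>)
  show "(LINT x|lborel. (cmod (ift v x))\<^sup>2) \<le> ?C * ?N"
    using * N by (subst (asm) nn_integral_eq_integral[OF i]) auto
qed

lemma integrable_mult_L2:
  fixes f g :: "'a \<Rightarrow> complex"
  assumes [measurable]: "f \<in> borel_measurable M" "g \<in> borel_measurable M"
    and "integrable M (\<lambda>x. (cmod (f x))\<^sup>2)" "integrable M (\<lambda>x. (cmod (g x))\<^sup>2)"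
  shows "integrable M (\<lambda>x. f x * g x)"
proof (rule Bochner_Integration.integrable_bound[of _ "\<lambda>x. (cmod (f x))\<^sup>2 + (cmod (g x))\<^sup>2"])
  have "cmod (f x) * cmod (g x) \<le> (cmod (f x))\<^sup>2 + (cmod (g x))\<^sup>2" for x
    using sum_squares_bound[of "cmod (f x)" "cmod (g x)"]
      mult_nonneg_nonneg[OF norm_ge_zero[of "f x"] norm_ge_zero[of "g x"]] by linarith
  then show "AE x in M. norm (f x * g x) \<le> norm ((cmod (f x))\<^sup>2 + (cmod (g x))\<^sup>2)"
    by (intro AE_I2) (simp add: norm_mult)
qed (use assms in auto)

text \<open>The two transforms have an integrable product by Plancherel's inequality, which
  dominates the damped integrals; on the other side the heat averages of \<open>h\<close> converge
  pointwise, as \<open>h\<close> is bounded and continuous.\<close>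

theorem ift_parseval:
  fixes v h :: "'a::euclidean_space \<Rightarrow> complex"
  assumes v: "integrable lborel v" "integrable lborel (\<lambda>\<xi>. (cmod (v \<xi>))\<^sup>2)"
    and h: "integrable lborel h" "integrable lborel (\<lambda>\<xi>. (cmod (h \<xi>))\<^sup>2)"
    and c: "continuous_on UNIV h" and b: "\<And>x. cmod (h x) \<le> B"
  shows "(LINT x|lborel. ift v x * ift h (- x)) = (2 * pi) ^ DIM('a) * (LINT \<xi>|lborel. v \<xi> * h \<xi>)"
proof -
  note [measurable] = ift_measurable[OF v(1)] ift_measurable[OF h(1)]
  have vm[measurable]: "v \<in> borel_measurable borel" "h \<in> borel_measurable borel"
    using v h by (auto dest: borel_measurable_integrable)
  have i: "integrable lborel (\<lambda>x. ift v x * ift h (- x))"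
    by (intro integrable_mult_L2 ift_square_integrable v)
       (use ift_square_integrable(1)[OF h] integrable_lborel_reflect_iff[of "\<lambda>x. (cmod (ift h x))\<^sup>2"] in auto)
  have "(\<lambda>n. LINT x|lborel. ift v x * (ift h (- x) * of_real (gauss (gstep n) x)))
      \<longlonglongrightarrow> (LINT x|lborel. ift v x * (ift h (- x) * of_real 1))"
  proof (rule integral_dominated_convergence[where w="\<lambda>x. cmod (ift v x * ift h (- x))"])
    show "AE x in lborel. cmod (ift v x * (ift h (- x) * of_real (gauss (gstep n) x))) \<le> cmod (ift v x * ift h (- x))" for n
      using gstep(1)[of n] by (intro AE_I2) (simp add: norm_mult mult_left_le mult_left_mono)
    show "AE x in lborel. (\<lambda>n. ift v x * (ift h (- x) * of_real (gauss (gstep n) x))) \<longlonglongrightarrow> ift v x * (ift h (- x) * of_real 1)"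
      by (intro AE_I2 tendsto_intros gauss_gstep_tendsto)
  qed (use i in auto)
  moreover have "(\<lambda>n. (2 * pi) ^ DIM('a) * (LINT \<xi>|lborel. v \<xi> * (LINT y|lborel. heat (gstep n) y *\<^sub>R h (\<xi> + y))))
     \<longlonglongrightarrow> (2 * pi) ^ DIM('a) * (LINT \<xi>|lborel. v \<xi> * h \<xi>)"
  proof (intro tendsto_intros)
    have hb: "cmod (LINT y|lborel. heat (gstep n) y *\<^sub>R h (\<xi> + y)) \<le> B" for n \<xi>
    proof -
      have "cmod (LINT y|lborel. heat (gstep n) y *\<^sub>R h (\<xi> + y)) \<le> (LINT y|lborel. heat (gstep n) (y::'a) * B)"
        by (rule order_trans[OF integral_norm_bound], rule integral_mono')
          (use gstep(1)[of n] b order_trans[OF norm_ge_zero b] in \<open>auto simp: integrable_heat intro!: mult_left_mono\<close>)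
      then show ?thesis using gstep(1)[of n] by (simp add: integral_heat)
    qed
    show "(\<lambda>n. LINT \<xi>|lborel. v \<xi> * (LINT y|lborel. heat (gstep n) y *\<^sub>R h (\<xi> + y))) \<longlonglongrightarrow> (LINT \<xi>|lborel. v \<xi> * h \<xi>)"
    proof (rule integral_dominated_convergence[where w="\<lambda>\<xi>. cmod (v \<xi>) * B"])
      show "AE \<xi> in lborel. (\<lambda>n. v \<xi> * (LINT y|lborel. heat (gstep n) y *\<^sub>R h (\<xi> + y))) \<longlonglongrightarrow> v \<xi> * h \<xi>"
        by (intro AE_I2 tendsto_intros heat_approximation[OF c b] gstep)
      show "AE \<xi> in lborel. norm (v \<xi> * (LINT y|lborel. heat (gstep n) y *\<^sub>R h (\<xi> + y))) \<le> cmod (v \<xi>) * B" for n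
        by (intro AE_I2) (simp add: norm_mult mult_left_mono hb)
      show "integrable lborel (\<lambda>\<xi>. cmod (v \<xi>) * B)" using v by simp
    qed measurable
  qed
  ultimately show ?thesis
    unfolding ift_heat_pairing(2)[OF v(1) h(1) gstep(1)] by (simp add: LIMSEQ_unique)
qed

section \<open>Derivatives of transforms and injectivity of the transform\<close>

lemma norm_cis_minus_linear: "cmod (cis y - 1 - \<i> * of_real y) \<le> y\<^sup>2 / 2"
  using iexp_approx1[of y 1] by (simp add: cis_conv_exp numeral_2_eq_2 diff_diff_eq)

lemma integrable_norm_mult_of_square:
  fixes g :: "'a::euclidean_space \<Rightarrow> complex"
  assumes g: "integrable lborel g" and g2: "integrable lborel (\<lambda>\<xi>. (norm \<xi>)\<^sup>2 * cmod (g \<xi>))"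
  shows "integrable lborel (\<lambda>\<xi>. norm \<xi> * cmod (g \<xi>))"
    and "integrable lborel (\<lambda>\<xi>. \<i> * of_real (v \<bullet> \<xi>) * g \<xi>)"
proof -
  have [measurable]: "g \<in> borel_measurable borel" using g by (auto dest: borel_measurable_integrable)
  have r: "r \<le> 1 + r\<^sup>2" for r :: real
    using sum_squares_bound[of r 1] by (smt (verit) zero_le_power2 mult_1_right one_power2)
  show i: "integrable lborel (\<lambda>\<xi>. norm \<xi> * cmod (g \<xi>))"
  proof (rule Bochner_Integration.integrable_bound[of _ "\<lambda>\<xi>. cmod (g \<xi>) + (norm \<xi>)\<^sup>2 * cmod (g \<xi>)"])
    have "norm \<xi> * cmod (g \<xi>) \<le> (1 + (norm \<xi>)\<^sup>2) * cmod (g \<xi>)" for \<xi>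
      by (intro mult_right_mono r) auto
    then show "AE \<xi> in lborel. norm (norm \<xi> * cmod (g \<xi>)) \<le> norm (cmod (g \<xi>) + (norm \<xi>)\<^sup>2 * cmod (g \<xi>))"
      by (intro AE_I2) (simp add: distrib_right)
  qed (use g g2 in auto)
  show "integrable lborel (\<lambda>\<xi>. \<i> * of_real (v \<bullet> \<xi>) * g \<xi>)"
  proof (rule Bochner_Integration.integrable_bound[of _ "\<lambda>\<xi>. norm v * (norm \<xi> * cmod (g \<xi>))"])
    have "\<bar>v \<bullet> \<xi>\<bar> * cmod (g \<xi>) \<le> norm v * norm \<xi> * cmod (g \<xi>)" for \<xi>
      by (intro mult_right_mono Cauchy_Schwarz_ineq2) auto
    then show "AE \<xi> in lborel. norm (\<i> * of_real (v \<bullet> \<xi>) * g \<xi>) \<le> norm (norm v * (norm \<xi> * cmod (g \<xi>)))"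
      by (intro AE_I2) (simp add: norm_mult mult.assoc)
  qed (use i in auto)
qed

text \<open>The quadratic Taylor bound for \<open>cis\<close> makes the remainder at most |y - x|^2
  / 2 times the second moment of \<open>g\<close>.\<close>

lemma has_derivative_ift:
  fixes g :: "'a::euclidean_space \<Rightarrow> complex"
  assumes g: "integrable lborel g" and g2: "integrable lborel (\<lambda>\<xi>. (norm \<xi>)\<^sup>2 * cmod (g \<xi>))"
  shows "(ift g has_derivative (\<lambda>v. ift (\<lambda>\<xi>. \<i> * of_real (v \<bullet> \<xi>) * g \<xi>) x)) (at x)"
proof (rule has_derivativeI_sandwich[of 1])
  note i1 = integrable_norm_mult_of_square[OF g g2]
  let ?D = "\<lambda>v. ift (\<lambda>\<xi>. \<i> * of_real (v \<bullet> \<xi>) * g \<xi>) x"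
  let ?M = "LINT \<xi>|lborel. (norm \<xi>)\<^sup>2 * cmod (g \<xi>)"
  show "bounded_linear ?D"
  proof (rule bounded_linear_intro)
    show "?D (u + v) = ?D u + ?D v" for u v
      by (subst ift_add[symmetric]) (auto intro!: i1 simp: inner_add_left distrib_left distrib_right)
    show "?D (r *\<^sub>R u) = r *\<^sub>R ?D u" for r u
      by (simp add: scaleR_conv_of_real mult.assoc mult.left_commute[of \<i>] flip: ift_cmult)
    show "norm (?D u) \<le> norm u * (LINT \<xi>|lborel. norm \<xi> * cmod (g \<xi>))" for u
    proof -
      have "norm (?D u) \<le> (LINT \<xi>|lborel. norm u * (norm \<xi> * cmod (g \<xi>)))"
      proof (rule order_trans[OF norm_ift_le], rule integral_mono')
        have "\<bar>u \<bullet> \<xi>\<bar> * cmod (g \<xi>) \<le> norm u * norm \<xi> * cmod (g \<xi>)" for \<xi>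
          by (intro mult_right_mono Cauchy_Schwarz_ineq2) auto
        then show "cmod (\<i> * of_real (u \<bullet> \<xi>) * g \<xi>) \<le> norm u * (norm \<xi> * cmod (g \<xi>))" for \<xi>
          by (simp add: norm_mult mult.assoc)
      qed (use i1 in auto)
      then show ?thesis by simp
    qed
  qed
  show "((\<lambda>y. norm (y - x) * (?M / 2)) \<longlongrightarrow> 0) (at x)"
    by (auto intro!: tendsto_eq_intros)
  show "norm (ift g y - ift g x - ?D (y - x)) / norm (y - x) \<le> norm (y - x) * (?M / 2)" if "y \<noteq> x" for y
  proof -
    let ?r = "\<lambda>\<xi>. cis (x \<bullet> \<xi>) * (cis ((y - x) \<bullet> \<xi>) - 1 - \<i> * of_real ((y - x) \<bullet> \<xi>)) * g \<xi>"
    have "ift g y - ift g x - ?D (y - x) = (LINT \<xi>|lborel. ?r \<xi>)"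
    proof -
      have "?r \<xi> = cis (y \<bullet> \<xi>) * g \<xi> - cis (x \<bullet> \<xi>) * g \<xi> - cis (x \<bullet> \<xi>) * (\<i> * of_real ((y - x) \<bullet> \<xi>) * g \<xi>)" for \<xi>
        by (simp add: algebra_simps cis_mult inner_diff_left flip: cis_mult)
           (simp add: cis_mult flip: mult.assoc)
      then show ?thesis
        unfolding ift_def using integrable_cis_mult[OF g] integrable_cis_mult[OF i1(2)] by simp
    qed
    also have "norm \<dots> \<le> (LINT \<xi>|lborel. (norm (y - x))\<^sup>2 / 2 * ((norm \<xi>)\<^sup>2 * cmod (g \<xi>)))"
    proof (rule order_trans[OF integral_norm_bound], rule integral_mono')
      fix \<xi>
      have "norm (?r \<xi>) \<le> ((y - x) \<bullet> \<xi>)\<^sup>2 / 2 * cmod (g \<xi>)"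
      proof -
        have "norm (?r \<xi>) = cmod (cis ((y - x) \<bullet> \<xi>) - 1 - \<i> * of_real ((y - x) \<bullet> \<xi>)) * cmod (g \<xi>)"
          by (simp only: norm_mult norm_cis mult_1_left)
        then show ?thesis by (simp only: mult_right_mono[OF norm_cis_minus_linear norm_ge_zero])
      qed
      also have "\<dots> \<le> (norm (y - x) * norm \<xi>)\<^sup>2 / 2 * cmod (g \<xi>)"
        by (intro mult_right_mono divide_right_mono abs_le_square_iff[THEN iffD1])
           (auto intro!: Cauchy_Schwarz_ineq2)
      finally show "norm (?r \<xi>) \<le> (norm (y - x))\<^sup>2 / 2 * ((norm \<xi>)\<^sup>2 * cmod (g \<xi>))"
        by (simp add: power_mult_distrib mult_ac)
    qed (use g2 in auto)
    also have "\<dots> = norm (y - x) * (?M / 2) * norm (y - x)" by (simp add: power2_eq_square)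
    finally show ?thesis using that by (simp add: divide_le_eq)
  qed
qed simp

text \<open>No decay at infinity is estimated. The difference F(x + e) - F(x) has integral 0 by
  translation invariance; it is also the integral over t in [0,1] of the derivative at x + t e, and
  by Fubini and translation invariance that integrates to the integral of the derivative.\<close>

theorem integral_derivative_eq_0:
  fixes F :: "'a::euclidean_space \<Rightarrow> 'b::euclidean_space"
  assumes d: "\<And>x. (F has_derivative F' x) (at x)" and c: "continuous_on UNIV (\<lambda>x. F' x e)"
    and F: "integrable lborel F" and G: "integrable lborel (\<lambda>x. F' x e)"
  shows "(LINT x|lborel. F' x e) = 0"
proof -
  define G where "G x = F' x e" for x
  have [measurable]: "G \<in> borel_measurable borel"
    using c unfolding G_def by (rule borel_measurable_continuous_onI)
  have Gi: "integrable lborel G" using G unfolding G_def .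
  have tr: "integrable lborel (\<lambda>x. q (x + y)) \<longleftrightarrow> integrable lborel q"
      "(LINT x|lborel. q (x + y)) = (LINT x|lborel. q x)"
      for q :: "'a \<Rightarrow> 'c::{banach,second_countable_topology}" and y
    using integrable_lborel_translate_iff[of q y] integral_lborel_translate[of q y] by (simp_all add: add.commute)
  let ?I = "indicator {0..1::real} :: real \<Rightarrow> real"
  have ftc: "(LINT t|lborel. ?I t *\<^sub>R G (x + t *\<^sub>R e)) = F (x + e) - F x" for x
  proof -
    have "(LINT t|lborel. ?I t *\<^sub>R G (x + t *\<^sub>R e)) = F (x + 1 *\<^sub>R e) - F (x + 0 *\<^sub>R e)"
    proof (rule integral_FTC_Icc)
      show "((\<lambda>t. F (x + t *\<^sub>R e)) has_vector_derivative G (x + t *\<^sub>R e)) (at t within {0..1})" for t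
      proof -
        have "((\<lambda>t. F (x + t *\<^sub>R e)) has_derivative (\<lambda>s. F' (x + t *\<^sub>R e) (s *\<^sub>R e))) (at t within {0..1})"
          by (rule has_derivative_compose[OF _ d]) (auto intro!: derivative_eq_intros)
        then show ?thesis
          unfolding has_vector_derivative_def G_def
          using linear_cmul[OF has_derivative_linear[OF d]] by simp
      qed
      show "continuous_on {0..1} (\<lambda>t. G (x + t *\<^sub>R e))"
        unfolding G_def by (rule continuous_on_compose2[OF c]) (auto intro!: continuous_intros)
    qed simp
    then show ?thesis by simp
  qed
  have i: "integrable (lborel \<Otimes>\<^sub>M lborel) (\<lambda>(t, x). ?I t *\<^sub>R G (x + t *\<^sub>R e))"
  proof (rule lborel_pair.Fubini_integrable)
    show "integrable lborel (\<lambda>t. LINT x|lborel. norm (case (t, x) of (t, x) \<Rightarrow> ?I t *\<^sub>R G (x + t *\<^sub>R e)))"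
      using tr(2)[of "\<lambda>x. norm (G x)"] by simp
    show "AE t in lborel. integrable lborel (\<lambda>x. case (t, x) of (t, x) \<Rightarrow> ?I t *\<^sub>R G (x + t *\<^sub>R e))"
      using tr(1)[of G] Gi by simp
  qed measurable
  have "0 = (LINT x|lborel. F (x + e)) - (LINT x|lborel. F x)" using tr(2)[of F] by simp
  also have "\<dots> = (LINT x|lborel. F (x + e) - F x)" using F tr(1)[of F] by simp
  also have "\<dots> = (LINT x|lborel. LINT t|lborel. ?I t *\<^sub>R G (x + t *\<^sub>R e))" by (simp add: ftc)
  also have "\<dots> = (LINT t|lborel. LINT x|lborel. ?I t *\<^sub>R G (x + t *\<^sub>R e))"
    by (rule lborel_pair.Fubini_integral[OF i])
  also have "\<dots> = (LINT t|lborel. ?I t *\<^sub>R (LINT x|lborel. G x))" using tr(2)[of G] by simp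
  also have "\<dots> = (LINT x|lborel. G x)" by simp
  finally show ?thesis by (simp add: G_def)
qed

text \<open>Open boxes generate the Borel sets and are stable under intersection, so disjoint
  induction reaches all Borel sets; the vanishing total integral is what handles
  complements.\<close>

lemma AE_eq_0_if_box_integrals_eq_0:
  fixes H :: "'a::euclidean_space \<Rightarrow> 'b::{banach,second_countable_topology}"
  assumes H: "integrable lborel H" and total: "(LINT x|lborel. H x) = 0"
    and box: "\<And>a b. (LINT x|lborel. indicator (box a b) x *\<^sub>R H x) = 0"
  shows "AE x in lborel. H x = 0"
proof (rule sigma_finite_measure.density_zero[OF sigma_finite_lborel H])
  fix A :: "'a set" assume "A \<in> sets lborel"
  then have A: "A \<in> sigma_sets UNIV (range (\<lambda>(a, b). box a b))"
    by (simp add: borel_eq_box)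
  have S: "sigma_sets UNIV (range (\<lambda>(a, b). box a b :: 'a set)) = sets lborel"
    by (simp add: borel_eq_box)
  have "Int_stable (range (\<lambda>(a, b). box a b :: 'a set))"
    by (auto simp: Int_stable_def box_Int_box)
  moreover have "range (\<lambda>(a, b). box a b :: 'a set) \<subseteq> Pow UNIV" by simp
  ultimately show "set_lebesgue_integral lborel A H = 0"
    using A
  proof (induction rule: sigma_sets_induct_disjoint)
    case (basic A)
    then show ?case using box by (auto simp: set_lebesgue_integral_def)
  next
    case (compl A)
    then have [measurable]: "A \<in> sets lborel" using S by simp
    have e: "indicator (UNIV - A) x *\<^sub>R H x = H x - indicator A x *\<^sub>R H x" for x
      by (auto simp: indicator_def)
    show ?case
      using compl(2) total H integrable_mult_indicator[OF \<open>A \<in> sets lborel\<close> H]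
      unfolding set_lebesgue_integral_def e by simp
  next
    case (union A)
    have m: "A i \<in> sets lborel" for i using union(2) S by auto
    have "(LINT x:(\<Union>i. A i)|lborel. H x) = (\<Sum>i. (LINT x:(A i)|lborel. H x))"
    proof (rule lebesgue_integral_countable_add[OF m])
      show "A i \<inter> A j = {}" if "i \<noteq> j" for i j
        using union(1) that by (auto simp: disjoint_family_on_def)
      show "set_integrable lborel (\<Union>i. A i) H"
        unfolding set_integrable_def by (intro integrable_mult_indicator H) (use m in auto)
    qed
    then show ?case using union(3) by simp
  qed (auto simp: set_lebesgue_integral_def)
qed

text \<open>By \<open>ift_heat_pairing\<close>, \<open>H\<close> is orthogonal to the heat averages
  of every bounded continuous integrable function, hence to the function itself; indicators of open
  boxes are bounded limits of such functions.\<close>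

theorem ift_eq_0_imp_AE_eq_0:
  fixes H :: "'a::euclidean_space \<Rightarrow> complex"
  assumes H: "integrable lborel H" and z: "\<And>x. ift H x = 0"
  shows "AE x in lborel. H x = 0"
proof (rule AE_eq_0_if_box_integrals_eq_0[OF H])
  show "(LINT x|lborel. H x) = 0" using z[of 0] by (simp add: ift_def)
  have [measurable]: "H \<in> borel_measurable borel" using H by (auto dest: borel_measurable_integrable)
  have test: "(LINT \<xi>|lborel. H \<xi> * h \<xi>) = 0"
    if h: "integrable lborel h" "continuous_on UNIV h" "\<And>x. cmod (h x) \<le> B" for h B
  proof -
    have [measurable]: "h \<in> borel_measurable borel" using h by (auto dest: borel_measurable_integrable)
    have "(\<lambda>n. LINT \<xi>|lborel. H \<xi> * (LINT y|lborel. heat (gstep n) y *\<^sub>R h (\<xi> + y))) \<longlonglongrightarrow> (LINT \<xi>|lborel. H \<xi> * h \<xi>)"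
    proof (rule integral_dominated_convergence[where w="\<lambda>\<xi>. cmod (H \<xi>) * B"])
      have hb: "cmod (LINT y|lborel. heat (gstep n) y *\<^sub>R h (\<xi> + y)) \<le> B" for n \<xi>
      proof -
        have "cmod (LINT y|lborel. heat (gstep n) y *\<^sub>R h (\<xi> + y)) \<le> (LINT y|lborel. heat (gstep n) (y::'a) * B)"
          by (rule order_trans[OF integral_norm_bound], rule integral_mono')
            (use gstep(1)[of n] h(3) order_trans[OF norm_ge_zero h(3)] in \<open>auto simp: integrable_heat intro!: mult_left_mono\<close>)
        then show ?thesis using gstep(1)[of n] by (simp add: integral_heat)
      qed
      show "AE \<xi> in lborel. (\<lambda>n. H \<xi> * (LINT y|lborel. heat (gstep n) y *\<^sub>R h (\<xi> + y))) \<longlonglongrightarrow> H \<xi> * h \<xi>"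
        by (intro AE_I2 tendsto_intros heat_approximation[OF h(2,3)] gstep)
      show "AE \<xi> in lborel. norm (H \<xi> * (LINT y|lborel. heat (gstep n) y *\<^sub>R h (\<xi> + y))) \<le> cmod (H \<xi>) * B" for n
        by (intro AE_I2) (simp add: norm_mult mult_left_mono hb)
      show "integrable lborel (\<lambda>\<xi>. cmod (H \<xi>) * B)" using H by simp
    qed measurable
    moreover have "(LINT \<xi>|lborel. H \<xi> * (LINT y|lborel. heat (gstep n) y *\<^sub>R h (\<xi> + y))) = 0" for n
      using ift_heat_pairing(2)[OF H h(1) gstep(1)[of n]] by (simp add: z)
    ultimately show ?thesis by (simp add: LIMSEQ_const_iff)
  qed
  fix a b :: 'a
  \<comment> \<open>Continuous functions increasing to the indicator of the open box: n times the
    distance to the complement, capped at 1.\<close>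
  define h where "h n x = complex_of_real (min 1 (real n * infdist x (- box a b)))" for n x
  \<comment> \<open>The distance to the empty set is 0 by convention, so a nonempty complement has
    to be secured before distances detect membership.\<close>
  have ne: "- box a b \<noteq> {}"
    using bounded_box[of a b] not_bounded_UNIV by (metis Compl_UNIV_eq double_compl)
  have h0: "h n x = 0" if "x \<notin> box a b" for n x using that by (simp add: h_def)
  have hle: "cmod (h n x) \<le> indicator (box a b) x" for n x
  proof (cases "x \<in> box a b")
    case True
    have "0 \<le> real n * infdist x (- box a b)" by (simp add: infdist_nonneg)
    then have "\<bar>min 1 (real n * infdist x (- box a b))\<bar> \<le> 1" by linarith
    with True show ?thesis by (simp only: h_def norm_of_real indicator_simps)
  qed (simp add: h0)
  have hc: "continuous_on UNIV (h n)" for n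
    unfolding h_def by (intro continuous_intros)
  have [measurable]: "h n \<in> borel_measurable borel" for n using hc by (rule borel_measurable_continuous_onI)
  have hi: "integrable lborel (h n)" for n
    by (rule Bochner_Integration.integrable_bound[of _ "indicator (box a b) :: 'a \<Rightarrow> real"])
       (use hle in \<open>auto intro!: integrable_real_indicator emeasure_lborel_box_finite\<close>)
  have "(\<lambda>n. LINT x|lborel. H x * h n x) \<longlonglongrightarrow> (LINT x|lborel. indicator (box a b) x *\<^sub>R H x)"
  proof (rule integral_dominated_convergence[where w="\<lambda>x. cmod (H x)"])
    show "AE x in lborel. (\<lambda>n. H x * h n x) \<longlonglongrightarrow> indicator (box a b) x *\<^sub>R H x"
    proof (intro AE_I2)
      fix x
      show "(\<lambda>n. H x * h n x) \<longlonglongrightarrow> indicator (box a b) x *\<^sub>R H x"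
      proof (cases "x \<in> box a b")
        case True
        have "closed (- box a b)" using open_box[of a b] by (simp only: closed_Compl)
        then have "infdist x (- box a b) \<noteq> 0"
          using in_closed_iff_infdist_zero[OF _ ne] True by auto
        then have d: "infdist x (- box a b) > 0" using infdist_nonneg[of x] by (simp add: less_le)
        have "\<forall>\<^sub>F n in sequentially. real n \<ge> 1 / infdist x (- box a b)"
          by (rule filterlim_at_top[THEN iffD1, rule_format, OF filterlim_real_sequentially])
        then have "\<forall>\<^sub>F n in sequentially. H x * h n x = H x"
          by eventually_elim (use d in \<open>simp add: h_def field_simps\<close>)
        then show ?thesis using True by (simp add: tendsto_eventually)
      qed (simp add: h0)
    qed
    show "AE x in lborel. norm (H x * h n x) \<le> cmod (H x)" for n
      using order_trans[OF hle, of x 1 for x] by (intro AE_I2) (auto simp: norm_mult intro!: mult_left_le)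
  qed (use H in auto)
  moreover have "(LINT x|lborel. H x * h n x) = 0" for n
    by (rule test[OF hi hc, of _ 1]) (rule order_trans[OF hle], simp)
  ultimately show "(LINT x|lborel. indicator (box a b) x *\<^sub>R H x) = 0" by (simp add: LIMSEQ_const_iff)
qed

section \<open>Rapidly decreasing functions\<close>

text \<open>Decay without smoothness. Multiplication by a bounded discontinuous symbol such as
  \<open>proj\<close> stays in this class, whereas it leaves the Schwartz functions.\<close>

definition rapid :: "('a::euclidean_space \<Rightarrow> complex) \<Rightarrow> bool" where
  "rapid \<phi> \<longleftrightarrow> \<phi> \<in> borel_measurable borel \<and> (\<forall>k. \<exists>B. \<forall>x. norm x ^ k * cmod (\<phi> x) \<le> B)"

lemma rapid_measurable: "rapid \<phi> \<Longrightarrow> \<phi> \<in> borel_measurable borel"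
  by (simp add: rapid_def)

lemma rapidE:
  assumes "rapid \<phi>"
  obtains B where "B \<ge> 0" "\<And>x. norm x ^ k * cmod (\<phi> x) \<le> B"
proof -
  obtain B where "\<And>x. norm x ^ k * cmod (\<phi> x) \<le> B" using assms by (auto simp: rapid_def)
  then show ?thesis by (intro that[of "max B 0"]) (auto intro: order_trans[OF _ max.cobounded1])
qed

lemma rapid_add:
  assumes "rapid \<phi>" "rapid \<psi>" shows "rapid (\<lambda>x. \<phi> x + \<psi> x)"
proof -
  have "\<exists>B. \<forall>x. norm x ^ k * cmod (\<phi> x + \<psi> x) \<le> B" for k
  proof -
    obtain B B' where B: "\<And>x. norm x ^ k * cmod (\<phi> x) \<le> B" "\<And>x. norm x ^ k * cmod (\<psi> x) \<le> B'"
      using rapidE[OF assms(1), of k] rapidE[OF assms(2), of k] by metis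
    have "norm x ^ k * cmod (\<phi> x + \<psi> x) \<le> norm x ^ k * (cmod (\<phi> x) + cmod (\<psi> x))" for x
      by (intro mult_left_mono norm_triangle_ineq) auto
    then have "norm x ^ k * cmod (\<phi> x + \<psi> x) \<le> B + B'" for x
      using B[of x] by (fastforce simp: distrib_left intro: order_trans)
    then show ?thesis by blast
  qed
  then show ?thesis using assms by (auto simp: rapid_def)
qed

lemma one_plus_power_le: "(1 + r) ^ n \<le> 2 ^ n * (1 + r ^ n)" if "r \<ge> 0" for r :: real
proof -
  have "(1 + r) ^ n \<le> (2 * max 1 r) ^ n" using that by (intro power_mono) auto
  also have "\<dots> \<le> 2 ^ n * (1 + r ^ n)"
    unfolding power_mult_distrib using that by (intro mult_left_mono) (auto simp: max_def)
  finally show ?thesis .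
qed

lemma rapid_mult:
  assumes \<phi>: "rapid \<phi>" and m: "m \<in> borel_measurable borel"
    and b: "\<And>x. cmod (m x) \<le> C * (1 + norm x) ^ N"
  shows "rapid (\<lambda>x. m x * \<phi> x)"
proof -
  have "\<exists>B. \<forall>x. norm x ^ k * cmod (m x * \<phi> x) \<le> B" for k
  proof -
    obtain B B' where B: "\<And>x. norm x ^ k * cmod (\<phi> x) \<le> B" "\<And>x. norm x ^ (k + N) * cmod (\<phi> x) \<le> B'"
      using rapidE[OF \<phi>, of k] rapidE[OF \<phi>, of "k + N"] by metis
    have C: "C \<ge> 0" using order_trans[OF norm_ge_zero b[of 0]] by simp
    have "norm x ^ k * cmod (m x * \<phi> x) \<le> C * 2 ^ N * (B + B')" for x
    proof -
      have "norm x ^ k * cmod (m x * \<phi> x) = cmod (m x) * (norm x ^ k * cmod (\<phi> x))"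
        by (simp add: norm_mult mult_ac)
      also have "\<dots> \<le> (C * (2 ^ N * (1 + norm x ^ N))) * (norm x ^ k * cmod (\<phi> x))"
        by (intro mult_right_mono order_trans[OF b] mult_left_mono one_plus_power_le C) auto
      also have "\<dots> = C * 2 ^ N * (norm x ^ k * cmod (\<phi> x) + norm x ^ (k + N) * cmod (\<phi> x))"
        by (simp add: algebra_simps power_add)
      also have "\<dots> \<le> C * 2 ^ N * (B + B')"
        using C by (intro mult_left_mono add_mono B) auto
      finally show ?thesis .
    qed
    then show ?thesis by blast
  qed
  then show ?thesis using \<phi> m by (auto simp: rapid_def)
qed

lemma rapid_cmult: "rapid \<phi> \<Longrightarrow> rapid (\<lambda>x. c * \<phi> x)"
  by (rule rapid_mult[where C="cmod c" and N=0]) auto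

lemma rapid_sum: "finite I \<Longrightarrow> (\<And>i. i \<in> I \<Longrightarrow> rapid (\<phi> i)) \<Longrightarrow> rapid (\<lambda>x. \<Sum>i\<in>I. \<phi> i x)"
proof (induction I rule: finite_induct)
  case empty
  then show ?case by (auto simp: rapid_def)
next
  case (insert i I)
  then show ?case by (auto intro: rapid_add)
qed

lemma rapid_mult_component:
  "rapid \<phi> \<Longrightarrow> rapid (\<lambda>x::real^3. \<i> * of_real (x $ j) * \<phi> x)"
  by (rule rapid_mult[where C=1 and N=1])
     (auto simp: norm_mult intro: order_trans[OF component_le_norm_cart])

lemma rapid_cnj: "rapid \<phi> \<Longrightarrow> rapid (\<lambda>x. cnj (\<phi> x))"
  by (auto simp: rapid_def intro: borel_measurable_cnj)

lemma rapid_reflect: "rapid \<phi> \<Longrightarrow> rapid (\<lambda>x. \<phi> (- x))"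
  unfolding rapid_def
proof safe
  fix k assume "\<forall>k. \<exists>B. \<forall>x. norm x ^ k * cmod (\<phi> x) \<le> B"
  then obtain B where "\<And>x. norm x ^ k * cmod (\<phi> x) \<le> B" by blast
  from this[of "- x" for x] show "\<exists>B. \<forall>x. norm x ^ k * cmod (\<phi> (- x)) \<le> B" by (intro exI[of _ B]) simp
qed (auto intro: measurable_compose[of uminus])

text \<open>A product majorant reduces integrability to one dimension. The profile is 1 / (1 + s^2)
  for rapidly decreasing functions, and gains the factor |s|^(-1/3) for functions with a singularity
  like 1 / |\<xi>|.\<close>

lemma integrable_if_decay:
  fixes g :: "'a::euclidean_space \<Rightarrow> complex"
  assumes m: "g \<in> borel_measurable borel" and p: "integrable lborel p" "\<And>s. p s \<ge> 0"
    and b: "AE x in lborel. cmod (g x) \<le> B * (\<Prod>b\<in>Basis. p (x \<bullet> b))"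
  shows "integrable lborel g"
proof (rule Bochner_Integration.integrable_bound)
  show "integrable lborel (\<lambda>x::'a. B * (\<Prod>b\<in>Basis. p (x \<bullet> b)))"
    by (intro integrable_mult_right integrable_lborel_prod_Basis p)
  show "AE x in lborel. norm (g x) \<le> norm (B * (\<Prod>b\<in>Basis. p (x \<bullet> b)))"
    using b by eventually_elim (auto intro: order_trans)
qed (use m in simp)

lemma prod_one_plus_square_le:
  "(\<Prod>b\<in>Basis. 1 + (x \<bullet> b)\<^sup>2) \<le> (1 + norm (x::'a::euclidean_space)) ^ (2 * DIM('a))"
proof -
  have "(\<Prod>b\<in>Basis. 1 + (x \<bullet> b)\<^sup>2) \<le> (\<Prod>b\<in>(Basis::'a set). (1 + norm x)\<^sup>2)"
  proof (intro prod_mono conjI)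
    fix b :: 'a assume "b \<in> Basis"
    then have "(x \<bullet> b)\<^sup>2 \<le> (norm x)\<^sup>2" using Basis_le_norm[of b x] by (simp add: abs_le_square_iff[symmetric])
    then show "1 + (x \<bullet> b)\<^sup>2 \<le> (1 + norm x)\<^sup>2" using norm_ge_zero[of x] unfolding power2_sum one_power2 by linarith
  qed auto
  then show ?thesis by (simp add: power_mult)
qed

lemma rapid_decay:
  assumes "rapid g"
  obtains B where "B \<ge> 0" "\<And>x. cmod (g x) \<le> B * (\<Prod>b\<in>Basis. 1 / (1 + (x \<bullet> b)\<^sup>2))"
proof -
  let ?m = "\<lambda>x::'a. complex_of_real ((1 + norm x) ^ (2 * DIM('a)))"
  have "rapid (\<lambda>x. ?m x * g x)"
    by (rule rapid_mult[OF assms, where C=1 and N="2 * DIM('a)"])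
       (auto simp: norm_power simp del: of_real_power)
  then obtain B where B: "B \<ge> 0" "\<And>x. norm x ^ 0 * cmod (?m x * g x) \<le> B"
    using rapidE[where k=0] by blast
  have "cmod (g x) \<le> B * (\<Prod>b\<in>Basis. 1 / (1 + (x \<bullet> b)\<^sup>2))" for x
  proof -
    have pos: "(\<Prod>b\<in>Basis. 1 + (x \<bullet> b)\<^sup>2) > 0" by (intro prod_pos) (auto intro: add_pos_nonneg)
    have "(\<Prod>b\<in>Basis. 1 + (x \<bullet> b)\<^sup>2) * cmod (g x) \<le> (1 + norm x) ^ (2 * DIM('a)) * cmod (g x)"
      by (intro mult_right_mono prod_one_plus_square_le) auto
    also have "\<dots> \<le> B" using B(2)[of x] by (simp add: norm_mult norm_power del: of_real_power)
    finally show ?thesis using pos by (simp add: prod_dividef field_simps)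
  qed
  with B(1) show ?thesis by (rule that)
qed

lemma rapid_integrable: "rapid g \<Longrightarrow> integrable lborel g"
proof -
  assume g: "rapid g"
  obtain B where "\<And>x. cmod (g x) \<le> B * (\<Prod>b\<in>Basis. 1 / (1 + (x \<bullet> b)\<^sup>2))"
    using rapid_decay[OF g] by blast
  then show ?thesis
    by (intro integrable_if_decay[where p="\<lambda>s. 1 / (1 + s\<^sup>2)" and B=B])
       (auto simp: rapid_measurable[OF g] integrable_inverse_square_real)
qed

lemma rapid_bounded: assumes "rapid g" obtains B where "B \<ge> 0" "\<And>x. cmod (g x) \<le> B"
  using rapidE[OF assms, of 0] by auto

lemma rapid_norm_power_integrable: "rapid g \<Longrightarrow> integrable lborel (\<lambda>x. norm x ^ k * cmod (g x))"
proof -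
  assume g: "rapid g"
  have "rapid (\<lambda>x. complex_of_real (norm x ^ k) * g x)"
    by (rule rapid_mult[OF g, where C=1 and N=k]) (auto simp: norm_power intro: power_mono)
  from integrable_norm[OF rapid_integrable[OF this]] show ?thesis by (simp add: norm_mult norm_power)
qed

lemma rapid_square_integrable:
  assumes g: "rapid g" shows "integrable lborel (\<lambda>x. (cmod (g x))\<^sup>2)"
proof -
  obtain B where B: "B \<ge> 0" "\<And>x. cmod (g x) \<le> B" using rapid_bounded[OF g] by blast
  note [measurable] = rapid_measurable[OF g]
  show ?thesis
    by (rule Bochner_Integration.integrable_bound[of _ "\<lambda>x. B * cmod (g x)"])
       (use rapid_integrable[OF g] B in \<open>auto simp: power2_eq_square intro!: mult_right_mono\<close>)
qed

lemma rapid_has_derivative_ift: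
  assumes "rapid g"
  shows "(ift g has_derivative (\<lambda>v. ift (\<lambda>\<xi>. \<i> * of_real (v \<bullet> \<xi>) * g \<xi>) x)) (at x)"
  by (intro has_derivative_ift rapid_integrable rapid_norm_power_integrable assms)

lemma partial_eqI: "(f has_derivative f') (at x) \<Longrightarrow> partial i f x = f' (axis i 1)"
  unfolding partial_def by (metis frechet_derivative_at)

lemma partial_ift:
  assumes g: "integrable lborel g" and g2: "integrable lborel (\<lambda>\<xi>. (norm \<xi>)\<^sup>2 * cmod (g \<xi>))"
  shows "partial i (ift g) = ift (\<lambda>\<xi>. \<i> * of_real (\<xi> $ i) * g \<xi>)"
  using partial_eqI[OF has_derivative_ift[OF assms], of i] by (auto simp: inner_axis')

lemma integrable_powr_decay: "integrable lborel (\<lambda>s::real. \<bar>s\<bar> powr (-1/3) * (1 / (1 + s\<^sup>2)))"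
proof -
  have "(\<lambda>s::real. s powr (-1/3)) integrable_on {0..1}"
    by (rule integrable_on_powr_from_0) auto
  then have "(\<lambda>s::real. s powr (-1/3)) absolutely_integrable_on {0..1}"
    by (intro nonnegative_absolutely_integrable_1) auto
  then have "integrable lebesgue (\<lambda>s::real. indicator {0..1} s *\<^sub>R s powr (-1/3))"
    by (simp add: set_integrable_def)
  then have p: "integrable lborel (\<lambda>s::real. indicator {0..1} s *\<^sub>R s powr (-1/3))"
    by (subst (asm) integrable_completion) auto
  then have n: "integrable lborel (\<lambda>s::real. indicator {0..1} (-s) *\<^sub>R (-s) powr (-1/3))"
    using integrable_lborel_reflect_iff[of "\<lambda>s::real. indicator {0..1} s *\<^sub>R s powr (-1/3)"] by simp
  show ?thesis
  proof (rule Bochner_Integration.integrable_bound)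
    show "integrable lborel (\<lambda>s::real. indicator {0..1} s *\<^sub>R s powr (-1/3) + indicator {0..1} (-s) *\<^sub>R (-s) powr (-1/3) + 1 / (1 + s\<^sup>2))"
      using p n integrable_inverse_square_real by (intro Bochner_Integration.integrable_add)
    have le: "\<bar>s\<bar> powr (-1/3) * (1 / (1 + s\<^sup>2)) \<le> indicator {0..1} s *\<^sub>R s powr (-1/3) + indicator {0..1} (-s) *\<^sub>R (-s) powr (-1/3) + 1 / (1 + s\<^sup>2)" for s :: real
    proof (cases "\<bar>s\<bar> \<le> 1")
      case True
      have "\<bar>s\<bar> powr (-1/3) * (1 / (1 + s\<^sup>2)) \<le> \<bar>s\<bar> powr (-1/3)"
        by (intro mult_left_le) (auto simp: divide_le_eq_1 add_pos_nonneg)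
      also have "\<dots> \<le> indicator {0..1} s *\<^sub>R s powr (-1/3) + indicator {0..1} (-s) *\<^sub>R (-s) powr (-1/3)"
        using True by (cases "s \<ge> 0") (auto simp: indicator_def abs_if)
      finally show ?thesis by (simp add: add_increasing2)
    next
      case False
      have "\<bar>s\<bar> powr (-1/3) \<le> 1" using False powr_mono[of "-1/3" 0 "\<bar>s\<bar>"] by (cases "s = 0") auto
      then have "\<bar>s\<bar> powr (-1/3) * (1 / (1 + s\<^sup>2)) \<le> 1 * (1 / (1 + s\<^sup>2))"
        by (intro mult_right_mono) auto
      also have "\<dots> \<le> indicator {0..1} s *\<^sub>R s powr (-1/3) + indicator {0..1} (-s) *\<^sub>R (-s) powr (-1/3) + 1 / (1 + s\<^sup>2)"
        by (simp add: indicator_def)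
      finally show ?thesis .
    qed
    show "AE s in lborel. norm (\<bar>s\<bar> powr (-1/3) * (1 / (1 + s\<^sup>2)))
      \<le> norm (indicator {0..1} s *\<^sub>R s powr (-1/3) + indicator {0..1} (-s) *\<^sub>R (-s) powr (-1/3) + 1 / (1 + s\<^sup>2) :: real)"
    proof (intro AE_I2)
      fix s :: real
      have "norm (\<bar>s\<bar> powr (-1/3) * (1 / (1 + s\<^sup>2))) = \<bar>s\<bar> powr (-1/3) * (1 / (1 + s\<^sup>2))"
        by (simp add: abs_mult)
      then show "norm (\<bar>s\<bar> powr (-1/3) * (1 / (1 + s\<^sup>2)))
        \<le> norm (indicator {0..1} s *\<^sub>R s powr (-1/3) + indicator {0..1} (-s) *\<^sub>R (-s) powr (-1/3) + 1 / (1 + s\<^sup>2) :: real)"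
        using le[of s] abs_ge_self unfolding real_norm_def by (metis order_trans)
    qed
  qed measurable
qed

lemma AE_inner_Basis_neq_0: "b \<in> Basis \<Longrightarrow> AE x in lborel. (x::'a::euclidean_space) \<bullet> b \<noteq> 0"
proof -
  assume b: "b \<in> Basis"
  have s: "{x::'a. x \<bullet> b = 0} \<in> sets borel" by measurable
  have "negligible {x::'a. x \<bullet> b = 0}" using negligible_standard_hyperplane[OF b] by simp
  then have "{x::'a. x \<bullet> b = 0} \<in> null_sets lborel"
    using s by (simp add: negligible_iff_null_sets null_sets_completion_iff)
  from AE_not_in[OF this] show ?thesis by simp
qed

text \<open>Functions of the form \<open>g = h / |\<xi>|\<close> with rapidly decreasing \<open>h\<close> arise from the inverse Laplacian;
  they are integrable because \<open>1 / |\<xi>| \<le> \<Prod>\<^sub>i |\<xi>\<^sub>i|\<^bsup>-1/3\<^esup>\<close>.\<close>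

lemma integrable_if_norm_mult_rapid:
  fixes g :: "real^3 \<Rightarrow> complex"
  assumes m: "g \<in> borel_measurable borel" and r: "rapid (\<lambda>\<xi>. of_real (norm \<xi>) * g \<xi>)"
  shows "integrable lborel g"
proof -
  obtain B where B: "B \<ge> 0" "\<And>\<xi>. cmod (of_real (norm \<xi>) * g \<xi>) \<le> B * (\<Prod>b\<in>Basis. 1 / (1 + (\<xi> \<bullet> b)\<^sup>2))"
    using rapid_decay[OF r] by blast
  let ?p = "\<lambda>s::real. \<bar>s\<bar> powr (-1/3) * (1 / (1 + s\<^sup>2))"
  \<comment> \<open>On the coordinate planes the majorant is 0, since \<open>0 powr a = 0\<close> by
    convention; these planes are null and are discarded.\<close>
  have "AE \<xi> in lborel. \<forall>b\<in>Basis. (\<xi>::real^3) \<bullet> b \<noteq> 0"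
    using AE_inner_Basis_neq_0 by (intro AE_finite_allI) auto
  then have "AE \<xi> in lborel. cmod (g \<xi>) \<le> B * (\<Prod>b\<in>Basis. ?p (\<xi> \<bullet> b))"
  proof eventually_elim
    case (elim \<xi>)
    obtain b0 :: "real^3" where b0: "b0 \<in> Basis" using nonempty_Basis by blast
    then have n: "norm \<xi> > 0" using elim by auto
    have "(\<Prod>b\<in>Basis. \<bar>\<xi> \<bullet> b\<bar> powr (1/3)) \<le> (\<Prod>b\<in>(Basis::(real^3) set). norm \<xi> powr (1/3))"
      by (intro prod_mono conjI powr_mono2) (auto intro: Basis_le_norm)
    also have "\<dots> = norm \<xi>" using n by (simp add: powr_powr flip: powr_realpow)
    finally have le: "(\<Prod>b\<in>Basis. \<bar>\<xi> \<bullet> b\<bar> powr (1/3)) \<le> norm \<xi>" .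
    have pos: "(\<Prod>b\<in>Basis. \<bar>\<xi> \<bullet> b\<bar> powr (1/3)) > 0" using elim by (intro prod_pos) auto
    have "1 / norm \<xi> \<le> 1 / (\<Prod>b\<in>Basis. \<bar>\<xi> \<bullet> b\<bar> powr (1/3))"
      using le pos n by (intro divide_left_mono mult_pos_pos) auto
    also have "\<dots> = (\<Prod>b\<in>Basis. \<bar>\<xi> \<bullet> b\<bar> powr (-1/3))"
      by (simp add: powr_minus_divide prod_dividef flip: minus_divide_left)
    finally have inv: "1 / norm \<xi> \<le> (\<Prod>b\<in>Basis. \<bar>\<xi> \<bullet> b\<bar> powr (-1/3))" .
    have "cmod (g \<xi>) = 1 / norm \<xi> * cmod (of_real (norm \<xi>) * g \<xi>)"
      using n by (simp add: norm_mult)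
    also have "\<dots> \<le> (\<Prod>b\<in>Basis. \<bar>\<xi> \<bullet> b\<bar> powr (-1/3)) * (B * (\<Prod>b\<in>Basis. 1 / (1 + (\<xi> \<bullet> b)\<^sup>2)))"
      by (intro mult_mono inv B) (auto intro!: prod_nonneg)
    also have "\<dots> = B * (\<Prod>b\<in>Basis. ?p (\<xi> \<bullet> b))"
      by (simp only: prod.distrib mult.left_commute)
    finally show ?case .
  qed
  then show ?thesis
    by (intro integrable_if_decay[OF m integrable_powr_decay]) auto
qed

section \<open>Schwartz functions\<close>

text \<open>The definition speaks of all iterated derivatives. A class closed under
  \<open>partial\<close> reduces this to single derivatives; each closure property below only has to
  exhibit such a class.\<close>

lemma schwartz_coinduct:
  assumes "\<phi> \<in> C" and p: "\<And>\<phi> i. \<phi> \<in> C \<Longrightarrow> partial i \<phi> \<in> C"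
    and d: "\<And>\<phi> x. \<phi> \<in> C \<Longrightarrow> \<phi> differentiable at x" and r: "\<And>\<phi>. \<phi> \<in> C \<Longrightarrow> rapid \<phi>"
  shows "schwartz \<phi>"
proof -
  have C: "foldr partial is \<phi> \<in> C" for "is" by (induction "is") (auto simp: assms)
  have "bounded (range (\<lambda>x. norm x ^ k *\<^sub>R foldr partial is \<phi> x))" for "is" k
  proof -
    obtain B where "\<And>x. norm x ^ k * cmod (foldr partial is \<phi> x) \<le> B"
      using rapidE[OF r[OF C], of k] by metis
    then show ?thesis by (auto simp: bounded_iff)
  qed
  then show ?thesis unfolding schwartz_def using d[OF C] by blast
qed

lemma schwartz_partial: assumes "schwartz \<phi>" shows "schwartz (partial i \<phi>)"
proof -
  have "foldr partial is (partial i \<phi>) = foldr partial (is @ [i]) \<phi>" for "is" by simp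
  then show ?thesis using assms unfolding schwartz_def by metis
qed

lemma schwartz_differentiable: "schwartz \<phi> \<Longrightarrow> \<phi> differentiable at x"
  unfolding schwartz_def by (metis foldr.simps(1) id_apply)

lemma schwartz_has_derivative: "schwartz \<phi> \<Longrightarrow> (\<phi> has_derivative frechet_derivative \<phi> (at x)) (at x)"
  using schwartz_differentiable frechet_derivative_works by blast

lemma schwartz_continuous: "schwartz \<phi> \<Longrightarrow> continuous_on S \<phi>"
  by (meson continuous_at_imp_continuous_on differentiable_imp_continuous_within schwartz_differentiable)

lemma schwartz_rapid: assumes "schwartz \<phi>" shows "rapid \<phi>"
  unfolding rapid_def
proof safe
  show "\<phi> \<in> borel_measurable borel" using schwartz_continuous[OF assms] by (rule borel_measurable_continuous_onI)
  fix k
  have "bounded (range (\<lambda>x. norm x ^ k *\<^sub>R \<phi> x))"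
    using assms unfolding schwartz_def by (metis foldr.simps(1) id_apply)
  then show "\<exists>B. \<forall>x. norm x ^ k * cmod (\<phi> x) \<le> B" by (auto simp: bounded_iff)
qed

lemma frechet_axis: "frechet_derivative \<phi> (at x) (axis i 1) = partial i \<phi> x"
  by (simp add: partial_def)

lemma schwartz_add: assumes "schwartz \<phi>" "schwartz \<psi>" shows "schwartz (\<lambda>x. \<phi> x + \<psi> x)"
proof (rule schwartz_coinduct[of _ "{(\<lambda>x. \<phi> x + \<psi> x) | \<phi> \<psi>. schwartz \<phi> \<and> schwartz \<psi>}"])
  show "partial i \<theta> \<in> {(\<lambda>x. \<phi> x + \<psi> x) | \<phi> \<psi>. schwartz \<phi> \<and> schwartz \<psi>}"
    if "\<theta> \<in> {(\<lambda>x. \<phi> x + \<psi> x) | \<phi> \<psi>. schwartz \<phi> \<and> schwartz \<psi>}" for \<theta> i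
  proof -
    from that obtain \<phi> \<psi> where *: "\<theta> = (\<lambda>x. \<phi> x + \<psi> x)" "schwartz \<phi>" "schwartz \<psi>" by blast
    have "partial i \<theta> x = partial i \<phi> x + partial i \<psi> x" for x
      using partial_eqI[OF has_derivative_add[OF schwartz_has_derivative[OF *(2)] schwartz_has_derivative[OF *(3)]], of i x]
      by (simp add: *(1) frechet_axis)
    then show ?thesis using * schwartz_partial by blast
  qed
  show "\<theta> differentiable at x" if "\<theta> \<in> {(\<lambda>x. \<phi> x + \<psi> x) | \<phi> \<psi>. schwartz \<phi> \<and> schwartz \<psi>}" for \<theta> x
    using that differentiable_add[OF schwartz_differentiable schwartz_differentiable] by blast
  show "rapid \<theta>" if "\<theta> \<in> {(\<lambda>x. \<phi> x + \<psi> x) | \<phi> \<psi>. schwartz \<phi> \<and> schwartz \<psi>}" for \<theta>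
    using that rapid_add[OF schwartz_rapid schwartz_rapid] by blast
qed (use assms in blast)

lemma schwartz_cmult: assumes "schwartz \<phi>" shows "schwartz (\<lambda>x. c * \<phi> x)"
proof (rule schwartz_coinduct[of _ "{(\<lambda>x. c * \<phi> x) | \<phi>. schwartz \<phi>}"])
  show "partial i \<theta> \<in> {(\<lambda>x. c * \<phi> x) | \<phi>. schwartz \<phi>}" if "\<theta> \<in> {(\<lambda>x. c * \<phi> x) | \<phi>. schwartz \<phi>}" for \<theta> i
  proof -
    from that obtain \<phi> where *: "\<theta> = (\<lambda>x. c * \<phi> x)" "schwartz \<phi>" by blast
    have "partial i \<theta> x = c * partial i \<phi> x" for x
    proof -
      have "((\<lambda>x. c * \<phi> x) has_derivative (\<lambda>v. c * frechet_derivative \<phi> (at x) v)) (at x)"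
        by (rule has_derivative_mult_right[OF schwartz_has_derivative[OF *(2)]])
      from partial_eqI[OF this, of i] show ?thesis by (simp add: *(1) frechet_axis)
    qed
    then show ?thesis using schwartz_partial[OF *(2)] by blast
  qed
  show "\<theta> differentiable at x" if "\<theta> \<in> {(\<lambda>x. c * \<phi> x) | \<phi>. schwartz \<phi>}" for \<theta> x
    using that differentiable_mult[OF differentiable_const schwartz_differentiable] by blast
  show "rapid \<theta>" if "\<theta> \<in> {(\<lambda>x. c * \<phi> x) | \<phi>. schwartz \<phi>}" for \<theta>
    using that rapid_cmult[OF schwartz_rapid] by blast
qed (use assms in blast)

lemma schwartz_sum: "finite I \<Longrightarrow> I \<noteq> {} \<Longrightarrow> (\<And>i. i \<in> I \<Longrightarrow> schwartz (\<phi> i)) \<Longrightarrow> schwartz (\<lambda>x. \<Sum>i\<in>I. \<phi> i x)"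
  by (induction I rule: finite_ne_induct) (auto intro: schwartz_add)

lemma partial_component_mult:
  assumes "\<phi> differentiable at x"
  shows "partial i (\<lambda>x. of_real (x $ j) * \<phi> x) x = of_real (if i = j then 1 else 0) * \<phi> x + of_real (x $ j) * partial i \<phi> x"
proof -
  have "((\<lambda>x. of_real (x $ j) * \<phi> x) has_derivative
      (\<lambda>v. of_real (x $ j) * frechet_derivative \<phi> (at x) v + of_real (v $ j) * \<phi> x)) (at x)"
    using assms[unfolded frechet_derivative_works]
    by (intro has_derivative_mult has_derivative_of_real bounded_linear_imp_has_derivative bounded_linear_vec_nth)
  moreover have "axis i (1::real) $ j = (if i = j then 1 else 0)" by (simp add: axis_def)
  ultimately show ?thesis using partial_eqI by (fastforce simp: frechet_axis)
qed

lemma differentiable_component_mult: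
  assumes "\<phi> differentiable at x"
  shows "(\<lambda>x::real^3. complex_of_real (x $ j) * \<phi> x) differentiable at x"
proof (intro differentiable_mult assms)
  have "((\<lambda>x::real^3. complex_of_real (x $ j)) has_derivative (\<lambda>v. of_real (v $ j))) (at x)"
    by (intro has_derivative_of_real bounded_linear_imp_has_derivative bounded_linear_vec_nth)
  then show "(\<lambda>x::real^3. complex_of_real (x $ j)) differentiable at x" unfolding differentiable_def by blast
qed

lemma rapid_component: "rapid \<phi> \<Longrightarrow> rapid (\<lambda>x::real^3. of_real (x $ j) * \<phi> x)"
  by (rule rapid_mult[where C=1 and N=1]) (auto intro: order_trans[OF component_le_norm_cart])

lemma schwartz_component: assumes "schwartz \<phi>" shows "schwartz (\<lambda>x. of_real (x $ j) * \<phi> x)"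
proof -
  \<comment> \<open>Differentiating the coordinate factor leaves a term without it, so the class
    that is closed under \<open>partial\<close> must consist of sums.\<close>
  let ?C = "{(\<lambda>x. of_real (x $ j) * \<phi> x + \<psi> x) | \<phi> \<psi>. schwartz \<phi> \<and> schwartz \<psi>}"
  have diff: "(\<lambda>x. of_real (x $ j) * \<phi> x) differentiable at x" if "schwartz \<phi>" for \<phi> x
    using that by (intro differentiable_component_mult schwartz_differentiable)
  have "schwartz (\<lambda>x. of_real (x $ j) * \<phi> x + 0 * \<phi> x)"
  proof (rule schwartz_coinduct[of _ ?C])
    show "partial i \<theta> \<in> ?C" if "\<theta> \<in> ?C" for \<theta> i
    proof -
      from that obtain \<phi> \<psi> where *: "\<theta> = (\<lambda>x. of_real (x $ j) * \<phi> x + \<psi> x)" "schwartz \<phi>" "schwartz \<psi>" by blast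
      have "partial i \<theta> x = partial i (\<lambda>x. of_real (x $ j) * \<phi> x) x + partial i \<psi> x" for x
        using partial_eqI[OF has_derivative_add[OF diff[OF *(2), unfolded frechet_derivative_works] schwartz_has_derivative[OF *(3)]], of i x]
        by (simp add: *(1) frechet_axis)
      then have "partial i \<theta> = (\<lambda>x. of_real (x $ j) * partial i \<phi> x + (of_real (if i = j then 1 else 0) * \<phi> x + partial i \<psi> x))"
        using * by (auto simp: partial_component_mult schwartz_differentiable)
      moreover have "schwartz (\<lambda>x. of_real (if i = j then 1 else 0) * \<phi> x + partial i \<psi> x)"
        using * by (intro schwartz_add schwartz_cmult schwartz_partial)
      ultimately show ?thesis using schwartz_partial[OF *(2), of i]
        by (intro CollectI exI[of _ "partial i \<phi>"]
            exI[of _ "\<lambda>x. of_real (if i = j then 1 else 0) * \<phi> x + partial i \<psi> x"] conjI)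
    qed
    show "\<theta> differentiable at x" if "\<theta> \<in> ?C" for \<theta> x
      using that differentiable_add[OF diff schwartz_differentiable] by blast
    show "rapid \<theta>" if "\<theta> \<in> ?C" for \<theta>
      using that rapid_add[OF rapid_component[OF schwartz_rapid] schwartz_rapid] by blast
    show "(\<lambda>x. of_real (x $ j) * \<phi> x + 0 * \<phi> x) \<in> ?C"
      using assms schwartz_cmult[OF assms, of 0]
      by - (intro CollectI, rule exI[of _ \<phi>], rule exI[of _ "\<lambda>x. 0 * \<phi> x"], simp)
  qed
  then show ?thesis by simp
qed

lemma schwartz_reflect: assumes "schwartz \<phi>" shows "schwartz (\<lambda>x. \<phi> (- x))"
proof (rule schwartz_coinduct[of _ "{(\<lambda>x. \<phi> (- x)) | \<phi>. schwartz \<phi>}"])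
  have d: "((\<lambda>x. \<phi> (- x)) has_derivative (\<lambda>v. frechet_derivative \<phi> (at (- x)) (- v))) (at x)" if "schwartz \<phi>" for \<phi> x
    by (rule has_derivative_compose[OF _ schwartz_has_derivative[OF that]]) (auto intro!: derivative_eq_intros)
  show "partial i \<theta> \<in> {(\<lambda>x. \<phi> (- x)) | \<phi>. schwartz \<phi>}" if "\<theta> \<in> {(\<lambda>x. \<phi> (- x)) | \<phi>. schwartz \<phi>}" for \<theta> i
  proof -
    from that obtain \<phi> where *: "\<theta> = (\<lambda>x. \<phi> (- x))" "schwartz \<phi>" by blast
    have "partial i \<theta> x = (\<lambda>x. - 1 * partial i \<phi> x) (- x)" for x
      using partial_eqI[OF d[OF *(2)], of i x] linear_neg[OF has_derivative_linear[OF schwartz_has_derivative[OF *(2)]]]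
      by (simp add: *(1) frechet_axis)
    then have "partial i \<theta> = (\<lambda>x. (\<lambda>y. - 1 * partial i \<phi> y) (- x))" by auto
    then show ?thesis using schwartz_cmult[OF schwartz_partial[OF *(2)], of "-1" i]
      by (intro CollectI exI[of _ "\<lambda>y. - 1 * partial i \<phi> y"] conjI)
  qed
  show "\<theta> differentiable at x" if "\<theta> \<in> {(\<lambda>x. \<phi> (- x)) | \<phi>. schwartz \<phi>}" for \<theta> x
    using that d differentiable_def by blast
  show "rapid \<theta>" if "\<theta> \<in> {(\<lambda>x. \<phi> (- x)) | \<phi>. schwartz \<phi>}" for \<theta>
    using that rapid_reflect[OF schwartz_rapid] by blast
qed (use assms in blast)

lemma schwartz_cnj: assumes "schwartz \<phi>" shows "schwartz (\<lambda>x. cnj (\<phi> x))"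
proof (rule schwartz_coinduct[of _ "{(\<lambda>x. cnj (\<phi> x)) | \<phi>. schwartz \<phi>}"])
  have d: "((\<lambda>x. cnj (\<phi> x)) has_derivative (\<lambda>v. cnj (frechet_derivative \<phi> (at x) v))) (at x)" if "schwartz \<phi>" for \<phi> x
    using schwartz_has_derivative[OF that] by (rule has_derivative_cnj)
  show "partial i \<theta> \<in> {(\<lambda>x. cnj (\<phi> x)) | \<phi>. schwartz \<phi>}" if "\<theta> \<in> {(\<lambda>x. cnj (\<phi> x)) | \<phi>. schwartz \<phi>}" for \<theta> i
  proof -
    from that obtain \<phi> where *: "\<theta> = (\<lambda>x. cnj (\<phi> x))" "schwartz \<phi>" by blast
    have "partial i \<theta> x = cnj (partial i \<phi> x)" for x
      using partial_eqI[OF d[OF *(2)], of i x] by (simp add: *(1) frechet_axis)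
    then show ?thesis using schwartz_partial[OF *(2)] by blast
  qed
  show "\<theta> differentiable at x" if "\<theta> \<in> {(\<lambda>x. cnj (\<phi> x)) | \<phi>. schwartz \<phi>}" for \<theta> x
    using that d differentiable_def by blast
  show "rapid \<theta>" if "\<theta> \<in> {(\<lambda>x. cnj (\<phi> x)) | \<phi>. schwartz \<phi>}" for \<theta>
    using that rapid_cnj[OF schwartz_rapid] by blast
qed (use assms in blast)

lemma has_derivative_cis_inner:
  "((\<lambda>\<xi>. cis (x \<bullet> \<xi>)) has_derivative (\<lambda>v. \<i> * of_real (x \<bullet> v) * cis (x \<bullet> \<xi>))) (at \<xi>)"
proof -
  have "((\<lambda>s. cis s) has_derivative (\<lambda>s. s *\<^sub>R (\<i> * cis (x \<bullet> \<xi>)))) (at (x \<bullet> \<xi>))"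
    using has_vector_derivative_iexp[of "x \<bullet> \<xi>" UNIV] by (simp add: has_vector_derivative_def cis_conv_exp)
  from has_derivative_compose[OF bounded_linear_imp_has_derivative[OF bounded_linear_inner_right] this]
  show ?thesis by (simp add: scaleR_conv_of_real mult_ac)
qed

text \<open>Integration by parts: the derivative of
  \<open>cis (x \<bullet> \<xi>) * \<phi> \<xi>\<close> in direction j has integral 0.\<close>

lemma ift_partial:
  assumes \<phi>: "schwartz \<phi>" shows "ift (partial j \<phi>) x = - \<i> * of_real (x $ j) * ift \<phi> x"
proof -
  let ?F' = "\<lambda>\<xi> v. cis (x \<bullet> \<xi>) * frechet_derivative \<phi> (at \<xi>) v + (\<i> * of_real (x \<bullet> v) * cis (x \<bullet> \<xi>)) * \<phi> \<xi>"
  have e: "?F' \<xi> (axis j 1) = cis (x \<bullet> \<xi>) * partial j \<phi> \<xi> + \<i> * of_real (x $ j) * (cis (x \<bullet> \<xi>) * \<phi> \<xi>)" for \<xi>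
    by (simp add: frechet_axis inner_axis)
  have i: "integrable lborel (\<lambda>\<xi>. cis (x \<bullet> \<xi>) * partial j \<phi> \<xi>)" "integrable lborel (\<lambda>\<xi>. cis (x \<bullet> \<xi>) * \<phi> \<xi>)"
    by (rule integrable_cis_mult, intro rapid_integrable schwartz_rapid schwartz_partial \<phi>)+
  have "(LINT \<xi>|lborel. ?F' \<xi> (axis j 1)) = 0"
  proof (rule integral_derivative_eq_0[where F="\<lambda>\<xi>. cis (x \<bullet> \<xi>) * \<phi> \<xi>" and F'="?F'" and e="axis j 1"])
    fix \<xi>
    from has_derivative_mult[OF has_derivative_cis_inner schwartz_has_derivative[OF \<phi>]]
    show "((\<lambda>\<xi>. cis (x \<bullet> \<xi>) * \<phi> \<xi>) has_derivative ?F' \<xi>) (at \<xi>)" by simp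
  next
    show "continuous_on UNIV (\<lambda>\<xi>. ?F' \<xi> (axis j 1))"
      unfolding e unfolding cis_conv_exp
      by (intro continuous_intros schwartz_continuous[OF schwartz_partial[OF \<phi>]] schwartz_continuous[OF \<phi>])
    show "integrable lborel (\<lambda>\<xi>. ?F' \<xi> (axis j 1))"
      unfolding e by (intro Bochner_Integration.integrable_add integrable_mult_right i)
  qed (rule i)
  then have "ift (partial j \<phi>) x + \<i> * of_real (x $ j) * ift \<phi> x = 0"
    unfolding e ift_def Bochner_Integration.integral_add[OF i(1) integrable_mult_right[OF i(2)]] integral_mult_right_zero .
  then show ?thesis by (simp add: eq_neg_iff_add_eq_0)
qed

text \<open>Each power of |x| is traded for one derivative of \<open>\<phi>\<close>, because |x| is
  at most the sum of the |x_j| and x_j times the transform is the transform of a derivative.\<close>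

lemma rapid_ift: assumes "schwartz \<phi>" shows "rapid (ift \<phi>)"
  unfolding rapid_def
proof safe
  have i: "integrable lborel \<phi>" if "schwartz \<phi>" for \<phi> using that by (intro rapid_integrable schwartz_rapid)
  show "ift \<phi> \<in> borel_measurable borel" by (rule ift_measurable[OF i[OF assms]])
  fix k
  show "\<exists>B. \<forall>x. norm x ^ k * cmod (ift \<phi> x) \<le> B"
    using assms
  proof (induction k arbitrary: \<phi>)
    case 0
    then show ?case using norm_ift_le by auto
  next
    case (Suc k)
    have "\<forall>j. \<exists>B. \<forall>x. norm x ^ k * cmod (ift (partial j \<phi>) x) \<le> B"
      using Suc.IH[OF schwartz_partial[OF Suc.prems]] by blast
    then obtain B where B: "\<And>j x. norm x ^ k * cmod (ift (partial j \<phi>) x) \<le> B j" by metis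
    have "norm x ^ Suc k * cmod (ift \<phi> x) \<le> (\<Sum>j\<in>UNIV. B j)" for x
    proof -
      have "norm x ^ Suc k * cmod (ift \<phi> x) \<le> (norm x ^ k * (\<Sum>j\<in>UNIV. \<bar>x $ j\<bar>)) * cmod (ift \<phi> x)"
        unfolding power_Suc2 by (intro mult_right_mono mult_left_mono norm_le_l1_cart) auto
      also have "\<dots> = (\<Sum>j\<in>UNIV. norm x ^ k * cmod (ift (partial j \<phi>) x))"
        by (simp add: ift_partial[OF Suc.prems] norm_mult sum_distrib_left sum_distrib_right mult_ac)
      also have "\<dots> \<le> (\<Sum>j\<in>UNIV. B j)" by (intro sum_mono B)
      finally show ?thesis .
    qed
    then show ?case by blast
  qed
qed

lemma schwartz_ift: assumes "schwartz \<phi>" shows "schwartz (ift \<phi>)"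
proof (rule schwartz_coinduct[of _ "{ift \<phi> | \<phi>. schwartz \<phi>}"])
  fix \<theta> assume "\<theta> \<in> {ift \<phi> | \<phi>. schwartz \<phi>}"
  then obtain \<phi> where *: "\<theta> = ift \<phi>" "schwartz \<phi>" by blast
  note r = schwartz_rapid[OF *(2)]
  show "partial i \<theta> \<in> {ift \<phi> | \<phi>. schwartz \<phi>}" for i
  proof -
    have "partial i \<theta> = ift (\<lambda>\<xi>. \<i> * (of_real (\<xi> $ i) * \<phi> \<xi>))"
      unfolding *(1) by (subst partial_ift) (auto intro!: rapid_integrable rapid_norm_power_integrable r simp: mult.assoc)
    then show ?thesis using schwartz_cmult[OF schwartz_component[OF *(2)], of \<i> i] by blast
  qed
  show "\<theta> differentiable at x" for x
    unfolding *(1) differentiable_def using rapid_has_derivative_ift[OF r] by blast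
  show "rapid \<theta>" unfolding *(1) using *(2) by (rule rapid_ift)
qed (use assms in blast)

lemma schwartz_one_plus_norm_square:
  assumes "schwartz \<phi>" shows "schwartz (\<lambda>x. of_real (1 + \<delta>\<^sup>2 * (norm x)\<^sup>2) * \<phi> x)"
proof -
  have "(norm x)\<^sup>2 = (\<Sum>j\<in>UNIV. (x $ j)\<^sup>2)" for x :: "real^3"
    unfolding power2_norm_eq_inner inner_vec_def by (simp add: power2_eq_square)
  then have "(\<lambda>x. of_real (1 + \<delta>\<^sup>2 * (norm x)\<^sup>2) * \<phi> x)
      = (\<lambda>x. \<phi> x + of_real (\<delta>\<^sup>2) * (\<Sum>j\<in>UNIV. of_real (x $ j) * (of_real (x $ j) * \<phi> x)))"
    by (auto simp: algebra_simps power2_eq_square sum_distrib_left)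
  moreover have "schwartz \<dots>"
    by (intro schwartz_add assms schwartz_cmult schwartz_sum schwartz_component) auto
  ultimately show ?thesis by simp
qed

lemma bessel_powr_le: "(1 + \<delta>\<^sup>2 * (norm x)\<^sup>2) powr s \<le> (1 + \<bar>\<delta>\<bar>) ^ (2 * nat \<lceil>\<bar>s\<bar>\<rceil>) * (1 + norm (x::'a::real_normed_vector)) ^ (2 * nat \<lceil>\<bar>s\<bar>\<rceil>)"
proof -
  let ?n = "nat \<lceil>\<bar>s\<bar>\<rceil>" and ?y = "1 + \<delta>\<^sup>2 * (norm x)\<^sup>2"
  have y: "?y \<ge> 1" by simp
  have "?y powr s \<le> ?y powr (real ?n)"
    using y by (intro powr_mono) linarith+
  also have "\<dots> = ?y ^ ?n" using y by (intro powr_realpow) linarith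
  also have "\<dots> \<le> (((1 + \<bar>\<delta>\<bar>) * (1 + norm x))\<^sup>2) ^ ?n"
  proof (intro power_mono)
    have "?y \<le> (1 + \<bar>\<delta>\<bar> * norm x)\<^sup>2" by (simp add: power2_sum power_mult_distrib)
    also have "\<dots> \<le> ((1 + \<bar>\<delta>\<bar>) * (1 + norm x))\<^sup>2" by (intro power_mono) (auto simp: algebra_simps)
    finally show "?y \<le> ((1 + \<bar>\<delta>\<bar>) * (1 + norm x))\<^sup>2" .
  qed simp
  also have "\<dots> = (1 + \<bar>\<delta>\<bar>) ^ (2 * ?n) * (1 + norm x) ^ (2 * ?n)"
    by (simp add: power_mult power_mult_distrib)
  finally show ?thesis .
qed

lemma rapid_bessel:
  assumes "rapid \<phi>" shows "rapid (\<lambda>x. of_real ((1 + \<delta>\<^sup>2 * (norm x)\<^sup>2) powr s) * \<phi> x)"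
  by (rule rapid_mult[OF assms, where C="(1 + \<bar>\<delta>\<bar>) ^ (2 * nat \<lceil>\<bar>s\<bar>\<rceil>)" and N="2 * nat \<lceil>\<bar>s\<bar>\<rceil>"])
     (auto simp del: of_real_add of_real_mult of_real_power intro: bessel_powr_le)

text \<open>The products of Schwartz functions with arbitrary real powers of \<open>1 + \<delta>\<^sup>2 |x|\<^sup>2\<close> are closed under
  differentiation, since \<open>\<partial>\<^sub>i (b\<^sup>s \<phi>) = b\<^bsup>s-1\<^esup> (b \<partial>\<^sub>i \<phi> + 2 s \<delta>\<^sup>2 x\<^sub>i \<phi>)\<close>.\<close>

lemma schwartz_bessel:
  assumes "schwartz \<phi>" shows "schwartz (\<lambda>x. of_real ((1 + \<delta>\<^sup>2 * (norm x)\<^sup>2) powr s) * \<phi> x)"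
proof (rule schwartz_coinduct)
  let ?b = "\<lambda>x::real^3. 1 + \<delta>\<^sup>2 * (norm x)\<^sup>2"
  let ?C = "{(\<lambda>x. of_real (?b x powr s) * \<phi> x) | s \<phi>. schwartz \<phi>}"
  have b: "?b x > 0" for x by (auto intro: add_pos_nonneg)
  have d: "((\<lambda>x. of_real (?b x powr s) * \<phi> x) has_derivative
    (\<lambda>v. of_real (?b x powr s) * frechet_derivative \<phi> (at x) v
       + of_real (?b x powr (s - 1) * (2 * s * \<delta>\<^sup>2 * (x \<bullet> v))) * \<phi> x)) (at x)"
    if "schwartz \<phi>" for \<phi> s x
  proof (intro has_derivative_mult has_derivative_of_real schwartz_has_derivative that)
    have db: "(?b has_derivative (\<lambda>v. \<delta>\<^sup>2 * (2 * (x \<bullet> v)))) (at x)"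
      unfolding power2_norm_eq_inner by (auto intro!: derivative_eq_intros simp: inner_commute)
    have "((\<lambda>y. y powr s) has_derivative (\<lambda>h. h * (s * ?b x powr (s - 1)))) (at (?b x))"
      using has_real_derivative_powr[OF b[of x], of s] unfolding has_field_derivative_def
      by (rule has_derivative_eq_rhs) auto
    from has_derivative_compose[OF db this]
    show "((\<lambda>x. ?b x powr s) has_derivative (\<lambda>v. ?b x powr (s - 1) * (2 * s * \<delta>\<^sup>2 * (x \<bullet> v)))) (at x)"
      by (simp add: mult_ac)
  qed
  show "(\<lambda>x. of_real (?b x powr s) * \<phi> x) \<in> ?C" using assms by blast
  fix \<theta> assume "\<theta> \<in> ?C"
  then obtain s \<phi> where *: "\<theta> = (\<lambda>x. of_real (?b x powr s) * \<phi> x)" "schwartz \<phi>" by blast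
  show "\<theta> differentiable at x" for x unfolding *(1) differentiable_def using d[OF *(2)] by blast
  show "rapid \<theta>" unfolding *(1) by (intro rapid_bessel schwartz_rapid *)
  show "partial i \<theta> \<in> ?C" for i
  proof -
    let ?\<psi> = "\<lambda>x. of_real (?b x) * partial i \<phi> x + of_real (2 * s * \<delta>\<^sup>2) * (of_real (x $ i) * \<phi> x)"
    have "partial i \<theta> x = of_real (?b x powr (s - 1)) * ?\<psi> x" for x
    proof -
      have "?b x powr s = ?b x powr (s - 1) * ?b x"
        using b[of x] powr_add[of "?b x" "s - 1" 1] by (simp add: powr_one)
      then have p: "complex_of_real (?b x powr s) = of_real (?b x powr (s - 1)) * of_real (?b x)"
        by (simp only: of_real_mult)
      show ?thesis
        unfolding *(1) partial_eqI[OF d[OF *(2)]] frechet_axis p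
        by (simp add: inner_axis algebra_simps del: of_real_add of_real_power)
    qed
    moreover have "schwartz ?\<psi>"
      by (intro schwartz_add schwartz_cmult schwartz_component schwartz_one_plus_norm_square schwartz_partial *)
    ultimately show ?thesis by (intro CollectI exI[of _ "s - 1"] exI[of _ ?\<psi>]) auto
  qed
qed

section \<open>Modulated Gaussians as test functions\<close>

lemma power_mult_exp_le: "r \<ge> 0 \<Longrightarrow> r ^ k * exp (- r\<^sup>2) \<le> exp 1 * fact k" for r :: real
proof -
  assume r: "r \<ge> 0"
  have "r ^ k / fact k \<le> exp r"
  proof -
    have "(\<Sum>n\<in>{k}. r ^ n /\<^sub>R fact n) \<le> (\<Sum>n. r ^ n /\<^sub>R fact n)"
      using r by (intro sum_le_suminf summable_exp_generic) auto
    then show ?thesis by (simp add: exp_def divide_inverse mult.commute)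
  qed
  then have "r ^ k \<le> fact k * exp r" by (simp add: field_simps)
  then have "r ^ k * exp (- r\<^sup>2) \<le> fact k * exp r * exp (- r\<^sup>2)" by (intro mult_right_mono) auto
  also have "\<dots> = fact k * exp (r - r\<^sup>2)" by (simp add: exp_diff exp_minus divide_inverse)
  also have "\<dots> \<le> fact k * exp 1"
  proof (intro mult_left_mono)
    have "r - r\<^sup>2 \<le> 1" using sum_squares_bound[of r 1] r by simp
    then show "exp (r - r\<^sup>2) \<le> exp 1" by simp
  qed auto
  finally show ?thesis by (simp add: mult.commute)
qed

text \<open>The integral of \<open>h\<close> against \<open>wave q\<close> is the transform of
  \<open>wave 0 * h\<close> at \<open>q\<close>: letting \<open>q\<close> vary recovers
  \<open>h\<close>, and the Gaussian factor supplies the integrability.\<close>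

definition wave :: "'a::euclidean_space \<Rightarrow> 'a \<Rightarrow> complex" where
  "wave q \<xi> = of_real (exp (- (norm \<xi>)\<^sup>2)) * cis (q \<bullet> \<xi>)"

lemma norm_wave [simp]: "cmod (wave q \<xi>) = exp (- (norm \<xi>)\<^sup>2)"
  by (simp add: wave_def norm_mult)

lemma wave_continuous: "continuous_on S (wave q)"
  unfolding wave_def cis_conv_exp by (intro continuous_intros)

lemma wave_measurable [measurable]: "wave q \<in> borel_measurable borel"
  using wave_continuous by (rule borel_measurable_continuous_onI)

lemma rapid_wave: "rapid (wave q)"
  unfolding rapid_def using power_mult_exp_le[of "norm _"] by auto

text \<open>Derivatives of \<open>wave q\<close> acquire polynomial factors; this is the class
  required by \<open>schwartz_coinduct\<close>.\<close>

inductive_set wave_polynomials :: "real^3 \<Rightarrow> (real^3 \<Rightarrow> complex) set" for q where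
  wave: "wave q \<in> wave_polynomials q"
| add: "\<phi> \<in> wave_polynomials q \<Longrightarrow> \<psi> \<in> wave_polynomials q \<Longrightarrow> (\<lambda>x. \<phi> x + \<psi> x) \<in> wave_polynomials q"
| cmult: "\<phi> \<in> wave_polynomials q \<Longrightarrow> (\<lambda>x. c * \<phi> x) \<in> wave_polynomials q"
| component: "\<phi> \<in> wave_polynomials q \<Longrightarrow> (\<lambda>x. of_real (x $ j) * \<phi> x) \<in> wave_polynomials q"

lemma schwartz_wave: "schwartz (wave q)"
proof (rule schwartz_coinduct[OF wave_polynomials.wave])
  have "(\<forall>x. \<phi> differentiable at x) \<and> (\<forall>i. partial i \<phi> \<in> wave_polynomials q) \<and> rapid \<phi>"
    if "\<phi> \<in> wave_polynomials q" for \<phi>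
    using that
  proof induction
    case wave
    have d: "(wave q has_derivative (\<lambda>v. (\<i> * of_real (q \<bullet> v) - of_real (2 * (x \<bullet> v))) * wave q x)) (at x)" for x
    proof -
      have "((\<lambda>x::real^3. exp (- (x \<bullet> x))) has_derivative (\<lambda>v. - 2 * (x \<bullet> v) * exp (- (x \<bullet> x)))) (at x)"
        by (auto intro!: derivative_eq_intros simp: inner_commute)
      from has_derivative_mult[OF has_derivative_of_real[OF this] has_derivative_cis_inner]
      show ?thesis unfolding wave_def power2_norm_eq_inner
        by (rule has_derivative_eq_rhs) (auto simp: algebra_simps)
    qed
    have "partial i (wave q) = (\<lambda>x. \<i> * of_real (q $ i) * wave q x + (- 2) * (of_real (x $ i) * wave q x))" for i
      using partial_eqI[OF d, of i] by (auto simp: inner_axis algebra_simps)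
    then have "partial i (wave q) \<in> wave_polynomials q" for i
      by (simp only:) (intro wave_polynomials.intros)
    then show ?case using d rapid_wave unfolding differentiable_def by blast
  next
    case (add \<phi> \<psi>)
    have "partial i (\<lambda>x. \<phi> x + \<psi> x) = (\<lambda>x. partial i \<phi> x + partial i \<psi> x)" for i
      using partial_eqI[OF has_derivative_add[OF frechet_derivative_works[THEN iffD1] frechet_derivative_works[THEN iffD1]]] add
      by (auto simp: frechet_axis)
    then show ?case using add by (auto intro: wave_polynomials.intros rapid_add)
  next
    case (cmult \<phi> c)
    have "partial i (\<lambda>x. c * \<phi> x) = (\<lambda>x. c * partial i \<phi> x)" for i
    proof
      fix x
      have "((\<lambda>x. c * \<phi> x) has_derivative (\<lambda>v. c * frechet_derivative \<phi> (at x) v)) (at x)"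
        using cmult frechet_derivative_works by (intro has_derivative_mult_right) blast
      from partial_eqI[OF this, of i] show "partial i (\<lambda>x. c * \<phi> x) x = c * partial i \<phi> x" by (simp add: frechet_axis)
    qed
    then show ?case using cmult by (auto intro: wave_polynomials.intros rapid_cmult)
  next
    case (component \<phi> j)
    have "partial i (\<lambda>x. of_real (x $ j) * \<phi> x)
        = (\<lambda>x. of_real (if i = j then 1 else 0) * \<phi> x + of_real (x $ j) * partial i \<phi> x)" for i
      using component by (auto simp: partial_component_mult)
    then have "partial i (\<lambda>x. of_real (x $ j) * \<phi> x) \<in> wave_polynomials q" for i
      using component by (simp only:) (intro wave_polynomials.intros, auto)
    then show ?case using component by (simp add: differentiable_component_mult rapid_component)
  qed
  then show "partial i \<phi> \<in> wave_polynomials q" "\<phi> differentiable at x" "rapid \<phi>"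
    if "\<phi> \<in> wave_polynomials q" for \<phi> i x using that by auto
qed

section \<open>Inversion and multipliers on Schwartz functions\<close>

lemma schwartz_inversion:
  fixes \<phi> :: "real^3 \<Rightarrow> complex"
  assumes "schwartz \<phi>" shows "ift (ift \<phi>) (- \<xi>) = (2 * pi) ^ 3 * \<phi> \<xi>"
proof -
  note r = schwartz_rapid[OF assms]
  obtain B where "\<And>x. cmod (\<phi> x) \<le> B" using rapid_bounded[OF r] by blast
  from ift_inversion[OF rapid_integrable[OF r] schwartz_continuous[OF assms] this rapid_integrable[OF rapid_ift[OF assms]], of \<xi>]
  show ?thesis by simp
qed

lemma fourier_eq_ift: "\<phi> \<in> borel_measurable borel \<Longrightarrow> fourier \<phi> \<xi> = ift \<phi> (- \<xi>)"
  unfolding fourier_def ift_def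
  by (subst integral_completion) (auto simp: cis_conv_exp inner_commute)

lemma schwartz_measurable: "schwartz \<phi> \<Longrightarrow> \<phi> \<in> borel_measurable borel"
  using rapid_measurable schwartz_rapid by blast

lemma schwartz_fourier: assumes "schwartz \<phi>" shows "schwartz (fourier \<phi>)"
proof -
  have "fourier \<phi> = (\<lambda>\<xi>. ift \<phi> (- \<xi>))" using fourier_eq_ift[OF schwartz_measurable[OF assms]] by auto
  then show ?thesis using schwartz_reflect[OF schwartz_ift[OF assms]] by simp
qed

text \<open>Weak identities may therefore be checked on test functions of the form
  \<open>fourier \<psi>\<close>, for which every pairing can be moved to the Fourier side.\<close>

lemma fourier_surj:
  assumes "schwartz \<phi>" obtains \<psi> where "schwartz \<psi>" "fourier \<psi> = \<phi>" "\<psi> = (\<lambda>x. 1 / (2 * pi) ^ 3 * ift \<phi> x)"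
proof (rule that)
  let ?\<psi> = "\<lambda>x. of_real (1 / (2 * pi) ^ 3) * ift \<phi> x"
  show s: "schwartz ?\<psi>" by (intro schwartz_cmult schwartz_ift assms)
  have "fourier ?\<psi> \<xi> = \<phi> \<xi>" for \<xi>
    unfolding fourier_eq_ift[OF schwartz_measurable[OF s]] ift_cmult schwartz_inversion[OF assms] by simp
  then show "fourier ?\<psi> = \<phi>" by auto
qed simp

lemma fourier_multiplier_eq_ift:
  assumes "schwartz \<phi>" and [measurable]: "m \<in> borel_measurable borel"
  shows "fourier_multiplier m \<phi> = (\<lambda>x. of_real (1 / (2 * pi) ^ 3) * ift (\<lambda>\<xi>. of_real (m \<xi>) * fourier \<phi> \<xi>) x)"
proof -
  have [measurable]: "fourier \<phi> \<in> borel_measurable borel"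
    by (rule schwartz_measurable[OF schwartz_fourier[OF assms(1)]])
  show ?thesis
    unfolding fourier_multiplier_def ift_def
    by (subst integral_completion) (auto simp: cis_conv_exp mult.assoc)
qed

text \<open>The modulated Gaussians alone suffice: their integrals against \<open>h\<close> are the
  values of the transform of \<open>wave 0 * h\<close>, which is injective. The function
  \<open>h\<close> itself need not be integrable.\<close>

theorem AE_eq_0_if_schwartz_integrals_eq_0:
  fixes h :: "real^3 \<Rightarrow> complex"
  assumes i: "integrable lborel (\<lambda>\<xi>. wave 0 \<xi> * h \<xi>)"
    and z: "\<And>\<phi>. schwartz \<phi> \<Longrightarrow> (LINT \<xi>|lborel. h \<xi> * \<phi> \<xi>) = 0"
  shows "AE \<xi> in lborel. h \<xi> = 0"
proof -
  have "AE \<xi> in lborel. wave 0 \<xi> * h \<xi> = 0"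
  proof (rule ift_eq_0_imp_AE_eq_0[OF i])
    fix x
    have "ift (\<lambda>\<xi>. wave 0 \<xi> * h \<xi>) x = (LINT \<xi>|lborel. h \<xi> * wave x \<xi>)"
      unfolding ift_def wave_def by (simp add: mult_ac)
    then show "ift (\<lambda>\<xi>. wave 0 \<xi> * h \<xi>) x = 0" by (simp add: z schwartz_wave)
  qed
  then show ?thesis by (simp add: wave_def)
qed

section \<open>Weak compactness in Hilbert spaces\<close>

text \<open>\<open>S\<close> is a span, in general not closed, and the functional is given on
  \<open>S\<close> only. The representing vector is the limit of a minimising sequence of |s|^2 - 2
  L(s), which is Cauchy by the parallelogram identity and thus lies in the closure.\<close>

lemma riesz_on_subspace:
  fixes L :: "'h::{real_inner,complete_space} \<Rightarrow> real"
  assumes S: "subspace S" and add: "\<And>s t. s \<in> S \<Longrightarrow> t \<in> S \<Longrightarrow> L (s + t) = L s + L t"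
    and scale: "\<And>c s. s \<in> S \<Longrightarrow> L (c *\<^sub>R s) = c * L s" and bound: "\<And>s. s \<in> S \<Longrightarrow> \<bar>L s\<bar> \<le> B * norm s"
  shows "\<exists>p\<in>closure S. \<forall>s\<in>S. p \<bullet> s = L s"
proof -
  define J where "J s = (norm s)\<^sup>2 - 2 * L s" for s
  define m where "m = Inf (J ` S)"
  have Jge: "J s \<ge> - B\<^sup>2" if "s \<in> S" for s
  proof -
    have "2 * L s \<le> 2 * (B * norm s)" using bound[OF that] by linarith
    also have "\<dots> \<le> B\<^sup>2 + (norm s)\<^sup>2" using sum_squares_bound[of B "norm s"] by simp
    finally show ?thesis by (simp add: J_def)
  qed
  have bdd: "bdd_below (J ` S)" using Jge by (intro bdd_belowI2)
  have ne: "J ` S \<noteq> {}" using subspace_0[OF S] by blast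
  have mle: "m \<le> J s" if "s \<in> S" for s unfolding m_def using that bdd by (intro cInf_lower) auto
  have "\<exists>s\<in>S. J s < m + 1 / Suc i" for i
    using cInf_lessD[OF ne, of "m + 1 / Suc i"] unfolding m_def by (auto simp: add_pos_pos)
  then obtain s where s: "\<And>i. s i \<in> S" "\<And>i. J (s i) < m + 1 / Suc i" by metis
  have par: "(norm (s i - s j))\<^sup>2 \<le> 2 / Suc i + 2 / Suc j" for i j
  proof -
    have mid: "(1/2) *\<^sub>R (s i + s j) \<in> S" by (intro subspace_scale subspace_add S s)
    have "L ((1/2) *\<^sub>R (s i + s j)) = 1/2 * (L (s i) + L (s j))"
      by (simp only: scale[OF subspace_add[OF S s(1) s(1)]] add[OF s(1) s(1)])
    moreover have "(norm (s i - s j))\<^sup>2 = 2 * (norm (s i))\<^sup>2 + 2 * (norm (s j))\<^sup>2 - 4 * (norm ((1/2) *\<^sub>R (s i + s j)))\<^sup>2"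
      unfolding power2_norm_eq_inner by (simp add: inner_commute algebra_simps)
    ultimately have "(norm (s i - s j))\<^sup>2 = 2 * J (s i) + 2 * J (s j) - 4 * J ((1/2) *\<^sub>R (s i + s j))"
      by (simp add: J_def)
    also have "\<dots> \<le> 2 * (1 / Suc i) + 2 * (1 / Suc j)"
    proof -
      have "2 * a + 2 * b - 4 * c \<le> 2 * u + 2 * w" if "a < m + u" "b < m + w" "m \<le> c" for a b c u w :: real
        using that by linarith
      from this[OF s(2) s(2) mle[OF mid]] show ?thesis .
    qed
    finally show ?thesis by simp
  qed
  have "Cauchy s"
  proof (rule metric_CauchyI)
    fix e :: real assume e: "e > 0"
    obtain N where N: "4 / e\<^sup>2 < real N" using reals_Archimedean2[of "4 / e\<^sup>2"] by blast
    have "dist (s i) (s j) < e" if "i \<ge> N" "j \<ge> N" for i j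
    proof -
      have pos: "0 < real (Suc i)" "0 < real (Suc j)" by simp_all
      have e2: "4 / e\<^sup>2 < Suc i" "4 / e\<^sup>2 < Suc j" using N that by linarith+
      have "2 / Suc i < e\<^sup>2 / 2" "2 / Suc j < e\<^sup>2 / 2"
        using e e2 pos by (simp_all add: pos_divide_less_eq mult.commute)
      then have "(norm (s i - s j))\<^sup>2 < e\<^sup>2" using par[of i j] by linarith
      then show ?thesis using e by (auto simp: dist_norm intro: power2_less_imp_less)
    qed
    then show "\<exists>N. \<forall>i\<ge>N. \<forall>j\<ge>N. dist (s i) (s j) < e" by blast
  qed
  then obtain p where p: "s \<longlonglongrightarrow> p"     using Cauchy_convergent unfolding convergent_def by blast
  show ?thesis
  proof (intro bexI ballI)
    show "p \<in> closure S" using p s(1) closure_sequential by blast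
    fix t assume t: "t \<in> S"
    \<comment> \<open>Optimality of the limit under variations c t in \<open>S\<close>; as a
      quadratic in c it forces the linear coefficient to vanish.\<close>
    have q: "0 \<le> 2 * c * (p \<bullet> t - L t) + c\<^sup>2 * (norm t)\<^sup>2" for c
    proof (rule LIMSEQ_le_const)
      show "(\<lambda>i. 1 / Suc i + (2 * c * (s i \<bullet> t - L t) + c\<^sup>2 * (norm t)\<^sup>2))
        \<longlonglongrightarrow> 2 * c * (p \<bullet> t - L t) + c\<^sup>2 * (norm t)\<^sup>2"
      proof -
        have "(\<lambda>i. 2 * c * (s i \<bullet> t - L t) + c\<^sup>2 * (norm t)\<^sup>2) \<longlonglongrightarrow> 2 * c * (p \<bullet> t - L t) + c\<^sup>2 * (norm t)\<^sup>2"
          by (intro tendsto_intros p)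
        from tendsto_add[OF gstep(2) this] show ?thesis by (simp only: gstep_def add_0_left)
      qed
      have "0 \<le> 1 / Suc i + (2 * c * (s i \<bullet> t - L t) + c\<^sup>2 * (norm t)\<^sup>2)" for i
      proof -
        have "m \<le> J (s i + c *\<^sub>R t)" by (intro mle subspace_add subspace_scale S s t)
        also have "\<dots> = J (s i) + (2 * c * (s i \<bullet> t - L t) + c\<^sup>2 * (norm t)\<^sup>2)"
        proof -
          have "L (s i + c *\<^sub>R t) = L (s i) + c * L t"
            by (simp only: add[OF s(1) subspace_scale[OF S t]] scale[OF t])
          moreover have "(norm (s i + c *\<^sub>R t))\<^sup>2 = (norm (s i))\<^sup>2 + 2 * c * (s i \<bullet> t) + c\<^sup>2 * (norm t)\<^sup>2"
            unfolding power2_norm_eq_inner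
            by (simp add: inner_add_left inner_add_right inner_commute[of t "s i"] power2_eq_square distrib_left)
          ultimately show ?thesis by (simp add: J_def right_diff_distrib)
        qed
        finally have le: "m \<le> J (s i) + (2 * c * (s i \<bullet> t - L t) + c\<^sup>2 * (norm t)\<^sup>2)" .
        have "0 \<le> u + w" if "m \<le> a + w" "a < m + u" for a u w :: real using that by linarith
        from this[OF le s(2)] show ?thesis .
      qed
      then show "\<exists>N. \<forall>i\<ge>N. 0 \<le> 1 / Suc i + (2 * c * (s i \<bullet> t - L t) + c\<^sup>2 * (norm t)\<^sup>2)" by blast
    qed
    show "p \<bullet> t = L t"
    proof (rule ccontr)
      assume ne: "p \<bullet> t \<noteq> L t"
      define d where "d = p \<bullet> t - L t"
      have d: "d \<noteq> 0" using ne by (simp add: d_def)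
      have n: "(norm t)\<^sup>2 \<ge> 0" by simp
      \<comment> \<open>Adding 1 to the leading coefficient avoids a separate case t = 0; with c = -
        d / T the quadratic is at most - d^2 / T.\<close>
      define T where "T = 1 + (norm t)\<^sup>2"
      have T: "T > 0" using n by (simp add: T_def add_pos_nonneg)
      define c where "c = - d / T"
      have "2 * c * d + c\<^sup>2 * (norm t)\<^sup>2 \<le> 2 * c * d + c\<^sup>2 * T" by (simp add: T_def distrib_left)
      also have "\<dots> = - (d\<^sup>2 / T)"
        using T by (simp add: c_def power2_eq_square)
      also have "\<dots> < 0" using d T by simp
      finally show False using q[of c] by (simp add: d_def)
    qed
  qed
qed

lemma bounded_imp_convergent_diagonal_subsequence:
  fixes z :: "nat \<Rightarrow> nat \<Rightarrow> real"
  assumes B: "\<And>n k. \<bar>z n k\<bar> \<le> B k"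
  obtains r where "strict_mono r" "\<And>k. convergent (\<lambda>n. z (r n) k)"
proof -
  interpret subseqs "\<lambda>k s. convergent (\<lambda>n. z (s n) k)"
  proof
    fix k and s :: "nat \<Rightarrow> nat"
    have "bounded (range (\<lambda>n. z (s n) k))" using B by (auto simp: bounded_iff)
    then obtain l r where "strict_mono r" "((\<lambda>n. z (s n) k) \<circ> r) \<longlonglongrightarrow> l"
      using bounded_imp_convergent_subsequence by blast
    then show "\<exists>r. strict_mono r \<and> convergent (\<lambda>n. z ((s \<circ> r) n) k)"
      by (auto simp: convergent_def o_def)
  qed
  have "convergent (\<lambda>n. z ((diagseq \<circ> (+) (Suc k)) n) k)" for k
  proof (rule diagseq_holds)
    fix s r k assume "strict_mono (r::nat \<Rightarrow> nat)" "convergent (\<lambda>n. z (s n) k)"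
    then show "convergent (\<lambda>n. z ((s \<circ> r) n) k)"
      using LIMSEQ_subseq_LIMSEQ[of "\<lambda>n. z (s n) k" _ r] by (auto simp: convergent_def o_def)
  qed
  moreover have "(diagseq \<circ> (+) (Suc k)) n = diagseq (n + Suc k)" for k n by (simp add: add.commute)
  ultimately have "convergent (\<lambda>n. z (diagseq (n + Suc k)) k)" for k by (simp only:)
  then have "convergent (\<lambda>n. z (diagseq n) k)" for k
    using convergent_ignore_initial_segment[of "\<lambda>n. z (diagseq n) k" "Suc k"] by blast
  with subseq_diagseq show thesis by (rule that)
qed

text \<open>Separability of the space is replaced by that of the closed span of the sequence: a
  diagonal subsequence converges against every \<open>v k\<close>, hence against the span. That the
  limit lies in the closed span is recorded because it later transfers linear constraints to the
  limit.\<close>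

theorem weakly_convergent_subsequence:
  fixes v :: "nat \<Rightarrow> 'h::{real_inner,complete_space}"
  assumes B: "\<And>n. norm (v n) \<le> B"
  obtains r g where "strict_mono r" "norm g \<le> B" "g \<in> closure (span (range v))"
    "\<And>y. (\<lambda>n. v (r n) \<bullet> y) \<longlonglongrightarrow> g \<bullet> y"
proof -
  have B0: "B \<ge> 0" using order_trans[OF norm_ge_zero B] .
  have ip: "\<bar>v n \<bullet> y\<bar> \<le> B * norm y" for n y
    using Cauchy_Schwarz_ineq2[of "v n" y] mult_right_mono[OF B norm_ge_zero, of n y] by linarith
  obtain r where r: "strict_mono r" "\<And>k. convergent (\<lambda>n. v (r n) \<bullet> v k)"
    using bounded_imp_convergent_diagonal_subsequence[of "\<lambda>n k. v n \<bullet> v k" "\<lambda>k. B * norm (v k)"] ip by blast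
  define S where "S = span (range v)"
  have S: "subspace S" by (simp add: S_def)
  have vS: "v n \<in> S" for n by (simp add: S_def span_base)
  have conv: "convergent (\<lambda>n. v (r n) \<bullet> s)" if "s \<in> S" for s
  proof -
    have "subspace {s. convergent (\<lambda>n. v (r n) \<bullet> s)}"
      by (auto simp: subspace_def inner_add_right intro: convergent_add convergent_mult_const_iff[THEN iffD2]
          convergent_const convergent_mult)
    then show ?thesis using that r(2) span_minimal[of "range v" "{s. convergent (\<lambda>n. v (r n) \<bullet> s)}"]
      by (auto simp: S_def)
  qed
  define L where "L s = lim (\<lambda>n. v (r n) \<bullet> s)" for s
  have L: "(\<lambda>n. v (r n) \<bullet> s) \<longlonglongrightarrow> L s" if "s \<in> S" for s
    unfolding L_def using conv[OF that] by (simp add: convergent_LIMSEQ_iff)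
  have "\<exists>g\<in>closure S. \<forall>s\<in>S. g \<bullet> s = L s"
  proof (rule riesz_on_subspace[OF S])
    show "L (s + t) = L s + L t" if "s \<in> S" "t \<in> S" for s t
      using LIMSEQ_unique[OF L[OF subspace_add[OF S that]]] tendsto_add[OF L[OF that(1)] L[OF that(2)]]
      by (simp add: inner_add_right)
    show "L (c *\<^sub>R s) = c * L s" if "s \<in> S" for c s
      using LIMSEQ_unique[OF L[OF subspace_scale[OF S that]]] tendsto_mult[OF tendsto_const[of c] L[OF that]]
      by simp
    show "\<bar>L s\<bar> \<le> B * norm s" if "s \<in> S" for s
      using ip by (intro LIMSEQ_le_const2[OF tendsto_rabs[OF L[OF that]]]) blast
  qed
  then obtain g where g: "g \<in> closure S" "\<And>s. s \<in> S \<Longrightarrow> g \<bullet> s = L s" by blast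
  have lim: "(\<lambda>n. v (r n) \<bullet> y) \<longlonglongrightarrow> g \<bullet> y" for y
  proof -
    \<comment> \<open>The vector obtained is the orthogonal projection of \<open>y\<close> onto the
      closure of \<open>S\<close>; neither the \<open>v n\<close> nor \<open>g\<close> see the
      difference between the two.\<close>
    have "\<exists>p\<in>closure S. \<forall>s\<in>S. p \<bullet> s = y \<bullet> s"
      by (rule riesz_on_subspace[OF S, of "\<lambda>s. y \<bullet> s" "norm y"])
         (simp_all add: inner_add_right Cauchy_Schwarz_ineq2)
    then obtain p where p: "p \<in> closure S" "\<And>s. s \<in> S \<Longrightarrow> p \<bullet> s = y \<bullet> s" by blast
    obtain t where t: "\<And>i. t i \<in> S" "t \<longlonglongrightarrow> g" using g(1) closure_sequential by blast
    have "(\<lambda>i. t i \<bullet> p) \<longlonglongrightarrow> g \<bullet> p" "(\<lambda>i. t i \<bullet> y) \<longlonglongrightarrow> g \<bullet> y"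
      by (intro tendsto_intros t)+
    moreover have "t i \<bullet> p = t i \<bullet> y" for i using p(2)[OF t(1)] by (simp add: inner_commute)
    ultimately have gp: "g \<bullet> p = g \<bullet> y" using LIMSEQ_unique by auto
    have vp: "v n \<bullet> p = v n \<bullet> y" for n using p(2)[OF vS] by (simp add: inner_commute)
    have "(\<lambda>n. v (r n) \<bullet> p) \<longlonglongrightarrow> g \<bullet> p"
    proof (rule LIMSEQ_I)
      fix e :: real assume e: "e > 0"
      define C where "C = B + norm g + 1"
      have C: "C > 0" using B0 by (simp add: C_def add_nonneg_pos)
      obtain s where s: "s \<in> S" "dist s p < e / (3 * C)"
        using p(1) e C unfolding closure_approachable by (meson divide_pos_pos mult_pos_pos zero_less_numeral)
      have sp: "C * norm (p - s) < e / 3" using s(2) C by (simp add: dist_norm norm_minus_commute field_simps)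
      obtain N where N: "\<And>n. n \<ge> N \<Longrightarrow> \<bar>v (r n) \<bullet> s - g \<bullet> s\<bar> < e / 3"
        using LIMSEQ_D[OF L[OF s(1)], of "e / 3"] e g(2)[OF s(1)] by auto
      have "norm (v (r n) \<bullet> p - g \<bullet> p) < e" if "n \<ge> N" for n
      proof -
        have "v (r n) \<bullet> p - g \<bullet> p = v (r n) \<bullet> (p - s) + (v (r n) \<bullet> s - g \<bullet> s) - g \<bullet> (p - s)"
          by (simp add: algebra_simps)
        moreover have "\<bar>v (r n) \<bullet> (p - s)\<bar> \<le> C * norm (p - s)"
          using ip[of "r n" "p - s"] mult_right_mono[of B C "norm (p - s)"] by (simp add: C_def)
        moreover have "\<bar>g \<bullet> (p - s)\<bar> \<le> C * norm (p - s)"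
          using Cauchy_Schwarz_ineq2[of g "p - s"] mult_right_mono[of "norm g" C "norm (p - s)"] B0 by (simp add: C_def)
        ultimately show ?thesis using sp N[OF that] unfolding real_norm_def by linarith
      qed
      then show "\<exists>N. \<forall>n\<ge>N. norm (v (r n) \<bullet> p - g \<bullet> p) < e" by blast
    qed
    then show ?thesis by (simp add: gp vp)
  qed
  have "norm g \<le> B"
  proof -
    have "g \<bullet> g \<le> B * norm g"
      using order_trans[OF abs_ge_self ip[of "r _" g]] by (intro LIMSEQ_le_const2[OF lim[of g]]) blast
    then have "norm g * norm g \<le> B * norm g" by (simp add: norm_eq_sqrt_inner)
    then show ?thesis using B0 by (cases "norm g = 0") auto
  qed
  with r(1) show thesis using g(1)[unfolded S_def] lim by (rule that)
qed

section \<open>Square-integrable functions\<close>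

definition sq_integrable :: "'a measure \<Rightarrow> ('a \<Rightarrow> 'b::euclidean_space) \<Rightarrow> bool" where
  "sq_integrable M f \<longleftrightarrow> f \<in> borel_measurable M \<and> integrable M (\<lambda>x. (norm (f x))\<^sup>2)"

lemma sq_integrable_measurable: "sq_integrable M f \<Longrightarrow> f \<in> borel_measurable M"
  by (simp add: sq_integrable_def)

lemma norm_add_square_le: "(norm (a + b))\<^sup>2 \<le> 2 * (norm a)\<^sup>2 + 2 * (norm (b::'b::real_normed_vector))\<^sup>2"
proof -
  have "(norm (a + b))\<^sup>2 \<le> (norm a + norm b)\<^sup>2" by (intro power_mono norm_triangle_ineq) auto
  also have "\<dots> \<le> 2 * (norm a)\<^sup>2 + 2 * (norm b)\<^sup>2"
    using sum_squares_bound[of "norm a" "norm b"] by (simp add: power2_sum)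
  finally show ?thesis .
qed

lemma sq_integrable_bound:
  assumes "sq_integrable M f" "g \<in> borel_measurable M" "\<And>x. norm (g x) \<le> C * norm (f x)"
  shows "sq_integrable M g"
  unfolding sq_integrable_def
proof (rule conjI[OF assms(2)], rule Bochner_Integration.integrable_bound[of _ "\<lambda>x. C\<^sup>2 * (norm (f x))\<^sup>2"])
  show "AE x in M. norm ((norm (g x))\<^sup>2) \<le> norm (C\<^sup>2 * (norm (f x))\<^sup>2)"
  proof (intro AE_I2)
    fix x
    have "(norm (g x))\<^sup>2 \<le> (C * norm (f x))\<^sup>2" by (intro power_mono assms(3)) simp
    then show "norm ((norm (g x))\<^sup>2) \<le> norm (C\<^sup>2 * (norm (f x))\<^sup>2)"
      using zero_le_power2[of "norm (g x)"] unfolding power_mult_distrib real_norm_def by linarith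
  qed
qed (use assms in \<open>auto simp: sq_integrable_def\<close>)

lemma sq_integrable_add:
  assumes "sq_integrable M f" "sq_integrable M g" shows "sq_integrable M (\<lambda>x. f x + g x)"
  unfolding sq_integrable_def
proof (rule conjI, goal_cases)
  case 1
  show ?case using assms by (auto simp: sq_integrable_def)
next
  case 2
  show ?case
  proof (rule Bochner_Integration.integrable_bound[of _ "\<lambda>x. 2 * (norm (f x))\<^sup>2 + 2 * (norm (g x))\<^sup>2"])
  show "AE x in M. norm ((norm (f x + g x))\<^sup>2) \<le> norm (2 * (norm (f x))\<^sup>2 + 2 * (norm (g x))\<^sup>2)"
  proof (intro AE_I2)
    fix x
    show "norm ((norm (f x + g x))\<^sup>2) \<le> norm (2 * (norm (f x))\<^sup>2 + 2 * (norm (g x))\<^sup>2)"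
      using norm_add_square_le[of "f x" "g x"] zero_le_power2[of "norm (f x + g x)"] unfolding real_norm_def by linarith
  qed
  qed (use assms in \<open>auto simp: sq_integrable_def\<close>)
qed

lemma sq_integrable_scaleR: "sq_integrable M f \<Longrightarrow> sq_integrable M (\<lambda>x. c *\<^sub>R f x)"
  by (rule sq_integrable_bound[where C="\<bar>c\<bar>" and f=f]) (auto simp: sq_integrable_def intro: borel_measurable_scaleR)

lemma sq_integrable_minus: "sq_integrable M f \<Longrightarrow> sq_integrable M (\<lambda>x. - f x)"
  by (rule sq_integrable_bound[where C=1 and f=f]) (simp_all add: sq_integrable_def)

lemma sq_integrable_diff: "sq_integrable M f \<Longrightarrow> sq_integrable M g \<Longrightarrow> sq_integrable M (\<lambda>x. f x - g x)"
  using sq_integrable_add[of M f "\<lambda>x. - g x"] sq_integrable_minus[of M g] by simp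

lemma norm_mult_le_squares: "norm a * norm b \<le> (norm a)\<^sup>2 + (norm b)\<^sup>2"
  for a :: "'a::real_normed_vector" and b :: "'b::real_normed_vector"
  using sum_squares_bound[of "norm a" "norm b"] mult_nonneg_nonneg[OF norm_ge_zero[of a] norm_ge_zero[of b]] by linarith

lemma sq_integrable_inner:
  assumes "sq_integrable M f" "sq_integrable M g" shows "integrable M (\<lambda>x. f x \<bullet> g x)"
proof (rule Bochner_Integration.integrable_bound[of _ "\<lambda>x. (norm (f x))\<^sup>2 + (norm (g x))\<^sup>2"])
  show "AE x in M. norm (f x \<bullet> g x) \<le> norm ((norm (f x))\<^sup>2 + (norm (g x))\<^sup>2)"
    using order_trans[OF Cauchy_Schwarz_ineq2 norm_mult_le_squares] by (intro AE_I2) simp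
qed (use assms in \<open>auto simp: sq_integrable_def\<close>)

text \<open>A subsequence whose consecutive squared distances are below 4^(-k) converges almost
  everywhere; Fatou's lemma then turns the pointwise limit into a limit in norm.\<close>

theorem L2_complete:
  fixes f :: "nat \<Rightarrow> 'a \<Rightarrow> 'b::euclidean_space"
  assumes f: "\<And>n. sq_integrable M (f n)"
    and C: "\<And>e. e > 0 \<Longrightarrow> \<exists>N. \<forall>m\<ge>N. \<forall>n\<ge>N. (LINT x|M. (norm (f m x - f n x))\<^sup>2) < e"
  shows "\<exists>g. sq_integrable M g \<and> (\<lambda>n. LINT x|M. (norm (f n x - g x))\<^sup>2) \<longlonglongrightarrow> 0"
proof -
  have [measurable]: "f n \<in> borel_measurable M" for n using f by (simp add: sq_integrable_def)
  have fi: "integrable M (\<lambda>x. (norm (f m x - f n x))\<^sup>2)" for m n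
    using sq_integrable_diff[OF f f] by (auto simp: sq_integrable_def)
  obtain N where N: "\<And>k m n. m \<ge> N k \<Longrightarrow> n \<ge> N k \<Longrightarrow> (LINT x|M. (norm (f m x - f n x))\<^sup>2) < (1/4)^k"
    using C[of "(1/4)^k" for k] by (metis zero_less_divide_1_iff zero_less_numeral zero_less_power)
  define r where "r k = (\<Sum>i\<le>k. N i) + k" for k
  have rN: "r k \<ge> N k" "r (Suc k) \<ge> N k" "r k \<ge> k" for k
    unfolding r_def by (simp_all add: sum.remove[of "{..k}" k] trans_le_add1 member_le_sum)
  define d where "d k x = norm (f (r (Suc k)) x - f (r k) x)" for k x
  have [measurable]: "d k \<in> borel_measurable M" for k unfolding d_def by measurable
  have di: "integrable M (\<lambda>x. 2^k * (d k x)\<^sup>2)" for k unfolding d_def using fi by simp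
  have dle: "(LINT x|M. 2^k * (d k x)\<^sup>2) \<le> (1/2)^k" for k
  proof -
    have "(LINT x|M. 2^k * (d k x)\<^sup>2) = 2^k * (LINT x|M. (d k x)\<^sup>2)" by simp
    also have "\<dots> \<le> 2^k * (1/4)^k"
      unfolding d_def by (intro mult_left_mono less_imp_le N rN) auto
    also have "\<dots> = (2 * (1/4))^k" by (rule power_mult_distrib[symmetric])
    also have "\<dots> = (1/2)^k" by simp
    finally show ?thesis .
  qed
  have "(\<integral>\<^sup>+x. (\<Sum>k. ennreal (2^k * (d k x)\<^sup>2)) \<partial>M) = (\<Sum>k. \<integral>\<^sup>+x. ennreal (2^k * (d k x)\<^sup>2) \<partial>M)"
    by (rule nn_integral_suminf) measurable
  also have "\<dots> \<le> (\<Sum>k. ennreal ((1/2)^k))"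
    using di dle by (intro suminf_le) (auto simp: nn_integral_eq_integral intro!: ennreal_leI)
  also have "\<dots> = ennreal 2"
    by (subst suminf_ennreal2) (auto simp: suminf_geometric summable_geometric)
  finally have "(\<integral>\<^sup>+x. (\<Sum>k. ennreal (2^k * (d k x)\<^sup>2)) \<partial>M) \<noteq> \<infinity>"
    by (metis ennreal_less_top infinity_ennreal_def leD)
  then have "AE x in M. (\<Sum>k. ennreal (2^k * (d k x)\<^sup>2)) \<noteq> \<infinity>"
    by (intro nn_integral_PInf_AE) auto
  then have ae: "AE x in M. convergent (\<lambda>k. f (r k) x)"
  proof eventually_elim
    case (elim x)
    then have "summable (\<lambda>k. 2^k * (d k x)\<^sup>2)"
      by (intro summable_suminf_not_top) (auto simp: infinity_ennreal_def)
    then have "summable (\<lambda>k. 2^k * (d k x)\<^sup>2 + (1/2)^k)" by (intro summable_add summable_geometric) auto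
    then have "summable (\<lambda>k. d k x)"
    proof (rule summable_comparison_test')
      fix k
      \<comment> \<open>The factor 2^k is affordable because the squares decay like 4^(-k), and it
        allows (2^k d - 1)^2 \<ge> 0 to turn summable squares into summable norms.\<close>
      have "2 * d k x \<le> 2^k * (d k x)\<^sup>2 + (1/2)^k"
      proof -
        have "2^k * (2 * d k x) \<le> 2^k * (2^k * (d k x)\<^sup>2 + (1/2)^k)"
          using sum_squares_bound[of "2^k * d k x" 1] by (simp add: power2_eq_square algebra_simps power_divide)
        then show ?thesis by simp
      qed
      moreover have "d k x \<ge> 0" by (simp add: d_def)
      ultimately show "norm (d k x) \<le> 2^k * (d k x)\<^sup>2 + (1/2)^k" by simp
    qed
    then have "summable (\<lambda>k. f (r (Suc k)) x - f (r k) x)"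
      unfolding d_def by (rule summable_norm_cancel)
    then have "convergent (\<lambda>n. \<Sum>k<n. f (r (Suc k)) x - f (r k) x)" by (simp add: summable_iff_convergent)
    then have "convergent (\<lambda>n. f (r n) x - f (r 0) x)"
      unfolding sum_lessThan_telescope[of "\<lambda>k. f (r k) x"] .
    from convergent_add[OF this convergent_const[of "f (r 0) x"]] show ?case by simp
  qed
  define g where "g x = lim (\<lambda>k. f (r k) x)" for x
  have [measurable]: "g \<in> borel_measurable M" unfolding g_def by measurable
  \<comment> \<open>Fatou along the subsequence compares every \<open>f n\<close> with n \<ge>
    \<open>N k\<close>, not only the selected ones, with the limit.\<close>
  have fat: "(\<integral>\<^sup>+x. ennreal ((norm (f n x - g x))\<^sup>2) \<partial>M) \<le> ennreal ((1/4)^k)" if "n \<ge> N k" for n k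
  proof -
    have "(\<integral>\<^sup>+x. ennreal ((norm (f n x - g x))\<^sup>2) \<partial>M) = (\<integral>\<^sup>+x. liminf (\<lambda>j. ennreal ((norm (f n x - f (r j) x))\<^sup>2)) \<partial>M)"
    proof (rule nn_integral_cong_AE, use ae in eventually_elim)
      case (elim x)
      then have "(\<lambda>j. f (r j) x) \<longlonglongrightarrow> g x" by (simp add: g_def convergent_LIMSEQ_iff)
      then have "(\<lambda>j. ennreal ((norm (f n x - f (r j) x))\<^sup>2)) \<longlonglongrightarrow> ennreal ((norm (f n x - g x))\<^sup>2)"
        by (intro tendsto_ennrealI tendsto_intros)
      from lim_imp_Liminf[OF sequentially_bot this] show ?case by simp
    qed
    also have "\<dots> \<le> liminf (\<lambda>j. \<integral>\<^sup>+x. ennreal ((norm (f n x - f (r j) x))\<^sup>2) \<partial>M)"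
      by (rule nn_integral_liminf) measurable
    also have "\<dots> \<le> liminf (\<lambda>j. ennreal ((1/4)^k))"
    proof (intro Liminf_mono)
      have "\<forall>\<^sub>F j in sequentially. j \<ge> N k" by (rule eventually_ge_at_top)
      then show "\<forall>\<^sub>F j in sequentially. (\<integral>\<^sup>+x. ennreal ((norm (f n x - f (r j) x))\<^sup>2) \<partial>M) \<le> ennreal ((1/4)^k)"
      proof eventually_elim
        case (elim j)
        then have "(LINT x|M. (norm (f n x - f (r j) x))\<^sup>2) \<le> (1/4)^k"
          using N[OF that, of "r j"] rN(3)[of j] by simp
        then show ?case by (subst nn_integral_eq_integral[OF fi]) (auto intro: ennreal_leI)
      qed
    qed
    also have "\<dots> = ennreal ((1/4)^k)" by (simp add: Liminf_const)
    finally show ?thesis .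
  qed
  have gi: "sq_integrable M (\<lambda>x. f n x - g x)" if "n \<ge> N k" for n k
    unfolding sq_integrable_def
    using le_less_trans[OF fat[OF that] ennreal_less_top] by (auto intro!: integrableI_bounded)
  have "sq_integrable M (\<lambda>x. f (N 0) x - (f (N 0) x - g x))"
    by (rule sq_integrable_diff[OF f gi[of 0]]) simp
  then have g: "sq_integrable M g" by simp
  show ?thesis
  proof (rule exI[of _ g], rule conjI[OF g], rule LIMSEQ_I)
    fix e :: real assume e: "e > 0"
    obtain k where k: "(1/4::real)^k < e" using real_arch_pow_inv[OF e, of "1/4"] by auto
    have "(LINT x|M. (norm (f n x - g x))\<^sup>2) \<le> (1/4)^k" if "n \<ge> N k" for n
    proof -
      have i: "integrable M (\<lambda>x. (norm (f n x - g x))\<^sup>2)" using gi[OF that] by (simp add: sq_integrable_def)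
      show ?thesis using fat[OF that] by (subst (asm) nn_integral_eq_integral[OF i]) auto
    qed
    then show "\<exists>no. \<forall>n\<ge>no. norm ((LINT x|M. (norm (f n x - g x))\<^sup>2) - 0) < e"
      using k by (intro exI[of _ "N k"]) (auto intro: le_less_trans)
  qed
qed

\<comment> \<open>The relation is partial: its domain consists of the square-integrable functions,
  and it identifies those that agree almost everywhere. The result is a complete inner product type,
  to which the abstract weak compactness theorem applies.\<close>
quotient_type (overloaded) ('a, 'b) l2 = "'a::euclidean_space \<Rightarrow> 'b::euclidean_space" / partial:
  "\<lambda>f g. sq_integrable lborel f \<and> sq_integrable lborel g \<and> (AE x in lborel. f x = g x)"
proof (rule part_equivpI)
  show "\<exists>f::'a \<Rightarrow> 'b. sq_integrable lborel f \<and> sq_integrable lborel f \<and> (AE x in lborel. f x = f x)"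
    by (rule exI[of _ "\<lambda>_. 0"]) (simp add: sq_integrable_def)
  show "symp (\<lambda>f g :: 'a \<Rightarrow> 'b. sq_integrable lborel f \<and> sq_integrable lborel g \<and> (AE x in lborel. f x = g x))"
    by (auto intro!: sympI)
  show "transp (\<lambda>f g :: 'a \<Rightarrow> 'b. sq_integrable lborel f \<and> sq_integrable lborel g \<and> (AE x in lborel. f x = g x))"
    by (auto intro!: transpI)
qed

instantiation l2 :: (euclidean_space, euclidean_space) real_inner
begin

lift_definition zero_l2 :: "('a, 'b) l2" is "\<lambda>_. 0" by (simp add: sq_integrable_def)
lift_definition plus_l2 :: "('a, 'b) l2 \<Rightarrow> ('a, 'b) l2 \<Rightarrow> ('a, 'b) l2" is "\<lambda>f g x. f x + g x"
  by (auto intro: sq_integrable_add)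
lift_definition uminus_l2 :: "('a, 'b) l2 \<Rightarrow> ('a, 'b) l2" is "\<lambda>f x. - f x"
  by (auto intro: sq_integrable_minus)
lift_definition minus_l2 :: "('a, 'b) l2 \<Rightarrow> ('a, 'b) l2 \<Rightarrow> ('a, 'b) l2" is "\<lambda>f g x. f x - g x"
  by (auto intro: sq_integrable_diff)
lift_definition scaleR_l2 :: "real \<Rightarrow> ('a, 'b) l2 \<Rightarrow> ('a, 'b) l2" is "\<lambda>c f x. c *\<^sub>R f x"
  by (auto intro: sq_integrable_scaleR)
lift_definition inner_l2 :: "('a, 'b) l2 \<Rightarrow> ('a, 'b) l2 \<Rightarrow> real" is "\<lambda>f g. LINT x|lborel. f x \<bullet> g x"
  by (intro integral_cong_AE) (auto simp: sq_integrable_def)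

definition norm_l2 :: "('a, 'b) l2 \<Rightarrow> real" where "norm_l2 f = sqrt (f \<bullet> f)"
definition dist_l2 :: "('a, 'b) l2 \<Rightarrow> ('a, 'b) l2 \<Rightarrow> real" where "dist_l2 f g = norm (f - g)"
definition sgn_l2 :: "('a, 'b) l2 \<Rightarrow> ('a, 'b) l2" where "sgn_l2 f = inverse (norm f) *\<^sub>R f"
definition uniformity_l2 :: "(('a, 'b) l2 \<times> ('a, 'b) l2) filter" where
  "uniformity_l2 = (INF e\<in>{0 <..}. principal {(x, y). dist x y < e})"
definition open_l2 :: "('a, 'b) l2 set \<Rightarrow> bool" where
  "open_l2 U \<longleftrightarrow> (\<forall>x\<in>U. eventually (\<lambda>(x', y). x' = x \<longrightarrow> y \<in> U) uniformity)"

instance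
proof
  fix f g h :: "('a, 'b) l2" and a b :: real
  show "f + g + h = f + (g + h)" by transfer (auto intro!: sq_integrable_add simp: add.assoc)
  show "f + g = g + f" by transfer (auto intro!: sq_integrable_add simp: add.commute)
  show "0 + f = f" by transfer auto
  show "- f + f = 0" by transfer (auto simp: sq_integrable_def)
  show "f - g = f + - g" by transfer (auto intro!: sq_integrable_diff)
  show "a *\<^sub>R (f + g) = a *\<^sub>R f + a *\<^sub>R g"
    by transfer (auto intro!: sq_integrable_add sq_integrable_scaleR simp: scaleR_add_right)
  show "(a + b) *\<^sub>R f = a *\<^sub>R f + b *\<^sub>R f"
    by transfer (auto intro!: sq_integrable_add sq_integrable_scaleR simp: scaleR_add_left)
  show "a *\<^sub>R b *\<^sub>R f = (a * b) *\<^sub>R f" by transfer (auto intro!: sq_integrable_scaleR)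
  show "1 *\<^sub>R f = f" by transfer auto
  show "dist f g = norm (f - g)" by (rule dist_l2_def)
  show "sgn f = inverse (norm f) *\<^sub>R f" by (rule sgn_l2_def)
  show "(uniformity :: (('a, 'b) l2 \<times> ('a, 'b) l2) filter) = (INF e\<in>{0 <..}. principal {(x, y). dist x y < e})"
    by (rule uniformity_l2_def)
  show "open U \<longleftrightarrow> (\<forall>x\<in>U. eventually (\<lambda>(x', y). x' = x \<longrightarrow> y \<in> U) uniformity)" for U :: "('a, 'b) l2 set"
    by (rule open_l2_def)
  show "f \<bullet> g = g \<bullet> f" by transfer (simp add: inner_commute)
  show "(f + g) \<bullet> h = f \<bullet> h + g \<bullet> h" by transfer (simp add: inner_add_left sq_integrable_inner)
  show "(a *\<^sub>R f) \<bullet> g = a * (f \<bullet> g)" by transfer simp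
  show "0 \<le> f \<bullet> f" by transfer simp
  show "f \<bullet> f = 0 \<longleftrightarrow> f = 0"
  proof transfer
    fix f :: "'a \<Rightarrow> 'b"
    assume f: "sq_integrable lborel f \<and> sq_integrable lborel f \<and> (AE x in lborel. f x = f x)"
    have "integrable lborel (\<lambda>x. f x \<bullet> f x)" using f sq_integrable_inner by blast
    then have "(LINT x|lborel. f x \<bullet> f x) = 0 \<longleftrightarrow> (AE x in lborel. f x \<bullet> f x = 0)"
      by (rule integral_nonneg_eq_0_iff_AE) simp
    then show "((LINT x|lborel. f x \<bullet> f x) = 0) \<longleftrightarrow>
      (sq_integrable lborel f \<and> sq_integrable lborel (\<lambda>_. 0 :: 'b) \<and> (AE x in lborel. f x = 0))"
      using f by (simp add: sq_integrable_def)
  qed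
  show "norm f = sqrt (f \<bullet> f)" by (rule norm_l2_def)
qed

end

lemma inner_abs_l2:
  "sq_integrable lborel f \<Longrightarrow> sq_integrable lborel g \<Longrightarrow> abs_l2 f \<bullet> abs_l2 g = (LINT x|lborel. f x \<bullet> g x)"
  by (rule inner_l2.abs_eq) simp_all

lemma norm_abs_l2_square: "sq_integrable lborel f \<Longrightarrow> (norm (abs_l2 f))\<^sup>2 = (LINT x|lborel. (norm (f x))\<^sup>2)"
  by (simp add: power2_norm_eq_inner inner_abs_l2)

lemma diff_abs_l2:
  "sq_integrable lborel f \<Longrightarrow> sq_integrable lborel g \<Longrightarrow> abs_l2 f - abs_l2 g = abs_l2 (\<lambda>x. f x - g x)"
  by (rule minus_l2.abs_eq) simp_all

lemma add_abs_l2: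
  "sq_integrable lborel f \<Longrightarrow> sq_integrable lborel g \<Longrightarrow> abs_l2 f + abs_l2 g = abs_l2 (\<lambda>x. f x + g x)"
  by (rule plus_l2.abs_eq) simp_all

lemma scaleR_abs_l2: "sq_integrable lborel f \<Longrightarrow> c *\<^sub>R abs_l2 f = abs_l2 (\<lambda>x. c *\<^sub>R f x)"
  by (rule scaleR_l2.abs_eq) simp_all

lemma sum_abs_l2:
  assumes "finite I" "\<And>i. i \<in> I \<Longrightarrow> sq_integrable lborel (f i)"
  shows "sq_integrable lborel (\<lambda>x. \<Sum>i\<in>I. f i x)" "(\<Sum>i\<in>I. abs_l2 (f i)) = abs_l2 (\<lambda>x. \<Sum>i\<in>I. f i x)"
proof -
  have "sq_integrable lborel (\<lambda>x. \<Sum>i\<in>I. f i x) \<and> (\<Sum>i\<in>I. abs_l2 (f i)) = abs_l2 (\<lambda>x. \<Sum>i\<in>I. f i x)"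
    using assms
  proof (induction I rule: finite_induct)
    case empty
    then show ?case by (simp add: zero_l2_def sq_integrable_def)
  next
    case (insert i I)
    then show ?case by (simp add: sq_integrable_add add_abs_l2)
  qed
  then show "sq_integrable lborel (\<lambda>x. \<Sum>i\<in>I. f i x)" "(\<Sum>i\<in>I. abs_l2 (f i)) = abs_l2 (\<lambda>x. \<Sum>i\<in>I. f i x)" by auto
qed

lemma abs_l2_cases:
  obtains f where "sq_integrable lborel f" "X = abs_l2 f"
proof -
  have "sq_integrable lborel (rep_l2 X)" using Quotient3_rep_reflp[OF Quotient3_l2, of X] by simp
  moreover have "X = abs_l2 (rep_l2 X)" using Quotient3_abs_rep[OF Quotient3_l2, of X] by simp
  ultimately show thesis by (rule that)
qed

lemma abs_l2_eq_iff:
  "sq_integrable lborel f \<Longrightarrow> sq_integrable lborel g \<Longrightarrow> abs_l2 f = abs_l2 g \<longleftrightarrow> (AE x in lborel. f x = g x)"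
  using Quotient3_rel[OF Quotient3_l2, of f g] by auto

instance l2 :: (euclidean_space, euclidean_space) complete_space
proof
  fix X :: "nat \<Rightarrow> ('a, 'b) l2" assume X: "Cauchy X"
  have "\<forall>n. \<exists>f. sq_integrable lborel f \<and> X n = abs_l2 f" using abs_l2_cases by metis
  then obtain f where f: "\<And>n. sq_integrable lborel (f n)" "\<And>n. X n = abs_l2 (f n)" by metis
  have d: "(dist (abs_l2 p) (abs_l2 q))\<^sup>2 = (LINT x|lborel. (norm (p x - q x))\<^sup>2)"
    if "sq_integrable lborel p" "sq_integrable lborel q" for p q :: "'a \<Rightarrow> 'b"
    using that by (simp add: dist_norm diff_abs_l2 norm_abs_l2_square sq_integrable_diff)
  have "\<exists>N. \<forall>m\<ge>N. \<forall>n\<ge>N. (LINT x|lborel. (norm (f m x - f n x))\<^sup>2) < e" if e: "e > 0" for e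
  proof -
    obtain N where N: "\<And>m n. m \<ge> N \<Longrightarrow> n \<ge> N \<Longrightarrow> dist (X m) (X n) < sqrt e"
      using metric_CauchyD[OF X, of "sqrt e"] e by auto
    have "(LINT x|lborel. (norm (f m x - f n x))\<^sup>2) < e" if "m \<ge> N" "n \<ge> N" for m n
      using real_less_lsqrt real_less_rsqrt N[OF that] \<open>e > 0\<close> zero_le_dist
      by (metis d f power_strict_mono real_sqrt_pow2 less_imp_le zero_less_numeral)
    then show ?thesis by blast
  qed
  from L2_complete[of lborel f, OF f(1) this]
  obtain g where g: "sq_integrable lborel g" "(\<lambda>n. LINT x|lborel. (norm (f n x - g x))\<^sup>2) \<longlonglongrightarrow> 0"
    by blast
  have "(\<lambda>n. sqrt ((dist (X n) (abs_l2 g))\<^sup>2)) \<longlonglongrightarrow> sqrt 0"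
    using g(2) by (intro tendsto_real_sqrt) (simp add: f d g)
  then have "(\<lambda>n. dist (X n) (abs_l2 g)) \<longlonglongrightarrow> 0" by simp
  then have "X \<longlonglongrightarrow> abs_l2 g" by (rule tendsto_dist_iff[THEN iffD2])
  then show "convergent X" by (auto simp: convergent_def)
qed

section \<open>Weights and solenoidal test fields\<close>

definition moderate :: "(real^3 \<Rightarrow> real) \<Rightarrow> bool" where
  "moderate m \<longleftrightarrow> m \<in> borel_measurable borel \<and> (\<exists>C N. \<forall>x. \<bar>m x\<bar> \<le> C * (1 + norm x) ^ N)"

lemma moderateI:
  assumes "m \<in> borel_measurable borel" "\<And>x. \<bar>m x\<bar> \<le> C * (1 + norm x) ^ N" shows "moderate m"
  using assms unfolding moderate_def by blast

lemma moderate_measurable: "moderate m \<Longrightarrow> m \<in> borel_measurable borel"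
  by (simp add: moderate_def)

lemma rapid_moderate: assumes "rapid \<phi>" "moderate m" shows "rapid (\<lambda>x. of_real (m x) * \<phi> x)"
proof -
  obtain C N where "\<And>x. \<bar>m x\<bar> \<le> C * (1 + norm x) ^ N" using assms(2) by (auto simp: moderate_def)
  then show ?thesis
    by (intro rapid_mult[OF assms(1), where C=C and N=N]) (use moderate_measurable[OF assms(2)] in auto)
qed

lemma moderate_mult: assumes "moderate m" "moderate m'" shows "moderate (\<lambda>x. m x * m' x)"
proof -
  obtain C N where C: "\<And>x. \<bar>m x\<bar> \<le> C * (1 + norm x) ^ N" using assms(1) by (auto simp: moderate_def)
  obtain C' N' where C': "\<And>x. \<bar>m' x\<bar> \<le> C' * (1 + norm x) ^ N'" using assms(2) by (auto simp: moderate_def)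
  show ?thesis
  proof (rule moderateI)
    show "(\<lambda>x. m x * m' x) \<in> borel_measurable borel" using assms by (auto simp: moderate_def)
    fix x
    have "\<bar>m x * m' x\<bar> \<le> (C * (1 + norm x) ^ N) * (C' * (1 + norm x) ^ N')"
      unfolding abs_mult using C[of x] C'[of x] by (intro mult_mono) (auto intro: order_trans[OF abs_ge_zero])
    then show "\<bar>m x * m' x\<bar> \<le> (C * C') * (1 + norm x) ^ (N + N')" by (simp add: power_add mult_ac)
  qed
qed

lemma moderate_const: "moderate (\<lambda>_. c)"
  by (rule moderateI[where C="\<bar>c\<bar>" and N=0]) auto

lemma moderate_add: assumes "moderate m" "moderate m'" shows "moderate (\<lambda>x. m x + m' x)"
proof -
  obtain C N where C: "\<And>x. \<bar>m x\<bar> \<le> C * (1 + norm x) ^ N" using assms(1) by (auto simp: moderate_def)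
  obtain C' N' where C': "\<And>x. \<bar>m' x\<bar> \<le> C' * (1 + norm x) ^ N'" using assms(2) by (auto simp: moderate_def)
  show ?thesis
  proof (rule moderateI)
    show "(\<lambda>x. m x + m' x) \<in> borel_measurable borel" using assms by (auto simp: moderate_def)
    fix x :: "real^3"
    have C0: "C \<ge> 0" "C' \<ge> 0" using order_trans[OF abs_ge_zero C[of 0]] order_trans[OF abs_ge_zero C'[of 0]] by auto
    have "C * (1 + norm x) ^ N \<le> C * (1 + norm x) ^ (N + N')" "C' * (1 + norm x) ^ N' \<le> C' * (1 + norm x) ^ (N + N')"
      using C0 by (intro mult_left_mono power_increasing; simp)+
    then show "\<bar>m x + m' x\<bar> \<le> (C + C') * (1 + norm x) ^ (N + N')"
      using C[of x] C'[of x] abs_triangle_ineq[of "m x" "m' x"] by (simp add: distrib_right)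
  qed
qed

lemma moderate_norm_powr: assumes "a \<ge> 0" shows "moderate (\<lambda>x. norm x powr a)"
proof (rule moderateI[where C=1 and N="nat \<lceil>a\<rceil>"])
  fix x :: "real^3"
  have "norm x powr a \<le> (1 + norm x) powr a" using assms by (intro powr_mono2) auto
  also have "\<dots> \<le> (1 + norm x) powr (real (nat \<lceil>a\<rceil>))" by (intro powr_mono) (auto, linarith)
  also have "\<dots> = (1 + norm x) ^ nat \<lceil>a\<rceil>" by (intro powr_realpow) (auto simp: add_pos_nonneg)
  finally show "\<bar>norm x powr a\<bar> \<le> 1 * (1 + norm x) ^ nat \<lceil>a\<rceil>" by simp
qed measurable

lemma moderate_bessel: "moderate (\<lambda>x. (1 + \<delta>\<^sup>2 * (norm x)\<^sup>2) powr s)"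
  by (rule moderateI[where C="(1 + \<bar>\<delta>\<bar>) ^ (2 * nat \<lceil>\<bar>s\<bar>\<rceil>)" and N="2 * nat \<lceil>\<bar>s\<bar>\<rceil>"])
     (use bessel_powr_le[of \<delta> _ s] in \<open>auto simp: abs_of_nonneg\<close>)

text \<open>These are transforms of real solenoidal fields: Hermitian symmetry encodes reality, the
  last condition solenoidality. Rapid decrease makes the fields in physical space smooth with
  bounded derivatives.\<close>

definition admissible :: "(real^3 \<Rightarrow> complex^3) \<Rightarrow> bool" where
  "admissible v \<longleftrightarrow> (\<forall>j. rapid (\<lambda>\<xi>. v \<xi> $ j)) \<and> (\<forall>\<xi> j. v (- \<xi>) $ j = cnj (v \<xi> $ j)) \<and>
     (\<forall>\<xi>. (\<Sum>j\<in>UNIV. of_real (\<xi> $ j) * v \<xi> $ j) = 0)"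

text \<open>The real part only adjusts the type, since Hermitian symmetry makes the integral real
  for admissible \<open>v\<close>. Without the factor (2 pi)^(-3), this is (2 pi)^3 times the field
  whose transform is \<open>v\<close>.\<close>

definition phys :: "(real^3 \<Rightarrow> complex^3) \<Rightarrow> 3 \<Rightarrow> real^3 \<Rightarrow> real" where
  "phys v j x = Re (ift (\<lambda>\<xi>. v \<xi> $ j) x)"

definition phys_partial :: "3 \<Rightarrow> (real^3 \<Rightarrow> complex^3) \<Rightarrow> 3 \<Rightarrow> real^3 \<Rightarrow> real" where
  "phys_partial k v j x = Re (ift (\<lambda>\<xi>. \<i> * of_real (\<xi> $ k) * v \<xi> $ j) x)"

text \<open>The weak form of the convection term, with the derivative on the third field: it makes
  sense when the first two are only square-integrable.\<close>

definition trilinear :: "(real^3 \<Rightarrow> complex^3) \<Rightarrow> (real^3 \<Rightarrow> complex^3) \<Rightarrow> (real^3 \<Rightarrow> complex^3) \<Rightarrow> real" where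
  "trilinear u v w = (\<Sum>j\<in>UNIV. \<Sum>k\<in>UNIV. LINT x|lborel. phys u j x * phys v k x * phys_partial k w j x)"

lemma admissible_rapid: "admissible v \<Longrightarrow> rapid (\<lambda>\<xi>. v \<xi> $ j)"
  by (simp add: admissible_def)

lemma admissible_partial_rapid: "admissible v \<Longrightarrow> rapid (\<lambda>\<xi>. \<i> * of_real (\<xi> $ k) * v \<xi> $ j)"
  by (intro rapid_mult_component admissible_rapid)

lemma Re_ift_props:
  assumes g: "rapid g"
  shows "(\<lambda>x. Re (ift g x)) \<in> borel_measurable borel"
    and "integrable lborel (\<lambda>x. (Re (ift g x))\<^sup>2)"
    and "\<bar>Re (ift g x)\<bar> \<le> (LINT \<xi>|lborel. cmod (g \<xi>))"
proof -
  note [measurable] = ift_measurable[OF rapid_integrable[OF g]]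
  show "(\<lambda>x. Re (ift g x)) \<in> borel_measurable borel" by measurable
  have "(Re z)\<^sup>2 \<le> (cmod z)\<^sup>2" for z using abs_Re_le_cmod[of z] by (simp add: abs_le_square_iff[symmetric])
  then show "integrable lborel (\<lambda>x. (Re (ift g x))\<^sup>2)"
    by (intro Bochner_Integration.integrable_bound[OF ift_square_integrable(1)[OF rapid_integrable[OF g] rapid_square_integrable[OF g]]])
       auto
  show "\<bar>Re (ift g x)\<bar> \<le> (LINT \<xi>|lborel. cmod (g \<xi>))"
    using abs_Re_le_cmod[of "ift g x"] norm_ift_le[of g x] by linarith
qed

lemma triple_integrable:
  fixes a b d :: "'a \<Rightarrow> real"
  assumes [measurable]: "a \<in> borel_measurable M" "b \<in> borel_measurable M" "d \<in> borel_measurable M"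
    and a: "integrable M (\<lambda>x. (a x)\<^sup>2)" and b: "integrable M (\<lambda>x. (b x)\<^sup>2)" and d: "\<And>x. \<bar>d x\<bar> \<le> B"
  shows "integrable M (\<lambda>x. a x * b x * d x)"
proof (rule Bochner_Integration.integrable_bound[of _ "\<lambda>x. B * ((a x)\<^sup>2 + (b x)\<^sup>2)"])
  show "AE x in M. norm (a x * b x * d x) \<le> norm (B * ((a x)\<^sup>2 + (b x)\<^sup>2))"
  proof (intro AE_I2)
    fix x
    have B: "B \<ge> 0" using order_trans[OF abs_ge_zero d[of x]] .
    have "\<bar>a x * b x * d x\<bar> = \<bar>d x\<bar> * (\<bar>a x\<bar> * \<bar>b x\<bar>)" by (simp add: abs_mult)
    also have "\<dots> \<le> B * ((a x)\<^sup>2 + (b x)\<^sup>2)"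
      using norm_mult_le_squares[of "a x" "b x"] by (intro mult_mono d B) auto
    finally show "norm (a x * b x * d x) \<le> norm (B * ((a x)\<^sup>2 + (b x)\<^sup>2))" using B by simp
  qed
qed (use a b in auto)

lemma trilinear_integrable:
  assumes "admissible u" "admissible v" "admissible w"
  shows "integrable lborel (\<lambda>x. phys u j x * phys v k x * phys_partial l w m x)"
proof -
  note a = Re_ift_props[OF admissible_rapid[OF assms(1)]] and b = Re_ift_props[OF admissible_rapid[OF assms(2)]]
    and d = Re_ift_props[OF admissible_partial_rapid[OF assms(3)]]
  show ?thesis
    unfolding phys_def phys_partial_def
    by (rule triple_integrable[OF _ _ _ a(2) b(2) d(3)]) (use a(1) b(1) d(1) in simp_all)
qed

section \<open>Linear combinations of admissible fields and the cancellation of the convection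
  term\<close>

lemma vec_sum_scaleR_component:
  "(\<Sum>i\<in>I. c i *\<^sub>R e i) $ j = (\<Sum>i\<in>I. complex_of_real (c i) * e i $ j)" for e :: "_ \<Rightarrow> complex^3"
  by (simp add: sum_component vector_scaleR_component) (simp add: scaleR_conv_of_real)

lemma admissible_sum:
  assumes "finite I" "\<And>i. i \<in> I \<Longrightarrow> admissible (e i)"
  shows "admissible (\<lambda>\<xi>. \<Sum>i\<in>I. c i *\<^sub>R e i \<xi>)"
  unfolding admissible_def
proof (intro conjI allI)
  note comp = vec_sum_scaleR_component
  show "rapid (\<lambda>\<xi>. (\<Sum>i\<in>I. c i *\<^sub>R e i \<xi>) $ j)" for j
    unfolding comp using assms by (intro rapid_sum rapid_cmult admissible_rapid)
  show "(\<Sum>i\<in>I. c i *\<^sub>R e i (- \<xi>)) $ j = cnj ((\<Sum>i\<in>I. c i *\<^sub>R e i \<xi>) $ j)" for \<xi> j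
    unfolding comp using assms by (simp add: admissible_def)
  show "(\<Sum>j\<in>UNIV. of_real (\<xi> $ j) * (\<Sum>i\<in>I. c i *\<^sub>R e i \<xi>) $ j) = 0" for \<xi>
  proof -
    have "(\<Sum>j\<in>UNIV. of_real (\<xi> $ j) * (\<Sum>i\<in>I. c i *\<^sub>R e i \<xi>) $ j)
      = (\<Sum>i\<in>I. of_real (c i) * (\<Sum>j\<in>UNIV. of_real (\<xi> $ j) * e i \<xi> $ j))"
      unfolding comp sum_distrib_left by (subst sum.swap) (simp add: mult_ac)
    then show ?thesis using assms by (simp add: admissible_def)
  qed
qed

lemma phys_sum:
  assumes "finite I" "\<And>i. i \<in> I \<Longrightarrow> admissible (e i)"
  shows "phys (\<lambda>\<xi>. \<Sum>i\<in>I. c i *\<^sub>R e i \<xi>) j x = (\<Sum>i\<in>I. c i * phys (e i) j x)"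
    and "phys_partial k (\<lambda>\<xi>. \<Sum>i\<in>I. c i *\<^sub>R e i \<xi>) j x = (\<Sum>i\<in>I. c i * phys_partial k (e i) j x)"
proof -
  have "ift (\<lambda>\<xi>. (\<Sum>i\<in>I. c i *\<^sub>R e i \<xi>) $ j) x = (\<Sum>i\<in>I. of_real (c i) * ift (\<lambda>\<xi>. e i \<xi> $ j) x)"
    unfolding vec_sum_scaleR_component using assms
    by (simp add: ift_sum ift_cmult rapid_integrable rapid_cmult admissible_rapid)
  then show "phys (\<lambda>\<xi>. \<Sum>i\<in>I. c i *\<^sub>R e i \<xi>) j x = (\<Sum>i\<in>I. c i * phys (e i) j x)"
    by (simp add: phys_def)
  have "\<i> * of_real (\<xi> $ k) * (\<Sum>i\<in>I. c i *\<^sub>R e i \<xi>) $ j = (\<Sum>i\<in>I. of_real (c i) * (\<i> * of_real (\<xi> $ k) * e i \<xi> $ j))" for \<xi>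
    unfolding vec_sum_scaleR_component by (simp add: sum_distrib_left mult_ac)
  then have "ift (\<lambda>\<xi>. \<i> * of_real (\<xi> $ k) * (\<Sum>i\<in>I. c i *\<^sub>R e i \<xi>) $ j) x
      = (\<Sum>i\<in>I. of_real (c i) * ift (\<lambda>\<xi>. \<i> * of_real (\<xi> $ k) * e i \<xi> $ j) x)"
    using assms by (simp only:) (subst ift_sum, auto intro!: rapid_integrable rapid_cmult admissible_partial_rapid simp: ift_cmult)
  then show "phys_partial k (\<lambda>\<xi>. \<Sum>i\<in>I. c i *\<^sub>R e i \<xi>) j x = (\<Sum>i\<in>I. c i * phys_partial k (e i) j x)"
    by (simp add: phys_partial_def)
qed

lemma trilinear_sum:
  assumes "finite I" "\<And>i. i \<in> I \<Longrightarrow> admissible (e i)" "admissible w"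
  shows "trilinear (\<lambda>\<xi>. \<Sum>i\<in>I. c i *\<^sub>R e i \<xi>) (\<lambda>\<xi>. \<Sum>i\<in>I. c i *\<^sub>R e i \<xi>) w
     = (\<Sum>m\<in>I. \<Sum>p\<in>I. c m * c p * trilinear (e m) (e p) w)"
proof -
  have "(LINT x|lborel. phys (\<lambda>\<xi>. \<Sum>i\<in>I. c i *\<^sub>R e i \<xi>) j x * phys (\<lambda>\<xi>. \<Sum>i\<in>I. c i *\<^sub>R e i \<xi>) k x * phys_partial k w j x)
     = (\<Sum>m\<in>I. \<Sum>p\<in>I. c m * c p * (LINT x|lborel. phys (e m) j x * phys (e p) k x * phys_partial k w j x))" for j k
  proof -
    have "phys (\<lambda>\<xi>. \<Sum>i\<in>I. c i *\<^sub>R e i \<xi>) j x * phys (\<lambda>\<xi>. \<Sum>i\<in>I. c i *\<^sub>R e i \<xi>) k x * phys_partial k w j x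
      = (\<Sum>m\<in>I. \<Sum>p\<in>I. c m * c p * (phys (e m) j x * phys (e p) k x * phys_partial k w j x))" for x
    proof -
      have "(\<Sum>m\<in>I. c m * a m) * (\<Sum>p\<in>I. c p * b p) * d = (\<Sum>m\<in>I. \<Sum>p\<in>I. c m * c p * (a m * b p * d))" for a b d
        unfolding sum_product unfolding sum_distrib_right by (intro sum.cong refl) (simp add: mult_ac)
      then show ?thesis by (simp only: phys_sum[OF assms(1,2)])
    qed
    then show ?thesis
      using trilinear_integrable[OF assms(2) assms(2) assms(3)] by (simp add: Bochner_Integration.integrable_sum)
  qed
  then have "trilinear (\<lambda>\<xi>. \<Sum>i\<in>I. c i *\<^sub>R e i \<xi>) (\<lambda>\<xi>. \<Sum>i\<in>I. c i *\<^sub>R e i \<xi>) w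
     = (\<Sum>j\<in>UNIV. \<Sum>k\<in>UNIV. \<Sum>m\<in>I. \<Sum>p\<in>I. c m * c p * (LINT x|lborel. phys (e m) j x * phys (e p) k x * phys_partial k w j x))"
    by (simp add: trilinear_def)
  also have "\<dots> = (\<Sum>j\<in>UNIV. \<Sum>m\<in>I. \<Sum>p\<in>I. \<Sum>k\<in>UNIV. c m * c p * (LINT x|lborel. phys (e m) j x * phys (e p) k x * phys_partial k w j x))"
    by (intro sum.cong refl, subst sum.swap, intro sum.cong refl, rule sum.swap)
  also have "\<dots> = (\<Sum>m\<in>I. \<Sum>p\<in>I. \<Sum>j\<in>UNIV. \<Sum>k\<in>UNIV. c m * c p * (LINT x|lborel. phys (e m) j x * phys (e p) k x * phys_partial k w j x))"
    by (subst sum.swap, intro sum.cong refl, rule sum.swap)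
  also have "\<dots> = (\<Sum>m\<in>I. \<Sum>p\<in>I. c m * c p * trilinear (e m) (e p) w)"
    by (simp only: trilinear_def sum_distrib_left)
  finally show ?thesis .
qed

lemma trilinear_sum_right:
  assumes "finite I" "\<And>i. i \<in> I \<Longrightarrow> admissible (e i)" "admissible u" "admissible v"
  shows "trilinear u v (\<lambda>\<xi>. \<Sum>i\<in>I. c i *\<^sub>R e i \<xi>) = (\<Sum>l\<in>I. c l * trilinear u v (e l))"
proof -
  have "(LINT x|lborel. phys u j x * phys v k x * phys_partial k (\<lambda>\<xi>. \<Sum>i\<in>I. c i *\<^sub>R e i \<xi>) j x)
     = (\<Sum>l\<in>I. c l * (LINT x|lborel. phys u j x * phys v k x * phys_partial k (e l) j x))" for j k
  proof -
    have "phys u j x * phys v k x * phys_partial k (\<lambda>\<xi>. \<Sum>i\<in>I. c i *\<^sub>R e i \<xi>) j x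
      = (\<Sum>l\<in>I. c l * (phys u j x * phys v k x * phys_partial k (e l) j x))" for x
      by (simp add: phys_sum[OF assms(1,2)] sum_distrib_left mult_ac)
    then show ?thesis
      using trilinear_integrable[OF assms(3,4) assms(2)] by (simp add: Bochner_Integration.integrable_sum)
  qed
  then have "trilinear u v (\<lambda>\<xi>. \<Sum>i\<in>I. c i *\<^sub>R e i \<xi>)
     = (\<Sum>j\<in>UNIV. \<Sum>k\<in>UNIV. \<Sum>l\<in>I. c l * (LINT x|lborel. phys u j x * phys v k x * phys_partial k (e l) j x))"
    by (simp add: trilinear_def)
  also have "\<dots> = (\<Sum>j\<in>UNIV. \<Sum>l\<in>I. \<Sum>k\<in>UNIV. c l * (LINT x|lborel. phys u j x * phys v k x * phys_partial k (e l) j x))"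
    by (intro sum.cong refl, rule sum.swap)
  also have "\<dots> = (\<Sum>l\<in>I. \<Sum>j\<in>UNIV. \<Sum>k\<in>UNIV. c l * (LINT x|lborel. phys u j x * phys v k x * phys_partial k (e l) j x))"
    by (rule sum.swap)
  also have "\<dots> = (\<Sum>l\<in>I. c l * trilinear u v (e l))"
    by (simp only: trilinear_def sum_distrib_left)
  finally show ?thesis .
qed

text \<open>With \<open>p = phys v\<close>, the integrand is the divergence of \<open>|p|\<^sup>2 p / 2\<close>, because \<open>p\<close> is solenoidal.\<close>

lemma trilinear_self:
  assumes v: "admissible v" shows "trilinear v v v = 0"
proof -
  let ?p = "phys v" and ?D = "\<lambda>k j. phys_partial k v j"
  have d: "(?p j has_derivative (\<lambda>y. Re (ift (\<lambda>\<xi>. \<i> * of_real (y \<bullet> \<xi>) * v \<xi> $ j) x))) (at x)" for j x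
    unfolding phys_def
    by (rule bounded_linear.has_derivative[OF bounded_linear_Re rapid_has_derivative_ift[OF admissible_rapid[OF v]]])
  have cont: "continuous_on UNIV (\<lambda>x. Re (ift g x))" if "rapid g" for g
    by (intro continuous_intros continuous_ift rapid_integrable that)
  have div: "(\<Sum>k\<in>UNIV. ?D k k x) = 0" for x
  proof -
    have "(\<Sum>k\<in>UNIV. ift (\<lambda>\<xi>. \<i> * of_real (\<xi> $ k) * v \<xi> $ k) x) = ift (\<lambda>\<xi>. \<Sum>k\<in>UNIV. \<i> * of_real (\<xi> $ k) * v \<xi> $ k) x"
      by (rule ift_sum[symmetric]) (intro rapid_integrable admissible_partial_rapid v)
    also have "(\<lambda>\<xi>. \<Sum>k\<in>UNIV. \<i> * of_real (\<xi> $ k) * v \<xi> $ k) = (\<lambda>\<xi>. \<i> * 0)"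
      using v by (simp only: admissible_def mult.assoc flip: sum_distrib_left)
    finally show ?thesis by (simp add: phys_partial_def ift_def flip: Re_sum)
  qed
  have T: "integrable lborel (\<lambda>x. ?p j x * ?p k x * ?D l m x)" for j k l m
    by (rule trilinear_integrable[OF v v v])
  \<comment> \<open>For each k this is the integral of the k-th derivative of |p|^2 p_k / 2.
    Solenoidality enters only afterwards: summed over k, the second group contains the divergence as
    a factor.\<close>
  have parts: "(LINT x|lborel. (\<Sum>j\<in>UNIV. ?p j x * ?p k x * ?D k j x) + 1/2 * (\<Sum>j\<in>UNIV. ?p j x * ?p j x * ?D k k x)) = 0" for k
  proof -
    let ?F = "\<lambda>x. 1/2 * (\<Sum>j\<in>UNIV. ?p j x * ?p j x * ?p k x)"
    let ?F' = "\<lambda>x y. 1/2 * (\<Sum>j\<in>UNIV. ?p j x * ?p j x * Re (ift (\<lambda>\<xi>. \<i> * of_real (y \<bullet> \<xi>) * v \<xi> $ k) x)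
        + (?p j x * Re (ift (\<lambda>\<xi>. \<i> * of_real (y \<bullet> \<xi>) * v \<xi> $ j) x) + Re (ift (\<lambda>\<xi>. \<i> * of_real (y \<bullet> \<xi>) * v \<xi> $ j) x) * ?p j x) * ?p k x)"
    have ax: "?F' x (axis k 1) = (\<Sum>j\<in>UNIV. ?p j x * ?p k x * ?D k j x) + 1/2 * (\<Sum>j\<in>UNIV. ?p j x * ?p j x * ?D k k x)" for x
      unfolding sum_distrib_left sum.distrib[symmetric]
      by (intro sum.cong refl) (simp add: phys_partial_def inner_axis' algebra_simps)
    have "(LINT x|lborel. ?F' x (axis k 1)) = 0"
    proof (rule integral_derivative_eq_0[where F="?F" and F'="?F'"])
      show "(?F has_derivative ?F' x) (at x)" for x
        by (intro has_derivative_mult_right has_derivative_sum has_derivative_mult d)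
      show "continuous_on UNIV (\<lambda>x. ?F' x (axis k 1))"
        unfolding ax unfolding phys_def phys_partial_def
        by (intro continuous_on_add continuous_on_sum continuous_on_mult continuous_on_const cont
            admissible_rapid admissible_partial_rapid v)
      show "integrable lborel ?F"
        unfolding phys_def
        by (intro integrable_mult_right Bochner_Integration.integrable_sum triple_integrable[OF _ _ _ _ _ Re_ift_props(3)])
           (use Re_ift_props[OF admissible_rapid[OF v]] admissible_rapid[OF v] in auto)
      show "integrable lborel (\<lambda>x. ?F' x (axis k 1))"
        unfolding ax by (intro integrable_mult_right Bochner_Integration.integrable_sum Bochner_Integration.integrable_add T)
    qed
    then show ?thesis unfolding ax .
  qed
  have "trilinear v v v = (\<Sum>k\<in>UNIV. \<Sum>j\<in>UNIV. LINT x|lborel. ?p j x * ?p k x * ?D k j x)"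
    unfolding trilinear_def by (rule sum.swap)
  also have "\<dots> = (\<Sum>k\<in>UNIV. LINT x|lborel. (\<Sum>j\<in>UNIV. ?p j x * ?p k x * ?D k j x))"
    using T by (simp add: Bochner_Integration.integral_sum)
  also have "\<dots> = (\<Sum>k\<in>UNIV. - (LINT x|lborel. 1/2 * (\<Sum>j\<in>UNIV. ?p j x * ?p j x * ?D k k x)))"
  proof (intro sum.cong refl)
    fix k
    have "(LINT x|lborel. (\<Sum>j\<in>UNIV. ?p j x * ?p k x * ?D k j x)) + (LINT x|lborel. 1/2 * (\<Sum>j\<in>UNIV. ?p j x * ?p j x * ?D k k x)) = 0"
      using parts[of k] by (subst Bochner_Integration.integral_add[symmetric]) (auto intro!: Bochner_Integration.integrable_sum integrable_mult_right T)
    then show "(LINT x|lborel. (\<Sum>j\<in>UNIV. ?p j x * ?p k x * ?D k j x)) = - (LINT x|lborel. 1/2 * (\<Sum>j\<in>UNIV. ?p j x * ?p j x * ?D k k x))"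
      by linarith
  qed
  also have "\<dots> = - (LINT x|lborel. (\<Sum>k\<in>UNIV. 1/2 * (\<Sum>j\<in>UNIV. ?p j x * ?p j x * ?D k k x)))"
    unfolding sum_negf by (subst Bochner_Integration.integral_sum) (auto intro!: Bochner_Integration.integrable_sum integrable_mult_right T)
  also have "(\<lambda>x. \<Sum>k\<in>UNIV. 1/2 * (\<Sum>j\<in>UNIV. ?p j x * ?p j x * ?D k k x)) = (\<lambda>x. 0)"
  proof
    fix x
    have "(\<Sum>k\<in>UNIV. 1/2 * (\<Sum>j\<in>UNIV. ?p j x * ?p j x * ?D k k x)) = 1/2 * (\<Sum>j\<in>UNIV. ?p j x * ?p j x) * (\<Sum>k\<in>UNIV. ?D k k x)"
    proof -
      have "1/2 * (\<Sum>j\<in>UNIV. ?p j x * ?p j x * ?D k k x) = 1/2 * (\<Sum>j\<in>UNIV. ?p j x * ?p j x) * ?D k k x" for k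
        unfolding sum_distrib_right[symmetric] by (simp only: mult.assoc)
      then show ?thesis by (simp only: sum_distrib_left[symmetric])
    qed
    then show "(\<Sum>k\<in>UNIV. 1/2 * (\<Sum>j\<in>UNIV. ?p j x * ?p j x * ?D k k x)) = 0" by (simp add: div)
  qed
  finally show ?thesis by simp
qed

text \<open>The matrix symbol of the Leray projector. At the origin \<open>x / 0 = 0\<close> turns
  it into the identity matrix, so its bound and its solenoidality hold at every frequency without
  exception.\<close>

definition proj :: "real^3 \<Rightarrow> 3 \<Rightarrow> 3 \<Rightarrow> real" where
  "proj \<xi> i j = (if i = j then 1 else 0) - \<xi> $ i * \<xi> $ j / (norm \<xi>)\<^sup>2"

lemma proj_measurable [measurable]: "(\<lambda>\<xi>. proj \<xi> i j) \<in> borel_measurable borel"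
  unfolding proj_def by measurable

lemma proj_minus [simp]: "proj (- \<xi>) i j = proj \<xi> i j"
  by (simp add: proj_def)

lemma abs_proj_le: "\<bar>proj \<xi> i j\<bar> \<le> 2"
proof -
  have "\<bar>\<xi> $ i * \<xi> $ j\<bar> \<le> norm \<xi> * norm \<xi>"
    unfolding abs_mult by (intro mult_mono component_le_norm_cart) auto
  then have "\<bar>\<xi> $ i * \<xi> $ j / (norm \<xi>)\<^sup>2\<bar> \<le> 1"
    by (cases "\<xi> = 0") (auto simp: power2_eq_square abs_mult)
  moreover have "\<bar>(if i = j then 1 else 0) - t\<bar> \<le> 2" if "\<bar>t\<bar> \<le> 1" for t :: real
    using that by (cases "i = j") (simp_all add: abs_le_iff)
  ultimately show ?thesis by (simp only: proj_def)
qed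

lemma norm_square_vec3: "(norm (\<xi>::real^3))\<^sup>2 = (\<Sum>j\<in>UNIV. \<xi> $ j * \<xi> $ j)"
  unfolding power2_norm_eq_inner inner_vec_def by simp

lemma proj_solenoidal: "(\<Sum>j\<in>UNIV. \<xi> $ j * proj \<xi> i j) = 0"
proof -
  have "(\<Sum>j\<in>UNIV. \<xi> $ j * proj \<xi> i j) = (\<Sum>j\<in>UNIV. (if i = j then \<xi> $ j else 0) - \<xi> $ i / (norm \<xi>)\<^sup>2 * (\<xi> $ j * \<xi> $ j))"
    by (intro sum.cong refl) (simp add: proj_def algebra_simps)
  also have "\<dots> = \<xi> $ i - \<xi> $ i / (norm \<xi>)\<^sup>2 * (norm \<xi>)\<^sup>2"
    by (simp only: sum_subtractf sum_distrib_left[symmetric] norm_square_vec3[symmetric]) simp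
  also have "\<dots> = 0" by (cases "\<xi> = 0") auto
  finally show ?thesis .
qed

lemma proj_apply_solenoidal:
  assumes "(\<Sum>j\<in>UNIV. of_real (\<xi> $ j) * z $ j) = (0::complex)"
  shows "(\<Sum>j\<in>UNIV. of_real (proj \<xi> i j) * z $ j) = z $ i"
proof -
  have "of_real (proj \<xi> i j) * z $ j = (if i = j then z $ j else 0) - of_real (\<xi> $ i / (norm \<xi>)\<^sup>2) * (of_real (\<xi> $ j) * z $ j)" for j
    by (simp add: proj_def algebra_simps)
  then have "(\<Sum>j\<in>UNIV. of_real (proj \<xi> i j) * z $ j)
      = z $ i - of_real (\<xi> $ i / (norm \<xi>)\<^sup>2) * (\<Sum>j\<in>UNIV. of_real (\<xi> $ j) * z $ j)"
    by (simp only: sum_subtractf sum_distrib_left[symmetric]) simp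
  then show ?thesis using assms by simp
qed

text \<open>The real inner product conjugates its second argument, which turns
  \<open>wave (- q)\<close> into \<open>wave q\<close>: pairing with this field tests component i of
  the projection against \<open>wave q\<close>.\<close>

definition test_field :: "real^3 \<Rightarrow> 3 \<Rightarrow> real^3 \<Rightarrow> complex^3" where
  "test_field q i \<xi> = (\<chi> j. of_real (proj \<xi> i j) * wave (- q) \<xi>)"

lemma wave_minus: "wave q (- \<xi>) = wave (- q) \<xi>" "cnj (wave q \<xi>) = wave (- q) \<xi>"
  by (simp_all add: wave_def cis_cnj)

lemma rapid_bounded_mult: "rapid \<phi> \<Longrightarrow> m \<in> borel_measurable borel \<Longrightarrow> (\<And>x. \<bar>m x\<bar> \<le> C) \<Longrightarrow> rapid (\<lambda>x. of_real (m x) * \<phi> x)"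
  by (rule rapid_mult[where C=C and N=0]) auto

lemma admissible_test_field: "admissible (test_field q i)"
  unfolding admissible_def
proof (intro conjI allI)
  show "rapid (\<lambda>\<xi>. test_field q i \<xi> $ j)" for j
    unfolding test_field_def vec_lambda_beta by (rule rapid_bounded_mult[OF rapid_wave proj_measurable abs_proj_le])
  show "test_field q i (- \<xi>) $ j = cnj (test_field q i \<xi> $ j)" for \<xi> j
    by (simp add: test_field_def wave_minus)
  show "(\<Sum>j\<in>UNIV. of_real (\<xi> $ j) * test_field q i \<xi> $ j) = 0" for \<xi>
  proof -
    have "(\<Sum>j\<in>UNIV. of_real (\<xi> $ j) * test_field q i \<xi> $ j) = of_real (\<Sum>j\<in>UNIV. \<xi> $ j * proj \<xi> i j) * wave (- q) \<xi>"
      by (simp add: test_field_def sum_distrib_right mult.assoc)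
    then show ?thesis by (simp only: proj_solenoidal) simp
  qed
qed

section \<open>Zeros of coercive vector fields\<close>

text \<open>Brouwer's fixed point theorem in the library is tied to the dimension of a type; here the dimension
  is a number. The combinatorial lemma behind it is applied to the grid of mesh \<open>2R/p\<close> in the cube
  \<open>[-R, R]\<^sup>n\<close>, with labels given by the signs of the components of the field.\<close>

theorem coercive_vector_field_zero:
  fixes F :: "nat \<Rightarrow> (nat \<Rightarrow> real) \<Rightarrow> real"
  assumes cont: "\<And>i u c. i < n \<Longrightarrow> (\<And>j. j < n \<Longrightarrow> (\<lambda>k. u k j) \<longlonglongrightarrow> c j) \<Longrightarrow> (\<lambda>k. F i (u k)) \<longlonglongrightarrow> F i c"
    and R: "R > 0" and pos: "\<And>c. (\<Sum>i<n. (c i)\<^sup>2) \<ge> R\<^sup>2 \<Longrightarrow> (\<Sum>i<n. F i c * c i) > 0"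
  shows "\<exists>c. \<forall>i<n. F i c = 0"
proof -
  define y where "y p x i = R * (2 * real (x i) / real p - 1)" for p :: nat and x :: "nat \<Rightarrow> nat" and i :: nat
  \<comment> \<open>The values on the faces of the cube are those that the combinatorial lemma
    prescribes; in the interior the label is the sign of the component.\<close>
  define label where "label p x i = (if x i = 0 then 0 else if x i = p then 1 else if F i (y p x) \<le> 0 then 0 else 1 :: nat)"
    for p :: nat and x :: "nat \<Rightarrow> nat" and i :: nat
  have yR: "y p x i = R" if "x i = p" "p > 0" for p x i using that by (simp add: y_def)
  have y0: "y p x i = - R" if "x i = 0" for p x i using that by (simp add: y_def)
  have lab01: "label p x i = 0 \<or> label p x i = 1" for p x i by (simp add: label_def)
  have "\<exists>q. \<forall>i<n. q i < p \<and> (\<exists>a b. (\<forall>j<n. q j \<le> a j \<and> a j \<le> q j + 1) \<and> (\<forall>j<n. q j \<le> b j \<and> b j \<le> q j + 1)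
       \<and> label p a i = 0 \<and> label p b i = 1)" if p: "p > 0" for p
  proof -
    obtain q where q: "\<forall>i<n. q i < p"
      "\<forall>i<n. \<exists>r s. (\<forall>j<n. q j \<le> r j \<and> r j \<le> q j + 1) \<and> (\<forall>j<n. q j \<le> s j \<and> s j \<le> q j + 1) \<and> label p r i \<noteq> label p s i"
    proof (rule kuhn_lemma[OF p, of n "label p"])
      show "\<forall>x. (\<forall>i<n. x i \<le> p) \<longrightarrow> (\<forall>i<n. label p x i = 0 \<or> label p x i = 1)" using lab01 by blast
      show "\<forall>x. (\<forall>i<n. x i \<le> p) \<longrightarrow> (\<forall>i<n. x i = 0 \<longrightarrow> label p x i = 0)" by (simp add: label_def)
      show "\<forall>x. (\<forall>i<n. x i \<le> p) \<longrightarrow> (\<forall>i<n. x i = p \<longrightarrow> label p x i = 1)" using p by (simp add: label_def)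
    qed (rule that)
    show ?thesis
    proof (rule exI[of _ q], intro allI impI conjI)
      fix i assume i: "i < n"
      show "q i < p" using q(1) i by blast
      obtain r s where rs: "\<forall>j<n. q j \<le> r j \<and> r j \<le> q j + 1" "\<forall>j<n. q j \<le> s j \<and> s j \<le> q j + 1" "label p r i \<noteq> label p s i"
        using q(2) i by blast
      then show "\<exists>a b. (\<forall>j<n. q j \<le> a j \<and> a j \<le> q j + 1) \<and> (\<forall>j<n. q j \<le> b j \<and> b j \<le> q j + 1)
         \<and> label p a i = 0 \<and> label p b i = 1"
        using lab01[of p r i] lab01[of p s i] by metis
    qed
  qed
  then have "\<forall>k. \<exists>q. \<forall>i<n. q i < Suc k \<and> (\<exists>a b. (\<forall>j<n. q j \<le> a j \<and> a j \<le> q j + 1) \<and> (\<forall>j<n. q j \<le> b j \<and> b j \<le> q j + 1)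
       \<and> label (Suc k) a i = 0 \<and> label (Suc k) b i = 1)" by blast
  then obtain q where q: "\<And>k i. i < n \<Longrightarrow> q k i < Suc k"
    "\<And>k i. i < n \<Longrightarrow> \<exists>a b. (\<forall>j<n. q k j \<le> a j \<and> a j \<le> q k j + 1) \<and> (\<forall>j<n. q k j \<le> b j \<and> b j \<le> q k j + 1)
       \<and> label (Suc k) a i = 0 \<and> label (Suc k) b i = 1" by metis
  define z where "z k j = (if j < n then y (Suc k) (q k) j else 0)" for k j
  have "\<bar>z k j\<bar> \<le> R" for k j
  proof -
    have "\<bar>2 * real (q k j) / real (Suc k) - 1\<bar> \<le> 1" if "j < n"
      using q(1)[OF that, of k] by (auto simp: abs_le_iff field_simps)
    then show ?thesis using R by (simp add: z_def y_def abs_mult mult_left_le)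
  qed
  then obtain r where r: "strict_mono r" "\<And>j. convergent (\<lambda>k. z (r k) j)"
    using bounded_imp_convergent_diagonal_subsequence[of z "\<lambda>_. R"] by blast
  define c where "c j = lim (\<lambda>k. z (r k) j)" for j
  have c: "(\<lambda>k. z (r k) j) \<longlonglongrightarrow> c j" for j
    unfolding c_def using r(2) by (simp add: convergent_LIMSEQ_iff)
  have near: "(\<lambda>k. y (Suc (r k)) (a k) j) \<longlonglongrightarrow> c j"
    if a: "\<And>k j. j < n \<Longrightarrow> q (r k) j \<le> a k j \<and> a k j \<le> q (r k) j + 1" and j: "j < n" for a j
  proof -
    have "(\<lambda>k. 1 / Suc (r k)) \<longlonglongrightarrow> 0"
      using LIMSEQ_subseq_LIMSEQ[OF gstep(2) r(1)] by (simp only: gstep_def o_def)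
    then have t0: "(\<lambda>k. 2 * R * (1 / Suc (r k))) \<longlonglongrightarrow> 0" by (rule tendsto_mult_right_zero)
    have b: "\<bar>y (Suc (r k)) (a k) j - z (r k) j\<bar> \<le> 2 * R * (1 / Suc (r k))" for k
    proof -
      have "y (Suc (r k)) (a k) j - z (r k) j = 2 * R * ((real (a k j) - real (q (r k) j)) * (1 / Suc (r k)))"
        using j by (simp add: z_def y_def diff_divide_distrib algebra_simps)
      moreover have "\<bar>(real (a k j) - real (q (r k) j)) * (1 / Suc (r k))\<bar> \<le> 1 / Suc (r k)"
        using a[OF j, of k] by (auto simp: abs_mult intro!: divide_right_mono)
      moreover have "\<bar>2 * R * X\<bar> \<le> 2 * R * u" if "\<bar>X\<bar> \<le> u" for X u
        using R mult_left_mono[OF that, of "2 * R"] by (simp add: abs_mult)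
      ultimately show ?thesis by (simp only:)
    qed
    have "(\<lambda>k. y (Suc (r k)) (a k) j - z (r k) j) \<longlonglongrightarrow> 0"
      by (rule Lim_null_comparison[OF _ t0]) (intro always_eventually allI, simp only: real_norm_def b)
    from tendsto_add[OF this c[of j]] show ?thesis by simp
  qed
  \<comment> \<open>A vertex may owe its label to a face of the cube instead of the sign of
    \<open>F\<close>. The minimum with the distance to that face states both alternatives as one
    closed condition, which survives the limit.\<close>
  have sgn: "min (c i + R) (F i c) \<le> 0" "min (R - c i) (- F i c) \<le> 0" if i: "i < n" for i
  proof -
    have "\<forall>k. \<exists>a b. (\<forall>j<n. q (r k) j \<le> a j \<and> a j \<le> q (r k) j + 1) \<and> (\<forall>j<n. q (r k) j \<le> b j \<and> b j \<le> q (r k) j + 1)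
       \<and> label (Suc (r k)) a i = 0 \<and> label (Suc (r k)) b i = 1" using q(2)[OF i] by blast
    then obtain a b where ab: "\<And>k j. j < n \<Longrightarrow> q (r k) j \<le> a k j \<and> a k j \<le> q (r k) j + 1"
      "\<And>k j. j < n \<Longrightarrow> q (r k) j \<le> b k j \<and> b k j \<le> q (r k) j + 1"
      "\<And>k. label (Suc (r k)) (a k) i = 0" "\<And>k. label (Suc (r k)) (b k) i = 1" by metis
    let ?a = "\<lambda>k. y (Suc (r k)) (a k)" and ?b = "\<lambda>k. y (Suc (r k)) (b k)"
    have "(\<lambda>k. min (?a k i + R) (F i (?a k))) \<longlonglongrightarrow> min (c i + R) (F i c)"
      by (intro tendsto_intros near ab cont i)
    moreover have "min (?a k i + R) (F i (?a k)) \<le> 0" for k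
      using ab(3)[of k] by (auto simp: label_def yR y0 min_le_iff_disj split: if_splits)
    ultimately show "min (c i + R) (F i c) \<le> 0" by (intro LIMSEQ_le_const2) blast+
    have "(\<lambda>k. min (R - ?b k i) (- F i (?b k))) \<longlonglongrightarrow> min (R - c i) (- F i c)"
      by (intro tendsto_intros near ab cont i)
    moreover have "min (R - ?b k i) (- F i (?b k)) \<le> 0" for k
      using ab(4)[of k] by (auto simp: label_def yR y0 min_le_iff_disj split: if_splits)
    ultimately show "min (R - c i) (- F i c) \<le> 0" by (intro LIMSEQ_le_const2) blast+
  qed
  have bd: "\<bar>c i\<bar> \<le> R" for i
    using \<open>\<And>k j. \<bar>z k j\<bar> \<le> R\<close> by (intro LIMSEQ_le_const2[OF tendsto_rabs[OF c]]) blast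
  \<comment> \<open>On a face the sign left over is the one opposite to coercivity. Hence the limit
    point lies inside the ball of radius R, off all faces, and only the sign alternatives
    remain.\<close>
  have "F i c * c i \<le> 0" if i: "i < n" for i
  proof -
    consider "F i c = 0" | "c i = R" "F i c \<le> 0" | "c i = - R" "F i c \<ge> 0"
      using sgn[OF i] bd[of i] by (fastforce simp: min_le_iff_disj)
    then show ?thesis using R by cases (auto simp: mult_nonpos_nonneg mult_nonneg_nonpos)
  qed
  then have "\<not> (\<Sum>i<n. F i c * c i) > 0" by (auto simp: not_less intro!: sum_nonpos)
  then have lt: "(\<Sum>i<n. (c i)\<^sup>2) < R\<^sup>2" using pos[of c] by force
  have "F i c = 0" if i: "i < n" for i
  proof -
    have "(c i)\<^sup>2 \<le> (\<Sum>i<n. (c i)\<^sup>2)" using i by (intro member_le_sum) auto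
    then have "\<bar>c i\<bar> < R" using lt R by (intro power2_less_imp_less[of "\<bar>c i\<bar>" R]) auto
    then show ?thesis using sgn[OF i] by (auto simp: min_le_iff_disj)
  qed
  then show ?thesis by blast
qed

text \<open>The term \<open>\<eta> c\<^sub>l\<close> added to the \<open>l\<close>-th equation makes the system coercive even if the vectors \<open>e\<^sub>l\<close> are
  linearly dependent; it is small at the zero.\<close>

theorem galerkin_approximation:
  fixes e :: "nat \<Rightarrow> 'h::real_inner" and A :: "nat \<Rightarrow> nat \<Rightarrow> real" and T :: "nat \<Rightarrow> nat \<Rightarrow> nat \<Rightarrow> real"
  assumes \<kappa>: "\<kappa> > 0" and \<epsilon>: "\<epsilon> > 0" and K: "K \<ge> 0"
    and coercive: "\<And>c. \<kappa> * (norm (\<Sum>l<n. c l *\<^sub>R e l))\<^sup>2 \<le> (\<Sum>l<n. \<Sum>m<n. c l * c m * A m l)"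
    and T: "\<And>c. (\<Sum>l<n. \<Sum>m<n. \<Sum>p<n. c l * c m * c p * T m p l) = 0"
    and b: "\<And>c. (\<Sum>l<n. c l * b l) \<le> K * norm (\<Sum>l<n. c l *\<^sub>R e l)"
  shows "\<exists>c. \<kappa> * norm (\<Sum>l<n. c l *\<^sub>R e l) \<le> K \<and>
    (\<forall>l<n. \<bar>(\<Sum>m<n. c m * A m l) + (\<Sum>m<n. \<Sum>p<n. c m * c p * T m p l) - b l\<bar> \<le> \<epsilon>)"
proof -
  \<comment> \<open>At the zero, \<eta> (c l)^2 is at most K^2 / (4 \<kappa>), so the square of
    \<eta> c l is at most \<eta> K^2 / (4 \<kappa>) = \<epsilon>^2 K^2 / (K^2 + 1). The summand 1
    keeps the denominator positive when K = 0.\<close>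
  define \<eta> where "\<eta> = 4 * \<kappa> * \<epsilon>\<^sup>2 / (K\<^sup>2 + 1)"
  have K1: "K\<^sup>2 + 1 > 0" by (simp add: add_nonneg_pos)
  have \<eta>: "\<eta> > 0" using \<kappa> \<epsilon> K1 by (simp add: \<eta>_def)
  define G where "G l c = (\<Sum>m<n. c m * A m l) + (\<Sum>m<n. \<Sum>p<n. c m * c p * T m p l) - b l" for l and c :: "nat \<Rightarrow> real"
  define N where "N c = norm (\<Sum>l<n. c l *\<^sub>R e l)" for c
  define S where "S c = (\<Sum>l<n. (c l)\<^sup>2)" for c :: "nat \<Rightarrow> real"
  have G: "(\<Sum>l<n. G l c * c l) \<ge> \<kappa> * (N c)\<^sup>2 - K * N c" for c
  proof -
    have "(\<Sum>l<n. G l c * c l) = (\<Sum>l<n. \<Sum>m<n. c l * c m * A m l)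
        + (\<Sum>l<n. \<Sum>m<n. \<Sum>p<n. c l * c m * c p * T m p l) - (\<Sum>l<n. c l * b l)"
      unfolding G_def by (simp add: algebra_simps sum.distrib sum_subtractf sum_distrib_left)
    then show ?thesis using T[of c] coercive[of c] b[of c] by (simp add: N_def)
  qed
  have young: "\<kappa> * x\<^sup>2 - K * x \<ge> - (K\<^sup>2 / (4 * \<kappa>))" for x
  proof -
    have "\<kappa> * x\<^sup>2 - K * x + K\<^sup>2 / (4 * \<kappa>) = \<kappa> * (x - K / (2 * \<kappa>))\<^sup>2"
      using \<kappa> by (simp add: power2_eq_square field_simps)
    moreover have "\<dots> \<ge> 0" using \<kappa> by simp
    ultimately show ?thesis by linarith
  qed
  \<comment> \<open>The quadratic part can fall below 0 by at most K^2 / (4 \<kappa>); outside the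
    ball of this radius the added term exceeds this deficit by at least \<eta>.\<close>
  define R where "R = sqrt (K\<^sup>2 / (4 * \<kappa> * \<eta>) + 1)"
  have q: "K\<^sup>2 / (4 * \<kappa> * \<eta>) \<ge> 0" using \<kappa> \<eta> by simp
  have R: "R > 0" "R\<^sup>2 = K\<^sup>2 / (4 * \<kappa> * \<eta>) + 1" using q by (auto simp: R_def)
  have F: "(\<Sum>l<n. (G l c + \<eta> * c l) * c l) = (\<Sum>l<n. G l c * c l) + \<eta> * S c" for c
    by (simp add: S_def distrib_right sum.distrib sum_distrib_left power2_eq_square mult.assoc)
  have "\<exists>c. \<forall>l<n. G l c + \<eta> * c l = 0"
  proof (rule coercive_vector_field_zero[OF _ R(1), where F="\<lambda>l c. G l c + \<eta> * c l"])
    show "(\<lambda>k. G i (u k) + \<eta> * u k i) \<longlonglongrightarrow> G i c + \<eta> * c i"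
      if "i < n" "\<And>j. j < n \<Longrightarrow> (\<lambda>k. u k j) \<longlonglongrightarrow> c j" for i u c
      unfolding G_def using that by (intro tendsto_intros) auto
    show "(\<Sum>l<n. (G l c + \<eta> * c l) * c l) > 0" if "(\<Sum>i<n. (c i)\<^sup>2) \<ge> R\<^sup>2" for c
    proof -
      have "\<eta> * S c \<ge> \<eta> * R\<^sup>2" using that \<eta> by (simp add: S_def)
      moreover have "\<eta> * R\<^sup>2 = K\<^sup>2 / (4 * \<kappa>) + \<eta>" unfolding R(2) using \<eta> \<kappa> by (simp add: field_simps)
      ultimately show ?thesis using F[of c] G[of c] young[of "N c"] \<eta> by linarith
    qed
  qed
  then obtain c where c: "\<And>l. l < n \<Longrightarrow> G l c + \<eta> * c l = 0" by blast
  have z: "(\<Sum>l<n. G l c * c l) + \<eta> * S c = 0" using F[of c] c by simp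
  have S0: "S c \<ge> 0" by (simp add: S_def sum_nonneg)
  \<comment> \<open>The added term has the favourable sign when tested with c, so the a priori bound
    suffers no loss from it.\<close>
  have "\<kappa> * N c \<le> K"
  proof (rule ccontr)
    assume n: "\<not> \<kappa> * N c \<le> K"
    have "N c \<ge> 0" by (simp add: N_def)
    moreover have "N c \<noteq> 0" using n K by auto
    ultimately have "0 < (\<kappa> * N c - K) * N c" using n by simp
    moreover have "\<eta> * S c \<ge> 0" using \<eta> S0 by simp
    moreover have "(\<kappa> * N c - K) * N c = \<kappa> * (N c)\<^sup>2 - K * N c" by (simp add: algebra_simps power2_eq_square)
    ultimately show False using z G[of c] by linarith
  qed
  moreover have "\<bar>G l c\<bar> \<le> \<epsilon>" if l: "l < n" for l
  proof -
    have "\<eta> * S c \<le> K\<^sup>2 / (4 * \<kappa>)" using z G[of c] young[of "N c"] by linarith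
    moreover have "(c l)\<^sup>2 \<le> S c" unfolding S_def using l by (intro member_le_sum) auto
    ultimately have "\<eta> * (\<eta> * (c l)\<^sup>2) \<le> \<eta> * (K\<^sup>2 / (4 * \<kappa>))"
      using \<eta> by (intro mult_left_mono) (auto intro: order_trans[OF mult_left_mono])
    also have "\<dots> = \<epsilon>\<^sup>2 * (K\<^sup>2 / (K\<^sup>2 + 1))" using \<kappa> by (simp add: \<eta>_def)
    also have "\<dots> \<le> \<epsilon>\<^sup>2" using K1 by (intro mult_left_le) auto
    finally have "(\<eta> * c l)\<^sup>2 \<le> \<epsilon>\<^sup>2" by (simp add: power2_eq_square mult_ac)
    then have "\<bar>\<eta> * c l\<bar> \<le> \<epsilon>" using \<epsilon> by (simp add: abs_le_square_iff[symmetric])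
    moreover have "G l c = - (\<eta> * c l)" using c[OF l] by linarith
    ultimately show ?thesis by simp
  qed
  ultimately show ?thesis unfolding G_def N_def by blast
qed

section \<open>The Fourier inverse of a square-integrable function\<close>

text \<open>A square-integrable function need not be integrable; cut off at a ball it is, and
  \<open>ift\<close> applies to it.\<close>

definition low_pass :: "nat \<Rightarrow> ('a::euclidean_space \<Rightarrow> complex) \<Rightarrow> 'a \<Rightarrow> complex" where
  "low_pass N g \<xi> = (if norm \<xi> \<le> real N then g \<xi> else 0)"

lemma norm_abs_l2_mono:
  fixes f :: "'a::euclidean_space \<Rightarrow> 'b::euclidean_space" and h :: "'a \<Rightarrow> 'c::euclidean_space"
  assumes f: "sq_integrable lborel f" and h: "sq_integrable lborel h" and le: "\<And>x. norm (f x) \<le> C * norm (h x)" and C: "C \<ge> 0"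
  shows "norm (abs_l2 f) \<le> C * norm (abs_l2 h)"
proof (rule power2_le_imp_le)
  have "(norm (abs_l2 f))\<^sup>2 \<le> (LINT x|lborel. C\<^sup>2 * (norm (h x))\<^sup>2)"
    unfolding norm_abs_l2_square[OF f]
  proof (rule integral_mono)
    show "(norm (f x))\<^sup>2 \<le> C\<^sup>2 * (norm (h x))\<^sup>2" for x
      using power_mono[OF le[of x], of 2] by (simp add: power_mult_distrib)
  qed (use f h in \<open>auto simp: sq_integrable_def\<close>)
  then show "(norm (abs_l2 f))\<^sup>2 \<le> (C * norm (abs_l2 h))\<^sup>2"
    by (simp add: power_mult_distrib norm_abs_l2_square[OF h])
qed (use C in auto)

lemma norm_integral_mult_le:
  fixes f h :: "'a::euclidean_space \<Rightarrow> complex"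
  assumes f: "sq_integrable lborel f" and h: "sq_integrable lborel h"
  shows "integrable lborel (\<lambda>x. f x * h x)" "cmod (LINT x|lborel. f x * h x) \<le> norm (abs_l2 f) * norm (abs_l2 h)"
proof -
  show i: "integrable lborel (\<lambda>x. f x * h x)"
    using f h by (intro integrable_mult_L2) (auto simp: sq_integrable_def)
  have sq: "sq_integrable lborel (\<lambda>x. cmod (f x))" "sq_integrable lborel (\<lambda>x. cmod (h x))"
    using f h by (auto simp: sq_integrable_def)
  have "cmod (LINT x|lborel. f x * h x) \<le> (LINT x|lborel. cmod (f x) \<bullet> cmod (h x))"
    using integral_norm_bound[of lborel "\<lambda>x. f x * h x"] by (simp add: norm_mult)
  also have "\<dots> = abs_l2 (\<lambda>x. cmod (f x)) \<bullet> abs_l2 (\<lambda>x. cmod (h x))"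
    by (simp add: inner_abs_l2 sq)
  also have "\<dots> \<le> norm (abs_l2 (\<lambda>x. cmod (f x))) * norm (abs_l2 (\<lambda>x. cmod (h x)))"
    by (rule norm_cauchy_schwarz)
  also have "\<dots> \<le> norm (abs_l2 f) * norm (abs_l2 h)"
    using norm_abs_l2_mono[OF sq(1) f, of 1] norm_abs_l2_mono[OF sq(2) h, of 1] by (intro mult_mono) auto
  finally show "cmod (LINT x|lborel. f x * h x) \<le> norm (abs_l2 f) * norm (abs_l2 h)" .
qed

lemma sq_integrable_low_pass:
  assumes g: "sq_integrable lborel g" shows "sq_integrable lborel (low_pass N g)"
proof (rule sq_integrable_bound[OF g, of _ 1])
  have [measurable]: "g \<in> borel_measurable borel" using sq_integrable_measurable[OF g] by simp
  show "low_pass N g \<in> borel_measurable lborel" unfolding low_pass_def[abs_def] by measurable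
qed (auto simp: low_pass_def)

lemma sq_integrable_indicator_cball: "sq_integrable lborel (indicator (cball 0 r) :: 'a::euclidean_space \<Rightarrow> complex)"
proof -
  have "integrable lborel (indicator (cball 0 r) :: 'a \<Rightarrow> real)"
    by (intro integrable_real_indicator emeasure_bounded_finite bounded_cball) simp
  moreover have "(\<lambda>x. (norm (indicator (cball 0 r) x :: complex))\<^sup>2) = (indicator (cball 0 r) :: 'a \<Rightarrow> real)"
    by (auto simp: indicator_def)
  moreover have "(indicator (cball 0 r) :: 'a \<Rightarrow> complex) \<in> borel_measurable borel"
    by (intro borel_measurable_indicator) simp
  ultimately show ?thesis by (simp add: sq_integrable_def)
qed

lemma integrable_low_pass:
  assumes g: "sq_integrable lborel g" shows "integrable lborel (low_pass N g)"
    and "(LINT \<xi>|lborel. cmod (low_pass N g \<xi>)) \<le> norm (abs_l2 (indicator (cball 0 (real N)) :: 'a::euclidean_space \<Rightarrow> complex)) * norm (abs_l2 (g :: 'a \<Rightarrow> complex))"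
proof -
  let ?I = "indicator (cball 0 (real N)) :: 'a \<Rightarrow> complex"
  have e: "low_pass N g = (\<lambda>\<xi>. ?I \<xi> * g \<xi>)" by (auto simp: low_pass_def indicator_def)
  show "integrable lborel (low_pass N g)"
    unfolding e by (rule norm_integral_mult_le(1)[OF sq_integrable_indicator_cball g])
  have n: "sq_integrable lborel (\<lambda>\<xi>. complex_of_real (cmod (g \<xi>)))"
    using g by (auto simp: sq_integrable_def)
  have "of_real (LINT \<xi>|lborel. cmod (low_pass N g \<xi>)) = (LINT \<xi>|lborel. ?I \<xi> * of_real (cmod (g \<xi>)))"
    by (subst integral_complex_of_real[symmetric], intro Bochner_Integration.integral_cong refl) (auto simp: e indicator_def)
  then have "(LINT \<xi>|lborel. cmod (low_pass N g \<xi>)) \<le> cmod (LINT \<xi>|lborel. ?I \<xi> * of_real (cmod (g \<xi>)))"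
    by (metis abs_ge_self norm_of_real)
  also have "\<dots> \<le> norm (abs_l2 ?I) * norm (abs_l2 (\<lambda>\<xi>. complex_of_real (cmod (g \<xi>))))"
    by (rule norm_integral_mult_le(2)[OF sq_integrable_indicator_cball n])
  also have "\<dots> \<le> norm (abs_l2 ?I) * norm (abs_l2 g)"
    using norm_abs_l2_mono[OF n g, of 1] by (intro mult_left_mono) auto
  finally show "(LINT \<xi>|lborel. cmod (low_pass N g \<xi>)) \<le> norm (abs_l2 ?I) * norm (abs_l2 g)" .
qed

lemma ift_diff_fun:
  "integrable lborel g \<Longrightarrow> integrable lborel h \<Longrightarrow> ift (\<lambda>\<xi>. g \<xi> - h \<xi>) = (\<lambda>x. ift g x - ift h x)"
  by (rule ext) (rule ift_diff)

definition tail :: "nat \<Rightarrow> ('a::euclidean_space \<Rightarrow> complex) \<Rightarrow> real" where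
  "tail N g = norm (abs_l2 (\<lambda>\<xi>. g \<xi> - low_pass N g \<xi>))"

lemma tail_tendsto:
  assumes g: "sq_integrable lborel g" shows "(\<lambda>N. tail N g) \<longlonglongrightarrow> 0"
proof -
  note s = sq_integrable_diff[OF g sq_integrable_low_pass[OF g]]
  have [measurable]: "g \<in> borel_measurable borel" using sq_integrable_measurable[OF g] by simp
  have [measurable]: "low_pass N g \<in> borel_measurable borel" for N
    using sq_integrable_measurable[OF sq_integrable_low_pass[OF g]] by simp
  have "(\<lambda>N. LINT \<xi>|lborel. (cmod (g \<xi> - low_pass N g \<xi>))\<^sup>2) \<longlonglongrightarrow> (LINT \<xi>|(lborel :: 'a measure). 0)"
  proof (rule integral_dominated_convergence[where w="\<lambda>\<xi>. (cmod (g \<xi>))\<^sup>2"])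
    show "AE \<xi> in lborel. (\<lambda>N. (cmod (g \<xi> - low_pass N g \<xi>))\<^sup>2) \<longlonglongrightarrow> 0"
    proof (intro AE_I2)
      fix \<xi> :: 'a
      have "\<forall>\<^sub>F N in sequentially. norm \<xi> \<le> real N"
        by (rule filterlim_at_top[THEN iffD1, rule_format, OF filterlim_real_sequentially])
      then have "\<forall>\<^sub>F N in sequentially. (cmod (g \<xi> - low_pass N g \<xi>))\<^sup>2 = 0"
        by eventually_elim (simp add: low_pass_def)
      then show "(\<lambda>N. (cmod (g \<xi> - low_pass N g \<xi>))\<^sup>2) \<longlonglongrightarrow> 0" by (simp add: tendsto_eventually)
    qed
  qed (use g in \<open>auto simp: sq_integrable_def low_pass_def\<close>)
  then have "(\<lambda>N. sqrt ((tail N g)\<^sup>2)) \<longlonglongrightarrow> sqrt 0"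
    unfolding tail_def norm_abs_l2_square[OF s] by (intro tendsto_real_sqrt) simp
  then show ?thesis by (simp add: tail_def)
qed

definition plancherel :: "'a::euclidean_space itself \<Rightarrow> real" where
  "plancherel _ = sqrt ((2 * pi) ^ DIM('a))"

lemma plancherel_pos: "plancherel TYPE('a::euclidean_space) > 0"
  by (simp add: plancherel_def)

lemma sq_integrable_ift:
  fixes v :: "'a::euclidean_space \<Rightarrow> complex"
  assumes v: "integrable lborel v" "sq_integrable lborel v"
  shows "sq_integrable lborel (ift v)" "norm (abs_l2 (ift v)) \<le> plancherel TYPE('a) * norm (abs_l2 v)"
proof -
  have v2: "integrable lborel (\<lambda>\<xi>. (cmod (v \<xi>))\<^sup>2)" using v(2) by (simp add: sq_integrable_def)
  note p = ift_square_integrable[OF v(1) v2]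
  show s: "sq_integrable lborel (ift v)" using p(1) ift_measurable[OF v(1)] by (simp add: sq_integrable_def)
  have "(norm (abs_l2 (ift v)))\<^sup>2 \<le> (plancherel TYPE('a) * norm (abs_l2 v))\<^sup>2"
    using p(2) by (simp add: power_mult_distrib plancherel_def norm_abs_l2_square s v(2))
  then show "norm (abs_l2 (ift v)) \<le> plancherel TYPE('a) * norm (abs_l2 v)"
    by (rule power2_le_imp_le) (simp add: plancherel_def)
qed

text \<open>This is the extension of \<open>ift\<close> to square-integrable functions, for
  real-valued results. \<open>U\<close> is described through its distance to the transforms of the
  truncations, which determines it up to null sets since the tails tend to 0.\<close>

definition inverse_transform :: "('a::euclidean_space \<Rightarrow> real) \<Rightarrow> ('a \<Rightarrow> complex) \<Rightarrow> bool" where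
  "inverse_transform U g \<longleftrightarrow> sq_integrable lborel U \<and>
     (\<forall>N. norm (abs_l2 (\<lambda>x. complex_of_real (U x) - ift (low_pass N g) x)) \<le> plancherel TYPE('a) * tail N g)"

text \<open>By Plancherel's inequality the transforms of the truncations form a Cauchy sequence.
  Hermitian symmetry makes all of them real, so passing to the real part of the limit does not
  increase any distance.\<close>

theorem inverse_transform_exists:
  fixes g :: "'a::euclidean_space \<Rightarrow> complex"
  assumes g: "sq_integrable lborel g" and herm: "AE \<xi> in lborel. g (- \<xi>) = cnj (g \<xi>)"
  shows "\<exists>U. inverse_transform U g"
proof -
  let ?K = "plancherel TYPE('a)"
  have K: "?K > 0" by (rule plancherel_pos)
  note sc = sq_integrable_low_pass[OF g] and ic = integrable_low_pass(1)[OF g]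
  note si = sq_integrable_ift(1)[OF ic sc]
  define a where "a N = abs_l2 (ift (low_pass N g))" for N
  have step: "norm (a M - a N) \<le> ?K * tail N g" if "M \<ge> N" for M N
  proof -
    have "a M - a N = abs_l2 (ift (\<lambda>\<xi>. low_pass M g \<xi> - low_pass N g \<xi>))"
      unfolding a_def by (simp add: diff_abs_l2 si ift_diff_fun[OF ic ic])
    also have "norm \<dots> \<le> ?K * norm (abs_l2 (\<lambda>\<xi>. low_pass M g \<xi> - low_pass N g \<xi>))"
      by (intro sq_integrable_ift(2) Bochner_Integration.integrable_diff ic sq_integrable_diff sc)
    also have "norm (abs_l2 (\<lambda>\<xi>. low_pass M g \<xi> - low_pass N g \<xi>)) \<le> 1 * tail N g"
      unfolding tail_def using that
      by (intro norm_abs_l2_mono sq_integrable_diff sc g) (auto simp: low_pass_def)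
    finally show ?thesis using K by (simp add: mult_left_mono)
  qed
  have t0: "(\<lambda>N. ?K * tail N g) \<longlonglongrightarrow> 0" using tail_tendsto[OF g] by (rule tendsto_mult_right_zero)
  have "Cauchy a"
  proof (rule CauchyI')
    fix e :: real assume "e > 0"
    then obtain N0 where N0: "\<And>N. N \<ge> N0 \<Longrightarrow> \<bar>?K * tail N g\<bar> < e"
      using LIMSEQ_D[OF t0, of e] by auto
    have "dist (a m) (a n) < e" if "m \<ge> N0" "n > m" for m n
      using step[of m n] N0[of m] that by (simp add: dist_norm norm_minus_commute)
    then show "\<exists>M. \<forall>m\<ge>M. \<forall>n>m. dist (a m) (a n) < e" by blast
  qed
  then obtain X where X: "a \<longlonglongrightarrow> X" using Cauchy_convergent unfolding convergent_def by blast
  obtain u where u: "sq_integrable lborel u" "X = abs_l2 u" by (rule abs_l2_cases)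
  have lim: "norm (X - a N) \<le> ?K * tail N g" for N
  proof (rule LIMSEQ_le_const2)
    show "(\<lambda>M. norm (a M - a N)) \<longlonglongrightarrow> norm (X - a N)" by (intro tendsto_intros X)
    show "\<exists>M0. \<forall>M\<ge>M0. norm (a M - a N) \<le> ?K * tail N g" using step by blast
  qed
  define U where "U x = Re (u x)" for x
  have sU: "sq_integrable lborel U"
    unfolding U_def using sq_integrable_measurable[OF u(1)]
    by (intro sq_integrable_bound[OF u(1), of _ 1]) (auto simp: abs_Re_le_cmod)
  have sU': "sq_integrable lborel (\<lambda>x. complex_of_real (U x))"
    using sU by (auto simp: sq_integrable_def)
  \<comment> \<open>The truncation is to balls centred at the origin, hence keeps the Hermitian
    symmetry.\<close>
  have real: "Im (ift (low_pass N g) x) = 0" for N x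
  proof -
    have "cnj (ift (low_pass N g) x) = ift (\<lambda>\<xi>. cnj (low_pass N g \<xi>)) (- x)" by (simp add: ift_cnj)
    also have "\<dots> = ift (\<lambda>\<xi>. low_pass N g (- \<xi>)) (- x)"
      unfolding ift_def
    proof (rule integral_cong_AE)
      have [measurable]: "low_pass N g \<in> borel_measurable borel"
        using sq_integrable_measurable[OF sc[of N]] by simp
      show "(\<lambda>\<xi>. cis (- x \<bullet> \<xi>) * cnj (low_pass N g \<xi>)) \<in> borel_measurable lborel"
        "(\<lambda>\<xi>. cis (- x \<bullet> \<xi>) * low_pass N g (- \<xi>)) \<in> borel_measurable lborel"
        by (auto intro!: borel_measurable_times measurable_compose[OF _ \<open>low_pass N g \<in> borel_measurable borel\<close>]
            borel_measurable_cnj)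
      show "AE \<xi> in lborel. cis (- x \<bullet> \<xi>) * cnj (low_pass N g \<xi>) = cis (- x \<bullet> \<xi>) * low_pass N g (- \<xi>)"
        using herm by eventually_elim (simp add: low_pass_def)
    qed
    also have "\<dots> = ift (low_pass N g) x" by (simp add: ift_reflect)
    finally show ?thesis by (simp add: complex_eq_iff)
  qed
  have "norm (abs_l2 (\<lambda>x. complex_of_real (U x) - ift (low_pass N g) x)) \<le> 1 * norm (abs_l2 (\<lambda>x. u x - ift (low_pass N g) x))" for N
  proof (rule norm_abs_l2_mono)
    fix x
    have "complex_of_real (U x) - ift (low_pass N g) x = of_real (Re (u x - ift (low_pass N g) x))"
      using real[of N x] by (simp add: U_def complex_eq_iff)
    then show "cmod (complex_of_real (U x) - ift (low_pass N g) x) \<le> 1 * cmod (u x - ift (low_pass N g) x)"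
      by (simp only: norm_of_real mult_1 abs_Re_le_cmod)
  qed (use sU' si u in \<open>auto intro: sq_integrable_diff\<close>)
  moreover have "norm (abs_l2 (\<lambda>x. u x - ift (low_pass N g) x)) = norm (X - a N)" for N
    unfolding u(2) a_def by (simp add: diff_abs_l2 u(1) si)
  ultimately have "inverse_transform U g"
    unfolding inverse_transform_def using sU lim order_trans by (metis mult_1)
  then show ?thesis by blast
qed

lemma inverse_transform_tendsto:
  assumes U: "inverse_transform U g" and g: "sq_integrable lborel g" and k: "sq_integrable lborel k"
  shows "(\<lambda>N. LINT x|lborel. ift (low_pass N g) x * k x) \<longlonglongrightarrow> (LINT x|lborel. of_real (U x) * k x)"
    and "(\<lambda>N. LINT x|lborel. low_pass N g x * k x) \<longlonglongrightarrow> (LINT x|lborel. g x * k x)"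
proof -
  note sc = sq_integrable_low_pass[OF g] and ic = integrable_low_pass(1)[OF g]
  note si = sq_integrable_ift(1)[OF ic sc]
  have sU: "sq_integrable lborel (\<lambda>x. complex_of_real (U x))"
    using U by (auto simp: inverse_transform_def sq_integrable_def)
  have "(\<lambda>N. (LINT x|lborel. of_real (U x) * k x) - (LINT x|lborel. ift (low_pass N g) x * k x)) \<longlonglongrightarrow> 0"
  proof (rule Lim_null_comparison)
    show "(\<lambda>N. plancherel TYPE('a) * tail N g * norm (abs_l2 k)) \<longlonglongrightarrow> 0"
      by (intro tendsto_mult_left_zero tendsto_mult_right_zero tail_tendsto g)
    show "\<forall>\<^sub>F N in sequentially. norm ((LINT x|lborel. of_real (U x) * k x) - (LINT x|lborel. ift (low_pass N g) x * k x))
        \<le> plancherel TYPE('a) * tail N g * norm (abs_l2 k)"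
    proof (intro always_eventually allI)
      fix N
      have "(LINT x|lborel. of_real (U x) * k x) - (LINT x|lborel. ift (low_pass N g) x * k x)
         = (LINT x|lborel. (of_real (U x) - ift (low_pass N g) x) * k x)"
        by (simp add: left_diff_distrib norm_integral_mult_le(1) sU si k)
      also have "cmod \<dots> \<le> norm (abs_l2 (\<lambda>x. of_real (U x) - ift (low_pass N g) x)) * norm (abs_l2 k)"
        by (intro norm_integral_mult_le sq_integrable_diff sU si k)
      also have "\<dots> \<le> plancherel TYPE('a) * tail N g * norm (abs_l2 k)"
        using U by (intro mult_right_mono) (auto simp: inverse_transform_def)
      finally show "norm ((LINT x|lborel. of_real (U x) * k x) - (LINT x|lborel. ift (low_pass N g) x * k x))
        \<le> plancherel TYPE('a) * tail N g * norm (abs_l2 k)" .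
    qed
  qed
  from tendsto_diff[OF tendsto_const this, of "LINT x|lborel. of_real (U x) * k x"]
  show "(\<lambda>N. LINT x|lborel. ift (low_pass N g) x * k x) \<longlonglongrightarrow> (LINT x|lborel. of_real (U x) * k x)" by simp
  have "(\<lambda>N. (LINT x|lborel. g x * k x) - (LINT x|lborel. low_pass N g x * k x)) \<longlonglongrightarrow> 0"
  proof (rule Lim_null_comparison)
    show "(\<lambda>N. tail N g * norm (abs_l2 k)) \<longlonglongrightarrow> 0"
      by (intro tendsto_mult_left_zero tail_tendsto g)
    show "\<forall>\<^sub>F N in sequentially. norm ((LINT x|lborel. g x * k x) - (LINT x|lborel. low_pass N g x * k x)) \<le> tail N g * norm (abs_l2 k)"
    proof (intro always_eventually allI)
      fix N
      have "(LINT x|lborel. g x * k x) - (LINT x|lborel. low_pass N g x * k x) = (LINT x|lborel. (g x - low_pass N g x) * k x)"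
        by (simp add: left_diff_distrib norm_integral_mult_le(1) g sc k)
      also have "cmod \<dots> \<le> tail N g * norm (abs_l2 k)"
        unfolding tail_def by (intro norm_integral_mult_le sq_integrable_diff g sc k)
      finally show "norm ((LINT x|lborel. g x * k x) - (LINT x|lborel. low_pass N g x * k x)) \<le> tail N g * norm (abs_l2 k)" .
    qed
  qed
  from tendsto_diff[OF tendsto_const this, of "LINT x|lborel. g x * k x"]
  show "(\<lambda>N. LINT x|lborel. low_pass N g x * k x) \<longlonglongrightarrow> (LINT x|lborel. g x * k x)" by simp
qed

theorem inverse_transform_parseval:
  fixes g h :: "'a::euclidean_space \<Rightarrow> complex"
  assumes U: "inverse_transform U g" and g: "sq_integrable lborel g"
    and h: "integrable lborel h" "sq_integrable lborel h" "continuous_on UNIV h" "\<And>x. cmod (h x) \<le> B"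
  shows "(LINT x|lborel. of_real (U x) * ift h (- x)) = (2 * pi) ^ DIM('a) * (LINT \<xi>|lborel. g \<xi> * h \<xi>)"
proof -
  have h2: "integrable lborel (\<lambda>\<xi>. (cmod (h \<xi>))\<^sup>2)" using h(2) by (simp add: sq_integrable_def)
  have sh: "sq_integrable lborel (\<lambda>x. ift h (- x))"
    using sq_integrable_ift(1)[OF h(1,2)] integrable_lborel_reflect_iff[of "\<lambda>x. (cmod (ift h x))\<^sup>2"] ift_measurable[OF h(1)]
    by (auto simp: sq_integrable_def)
  have "(\<lambda>N. LINT x|lborel. ift (low_pass N g) x * ift h (- x)) \<longlonglongrightarrow> (LINT x|lborel. of_real (U x) * ift h (- x))"
    by (rule inverse_transform_tendsto(1)[OF U g sh])
  moreover have "(LINT x|lborel. ift (low_pass N g) x * ift h (- x)) = (2 * pi) ^ DIM('a) * (LINT \<xi>|lborel. low_pass N g \<xi> * h \<xi>)" for N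
    using sq_integrable_low_pass[OF g, of N] by (intro ift_parseval[OF integrable_low_pass(1)[OF g] _ h(1) h2 h(3,4)]) (simp add: sq_integrable_def)
  moreover have "(\<lambda>N. (2 * pi) ^ DIM('a) * (LINT \<xi>|lborel. low_pass N g \<xi> * h \<xi>)) \<longlonglongrightarrow> (2 * pi) ^ DIM('a) * (LINT \<xi>|lborel. g \<xi> * h \<xi>)"
    by (intro tendsto_intros inverse_transform_tendsto(2)[OF U g h(2)])
  ultimately show ?thesis by (simp add: LIMSEQ_unique)
qed

section \<open>Compactness of the quadratic term\<close>

text \<open>The high frequencies are uniformly small because of the weight; the low frequencies converge
  pointwise and boundedly, since the exponentials restricted to a ball are admissible test functions.\<close>

lemma local_strong_convergence:
  fixes v :: "nat \<Rightarrow> 'a::euclidean_space \<Rightarrow> complex"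
  assumes s: "s > 0" and v: "\<And>n. integrable lborel (v n)" "\<And>n. sq_integrable lborel (v n)"
    and bound: "\<And>n. integrable lborel (\<lambda>\<xi>. (1 + (norm \<xi>)\<^sup>2) powr s * (cmod (v n \<xi>))\<^sup>2)"
      "\<And>n. (LINT \<xi>|lborel. (1 + (norm \<xi>)\<^sup>2) powr s * (cmod (v n \<xi>))\<^sup>2) \<le> \<rho>\<^sup>2" and \<rho>: "\<rho> \<ge> 0"
    and g: "sq_integrable lborel g" and U: "inverse_transform U g"
    and weak: "\<And>y. sq_integrable lborel y \<Longrightarrow> (\<lambda>n. LINT \<xi>|lborel. v n \<xi> * y \<xi>) \<longlonglongrightarrow> (LINT \<xi>|lborel. g \<xi> * y \<xi>)"
    and d: "sq_integrable lborel d" "\<And>x. \<bar>d x\<bar> \<le> B"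
  shows "(\<lambda>n. norm (abs_l2 (\<lambda>x. (Re (ift (v n) x) - U x) * d x))) \<longlonglongrightarrow> 0"
proof -
  let ?K = "plancherel TYPE('a)"
  have K: "?K > 0" by (rule plancherel_pos)
  have B: "B \<ge> 0" using order_trans[OF abs_ge_zero d(2)[of 0]] .
  have [measurable]: "v n \<in> borel_measurable borel" "d \<in> borel_measurable borel" "U \<in> borel_measurable borel"
    "g \<in> borel_measurable borel" for n
    using v d U g by (auto simp: sq_integrable_def inverse_transform_def)
  note scv = sq_integrable_low_pass[OF v(2)] and icv = integrable_low_pass(1)[OF v(2)]
  note scg = sq_integrable_low_pass[OF g] and icg = integrable_low_pass(1)[OF g]
  note [measurable] = ift_measurable[OF v(1)] ift_measurable[OF icv] ift_measurable[OF icg]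
  have sU: "sq_integrable lborel (\<lambda>x. complex_of_real (U x))"
    using U by (auto simp: inverse_transform_def sq_integrable_def)
  \<comment> \<open>Chebyshev's argument: beyond radius N the weight is at least its value at N,
    uniformly in n.\<close>
  have tailv: "tail N (v n) \<le> \<rho> / sqrt ((1 + (real N)\<^sup>2) powr s)" for N n
  proof -
    let ?w = "(1 + (real N)\<^sup>2) powr s"
    have w: "?w > 0" by (simp add: add_nonneg_eq_0_iff)
    have "?w * (tail N (v n))\<^sup>2 = (LINT \<xi>|lborel. ?w * (cmod (v n \<xi> - low_pass N (v n) \<xi>))\<^sup>2)"
      unfolding tail_def norm_abs_l2_square[OF sq_integrable_diff[OF v(2) scv]] by simp
    also have "\<dots> \<le> (LINT \<xi>|lborel. (1 + (norm \<xi>)\<^sup>2) powr s * (cmod (v n \<xi>))\<^sup>2)"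
    proof (rule integral_mono)
      show "integrable lborel (\<lambda>\<xi>. ?w * (cmod (v n \<xi> - low_pass N (v n) \<xi>))\<^sup>2)"
        using sq_integrable_diff[OF v(2) scv] by (simp add: sq_integrable_def)
      show "?w * (cmod (v n \<xi> - low_pass N (v n) \<xi>))\<^sup>2 \<le> (1 + (norm \<xi>)\<^sup>2) powr s * (cmod (v n \<xi>))\<^sup>2" for \<xi>
        using s by (auto simp: low_pass_def not_le intro!: mult_right_mono powr_mono2 power_mono)
    qed (rule bound)
    also have "\<dots> \<le> \<rho>\<^sup>2" by (rule bound)
    finally have "(sqrt ?w * tail N (v n))\<^sup>2 \<le> \<rho>\<^sup>2" using w by (simp add: power_mult_distrib)
    then have "sqrt ?w * tail N (v n) \<le> \<rho>" using \<rho> by (rule power2_le_imp_le)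
    then show ?thesis using w by (simp add: pos_le_divide_eq mult.commute)
  qed
  have normv: "norm (abs_l2 (v n)) \<le> \<rho>" for n
  proof -
    have "(norm (abs_l2 (v n)))\<^sup>2 \<le> (LINT \<xi>|lborel. (1 + (norm \<xi>)\<^sup>2) powr s * (cmod (v n \<xi>))\<^sup>2)"
      unfolding norm_abs_l2_square[OF v(2)]
    proof (rule integral_mono)
      show "(cmod (v n \<xi>))\<^sup>2 \<le> (1 + (norm \<xi>)\<^sup>2) powr s * (cmod (v n \<xi>))\<^sup>2" for \<xi>
        using s ge_one_powr_ge_zero[of "1 + (norm \<xi>)\<^sup>2" s] mult_right_mono[of 1 "(1 + (norm \<xi>)\<^sup>2) powr s" "(cmod (v n \<xi>))\<^sup>2"]
        by simp
    qed (use bound v in \<open>auto simp: sq_integrable_def\<close>)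
    then have "(norm (abs_l2 (v n)))\<^sup>2 \<le> \<rho>\<^sup>2" using bound(2)[of n] by linarith
    then show ?thesis using \<rho> by (rule power2_le_imp_le)
  qed
  have sd: "sq_integrable lborel (\<lambda>x. complex_of_real (d x) * f x)" "norm (abs_l2 (\<lambda>x. complex_of_real (d x) * f x)) \<le> B * norm (abs_l2 f)"
    if f: "sq_integrable lborel f" for f
  proof -
    have b: "cmod (complex_of_real (d x) * f x) \<le> B * cmod (f x)" for x
      unfolding norm_mult norm_of_real by (intro mult_right_mono d) auto
    have [measurable]: "f \<in> borel_measurable borel" using sq_integrable_measurable[OF f] by simp
    show s: "sq_integrable lborel (\<lambda>x. complex_of_real (d x) * f x)"
      by (rule sq_integrable_bound[OF f _ b]) simp
    show "norm (abs_l2 (\<lambda>x. complex_of_real (d x) * f x)) \<le> B * norm (abs_l2 f)"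
      by (rule norm_abs_l2_mono[OF s f b B])
  qed
  define mid where "mid N n = norm (abs_l2 (\<lambda>x. complex_of_real (d x) * (ift (low_pass N (v n)) x - ift (low_pass N g) x)))" for N n
  have mid0: "(\<lambda>n. mid N n) \<longlonglongrightarrow> 0" for N
  proof -
    note sm = sd(1)[OF sq_integrable_diff[OF sq_integrable_ift(1)[OF icv scv] sq_integrable_ift(1)[OF icg scg]]]
    define M where "M = norm (abs_l2 (indicator (cball 0 (real N)) :: 'a \<Rightarrow> complex)) * (\<rho> + norm (abs_l2 g))"
    have Mb: "cmod (ift (low_pass N (v n)) x - ift (low_pass N g) x) \<le> M" for n x
    proof -
      have "cmod (ift (low_pass N (v n)) x) \<le> norm (abs_l2 (indicator (cball 0 (real N)) :: 'a \<Rightarrow> complex)) * \<rho>"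
        by (rule order_trans[OF norm_ift_le order_trans[OF integrable_low_pass(2)[OF v(2)]]]) (intro mult_left_mono normv, simp)
      moreover have "cmod (ift (low_pass N g) x) \<le> norm (abs_l2 (indicator (cball 0 (real N)) :: 'a \<Rightarrow> complex)) * norm (abs_l2 g)"
        by (rule order_trans[OF norm_ift_le integrable_low_pass(2)[OF g]])
      ultimately show ?thesis
        using norm_triangle_ineq4[of "ift (low_pass N (v n)) x" "ift (low_pass N g) x"] by (simp add: M_def distrib_left)
    qed
    have pt: "(\<lambda>n. ift (low_pass N (v n)) x) \<longlonglongrightarrow> ift (low_pass N g) x" for x
    proof -
      let ?y = "\<lambda>\<xi>. cis (x \<bullet> \<xi>) * indicator (cball 0 (real N)) \<xi>"
      have y: "sq_integrable lborel ?y"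
        by (rule sq_integrable_bound[OF sq_integrable_indicator_cball, of _ 1]) (auto simp: indicator_def)
      have "ift (low_pass N f) x = (LINT \<xi>|lborel. f \<xi> * ?y \<xi>)" for f :: "'a \<Rightarrow> complex"
        unfolding ift_def by (intro Bochner_Integration.integral_cong refl) (auto simp: low_pass_def indicator_def)
      then show ?thesis using weak[OF y] by simp
    qed
    have "(\<lambda>n. LINT x|lborel. (cmod (of_real (d x) * (ift (low_pass N (v n)) x - ift (low_pass N g) x)))\<^sup>2) \<longlonglongrightarrow> (LINT x|(lborel :: 'a measure). 0)"
    \<comment> \<open>The low-frequency parts are only bounded in x. The square-integrable factor
      \<open>d\<close> supplies the majorant and so plays the role of a cutoff function.\<close>
    proof (rule integral_dominated_convergence[where w="\<lambda>x. M\<^sup>2 * (d x)\<^sup>2"])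
      show "integrable lborel (\<lambda>x. M\<^sup>2 * (d x)\<^sup>2)" using d(1) by (simp add: sq_integrable_def)
      show "AE x in lborel. (\<lambda>n. (cmod (of_real (d x) * (ift (low_pass N (v n)) x - ift (low_pass N g) x)))\<^sup>2) \<longlonglongrightarrow> 0"
      proof (intro AE_I2)
        fix x
        have "(\<lambda>n. (cmod (of_real (d x) * (ift (low_pass N (v n)) x - ift (low_pass N g) x)))\<^sup>2) \<longlonglongrightarrow> (cmod (of_real (d x) * (ift (low_pass N g) x - ift (low_pass N g) x)))\<^sup>2"
          by (intro tendsto_intros pt)
        then show "(\<lambda>n. (cmod (of_real (d x) * (ift (low_pass N (v n)) x - ift (low_pass N g) x)))\<^sup>2) \<longlonglongrightarrow> 0" by simp
      qed
      show "AE x in lborel. norm ((cmod (of_real (d x) * (ift (low_pass N (v n)) x - ift (low_pass N g) x)))\<^sup>2) \<le> M\<^sup>2 * (d x)\<^sup>2" for n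
      proof (intro AE_I2)
        fix x
        have "(cmod (ift (low_pass N (v n)) x - ift (low_pass N g) x))\<^sup>2 * (d x)\<^sup>2 \<le> M\<^sup>2 * (d x)\<^sup>2"
          by (intro mult_right_mono power_mono Mb) auto
        then show "norm ((cmod (of_real (d x) * (ift (low_pass N (v n)) x - ift (low_pass N g) x)))\<^sup>2) \<le> M\<^sup>2 * (d x)\<^sup>2"
          by (simp add: norm_mult power_mult_distrib mult.commute)
      qed
    qed measurable
    then have "(\<lambda>n. sqrt ((mid N n)\<^sup>2)) \<longlonglongrightarrow> sqrt 0"
      unfolding mid_def norm_abs_l2_square[OF sm] by (intro tendsto_real_sqrt) simp
    then show ?thesis by (simp add: mid_def)
  qed
  \<comment> \<open>High frequencies of the sequence, difference of the low-frequency parts, high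
    frequencies of the limit. The outer terms are small uniformly in n, so N is fixed before
    n.\<close>
  have main: "norm (abs_l2 (\<lambda>x. (Re (ift (v n) x) - U x) * d x))
      \<le> B * ?K * (\<rho> / sqrt ((1 + (real N)\<^sup>2) powr s)) + mid N n + B * ?K * tail N g" for N n
  proof -
    let ?a = "\<lambda>x. ift (v n) x - ift (low_pass N (v n)) x" and ?b = "\<lambda>x. ift (low_pass N (v n)) x - ift (low_pass N g) x"
      and ?c = "\<lambda>x. complex_of_real (U x) - ift (low_pass N g) x" and ?d = "\<lambda>x. complex_of_real (d x)"
    have sa: "sq_integrable lborel ?a" and sb: "sq_integrable lborel ?b" and sc: "sq_integrable lborel ?c"
      by (intro sq_integrable_diff sq_integrable_ift(1) v scv icv scg icg sU)+
    have S: "sq_integrable lborel (\<lambda>x. ?d x * (ift (v n) x - of_real (U x)))"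
      by (intro sd sq_integrable_diff sq_integrable_ift(1) v sU)
    have "norm (abs_l2 (\<lambda>x. (Re (ift (v n) x) - U x) * d x)) \<le> 1 * norm (abs_l2 (\<lambda>x. ?d x * (ift (v n) x - of_real (U x))))"
    proof (rule norm_abs_l2_mono[OF _ S])
      have le: "norm ((Re (ift (v n) x) - U x) * d x) \<le> 1 * cmod (?d x * (ift (v n) x - of_real (U x)))" for x
        using abs_Re_le_cmod[of "ift (v n) x - of_real (U x)"]
        by (simp add: abs_mult norm_mult mult.commute mult_left_mono)
      then show "norm ((Re (ift (v n) x) - U x) * d x) \<le> 1 * cmod (?d x * (ift (v n) x - of_real (U x)))" for x .
      show "sq_integrable lborel (\<lambda>x. (Re (ift (v n) x) - U x) * d x)"
        by (rule sq_integrable_bound[OF S _ le]) measurable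
    qed simp
    also have "(\<lambda>x. ?d x * (ift (v n) x - of_real (U x))) = (\<lambda>x. (?d x * ?a x + ?d x * ?b x) - ?d x * ?c x)"
      by (auto simp: algebra_simps)
    also have "abs_l2 \<dots> = (abs_l2 (\<lambda>x. ?d x * ?a x) + abs_l2 (\<lambda>x. ?d x * ?b x)) - abs_l2 (\<lambda>x. ?d x * ?c x)"
      by (simp add: add_abs_l2 diff_abs_l2 sd(1)[OF sa] sd(1)[OF sb] sd(1)[OF sc] sq_integrable_add)
    also have "1 * norm \<dots> \<le> norm (abs_l2 (\<lambda>x. ?d x * ?a x)) + mid N n + norm (abs_l2 (\<lambda>x. ?d x * ?c x))"
      unfolding mid_def mult_1
      using norm_triangle_ineq4[of "abs_l2 (\<lambda>x. ?d x * ?a x) + abs_l2 (\<lambda>x. ?d x * ?b x)" "abs_l2 (\<lambda>x. ?d x * ?c x)"]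
        norm_triangle_ineq[of "abs_l2 (\<lambda>x. ?d x * ?a x)" "abs_l2 (\<lambda>x. ?d x * ?b x)"] by linarith
    also have "norm (abs_l2 (\<lambda>x. ?d x * ?a x)) \<le> B * ?K * (\<rho> / sqrt ((1 + (real N)\<^sup>2) powr s))"
    proof -
      have "norm (abs_l2 ?a) = norm (abs_l2 (ift (\<lambda>\<xi>. v n \<xi> - low_pass N (v n) \<xi>)))"
        by (simp only: ift_diff_fun[OF v(1) icv])
      also have "\<dots> \<le> ?K * tail N (v n)"
        unfolding tail_def by (intro sq_integrable_ift Bochner_Integration.integrable_diff sq_integrable_diff v icv scv)
      also have "\<dots> \<le> ?K * (\<rho> / sqrt ((1 + (real N)\<^sup>2) powr s))" using K by (intro mult_left_mono tailv) auto
      finally have "B * norm (abs_l2 ?a) \<le> B * (?K * (\<rho> / sqrt ((1 + (real N)\<^sup>2) powr s)))" using B by (intro mult_left_mono)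
      then show ?thesis using sd(2)[OF sa] by (simp only: mult.assoc)
    qed
    also have "norm (abs_l2 (\<lambda>x. ?d x * ?c x)) \<le> B * ?K * tail N g"
    proof -
      have "B * norm (abs_l2 ?c) \<le> B * (?K * tail N g)"
        using B U by (intro mult_left_mono) (auto simp: inverse_transform_def)
      then show ?thesis using sd(2)[OF sc] by (simp only: mult.assoc)
    qed
    finally show ?thesis by simp
  qed
  have hi: "(\<lambda>N. B * ?K * (\<rho> / sqrt ((1 + (real N)\<^sup>2) powr s)) + B * ?K * tail N g) \<longlonglongrightarrow> 0"
  proof -
    have "filterlim (\<lambda>N. 1 + (real N)\<^sup>2) at_top sequentially"
      by (intro filterlim_tendsto_add_at_top[OF tendsto_const] filterlim_pow_at_top filterlim_real_sequentially) simp
    then have "(\<lambda>N. (1 + (real N)\<^sup>2) powr (- (s / 2))) \<longlonglongrightarrow> 0"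
      using s by (intro tendsto_neg_powr) auto
    moreover have "\<rho> / sqrt ((1 + (real N)\<^sup>2) powr s) = \<rho> * (1 + (real N)\<^sup>2) powr (- (s / 2))" for N
    proof -
      have "sqrt ((1 + (real N)\<^sup>2) powr s) = ((1 + (real N)\<^sup>2) powr s) powr (1/2)"
        by (rule powr_half_sqrt[symmetric]) simp
      also have "\<dots> = (1 + (real N)\<^sup>2) powr (s / 2)" by (simp only: powr_powr) simp
      finally show ?thesis by (simp only: powr_minus_divide times_divide_eq_right mult_1_right)
    qed
    ultimately have "(\<lambda>N. \<rho> / sqrt ((1 + (real N)\<^sup>2) powr s)) \<longlonglongrightarrow> 0"
      by (simp only:) (rule tendsto_mult_right_zero)
    from tendsto_add[OF tendsto_mult_right_zero[OF this, of "B * ?K"] tendsto_mult_right_zero[OF tail_tendsto[OF g], of "B * ?K"]]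
    show ?thesis by simp
  qed
  show ?thesis
  proof (rule LIMSEQ_I)
    fix e :: real assume e: "e > 0"
    obtain N where N: "\<bar>B * ?K * (\<rho> / sqrt ((1 + (real N)\<^sup>2) powr s)) + B * ?K * tail N g\<bar> < e / 2"
      using LIMSEQ_D[OF hi, of "e / 2"] e by auto
    obtain n0 where n0: "\<And>n. n \<ge> n0 \<Longrightarrow> \<bar>mid N n\<bar> < e / 2"
      using LIMSEQ_D[OF mid0[of N], of "e / 2"] e by auto
    have "norm (norm (abs_l2 (\<lambda>x. (Re (ift (v n) x) - U x) * d x)) - 0) < e" if "n \<ge> n0" for n
    proof -
      have "x < e" if "x \<le> a + m + b" "\<bar>a + b\<bar> < e / 2" "\<bar>m\<bar> < e / 2" for x a m b :: real
        using that by linarith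
      from this[OF main N n0[OF that]] show ?thesis by simp
    qed
    then show "\<exists>no. \<forall>n\<ge>no. norm (norm (abs_l2 (\<lambda>x. (Re (ift (v n) x) - U x) * d x)) - 0) < e" by blast
  qed
qed

text \<open>The identity pq - UV = (p - U) q + U (q - V) lets the weight \<open>d\<close> go with
  the factor that converges, while the other one is merely bounded in norm.\<close>

lemma product_convergence:
  fixes p q :: "nat \<Rightarrow> 'a::euclidean_space \<Rightarrow> real"
  assumes p: "\<And>n. sq_integrable lborel (p n)" and q: "\<And>n. sq_integrable lborel (q n)" "\<And>n. norm (abs_l2 (q n)) \<le> C"
    and U: "sq_integrable lborel U" and V: "sq_integrable lborel V"
    and d: "d \<in> borel_measurable borel" "\<And>x. \<bar>d x\<bar> \<le> B"
    and pU: "(\<lambda>n. norm (abs_l2 (\<lambda>x. (p n x - U x) * d x))) \<longlonglongrightarrow> 0"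
    and qV: "(\<lambda>n. norm (abs_l2 (\<lambda>x. (q n x - V x) * d x))) \<longlonglongrightarrow> 0"
  shows "(\<lambda>n. LINT x|lborel. p n x * q n x * d x) \<longlonglongrightarrow> (LINT x|lborel. U x * V x * d x)"
proof -
  have sd: "sq_integrable lborel (\<lambda>x. f x * d x)" if f: "sq_integrable lborel f" for f :: "'a \<Rightarrow> real"
    using d sq_integrable_measurable[OF f]
    by (intro sq_integrable_bound[OF f, of _ B]) (auto simp: abs_mult mult.commute intro: mult_right_mono)
  have S: "sq_integrable lborel (\<lambda>x. (p n x - U x) * d x)" "sq_integrable lborel (\<lambda>x. (q n x - V x) * d x)" for n
    by (intro sd sq_integrable_diff p q U V)+
  have "(\<lambda>n. (LINT x|lborel. p n x * q n x * d x) - (LINT x|lborel. U x * V x * d x)) \<longlonglongrightarrow> 0"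
  proof (rule Lim_null_comparison)
    show "(\<lambda>n. norm (abs_l2 (\<lambda>x. (p n x - U x) * d x)) * C + norm (abs_l2 U) * norm (abs_l2 (\<lambda>x. (q n x - V x) * d x))) \<longlonglongrightarrow> 0"
      using tendsto_add[OF tendsto_mult_left_zero[OF pU, of C] tendsto_mult_right_zero[OF qV, of "norm (abs_l2 U)"]] by simp
    show "\<forall>\<^sub>F n in sequentially. norm ((LINT x|lborel. p n x * q n x * d x) - (LINT x|lborel. U x * V x * d x))
      \<le> norm (abs_l2 (\<lambda>x. (p n x - U x) * d x)) * C + norm (abs_l2 U) * norm (abs_l2 (\<lambda>x. (q n x - V x) * d x))"
    proof (intro always_eventually allI)
      fix n
      have i: "integrable lborel (\<lambda>x. p n x * q n x * d x)" "integrable lborel (\<lambda>x. U x * V x * d x)"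
        using sq_integrable_inner[OF p sd[OF q(1)]] sq_integrable_inner[OF U sd[OF V]] by (simp_all add: mult.assoc)
      have j: "integrable lborel (\<lambda>x. ((p n x - U x) * d x) * q n x)" "integrable lborel (\<lambda>x. U x * ((q n x - V x) * d x))"
        using sq_integrable_inner[OF S(1) q(1)] sq_integrable_inner[OF U S(2)] by simp_all
      have "(LINT x|lborel. p n x * q n x * d x) - (LINT x|lborel. U x * V x * d x)
        = (LINT x|lborel. ((p n x - U x) * d x) * q n x + U x * ((q n x - V x) * d x))"
        by (subst Bochner_Integration.integral_diff[symmetric, OF i]) (simp add: algebra_simps)
      also have "\<dots> = abs_l2 (\<lambda>x. (p n x - U x) * d x) \<bullet> abs_l2 (q n) + abs_l2 U \<bullet> abs_l2 (\<lambda>x. (q n x - V x) * d x)"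
        by (subst Bochner_Integration.integral_add[OF j]) (simp add: inner_abs_l2 S q U)
      also have "norm \<dots> \<le> norm (abs_l2 (\<lambda>x. (p n x - U x) * d x)) * norm (abs_l2 (q n)) + norm (abs_l2 U) * norm (abs_l2 (\<lambda>x. (q n x - V x) * d x))"
        unfolding real_norm_def
        by (intro order_trans[OF abs_triangle_ineq] add_mono Cauchy_Schwarz_ineq2)
      also have "\<dots> \<le> norm (abs_l2 (\<lambda>x. (p n x - U x) * d x)) * C + norm (abs_l2 U) * norm (abs_l2 (\<lambda>x. (q n x - V x) * d x))"
        by (intro add_right_mono mult_left_mono q) auto
      finally show "norm ((LINT x|lborel. p n x * q n x * d x) - (LINT x|lborel. U x * V x * d x))
        \<le> norm (abs_l2 (\<lambda>x. (p n x - U x) * d x)) * C + norm (abs_l2 U) * norm (abs_l2 (\<lambda>x. (q n x - V x) * d x))" .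
    qed
  qed
  from tendsto_add[OF this tendsto_const[of "LINT x|lborel. U x * V x * d x"]] show ?thesis by simp
qed

section \<open>Vector-valued functions, weighted norms and comparison of symbols\<close>

lemma measurable_vec3I:
  fixes f :: "'a \<Rightarrow> complex^3"
  assumes "\<And>j. (\<lambda>x. f x $ j) \<in> borel_measurable M" shows "f \<in> borel_measurable M"
proof (rule borel_measurable_euclidean_space[THEN iffD2], rule ballI)
  fix b :: "complex^3" assume "b \<in> Basis"
  then obtain j u where "b = axis j u" by (auto simp: Basis_vec_def)
  then show "(\<lambda>x. f x \<bullet> b) \<in> borel_measurable M" using assms[of j] by (simp add: inner_axis)
qed

lemma measurable_vec3_nth:
  fixes f :: "'a \<Rightarrow> complex^3"
  assumes "f \<in> borel_measurable M" shows "(\<lambda>x. f x $ j) \<in> borel_measurable M"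
  using measurable_compose[OF assms borel_measurable_continuous_onI[OF
      linear_continuous_on[OF bounded_linear_vec_nth[of j]]]] by simp

lemma sq_integrable_vec3I:
  fixes f :: "'a \<Rightarrow> complex^3"
  assumes "\<And>j. sq_integrable M (\<lambda>x. f x $ j)" shows "sq_integrable M f"
proof -
  have "(norm (f x))\<^sup>2 = (\<Sum>j\<in>UNIV. (norm (f x $ j))\<^sup>2)" for x
    unfolding power2_norm_eq_inner inner_vec_def by simp
  then show ?thesis
    using assms by (auto simp: sq_integrable_def intro: measurable_vec3I)
qed

lemma sq_integrable_vec3_nth:
  fixes f :: "'a \<Rightarrow> complex^3"
  assumes "sq_integrable M f" shows "sq_integrable M (\<lambda>x. f x $ j)"
  by (rule sq_integrable_bound[OF assms, of _ 1])
     (auto intro: measurable_vec3_nth sq_integrable_measurable assms Finite_Cartesian_Product.norm_nth_le)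

lemma sq_integrable_unweighted:
  fixes a :: "real^3 \<Rightarrow> complex^3"
  assumes a: "sq_integrable lborel (\<lambda>\<xi>. m \<xi> *\<^sub>R a \<xi>)" and m: "m \<in> borel_measurable borel" "\<And>\<xi>. m \<xi> \<ge> 1"
  shows "sq_integrable lborel (\<lambda>\<xi>. a \<xi> $ j)"
proof (rule sq_integrable_bound[OF a, of _ 1])
  have "(\<lambda>\<xi>. inverse (m \<xi>) *\<^sub>R m \<xi> *\<^sub>R a \<xi>) \<in> borel_measurable lborel"
    by (intro borel_measurable_scaleR sq_integrable_measurable[OF a]) (use m in simp)
  moreover have "(\<lambda>\<xi>. inverse (m \<xi>) *\<^sub>R m \<xi> *\<^sub>R a \<xi>) = a"
  proof
    show "inverse (m \<xi>) *\<^sub>R m \<xi> *\<^sub>R a \<xi> = a \<xi>" for \<xi> using m(2)[of \<xi>] by simp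
  qed
  ultimately show "(\<lambda>\<xi>. a \<xi> $ j) \<in> borel_measurable lborel" by (simp add: measurable_vec3_nth)
  show "cmod (a \<xi> $ j) \<le> 1 * norm (m \<xi> *\<^sub>R a \<xi>)" for \<xi>
    using m(2)[of \<xi>] mult_right_mono[of 1 "m \<xi>" "norm (a \<xi>)"] Finite_Cartesian_Product.norm_nth_le[of "a \<xi>" j] by simp
qed

lemma inner_vec3_complex: "(v :: complex^3) \<bullet> h = Re (\<Sum>j\<in>UNIV. v $ j * cnj (h $ j))"
  by (simp add: inner_vec_def inner_complex_def)

lemma moderate_sqrt: assumes "moderate m" "\<And>x. m x \<ge> 0" shows "moderate (\<lambda>x. sqrt (m x))"
proof -
  obtain C N where C: "\<And>x. \<bar>m x\<bar> \<le> C * (1 + norm x) ^ N" using assms(1) by (auto simp: moderate_def)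
  show ?thesis
  proof (rule moderateI)
    show "(\<lambda>x. sqrt (m x)) \<in> borel_measurable borel" using moderate_measurable[OF assms(1)] by simp
    fix x :: "real^3"
    have "sqrt (m x) \<le> 1 + m x"
      using assms(2)[of x] by (intro real_le_lsqrt) (auto simp: power2_eq_square algebra_simps)
    also have "\<dots> \<le> 1 * (1 + norm x) ^ N + C * (1 + norm x) ^ N"
      using C[of x] by (intro add_mono) auto
    finally show "\<bar>sqrt (m x)\<bar> \<le> (1 + C) * (1 + norm x) ^ N"
      using assms(2)[of x] by (simp add: distrib_right)
  qed
qed

text \<open>All weighted spaces are realised inside one Hilbert space by multiplying the field by
  the weight; weak compactness is then needed for a single type.\<close>

definition weighted :: "(real^3 \<Rightarrow> real) \<Rightarrow> (real^3 \<Rightarrow> complex^3) \<Rightarrow> (real^3, complex^3) l2" where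
  "weighted m v = abs_l2 (\<lambda>\<xi>. m \<xi> *\<^sub>R v \<xi>)"

lemma rapid_sq_integrable: "rapid g \<Longrightarrow> sq_integrable lborel g"
  using rapid_measurable rapid_square_integrable by (auto simp: sq_integrable_def)

lemma sq_integrable_weighted:
  assumes "moderate m" "admissible v" shows "sq_integrable lborel (\<lambda>\<xi>. m \<xi> *\<^sub>R v \<xi>)"
proof (rule sq_integrable_vec3I)
  fix j
  have "(\<lambda>\<xi>. (m \<xi> *\<^sub>R v \<xi>) $ j) = (\<lambda>\<xi>. of_real (m \<xi>) * v \<xi> $ j)"
    by (simp add: vector_scaleR_component) (simp add: scaleR_conv_of_real)
  then show "sq_integrable lborel (\<lambda>\<xi>. (m \<xi> *\<^sub>R v \<xi>) $ j)"
    using rapid_sq_integrable[OF rapid_moderate[OF admissible_rapid[OF assms(2)] assms(1)]] by simp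
qed

lemma weighted_sum:
  assumes "moderate m" "finite I" "\<And>i. i \<in> I \<Longrightarrow> admissible (e i)"
  shows "weighted m (\<lambda>\<xi>. \<Sum>i\<in>I. c i *\<^sub>R e i \<xi>) = (\<Sum>i\<in>I. c i *\<^sub>R weighted m (e i))"
proof -
  note s = sq_integrable_weighted[OF assms(1) assms(3)]
  have "(\<Sum>i\<in>I. c i *\<^sub>R weighted m (e i)) = (\<Sum>i\<in>I. abs_l2 (\<lambda>\<xi>. c i *\<^sub>R m \<xi> *\<^sub>R e i \<xi>))"
    unfolding weighted_def by (intro sum.cong refl scaleR_abs_l2 s)
  also have "\<dots> = abs_l2 (\<lambda>\<xi>. \<Sum>i\<in>I. c i *\<^sub>R m \<xi> *\<^sub>R e i \<xi>)"
    by (rule sum_abs_l2(2)[OF assms(2)]) (intro sq_integrable_scaleR s)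
  also have "(\<lambda>\<xi>. \<Sum>i\<in>I. c i *\<^sub>R m \<xi> *\<^sub>R e i \<xi>) = (\<lambda>\<xi>. m \<xi> *\<^sub>R (\<Sum>i\<in>I. c i *\<^sub>R e i \<xi>))"
    by (simp add: scaleR_sum_right mult.commute)
  finally show ?thesis unfolding weighted_def ..
qed

text \<open>With s = \<beta>/2 this is the origin of the constants a and b. For d \<le> 1 the
  quantity 1 + d^2 r^2 lies between d^2 (1 + r^2) and 1 + r^2, and for d > 1 the two bounds change
  places.\<close>

lemma one_plus_square_le:
  fixes r d s :: real
  assumes "d > 0" "s \<ge> 0"
  shows "min 1 (d powr (2 * s)) * (1 + r\<^sup>2) powr s \<le> (1 + d\<^sup>2 * r\<^sup>2) powr s"
    and "(1 + d\<^sup>2 * r\<^sup>2) powr s \<le> max 1 (d powr (2 * s)) * (1 + r\<^sup>2) powr s"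
proof -
  have p: "1 + r\<^sup>2 > 0" "1 + d\<^sup>2 * r\<^sup>2 > 0" by (auto intro: add_pos_nonneg)
  have d2: "d powr (2 * s) * (1 + r\<^sup>2) powr s = (d\<^sup>2 + d\<^sup>2 * r\<^sup>2) powr s"
  proof -
    have "d powr (2 * s) = (d\<^sup>2) powr s" using assms by (simp add: powr_powr flip: powr_numeral)
    then show ?thesis using p by (simp add: powr_mult[symmetric] distrib_left)
  qed
  show "min 1 (d powr (2 * s)) * (1 + r\<^sup>2) powr s \<le> (1 + d\<^sup>2 * r\<^sup>2) powr s"
  proof (cases "d \<le> 1")
    case True
    then have "d\<^sup>2 \<le> 1" using assms by (simp add: power_le_one)
    then have "(d\<^sup>2 + d\<^sup>2 * r\<^sup>2) powr s \<le> (1 + d\<^sup>2 * r\<^sup>2) powr s" using assms p by (intro powr_mono2) auto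
    moreover have "min 1 (d powr (2 * s)) * (1 + r\<^sup>2) powr s \<le> d powr (2 * s) * (1 + r\<^sup>2) powr s"
      by (intro mult_right_mono) auto
    ultimately show ?thesis using d2 by linarith
  next
    case False
    then have "1 * r\<^sup>2 \<le> d\<^sup>2 * r\<^sup>2" by (intro mult_right_mono) (auto simp: one_le_power)
    then have "(1 + r\<^sup>2) powr s \<le> (1 + d\<^sup>2 * r\<^sup>2) powr s" using assms p by (intro powr_mono2) auto
    moreover have "min 1 (d powr (2 * s)) * (1 + r\<^sup>2) powr s \<le> 1 * (1 + r\<^sup>2) powr s"
      by (intro mult_right_mono) auto
    ultimately show ?thesis by linarith
  qed
  show "(1 + d\<^sup>2 * r\<^sup>2) powr s \<le> max 1 (d powr (2 * s)) * (1 + r\<^sup>2) powr s"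
  proof (cases "d \<le> 1")
    case True
    then have "d\<^sup>2 * r\<^sup>2 \<le> 1 * r\<^sup>2" using assms by (intro mult_right_mono) (auto simp: power_le_one)
    then have "(1 + d\<^sup>2 * r\<^sup>2) powr s \<le> (1 + r\<^sup>2) powr s" using assms p by (intro powr_mono2) auto
    moreover have "1 * (1 + r\<^sup>2) powr s \<le> max 1 (d powr (2 * s)) * (1 + r\<^sup>2) powr s"
      by (intro mult_right_mono) auto
    ultimately show ?thesis by linarith
  next
    case False
    then have "1 \<le> d\<^sup>2" by (simp add: one_le_power)
    then have "(1 + d\<^sup>2 * r\<^sup>2) powr s \<le> (d\<^sup>2 + d\<^sup>2 * r\<^sup>2) powr s" using assms p by (intro powr_mono2) auto
    moreover have "d powr (2 * s) * (1 + r\<^sup>2) powr s \<le> max 1 (d powr (2 * s)) * (1 + r\<^sup>2) powr s"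
      by (intro mult_right_mono) auto
    ultimately show ?thesis using d2 by linarith
  qed
qed

text \<open>From 1 + r^2 \<le> 2 max(1, r)^2 the quotient is at least 2^(-\<alpha>/2); the same
  bound makes the infimum positive and guarantees that it is a lower bound.\<close>

lemma m_const:
  assumes "\<alpha> > 0"
  shows "m_const \<alpha> > 0" "m_const \<alpha> * (1 + (norm (\<xi>::real^3))\<^sup>2) powr (\<alpha> / 2) \<le> 1 + norm \<xi> powr \<alpha>"
proof -
  let ?q = "\<lambda>\<xi>::real^3. (1 + norm \<xi> powr \<alpha>) / (1 + (norm \<xi>)\<^sup>2) powr (\<alpha> / 2)"
  have p: "(1 + (norm \<xi>)\<^sup>2) powr (\<alpha> / 2) > 0" for \<xi> :: "real^3" by (simp add: add_nonneg_eq_0_iff)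
  have lower: "2 powr (- (\<alpha> / 2)) \<le> ?q \<xi>" for \<xi> :: "real^3"
  proof -
    let ?M = "max 1 (norm \<xi>)"
    have "(1 + (norm \<xi>)\<^sup>2) powr (\<alpha> / 2) \<le> (2 * ?M\<^sup>2) powr (\<alpha> / 2)"
      using assms by (intro powr_mono2) (auto simp: max_def power_le_one one_le_power)
    also have "\<dots> = 2 powr (\<alpha> / 2) * ?M powr \<alpha>"
    proof -
      have "(?M\<^sup>2) powr (\<alpha> / 2) = ?M powr \<alpha>" by (simp add: powr_powr flip: powr_numeral)
      then show ?thesis by (simp add: powr_mult)
    qed
    also have "\<dots> \<le> 2 powr (\<alpha> / 2) * (1 + norm \<xi> powr \<alpha>)"
      by (intro mult_left_mono) (auto simp: max_def)
    finally have "2 powr (- (\<alpha> / 2)) * (1 + (norm \<xi>)\<^sup>2) powr (\<alpha> / 2) \<le> 1 + norm \<xi> powr \<alpha>"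
      by (simp add: powr_minus field_simps)
    then show ?thesis using p[of \<xi>] by (simp add: pos_le_divide_eq)
  qed
  have "2 powr (- (\<alpha> / 2)) \<le> m_const \<alpha>"
    unfolding m_const_def by (rule cINF_greatest) (use lower in auto)
  then show "m_const \<alpha> > 0" by (rule less_le_trans[rotated]) simp
  have "m_const \<alpha> \<le> ?q \<xi>"
    unfolding m_const_def by (rule cINF_lower) (use lower in \<open>auto intro!: bdd_belowI2\<close>)
  then show "m_const \<alpha> * (1 + (norm \<xi>)\<^sup>2) powr (\<alpha> / 2) \<le> 1 + norm \<xi> powr \<alpha>"
    using p[of \<xi>] by (simp add: pos_le_divide_eq)
qed

section \<open>Galerkin approximation of the stationary problem\<close>

text \<open>The force enters through its transform \<open>gf\<close>. The exponent \<beta>/4 occurs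
  because the Sobolev norm of order \<beta>/2 multiplies the transform by (1 +
  |\<xi>|^2)^(\<beta>/4).\<close>

locale stationary =
  fixes \<alpha> \<beta> \<gamma> \<delta> \<nu> :: real and gf :: "real^3 \<Rightarrow> complex^3"
  assumes \<alpha>: "\<alpha> > 0" and \<beta>: "\<beta> \<ge> 0" and \<gamma>: "\<gamma> > 0" and \<delta>: "\<delta> > 0" and \<nu>: "\<nu> > 0"
    and gf: "sq_integrable lborel (\<lambda>\<xi>. (1 + (norm \<xi>)\<^sup>2) powr (\<beta> / 4) *\<^sub>R gf \<xi>)"
begin

text \<open>Here \<open>w\<close> is the symbol of the operator applied to the equation,
  \<open>W\<close> the symbol of the linear part afterwards and \<open>h\<close> the weight of the
  norm of order (\<alpha> + \<beta>)/2. The constant \<open>\<kappa>\<close> is the product a c, and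
  \<open>\<rho>\<close> is the claimed bound before the normalising factor (2 pi)^(-3/2).\<close>

definition w :: "real^3 \<Rightarrow> real" where "w \<xi> = (1 + \<delta>\<^sup>2 * (norm \<xi>)\<^sup>2) powr (\<beta> / 2)"
definition W :: "real^3 \<Rightarrow> real" where "W \<xi> = w \<xi> * (\<nu> * norm \<xi> powr \<alpha> + \<gamma>)"
definition h :: "real^3 \<Rightarrow> real" where "h \<xi> = (1 + (norm \<xi>)\<^sup>2) powr ((\<alpha> + \<beta>) / 4)"
definition \<kappa> :: real where "\<kappa> = min 1 (\<delta> powr \<beta>) * (m_const \<alpha> * min \<gamma> \<nu>)"
definition load :: "(real^3, complex^3) l2" where "load = abs_l2 (\<lambda>\<xi>. (1 + (norm \<xi>)\<^sup>2) powr (\<beta> / 4) *\<^sub>R gf \<xi>)"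
definition \<rho> :: real where "\<rho> = max 1 (\<delta> powr \<beta>) / \<kappa> * norm load"

lemma bp: "1 + (norm \<xi>)\<^sup>2 > (0::real)" by (simp add: add_pos_nonneg)

lemma w_pos: "w \<xi> > 0"
  unfolding w_def by (simp add: add_nonneg_eq_0_iff)

lemma W_pos: "W \<xi> > 0"
  unfolding W_def using w_pos \<gamma> \<nu> by (intro mult_pos_pos add_nonneg_pos) auto

lemma h_pos: "h \<xi> > 0"
  unfolding h_def by (simp add: add_nonneg_eq_0_iff)

lemma \<kappa>_pos: "\<kappa> > 0"
  unfolding \<kappa>_def using m_const(1)[OF \<alpha>] \<gamma> \<nu> \<delta> by simp

lemma h_square: "(h \<xi>)\<^sup>2 = (1 + (norm \<xi>)\<^sup>2) powr ((\<alpha> + \<beta>) / 2)"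
proof -
  have "(h \<xi>)\<^sup>2 = h \<xi> * h \<xi>" by (rule power2_eq_square)
  also have "\<dots> = (1 + (norm \<xi>)\<^sup>2) powr ((\<alpha> + \<beta>) / 4 + (\<alpha> + \<beta>) / 4)" unfolding h_def powr_add ..
  finally show ?thesis by simp
qed

text \<open>Coercivity with the exact constant: the factor \<open>w\<close> contributes a, and \<nu>
  |\<xi>|^\<alpha> + \<gamma> \<ge> min(\<gamma>, \<nu>) (1 + |\<xi>|^\<alpha>) contributes
  c.\<close>

lemma W_lower: "\<kappa> * (h \<xi>)\<^sup>2 \<le> W \<xi>"
proof -
  have 1: "min 1 (\<delta> powr \<beta>) * (1 + (norm \<xi>)\<^sup>2) powr (\<beta> / 2) \<le> w \<xi>"
    using one_plus_square_le(1)[OF \<delta>, of "\<beta> / 2" "norm \<xi>"] \<beta> by (simp add: w_def)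
  have "m_const \<alpha> * min \<gamma> \<nu> * (1 + (norm \<xi>)\<^sup>2) powr (\<alpha> / 2) \<le> min \<gamma> \<nu> * (1 + norm \<xi> powr \<alpha>)"
    using mult_left_mono[OF m_const(2)[OF \<alpha>, of \<xi>], of "min \<gamma> \<nu>"] \<gamma> \<nu> by (simp add: mult_ac)
  also have "\<dots> \<le> \<nu> * norm \<xi> powr \<alpha> + \<gamma>"
    using mult_right_mono[of "min \<gamma> \<nu>" \<nu> "norm \<xi> powr \<alpha>"] by (simp add: distrib_left)
  finally have 2: "m_const \<alpha> * min \<gamma> \<nu> * (1 + (norm \<xi>)\<^sup>2) powr (\<alpha> / 2) \<le> \<nu> * norm \<xi> powr \<alpha> + \<gamma>" .
  have "(min 1 (\<delta> powr \<beta>) * (1 + (norm \<xi>)\<^sup>2) powr (\<beta> / 2)) * (m_const \<alpha> * min \<gamma> \<nu> * (1 + (norm \<xi>)\<^sup>2) powr (\<alpha> / 2)) \<le> W \<xi>"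
    unfolding W_def using w_pos[of \<xi>] m_const(1)[OF \<alpha>] \<gamma> \<nu>
    by (intro mult_mono 1 2) (auto intro: less_imp_le)
  moreover have "(h \<xi>)\<^sup>2 = (1 + (norm \<xi>)\<^sup>2) powr (\<beta> / 2) * (1 + (norm \<xi>)\<^sup>2) powr (\<alpha> / 2)"
    unfolding h_square by (simp add: powr_add[symmetric] add_divide_distrib add.commute)
  ultimately show ?thesis by (simp add: \<kappa>_def mult_ac)
qed

text \<open>Of the weight \<open>w\<close> in the force term the load absorbs the exponent
  \<beta>/4; the rest on the test field is at most b times the weight of exponent \<beta>/4, and
  this is below \<open>h\<close> as \<alpha> > 0.\<close>

lemma load_weight_le: "w \<xi> * (1 + (norm \<xi>)\<^sup>2) powr (- (\<beta> / 4)) \<le> max 1 (\<delta> powr \<beta>) * h \<xi>"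
proof -
  let ?b = "max 1 (\<delta> powr \<beta>)" and ?p = "1 + (norm \<xi>)\<^sup>2"
  have "w \<xi> \<le> ?b * ?p powr (\<beta> / 2)"
    using one_plus_square_le(2)[OF \<delta>, of "\<beta> / 2" "norm \<xi>"] \<beta> by (simp add: w_def)
  then have "w \<xi> * ?p powr (- (\<beta> / 4)) \<le> ?b * ?p powr (\<beta> / 2) * ?p powr (- (\<beta> / 4))" by (intro mult_right_mono) auto
  also have "\<dots> = ?b * ?p powr (\<beta> / 4)" by (simp add: mult.assoc flip: powr_add)
  also have "\<dots> \<le> ?b * h \<xi>"
    unfolding h_def using \<alpha> by (intro mult_left_mono powr_mono) auto
  finally show ?thesis .
qed

lemma moderate_one_plus_powr: "moderate (\<lambda>\<xi>. (1 + (norm \<xi>)\<^sup>2) powr s)"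
  using moderate_bessel[of 1 s] by simp

lemma moderate_w: "moderate w"
  unfolding w_def by (rule moderate_bessel)

lemma moderate_W: "moderate W"
  unfolding W_def using \<alpha> by (intro moderate_mult moderate_w moderate_add moderate_const moderate_norm_powr) simp

lemma moderate_h: "moderate h"
  unfolding h_def by (rule moderate_one_plus_powr)

lemma moderate_sqrt_W: "moderate (\<lambda>\<xi>. sqrt (W \<xi>))"
  using W_pos by (intro moderate_sqrt moderate_W) (auto intro: less_imp_le)

lemma moderate_load_weight: "moderate (\<lambda>\<xi>. w \<xi> * (1 + (norm \<xi>)\<^sup>2) powr (- (\<beta> / 4)))"
  by (intro moderate_mult moderate_w moderate_one_plus_powr)

definition energy :: "(real^3 \<Rightarrow> complex^3) \<Rightarrow> (real^3 \<Rightarrow> complex^3) \<Rightarrow> real" where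
  "energy u v = (LINT \<xi>|lborel. W \<xi> * (u \<xi> \<bullet> v \<xi>))"

definition force :: "(real^3 \<Rightarrow> complex^3) \<Rightarrow> real" where
  "force v = (LINT \<xi>|lborel. w \<xi> * (gf \<xi> \<bullet> v \<xi>))"

lemma energy_eq: "admissible u \<Longrightarrow> admissible v \<Longrightarrow>
    energy u v = weighted (\<lambda>\<xi>. sqrt (W \<xi>)) u \<bullet> weighted (\<lambda>\<xi>. sqrt (W \<xi>)) v"
  using W_pos by (simp add: energy_def weighted_def inner_abs_l2 sq_integrable_weighted moderate_sqrt_W
      less_imp_le flip: mult.assoc)

lemma force_eq: "admissible v \<Longrightarrow> force v = load \<bullet> weighted (\<lambda>\<xi>. w \<xi> * (1 + (norm \<xi>)\<^sup>2) powr (- (\<beta> / 4))) v"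
proof -
  assume v: "admissible v"
  have "w \<xi> * (1 + (norm \<xi>)\<^sup>2) powr (- (\<beta> / 4)) * (1 + (norm \<xi>)\<^sup>2) powr (\<beta> / 4) = w \<xi>" for \<xi> :: "real^3"
    using bp[of \<xi>] by (simp add: powr_minus)
  then have "(1 + (norm \<xi>)\<^sup>2) powr (\<beta> / 4) *\<^sub>R gf \<xi> \<bullet> (w \<xi> * (1 + (norm \<xi>)\<^sup>2) powr (- (\<beta> / 4))) *\<^sub>R v \<xi> = w \<xi> * (gf \<xi> \<bullet> v \<xi>)" for \<xi>
    by (simp only: inner_scaleR_left inner_scaleR_right mult.assoc[symmetric])
  then show ?thesis
    unfolding load_def weighted_def force_def
    by (subst inner_abs_l2[OF gf sq_integrable_weighted[OF moderate_load_weight v]]) (simp only:)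
qed

text \<open>The field with transform \<open>v\<close> is \<open>phys v / c0\<close>. The two
  velocity factors of \<open>trilinear\<close> therefore bring the divisor \<open>c0^2\<close>,
  whereas the test field keeps its factor: Parseval's identity gives the same factor in the linear
  terms.\<close>

definition c0 :: real where "c0 = (2 * pi) ^ 3"

lemma c0_pos: "c0 > 0" by (simp add: c0_def)

text \<open>The unknown is a combination of the first n fields and equation l is tested with
  \<open>e l\<close>. The norm in which coercivity and the load are measured has weight
  \<open>h\<close>, and \<open>\<rho>\<close> is the quotient of the load constant by
  \<open>\<kappa>\<close>.\<close>

lemma galerkin_solution:
  fixes e :: "nat \<Rightarrow> real^3 \<Rightarrow> complex^3"
  assumes e: "\<And>l. admissible (e l)" and \<epsilon>: "\<epsilon> > 0"
  shows "\<exists>v. admissible v \<and> norm (weighted h v) \<le> \<rho> \<and>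
    (\<forall>l<n. \<bar>energy v (e l) - trilinear v v (e l) / c0\<^sup>2 - force (e l)\<bar> \<le> \<epsilon>)"
proof -
  define K where "K = max 1 (\<delta> powr \<beta>) * norm load"
  define v where "v c = (\<lambda>\<xi>. \<Sum>l<n. c l *\<^sub>R e l \<xi>)" for c
  let ?sW = "\<lambda>\<xi>. sqrt (W \<xi>)" and ?m = "\<lambda>\<xi>. w \<xi> * (1 + (norm \<xi>)\<^sup>2) powr (- (\<beta> / 4))"
  have adm: "admissible (v c)" for c unfolding v_def by (intro admissible_sum e) simp
  have sums: "weighted m (v c) = (\<Sum>l<n. c l *\<^sub>R weighted m (e l))" if "moderate m" for m c
    unfolding v_def by (intro weighted_sum that e) simp
  have E2: "energy (v c) (e l) = (\<Sum>m<n. c m * energy (e m) (e l))" for c l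
    by (simp add: energy_eq adm e sums[OF moderate_sqrt_W] inner_sum_left)
  have E1: "energy (v c) (v c) = (\<Sum>l<n. \<Sum>m<n. c l * c m * energy (e m) (e l))" for c
  proof -
    have "energy (v c) (v c) = (\<Sum>l<n. c l * energy (v c) (e l))"
      by (simp add: energy_eq adm e inner_sum_right sums[OF moderate_sqrt_W, of c])
    then show ?thesis by (simp add: E2 sum_distrib_left mult.assoc)
  qed
  have T: "trilinear (v c) (v c) (e l) = (\<Sum>m<n. \<Sum>p<n. c m * c p * trilinear (e m) (e p) (e l))" for c l
    unfolding v_def by (intro trilinear_sum e) simp
  have "\<exists>c. \<kappa> * norm (\<Sum>l<n. c l *\<^sub>R weighted h (e l)) \<le> K \<and>
    (\<forall>l<n. \<bar>(\<Sum>m<n. c m * energy (e m) (e l))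
       + (\<Sum>m<n. \<Sum>p<n. c m * c p * (- trilinear (e m) (e p) (e l) / c0\<^sup>2)) - force (e l)\<bar> \<le> \<epsilon>)"
  proof (rule galerkin_approximation[OF \<kappa>_pos \<epsilon>])
    show "K \<ge> 0" by (simp add: K_def)
    show "\<kappa> * (norm (\<Sum>l<n. c l *\<^sub>R weighted h (e l)))\<^sup>2 \<le> (\<Sum>l<n. \<Sum>m<n. c l * c m * energy (e m) (e l))" for c
    proof -
      have "\<kappa> * (norm (weighted h (v c)))\<^sup>2 = (LINT \<xi>|lborel. \<kappa> * (norm (h \<xi> *\<^sub>R v c \<xi>))\<^sup>2)"
        unfolding weighted_def by (simp add: norm_abs_l2_square sq_integrable_weighted moderate_h adm)
      also have "\<dots> \<le> (LINT \<xi>|lborel. (norm (?sW \<xi> *\<^sub>R v c \<xi>))\<^sup>2)"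
      proof (rule integral_mono)
        show "integrable lborel (\<lambda>\<xi>. \<kappa> * (norm (h \<xi> *\<^sub>R v c \<xi>))\<^sup>2)" "integrable lborel (\<lambda>\<xi>. (norm (?sW \<xi> *\<^sub>R v c \<xi>))\<^sup>2)"
          using sq_integrable_weighted[OF moderate_h adm] sq_integrable_weighted[OF moderate_sqrt_W adm]
          by (auto simp: sq_integrable_def)
        show "\<kappa> * (norm (h \<xi> *\<^sub>R v c \<xi>))\<^sup>2 \<le> (norm (?sW \<xi> *\<^sub>R v c \<xi>))\<^sup>2" for \<xi>
          using mult_right_mono[OF W_lower[of \<xi>], of "(norm (v c \<xi>))\<^sup>2"] W_pos[of \<xi>]
          by (simp add: power_mult_distrib mult.assoc less_imp_le)
      qed
      also have "\<dots> = energy (v c) (v c)"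
        by (simp add: energy_eq adm weighted_def norm_abs_l2_square sq_integrable_weighted moderate_sqrt_W flip: power2_norm_eq_inner)
      finally show ?thesis by (simp add: sums[OF moderate_h] E1)
    qed
    \<comment> \<open>Expanding \<open>trilinear_self\<close> for the combination in all three
      arguments; it holds for every coefficient vector because combinations of admissible fields are
      admissible.\<close>
    show "(\<Sum>l<n. \<Sum>m<n. \<Sum>p<n. c l * c m * c p * (- trilinear (e m) (e p) (e l) / c0\<^sup>2)) = 0" for c
    proof -
      have "0 = (\<Sum>l<n. c l * trilinear (v c) (v c) (e l))"
        using trilinear_self[OF adm[of c]] trilinear_sum_right[of "{..<n}" e "v c" "v c" c] e adm
        by (simp add: v_def)
      also have "\<dots> = (\<Sum>l<n. \<Sum>m<n. \<Sum>p<n. c l * c m * c p * trilinear (e m) (e p) (e l))"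
        by (simp add: T sum_distrib_left mult.assoc)
      finally have "(- 1 / c0\<^sup>2) * (\<Sum>l<n. \<Sum>m<n. \<Sum>p<n. c l * c m * c p * trilinear (e m) (e p) (e l)) = 0" by simp
      then show ?thesis by (simp only: sum_distrib_left) (simp add: mult_ac)
    qed
    show "(\<Sum>l<n. c l * force (e l)) \<le> K * norm (\<Sum>l<n. c l *\<^sub>R weighted h (e l))" for c
    proof -
      have "(\<Sum>l<n. c l * force (e l)) = load \<bullet> weighted ?m (v c)"
        by (simp add: force_eq e sums[OF moderate_load_weight] inner_sum_right)
      also have "\<dots> \<le> norm load * norm (weighted ?m (v c))" by (rule norm_cauchy_schwarz)
      also have "\<dots> \<le> norm load * (max 1 (\<delta> powr \<beta>) * norm (weighted h (v c)))"
        unfolding weighted_def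
      proof (rule mult_left_mono[OF _ norm_ge_zero])
        show "norm (abs_l2 (\<lambda>\<xi>. ?m \<xi> *\<^sub>R v c \<xi>)) \<le> max 1 (\<delta> powr \<beta>) * norm (abs_l2 (\<lambda>\<xi>. h \<xi> *\<^sub>R v c \<xi>))"
      proof (rule norm_abs_l2_mono[OF sq_integrable_weighted[OF moderate_load_weight adm] sq_integrable_weighted[OF moderate_h adm]])
        show "norm (?m \<xi> *\<^sub>R v c \<xi>) \<le> max 1 (\<delta> powr \<beta>) * norm (h \<xi> *\<^sub>R v c \<xi>)" for \<xi>
          using mult_right_mono[OF load_weight_le[of \<xi>], of "norm (v c \<xi>)"] w_pos[of \<xi>] h_pos[of \<xi>]
          by (simp add: abs_mult mult.assoc)
      qed simp
      qed
      finally show ?thesis by (simp add: K_def sums[OF moderate_h] mult_ac)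
    qed
  qed
  then obtain c where c: "\<kappa> * norm (weighted h (v c)) \<le> K"
    "\<And>l. l < n \<Longrightarrow> \<bar>energy (v c) (e l) + (\<Sum>m<n. \<Sum>p<n. c m * c p * (- trilinear (e m) (e p) (e l) / c0\<^sup>2)) - force (e l)\<bar> \<le> \<epsilon>"
    by (auto simp: sums[OF moderate_h] E2)
  have "(\<Sum>m<n. \<Sum>p<n. c m * c p * (- trilinear (e m) (e p) (e l) / c0\<^sup>2)) = - trilinear (v c) (v c) (e l) / c0\<^sup>2" for l
    by (simp add: T sum_divide_distrib sum_negf)
  then have "\<bar>energy (v c) (e l) - trilinear (v c) (v c) (e l) / c0\<^sup>2 - force (e l)\<bar> \<le> \<epsilon>" if "l < n" for l
    using c(2)[OF that] by simp
  moreover have "norm (weighted h (v c)) \<le> \<rho>"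
    using c(1) \<kappa>_pos by (simp add: \<rho>_def K_def field_simps)
  ultimately show ?thesis using adm[of c] by blast
qed

end

section \<open>The limit of the Galerkin approximations\<close>

context stationary
begin

text \<open>The weak limit is a norm limit of elements of this span; identifying them with weighted
  admissible fields gives access to their pointwise symmetries.\<close>

lemma span_weighted_admissible:
  assumes "\<And>n. admissible (v n)" "s \<in> span (range (\<lambda>n. weighted h (v n)))"
  shows "\<exists>u. admissible u \<and> s = weighted h u"
proof -
  have "subspace {weighted h u | u. admissible u}"
    unfolding subspace_def
  proof (intro conjI ballI allI)
    show "0 \<in> {weighted h u | u. admissible u}"
      using weighted_sum[OF moderate_h, of "{}"] admissible_sum[of "{}"] by fastforce
    show "x + y \<in> {weighted h u | u. admissible u}" if xy: "x \<in> {weighted h u | u. admissible u}" "y \<in> {weighted h u | u. admissible u}" for x y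
    proof -
      obtain u u' where u: "x = weighted h u" "admissible u" "y = weighted h u'" "admissible u'" using xy by blast
      \<comment> \<open>The sum of two fields is written as a sum over \<open>bool\<close>, so that
        the facts about finite combinations apply.\<close>
      let ?e = "\<lambda>b::bool. if b then u else u'"
      have "admissible (\<lambda>\<xi>. \<Sum>b\<in>UNIV. 1 *\<^sub>R ?e b \<xi>)" using u by (intro admissible_sum) auto
      moreover have "weighted h (\<lambda>\<xi>. \<Sum>b\<in>UNIV. 1 *\<^sub>R ?e b \<xi>) = x + y"
        using u by (subst weighted_sum[OF moderate_h]) (auto simp: UNIV_bool add.commute)
      ultimately show ?thesis unfolding mem_Collect_eq by (intro exI conjI) (rule sym, assumption+)
    qed
    show "c *\<^sub>R x \<in> {weighted h u | u. admissible u}" if x: "x \<in> {weighted h u | u. admissible u}" for c x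
    proof -
      obtain u where u: "x = weighted h u" "admissible u" using x by blast
      have "admissible (\<lambda>\<xi>. \<Sum>b\<in>{()}. c *\<^sub>R u \<xi>)" using u by (intro admissible_sum) auto
      moreover have "weighted h (\<lambda>\<xi>. \<Sum>b\<in>{()}. c *\<^sub>R u \<xi>) = c *\<^sub>R x"
        using u by (subst weighted_sum[OF moderate_h]) auto
      ultimately show ?thesis unfolding mem_Collect_eq by (intro exI conjI) (rule sym, assumption+)
    qed
  qed
  moreover have "range (\<lambda>n. weighted h (v n)) \<subseteq> {weighted h u | u. admissible u}" using assms(1) by blast
  ultimately show ?thesis using span_minimal assms(2) by blast
qed

lemma AE_eq_0_if_norm_le:
  fixes f :: "real^3 \<Rightarrow> 'b::euclidean_space"
  assumes f: "sq_integrable lborel f" and le: "\<And>i. norm (abs_l2 f) \<le> C * t i" and t: "t \<longlonglongrightarrow> 0"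
  shows "AE x in lborel. f x = 0"
proof -
  have "(\<lambda>i::nat. C * t i) \<longlonglongrightarrow> 0" using t by (rule tendsto_mult_right_zero)
  then have "norm (abs_l2 f) \<le> 0" using le by (intro LIMSEQ_le_const) blast+
  then have "abs_l2 f = abs_l2 (\<lambda>_. 0)" by (simp add: zero_l2_def)
  then show ?thesis using abs_l2_eq_iff[OF f, of "\<lambda>_. 0"] by (simp add: sq_integrable_def)
qed

text \<open>Reality and solenoidality are closed linear conditions, and the limit belongs to the
  closed span: elements of the span satisfying them converge to it in norm. The even positive weight
  \<open>h\<close> does not disturb either condition.\<close>

lemma weak_limit_symmetries:
  assumes v: "\<And>n. admissible (v n)" and G: "G \<in> closure (span (range (\<lambda>n. weighted h (v n))))"
    and G0: "sq_integrable lborel G0" "G = abs_l2 G0"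
  shows "AE \<xi> in lborel. \<forall>j. G0 (- \<xi>) $ j = cnj (G0 \<xi> $ j)"
    and "AE \<xi> in lborel. (\<Sum>j\<in>UNIV. of_real (\<xi> $ j) * G0 \<xi> $ j) = 0"
proof -
  obtain s where s: "\<And>i. s i \<in> span (range (\<lambda>n. weighted h (v n)))" "s \<longlonglongrightarrow> G"
    using G closure_sequential by blast
  then obtain u where u: "\<And>i. admissible (u i)" "\<And>i. s i = weighted h (u i)"
    using span_weighted_admissible[OF v s(1)] by metis
  note su = sq_integrable_weighted[OF moderate_h u(1)]
  define D where "D i \<xi> = G0 \<xi> - h \<xi> *\<^sub>R u i \<xi>" for i :: nat and \<xi>
  have sD: "sq_integrable lborel (D i)" for i unfolding D_def by (intro sq_integrable_diff G0 su)
  have t: "(\<lambda>i. norm (abs_l2 (D i))) \<longlonglongrightarrow> 0"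
  proof -
    have "abs_l2 (D i) = G - s i" for i
      unfolding D_def G0(2) u(2) weighted_def by (simp add: diff_abs_l2 G0(1) su)
    then have "norm (abs_l2 (D i)) = dist (s i) G" for i by (simp add: dist_norm norm_minus_commute)
    then show ?thesis using s(2)[THEN tendsto_dist_iff[THEN iffD1]] by simp
  qed
  have hm: "h (- \<xi>) = h \<xi>" for \<xi> by (simp add: h_def)
  have mG[measurable]: "G0 \<in> borel_measurable borel" using sq_integrable_measurable[OF G0(1)] by simp
  have comp: "(h \<xi> *\<^sub>R u i \<xi>) $ j = of_real (h \<xi>) * u i \<xi> $ j" for i j \<xi>
    by (simp add: vector_scaleR_component) (simp add: scaleR_conv_of_real)
  have "AE \<xi> in lborel. G0 (- \<xi>) $ j - cnj (G0 \<xi> $ j) = 0" for j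
  proof (rule AE_eq_0_if_norm_le[OF _ _ t])
    have refl: "sq_integrable lborel (\<lambda>\<xi>. f (- \<xi>))" "norm (abs_l2 (\<lambda>\<xi>. f (- \<xi>))) = norm (abs_l2 f)"
      if f: "sq_integrable lborel f" for f :: "real^3 \<Rightarrow> complex"
    proof -
      show r: "sq_integrable lborel (\<lambda>\<xi>. f (- \<xi>))"
        using f integrable_lborel_reflect_iff[of "\<lambda>\<xi>. (cmod (f \<xi>))\<^sup>2"]
        by (auto simp: sq_integrable_def intro: measurable_compose[of uminus])
      have "(norm (abs_l2 (\<lambda>\<xi>. f (- \<xi>))))\<^sup>2 = (norm (abs_l2 f))\<^sup>2"
        using integral_lborel_reflect[of "\<lambda>\<xi>. (cmod (f \<xi>))\<^sup>2"] by (simp add: norm_abs_l2_square r f)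
      then show "norm (abs_l2 (\<lambda>\<xi>. f (- \<xi>))) = norm (abs_l2 f)" by (simp add: power2_eq_iff_nonneg)
    qed
    have cn: "sq_integrable lborel (\<lambda>\<xi>. cnj (f \<xi>))" if f: "sq_integrable lborel f" for f :: "real^3 \<Rightarrow> complex"
      using f borel_measurable_cnj[of f] by (simp add: sq_integrable_def)
    note Gj = sq_integrable_vec3_nth[OF G0(1), of j] and Dj = sq_integrable_vec3_nth[OF sD, of _ j]
    show "sq_integrable lborel (\<lambda>\<xi>. G0 (- \<xi>) $ j - cnj (G0 \<xi> $ j))"
      by (intro sq_integrable_diff refl(1)[OF Gj] cn[OF Gj])
    show "norm (abs_l2 (\<lambda>\<xi>. G0 (- \<xi>) $ j - cnj (G0 \<xi> $ j))) \<le> 2 * norm (abs_l2 (D i))" for i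
    proof -
      have "u i (- \<xi>) $ j = cnj (u i \<xi> $ j)" for \<xi> using u(1)[of i] by (simp add: admissible_def)
      then have "(\<lambda>\<xi>. G0 (- \<xi>) $ j - cnj (G0 \<xi> $ j)) = (\<lambda>\<xi>. D i (- \<xi>) $ j - cnj (D i \<xi> $ j))"
        by (simp add: D_def comp hm)
      then have "norm (abs_l2 (\<lambda>\<xi>. G0 (- \<xi>) $ j - cnj (G0 \<xi> $ j))) = norm (abs_l2 (\<lambda>\<xi>. D i (- \<xi>) $ j) - abs_l2 (\<lambda>\<xi>. cnj (D i \<xi> $ j)))"
        by (simp add: diff_abs_l2 refl(1)[OF Dj] cn[OF Dj])
      also have "\<dots> \<le> norm (abs_l2 (\<lambda>\<xi>. D i \<xi> $ j)) + norm (abs_l2 (\<lambda>\<xi>. cnj (D i \<xi> $ j)))"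
        using norm_triangle_ineq4[of "abs_l2 (\<lambda>\<xi>. D i (- \<xi>) $ j)" "abs_l2 (\<lambda>\<xi>. cnj (D i \<xi> $ j))"] refl(2)[OF Dj, of i]
        by simp
      also have "\<dots> \<le> 1 * norm (abs_l2 (D i)) + 1 * norm (abs_l2 (D i))"
        by (intro add_mono norm_abs_l2_mono Dj cn[OF Dj] sD) (auto simp: Finite_Cartesian_Product.norm_nth_le)
      finally show ?thesis by simp
    qed
  qed
  then have "AE \<xi> in lborel. \<forall>j\<in>UNIV. G0 (- \<xi>) $ j - cnj (G0 \<xi> $ j) = 0"
    by (intro AE_finite_allI) auto
  then show "AE \<xi> in lborel. \<forall>j. G0 (- \<xi>) $ j = cnj (G0 \<xi> $ j)" by simp
  \<comment> \<open>The factor compensates the growth of \<xi>, the 3 counting the components, so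
    that the divergence becomes square-integrable and is bounded by the norm of the field.\<close>
  let ?f = "\<lambda>\<xi>. of_real (1 / (3 * (1 + norm \<xi>))) * (\<Sum>j\<in>UNIV. of_real (\<xi> $ j) * G0 \<xi> $ j)"
  have fle: "cmod (of_real (1 / (3 * (1 + norm \<xi>))) * (\<Sum>j\<in>UNIV. of_real (\<xi> $ j) * z $ j)) \<le> 1 * norm z" for \<xi> :: "real^3" and z :: "complex^3"
  proof -
    have "cmod (\<Sum>j\<in>UNIV. of_real (\<xi> $ j) * z $ j) \<le> (\<Sum>j\<in>(UNIV::3 set). norm \<xi> * norm z)"
      by (intro order_trans[OF norm_sum] sum_mono)
         (auto simp: norm_mult intro!: mult_mono component_le_norm_cart Finite_Cartesian_Product.norm_nth_le)
    also have "\<dots> \<le> (3 * (1 + norm \<xi>)) * norm z" by (simp add: algebra_simps)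
    finally have "1 / (3 * (1 + norm \<xi>)) * cmod (\<Sum>j\<in>UNIV. of_real (\<xi> $ j) * z $ j) \<le> norm z"
      by (simp add: pos_divide_le_eq add_pos_nonneg mult.commute)
    then show ?thesis unfolding norm_mult norm_of_real by simp
  qed
  have "AE \<xi> in lborel. ?f \<xi> = 0"
  proof (rule AE_eq_0_if_norm_le[OF _ _ t])
    show sf: "sq_integrable lborel ?f"
    proof (rule sq_integrable_bound[OF G0(1) _ fle])
      note [measurable] = measurable_vec3_nth[OF mG]
      have [measurable]: "(\<lambda>\<xi>::real^3. \<xi> $ j) \<in> borel_measurable borel" for j
        by (intro borel_measurable_continuous_onI continuous_intros)
      have "?f \<in> borel_measurable borel" by measurable
      then show "?f \<in> borel_measurable lborel" by simp
    qed
    show "norm (abs_l2 ?f) \<le> 1 * norm (abs_l2 (D i))" for i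
    proof (rule norm_abs_l2_mono[OF sf sD])
      fix \<xi>
      have "(\<Sum>j\<in>UNIV. of_real (\<xi> $ j) * D i \<xi> $ j)
          = (\<Sum>j\<in>UNIV. of_real (\<xi> $ j) * G0 \<xi> $ j) - of_real (h \<xi>) * (\<Sum>j\<in>UNIV. of_real (\<xi> $ j) * u i \<xi> $ j)"
        unfolding D_def vector_minus_component comp by (simp add: right_diff_distrib sum_subtractf sum_distrib_left mult_ac)
      also have "\<dots> = (\<Sum>j\<in>UNIV. of_real (\<xi> $ j) * G0 \<xi> $ j)"
        using u(1)[of i] by (simp add: admissible_def)
      finally show "cmod (?f \<xi>) \<le> 1 * norm (D i \<xi>)" using fle[of \<xi> "D i \<xi>"] by simp
    qed simp
  qed
  then show "AE \<xi> in lborel. (\<Sum>j\<in>UNIV. of_real (\<xi> $ j) * G0 \<xi> $ j) = 0"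
  proof eventually_elim
    case (elim \<xi>)
    have "3 * (1 + norm \<xi>) > 0" by (simp add: add_pos_nonneg)
    then have "complex_of_real (1 / (3 * (1 + norm \<xi>))) \<noteq> 0" by (simp del: of_real_mult of_real_add of_real_divide)
    with elim show ?case by (metis mult_eq_0_iff)
  qed
qed

lemma h_ge_1: "h \<xi> \<ge> 1"
  unfolding h_def using \<alpha> \<beta> by (intro ge_one_powr_ge_zero) auto

text \<open>Exhibits integration of one component against \<open>y\<close> as an inner product in
  the weighted space: the test vector has conj(y) / h in position j. Weak convergence in that space
  thus yields weak convergence of the components.\<close>

lemma inner_component_test:
  assumes a: "sq_integrable lborel (\<lambda>\<xi>. h \<xi> *\<^sub>R a \<xi>)" and y: "sq_integrable lborel y"
  shows "sq_integrable lborel (\<lambda>\<xi>. axis j (cnj (y \<xi>) / of_real (h \<xi>)) :: complex^3)"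
    and "abs_l2 (\<lambda>\<xi>. h \<xi> *\<^sub>R a \<xi>) \<bullet> abs_l2 (\<lambda>\<xi>. axis j (cnj (y \<xi>) / of_real (h \<xi>)))
      = Re (LINT \<xi>|lborel. a \<xi> $ j * y \<xi>)"
    and "integrable lborel (\<lambda>\<xi>. a \<xi> $ j * y \<xi>)"
proof -
  let ?Y = "\<lambda>\<xi>. axis j (cnj (y \<xi>) / of_real (h \<xi>)) :: complex^3"
  have [measurable]: "h \<in> borel_measurable borel" using moderate_measurable[OF moderate_h] .
  have [measurable]: "y \<in> borel_measurable borel" using sq_integrable_measurable[OF y] by simp
  have cy: "(\<lambda>\<xi>. cnj (y \<xi>)) \<in> borel_measurable borel"
    by (rule borel_measurable_cnj) measurable
  show sY: "sq_integrable lborel ?Y"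
  proof (rule sq_integrable_bound[OF y, of _ 1])
    show "?Y \<in> borel_measurable lborel"
      using cy by (intro measurable_vec3I) (auto simp: axis_def)
    show "norm (?Y \<xi>) \<le> 1 * cmod (y \<xi>)" for \<xi>
      using h_ge_1[of \<xi>] mult_left_mono[of 1 "h \<xi>" "cmod (y \<xi>)"]
      by (simp add: norm_eq_sqrt_inner[of "axis _ _ :: complex^3"] inner_axis_axis flip: norm_eq_sqrt_inner) (simp add: norm_divide divide_le_eq)
  qed
  have a1: "sq_integrable lborel (\<lambda>\<xi>. a \<xi> $ j)"
    by (rule sq_integrable_unweighted[OF a moderate_measurable[OF moderate_h] h_ge_1])
  show i: "integrable lborel (\<lambda>\<xi>. a \<xi> $ j * y \<xi>)" by (rule norm_integral_mult_le(1)[OF a1 y])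
  have "abs_l2 (\<lambda>\<xi>. h \<xi> *\<^sub>R a \<xi>) \<bullet> abs_l2 ?Y = (LINT \<xi>|lborel. (h \<xi> *\<^sub>R a \<xi>) \<bullet> ?Y \<xi>)"
    by (rule inner_abs_l2[OF a sY])
  also have "\<dots> = (LINT \<xi>|lborel. Re (a \<xi> $ j * y \<xi>))"
  proof (intro Bochner_Integration.integral_cong refl)
    fix \<xi>
    have hp: "h \<xi> \<noteq> 0" using h_pos[of \<xi>] by simp
    have "(h \<xi> *\<^sub>R a \<xi>) \<bullet> ?Y \<xi> = h \<xi> * (a \<xi> $ j \<bullet> (cnj (y \<xi>) / of_real (h \<xi>)))" by (simp add: inner_axis)
    also have "\<dots> = Re (a \<xi> $ j * y \<xi>)"
      using hp by (simp add: inner_complex_def Re_divide_of_real Im_divide_of_real right_diff_distrib)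
    finally show "(h \<xi> *\<^sub>R a \<xi>) \<bullet> ?Y \<xi> = Re (a \<xi> $ j * y \<xi>)" .
  qed
  also have "\<dots> = Re (LINT \<xi>|lborel. a \<xi> $ j * y \<xi>)" using i by (rule integral_Re)
  finally show "abs_l2 (\<lambda>\<xi>. h \<xi> *\<^sub>R a \<xi>) \<bullet> abs_l2 ?Y = Re (LINT \<xi>|lborel. a \<xi> $ j * y \<xi>)" .
qed

theorem galerkin_limit:
  fixes e :: "nat \<Rightarrow> real^3 \<Rightarrow> complex^3"
  assumes e: "\<And>l. admissible (e l)"
  shows "\<exists>g U. sq_integrable lborel (\<lambda>\<xi>. h \<xi> *\<^sub>R g \<xi>) \<and> norm (abs_l2 (\<lambda>\<xi>. h \<xi> *\<^sub>R g \<xi>)) \<le> \<rho> \<and>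
    (AE \<xi> in lborel. \<forall>j. g (- \<xi>) $ j = cnj (g \<xi> $ j)) \<and>
    (AE \<xi> in lborel. (\<Sum>j\<in>UNIV. of_real (\<xi> $ j) * g \<xi> $ j) = 0) \<and>
    (\<forall>j. inverse_transform (U j) (\<lambda>\<xi>. g \<xi> $ j / of_real c0)) \<and>
    (\<forall>l. energy g (e l) - (\<Sum>j\<in>UNIV. \<Sum>k\<in>UNIV. LINT x|lborel. U j x * U k x * phys_partial k (e l) j x) = force (e l))"
proof -
  have "\<exists>v. admissible v \<and> norm (weighted h v) \<le> \<rho> \<and>
    (\<forall>l<n. \<bar>energy v (e l) - trilinear v v (e l) / c0\<^sup>2 - force (e l)\<bar> \<le> gstep n)" for n
    using galerkin_solution[where e=e and n=n, OF e gstep(1)[of n]] by (elim exE conjE) (intro exI conjI; assumption)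
  then obtain v where vv: "\<And>n. admissible (v n) \<and> norm (weighted h (v n)) \<le> \<rho> \<and>
    (\<forall>l<n. \<bar>energy (v n) (e l) - trilinear (v n) (v n) (e l) / c0\<^sup>2 - force (e l)\<bar> \<le> gstep n)"
    using choice[of "\<lambda>n v. admissible v \<and> norm (weighted h v) \<le> \<rho> \<and>
    (\<forall>l<n. \<bar>energy v (e l) - trilinear v v (e l) / c0\<^sup>2 - force (e l)\<bar> \<le> gstep n)"] by meson
  note v = vv[THEN conjunct1] vv[THEN conjunct2, THEN conjunct1] vv[THEN conjunct2, THEN conjunct2, rule_format]
  obtain r G where r: "strict_mono r" and G: "norm G \<le> \<rho>" "G \<in> closure (span (range (\<lambda>n. weighted h (v n))))"
    "\<And>y. (\<lambda>n. weighted h (v (r n)) \<bullet> y) \<longlonglongrightarrow> G \<bullet> y"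
    using weakly_convergent_subsequence[of "\<lambda>n. weighted h (v n)" \<rho>, OF v(2)] by blast
  obtain G0 where G0: "sq_integrable lborel G0" "G = abs_l2 G0" by (rule abs_l2_cases)
  define g where "g \<xi> = inverse (h \<xi>) *\<^sub>R G0 \<xi>" for \<xi>
  have hg: "(\<lambda>\<xi>. h \<xi> *\<^sub>R g \<xi>) = G0" using h_pos by (auto simp: g_def less_imp_neq[symmetric])
  have sg: "sq_integrable lborel (\<lambda>\<xi>. h \<xi> *\<^sub>R g \<xi>)" and Gg: "G = abs_l2 (\<lambda>\<xi>. h \<xi> *\<^sub>R g \<xi>)"
    unfolding hg by (rule G0)+
  have gcomp: "g \<xi> $ j = of_real (inverse (h \<xi>)) * G0 \<xi> $ j" for \<xi> j
    unfolding g_def by (simp add: vector_scaleR_component) (simp add: scaleR_conv_of_real)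
  have hm: "h (- \<xi>) = h \<xi>" for \<xi> by (simp add: h_def)
  have herm: "AE \<xi> in lborel. \<forall>j. g (- \<xi>) $ j = cnj (g \<xi> $ j)"
    using weak_limit_symmetries(1)[OF v(1) G(2) G0] by eventually_elim (simp add: gcomp hm)
  have sol: "AE \<xi> in lborel. (\<Sum>j\<in>UNIV. of_real (\<xi> $ j) * g \<xi> $ j) = 0"
    using weak_limit_symmetries(2)[OF v(1) G(2) G0]
  proof eventually_elim
    case (elim \<xi>)
    have "(\<Sum>j\<in>UNIV. of_real (\<xi> $ j) * g \<xi> $ j) = of_real (inverse (h \<xi>)) * (\<Sum>j\<in>UNIV. of_real (\<xi> $ j) * G0 \<xi> $ j)"
      by (simp add: gcomp sum_distrib_left mult_ac)
    with elim show ?case by simp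
  qed
  define gj where "gj j \<xi> = g \<xi> $ j / of_real c0" for j \<xi>
  define vj where "vj j n \<xi> = v (r n) \<xi> $ j / of_real c0" for j n \<xi>
  have c0: "c0 > 0" by (rule c0_pos)
  have rv: "rapid (vj j n)" for j n
    using rapid_cmult[OF admissible_rapid[OF v(1)], of "1 / of_real c0" "r n" j] by (simp add: vj_def[abs_def])
  note sv = rapid_sq_integrable[OF rv] and iv = rapid_integrable[OF rv]
  note shv = sq_integrable_weighted[OF moderate_h v(1)]
  have comp_le: "cmod (a $ j / of_real c0) \<le> 1 / c0 * norm (h \<xi> *\<^sub>R a)" for a :: "complex^3" and j \<xi>
  proof -
    have "cmod (a $ j) \<le> norm (h \<xi> *\<^sub>R a)"
      using h_ge_1[of \<xi>] mult_right_mono[of 1 "h \<xi>" "norm a"] Finite_Cartesian_Product.norm_nth_le[of a j] by simp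
    then show ?thesis using c0 by (simp add: norm_divide divide_right_mono)
  qed
  have sgj: "sq_integrable lborel (gj j)" for j
  proof -
    have g: "sq_integrable lborel (\<lambda>\<xi>. g \<xi> $ j)"
      by (rule sq_integrable_unweighted[OF sg moderate_measurable[OF moderate_h] h_ge_1])
    show ?thesis
      unfolding gj_def using sq_integrable_measurable[OF g]
      by (intro sq_integrable_bound[OF g, of _ "1 / c0"]) (use c0 in \<open>auto simp: norm_divide\<close>)
  qed
  have "\<forall>j. \<exists>U. inverse_transform U (gj j)"
  proof
    fix j
    have "AE \<xi> in lborel. gj j (- \<xi>) = cnj (gj j \<xi>)" using herm by eventually_elim (simp add: gj_def)
    then show "\<exists>U. inverse_transform U (gj j)" by (rule inverse_transform_exists[OF sgj])
  qed
  then obtain U where U: "\<And>j. inverse_transform (U j) (gj j)" by metis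
  have sU: "sq_integrable lborel (U j)" for j using U[of j] by (simp add: inverse_transform_def)
  have weak: "(\<lambda>n. LINT \<xi>|lborel. vj j n \<xi> * y \<xi>) \<longlonglongrightarrow> (LINT \<xi>|lborel. gj j \<xi> * y \<xi>)" if y: "sq_integrable lborel y" for j y
  proof -
    have re: "(\<lambda>n. Re (LINT \<xi>|lborel. v (r n) \<xi> $ j * y \<xi>)) \<longlonglongrightarrow> Re (LINT \<xi>|lborel. g \<xi> $ j * y \<xi>)"
      if y: "sq_integrable lborel y" for y
      using G(3)[of "abs_l2 (\<lambda>\<xi>. axis j (cnj (y \<xi>) / of_real (h \<xi>)))"]
      unfolding Gg weighted_def inner_component_test(2)[OF sg y] inner_component_test(2)[OF shv y] .
    \<comment> \<open>The real inner product sees only real parts; imaginary parts are obtained by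
      testing with - i y.\<close>
    have yi: "sq_integrable lborel (\<lambda>\<xi>. - \<i> * y \<xi>)"
      using sq_integrable_measurable[OF y] by (intro sq_integrable_bound[OF y, of _ 1]) (auto simp: norm_mult)
    have im: "Re (LINT \<xi>|lborel. a \<xi> * (- \<i> * y \<xi>)) = Im (LINT \<xi>|lborel. a \<xi> * y \<xi>)" for a
    proof -
      have "(LINT \<xi>|lborel. a \<xi> * (- \<i> * y \<xi>)) = - \<i> * (LINT \<xi>|lborel. a \<xi> * y \<xi>)"
        by (simp only: mult.left_commute[of "a _"] integral_mult_right_zero)
      then show ?thesis by simp
    qed
    have "(\<lambda>n. LINT \<xi>|lborel. v (r n) \<xi> $ j * y \<xi>) \<longlonglongrightarrow> (LINT \<xi>|lborel. g \<xi> $ j * y \<xi>)"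
      by (rule tendsto_complex_iff[THEN iffD2, OF conjI[OF re[OF y] re[OF yi, unfolded im]]])
    from tendsto_mult[OF tendsto_const[of "1 / of_real c0"] this] show ?thesis
      by (simp add: vj_def gj_def)
  qed
  have dprops: "sq_integrable lborel (phys_partial k (e l) j)" "\<bar>phys_partial k (e l) j x\<bar> \<le> (LINT \<xi>|lborel. cmod (\<i> * of_real (\<xi> $ k) * e l \<xi> $ j))"
    "phys_partial k (e l) j \<in> borel_measurable borel" for k l j x
    using Re_ift_props[OF admissible_partial_rapid[OF e[of l], of k j]]
    by (simp_all add: sq_integrable_def phys_partial_def[abs_def])
  have bound: "integrable lborel (\<lambda>\<xi>. (1 + (norm \<xi>)\<^sup>2) powr ((\<alpha> + \<beta>) / 2) * (cmod (vj i n \<xi>))\<^sup>2)"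
      "(LINT \<xi>|lborel. (1 + (norm \<xi>)\<^sup>2) powr ((\<alpha> + \<beta>) / 2) * (cmod (vj i n \<xi>))\<^sup>2) \<le> (\<rho> / c0)\<^sup>2" for i n
  proof -
    have le: "(1 + (norm \<xi>)\<^sup>2) powr ((\<alpha> + \<beta>) / 2) * (cmod (vj i n \<xi>))\<^sup>2 \<le> (1 / c0\<^sup>2) * (norm (h \<xi> *\<^sub>R v (r n) \<xi>))\<^sup>2" for n \<xi>
    proof -
      have "(h \<xi>)\<^sup>2 * (cmod (vj i n \<xi>))\<^sup>2 = (1 / c0\<^sup>2) * ((h \<xi>)\<^sup>2 * (cmod (v (r n) \<xi> $ i))\<^sup>2)"
        using c0 by (simp add: vj_def norm_divide power_divide)
      also have "\<dots> \<le> (1 / c0\<^sup>2) * ((h \<xi>)\<^sup>2 * (norm (v (r n) \<xi>))\<^sup>2)"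
        by (intro mult_left_mono power_mono Finite_Cartesian_Product.norm_nth_le) auto
      finally show ?thesis by (simp add: h_square power_mult_distrib)
    qed
    have shv2: "integrable lborel (\<lambda>\<xi>. (1 / c0\<^sup>2) * (norm (h \<xi> *\<^sub>R v (r n) \<xi>))\<^sup>2)" for n
      using shv[of "r n"] by (simp add: sq_integrable_def)
    show i: "integrable lborel (\<lambda>\<xi>. (1 + (norm \<xi>)\<^sup>2) powr ((\<alpha> + \<beta>) / 2) * (cmod (vj i n \<xi>))\<^sup>2)"
    proof (rule Bochner_Integration.integrable_bound[OF shv2[of n]])
      have [measurable]: "vj i n \<in> borel_measurable borel" by (rule rapid_measurable[OF rv])
      show "(\<lambda>\<xi>. (1 + (norm \<xi>)\<^sup>2) powr ((\<alpha> + \<beta>) / 2) * (cmod (vj i n \<xi>))\<^sup>2) \<in> borel_measurable lborel" by measurable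
      show "AE \<xi> in lborel. norm ((1 + (norm \<xi>)\<^sup>2) powr ((\<alpha> + \<beta>) / 2) * (cmod (vj i n \<xi>))\<^sup>2) \<le> norm ((1 / c0\<^sup>2) * (norm (h \<xi> *\<^sub>R v (r n) \<xi>))\<^sup>2)"
        using le[of _ n] by (intro AE_I2) (simp add: abs_mult)
    qed
    show "(LINT \<xi>|lborel. (1 + (norm \<xi>)\<^sup>2) powr ((\<alpha> + \<beta>) / 2) * (cmod (vj i n \<xi>))\<^sup>2) \<le> (\<rho> / c0)\<^sup>2"
    proof -
      have "(LINT \<xi>|lborel. (1 + (norm \<xi>)\<^sup>2) powr ((\<alpha> + \<beta>) / 2) * (cmod (vj i n \<xi>))\<^sup>2) \<le> (LINT \<xi>|lborel. (1 / c0\<^sup>2) * (norm (h \<xi> *\<^sub>R v (r n) \<xi>))\<^sup>2)"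
        by (rule integral_mono[OF i shv2 le])
      also have "\<dots> = (1 / c0\<^sup>2) * (norm (weighted h (v (r n))))\<^sup>2"
        unfolding weighted_def norm_abs_l2_square[OF shv] by simp
      also have "\<dots> \<le> (1 / c0\<^sup>2) * \<rho>\<^sup>2"
        by (intro mult_left_mono power_mono v(2)) auto
      finally show ?thesis by (simp add: power_divide)
    qed
  qed
  have spos: "(\<alpha> + \<beta>) / 2 > 0" using \<alpha> \<beta> by simp
  have rpos: "\<rho> / c0 \<ge> 0" using order_trans[OF norm_ge_zero v(2)] c0 by simp
  have strong: "(\<lambda>n. norm (abs_l2 (\<lambda>x. (Re (ift (vj i n) x) - U i x) * phys_partial k (e l) j x))) \<longlonglongrightarrow> 0" for i j k l
    by (rule local_strong_convergence[where v="vj i" and U="U i" and d="phys_partial k (e l) j",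
          OF spos iv sv bound rpos sgj U weak dprops(1,2)])
  have Kb: "norm (abs_l2 (\<lambda>x. Re (ift (vj k n) x))) \<le> plancherel TYPE(real^3) * (\<rho> / c0)" and sRe: "sq_integrable lborel (\<lambda>x. Re (ift (vj k n) x))" for k n
  proof -
    note si = sq_integrable_ift[OF iv sv, of k n]
    show sR: "sq_integrable lborel (\<lambda>x. Re (ift (vj k n) x))"
      using Re_ift_props[OF rv] by (simp add: sq_integrable_def)
    have "norm (abs_l2 (\<lambda>x. Re (ift (vj k n) x))) \<le> 1 * norm (abs_l2 (ift (vj k n)))"
      by (rule norm_abs_l2_mono[OF sR si(1)]) (auto simp: abs_Re_le_cmod)
    also have "\<dots> \<le> plancherel TYPE(real^3) * norm (abs_l2 (vj k n))" using si(2) by simp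
    also have "\<dots> \<le> plancherel TYPE(real^3) * (1 / c0 * norm (weighted h (v (r n))))"
      unfolding weighted_def
      by (intro mult_left_mono norm_abs_l2_mono sv shv) (use comp_le c0 plancherel_pos[where 'a="real^3"] in \<open>auto simp: vj_def intro: less_imp_le\<close>)
    also have "\<dots> \<le> plancherel TYPE(real^3) * (1 / c0 * \<rho>)"
      using c0 plancherel_pos[where 'a="real^3"] by (intro mult_left_mono v(2)) (auto intro: less_imp_le)
    finally show "norm (abs_l2 (\<lambda>x. Re (ift (vj k n) x))) \<le> plancherel TYPE(real^3) * (\<rho> / c0)" by simp
  qed
  have nonlin: "(\<lambda>n. trilinear (v (r n)) (v (r n)) (e l) / c0\<^sup>2)
      \<longlonglongrightarrow> (\<Sum>j\<in>UNIV. \<Sum>k\<in>UNIV. LINT x|lborel. U j x * U k x * phys_partial k (e l) j x)" for l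
  proof -
    have ph: "Re (ift (vj j n) x) = phys (v (r n)) j x / c0" for j n x
    proof -
      have "ift (vj j n) x = (1 / of_real c0) * ift (\<lambda>\<xi>. v (r n) \<xi> $ j) x"
        unfolding ift_cmult[symmetric] by (simp add: vj_def[abs_def])
      then show ?thesis by (simp add: phys_def)
    qed
    have "trilinear (v (r n)) (v (r n)) (e l) / c0\<^sup>2
       = (\<Sum>j\<in>UNIV. \<Sum>k\<in>UNIV. LINT x|lborel. Re (ift (vj j n) x) * Re (ift (vj k n) x) * phys_partial k (e l) j x)" for n
      by (simp add: trilinear_def ph sum_divide_distrib power2_eq_square)
    moreover have "(\<lambda>n. \<Sum>j\<in>UNIV. \<Sum>k\<in>UNIV. LINT x|lborel. Re (ift (vj j n) x) * Re (ift (vj k n) x) * phys_partial k (e l) j x)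
      \<longlonglongrightarrow> (\<Sum>j\<in>UNIV. \<Sum>k\<in>UNIV. LINT x|lborel. U j x * U k x * phys_partial k (e l) j x)"
      by (rule tendsto_sum, rule tendsto_sum, rule product_convergence[where p="\<lambda>n x. Re (ift (vj _ n) x)" and q="\<lambda>n x. Re (ift (vj _ n) x)", OF sRe sRe Kb sU sU dprops(3) dprops(2) strong strong])
    ultimately show ?thesis by simp
  qed
  have lin: "(\<lambda>n. energy (v (r n)) (e l)) \<longlonglongrightarrow> energy g (e l)" for l
  proof -
    \<comment> \<open>One factor \<open>h\<close> already belongs to the field, so the test vector
      carries W / h; rapid decrease of \<open>e l\<close> makes it square-integrable.\<close>
    let ?m = "\<lambda>\<xi>. W \<xi> * (1 + (norm \<xi>)\<^sup>2) powr (- ((\<alpha> + \<beta>) / 4))"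
    have mm: "moderate ?m" by (intro moderate_mult moderate_W moderate_one_plus_powr)
    have mh: "?m \<xi> * h \<xi> = W \<xi>" for \<xi>
      using bp[of \<xi>] by (simp add: h_def powr_minus)
    have "abs_l2 (\<lambda>\<xi>. h \<xi> *\<^sub>R a \<xi>) \<bullet> weighted ?m (e l) = energy a (e l)" if a: "sq_integrable lborel (\<lambda>\<xi>. h \<xi> *\<^sub>R a \<xi>)" for a
      unfolding weighted_def energy_def
      by (subst inner_abs_l2[OF a sq_integrable_weighted[OF mm e]])
         (simp only: inner_scaleR_left inner_scaleR_right mult.assoc[symmetric] mh)
    from this[OF shv] this[OF sg] show ?thesis
      using G(3)[of "weighted ?m (e l)"] unfolding Gg weighted_def[of h] by simp
  qed
  have "energy g (e l) - (\<Sum>j\<in>UNIV. \<Sum>k\<in>UNIV. LINT x|lborel. U j x * U k x * phys_partial k (e l) j x) = force (e l)" for l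
  proof -
    \<comment> \<open>System n contains the equations with index below n, so equation l is available
      once \<open>r n\<close> exceeds l, with an error that tends to 0.\<close>
    have "(\<lambda>n. energy (v (r n)) (e l) - trilinear (v (r n)) (v (r n)) (e l) / c0\<^sup>2 - force (e l)) \<longlonglongrightarrow> 0"
    proof (rule Lim_null_comparison)
      show "(\<lambda>n. gstep (r n)) \<longlonglongrightarrow> 0" using LIMSEQ_subseq_LIMSEQ[OF gstep(2) r] by (simp add: o_def)
      have "\<forall>\<^sub>F n in sequentially. l < r n"
        using filterlim_subseq[OF r] by (metis eventually_gt_at_top eventually_compose_filterlim)
      then show "\<forall>\<^sub>F n in sequentially. norm (energy (v (r n)) (e l) - trilinear (v (r n)) (v (r n)) (e l) / c0\<^sup>2 - force (e l)) \<le> gstep (r n)"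
        by eventually_elim (simp add: v(3))
    qed
    from LIMSEQ_unique[OF this tendsto_diff[OF tendsto_diff[OF lin nonlin] tendsto_const]] show ?thesis by simp
  qed
  moreover have "norm (abs_l2 (\<lambda>\<xi>. h \<xi> *\<^sub>R g \<xi>)) \<le> \<rho>" using G(1) by (simp only: Gg)
  moreover have "\<forall>j. inverse_transform (U j) (\<lambda>\<xi>. g \<xi> $ j / of_real c0)" using U by (simp add: gj_def[abs_def])
  ultimately show ?thesis using sg herm sol by blast
qed

end

section \<open>The limit equation on the Fourier side\<close>

text \<open>The transform of the product of two velocity components. That product is integrable, so
  the transform is a bounded function and can be multiplied pointwise by \<open>proj\<close> and by
  \<xi>.\<close>

definition flux :: "(3 \<Rightarrow> real^3 \<Rightarrow> real) \<Rightarrow> 3 \<Rightarrow> 3 \<Rightarrow> real^3 \<Rightarrow> complex" where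
  "flux U j k \<xi> = ift (\<lambda>x. complex_of_real (U j x * U k x)) (- \<xi>)"

lemma flux_integrable:
  assumes "\<And>j. sq_integrable lborel (U j)"
  shows "integrable lborel (\<lambda>x. complex_of_real (U j x * U k x))"
proof -
  have "sq_integrable lborel (\<lambda>x. complex_of_real (U j x))" for j
    using assms[of j] by (auto simp: sq_integrable_def intro!: borel_measurable_of_real)
  from norm_integral_mult_le(1)[OF this[of j] this[of k]] show ?thesis by simp
qed

lemma flux_measurable:
  assumes "\<And>j. sq_integrable lborel (U j)" shows "flux U j k \<in> borel_measurable borel"
  unfolding flux_def[abs_def] using ift_measurable[OF flux_integrable[OF assms]] by measurable

lemma flux_bound: "cmod (flux U j k \<xi>) \<le> (LINT x|lborel. cmod (complex_of_real (U j x * U k x)))"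
  unfolding flux_def by (rule norm_ift_le)

lemma flux_minus: "flux U j k (- \<xi>) = cnj (flux U j k \<xi>)"
  unfolding flux_def using ift_cnj[of "\<lambda>x. complex_of_real (U j x * U k x)" \<xi>] by simp

lemma flux_pairing:
  assumes U: "\<And>j. sq_integrable lborel (U j)" and H: "integrable lborel H"
  shows "(LINT x|lborel. of_real (U j x * U k x) * ift H x) = (LINT \<xi>|lborel. H (- \<xi>) * flux U j k \<xi>)"
proof -
  have "(LINT x|lborel. of_real (U j x * U k x) * ift H x) = (LINT \<xi>|lborel. H \<xi> * ift (\<lambda>x. complex_of_real (U j x * U k x)) \<xi>)"
    using ift_mult_formula[OF H flux_integrable[OF U]] by (simp add: mult.commute)
  also have "\<dots> = (LINT \<xi>|lborel. H (- \<xi>) * ift (\<lambda>x. complex_of_real (U j x * U k x)) (- \<xi>))"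
    by (rule integral_lborel_reflect[symmetric])
  finally show ?thesis by (simp add: flux_def)
qed

lemma integrable_rapid_flux:
  assumes U: "\<And>j. sq_integrable lborel (U j)" and H: "rapid H"
  shows "integrable lborel (\<lambda>\<xi>. H \<xi> * flux U j k \<xi>)"
proof (rule Bochner_Integration.integrable_bound)
  let ?C = "LINT x|lborel. cmod (complex_of_real (U j x * U k x))"
  show "integrable lborel (\<lambda>\<xi>. of_real ?C * H \<xi>)" by (intro integrable_mult_right rapid_integrable H)
  show "(\<lambda>\<xi>. H \<xi> * flux U j k \<xi>) \<in> borel_measurable lborel"
    using rapid_measurable[OF H] flux_measurable[where U=U, OF U] by simp
  have "?C \<ge> 0" by simp
  then show "AE \<xi> in lborel. norm (H \<xi> * flux U j k \<xi>) \<le> norm (of_real ?C * H \<xi>)"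
    using mult_left_mono[OF flux_bound norm_ge_zero, of "H _" U j k]
    by (intro AE_I2) (simp add: norm_mult mult.commute)
qed

lemma rapid_proj: "rapid \<phi> \<Longrightarrow> rapid (\<lambda>\<xi>. of_real (proj \<xi> i j) * \<phi> \<xi>)"
  by (rule rapid_bounded_mult[OF _ proj_measurable abs_proj_le])

lemma integrable_proj_wave:
  assumes a: "sq_integrable lborel (\<lambda>\<xi>. a \<xi> $ j)" and m: "moderate m"
  shows "integrable lborel (\<lambda>\<xi>. of_real (proj \<xi> i j) * (of_real (m \<xi>) * (a \<xi> :: complex^3) $ j) * wave q \<xi>)"
  using norm_integral_mult_le(1)[OF a rapid_sq_integrable[OF rapid_proj[OF rapid_moderate[OF rapid_wave m]]], of i j q]
  by (simp add: mult_ac)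

lemma pairing_test_field:
  assumes a: "\<And>j. sq_integrable lborel (\<lambda>\<xi>. a \<xi> $ j)" and m: "moderate m"
  shows "(LINT \<xi>|lborel. m \<xi> * (a \<xi> \<bullet> test_field q i \<xi>))
    = Re (\<Sum>j\<in>UNIV. LINT \<xi>|lborel. of_real (proj \<xi> i j) * (of_real (m \<xi>) * a \<xi> $ j) * wave q \<xi>)"
proof -
  note I = integrable_proj_wave[OF a m, of i _ q]
  have "m \<xi> * (a \<xi> \<bullet> test_field q i \<xi>) = Re (\<Sum>j\<in>UNIV. of_real (proj \<xi> i j) * (of_real (m \<xi>) * a \<xi> $ j) * wave q \<xi>)" for \<xi>
  proof -
    have "m \<xi> * (a \<xi> \<bullet> test_field q i \<xi>) = Re (of_real (m \<xi>) * (\<Sum>j\<in>UNIV. a \<xi> $ j * cnj (test_field q i \<xi> $ j)))"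
      by (simp add: inner_vec3_complex)
    also have "\<dots> = Re (\<Sum>j\<in>UNIV. of_real (proj \<xi> i j) * (of_real (m \<xi>) * a \<xi> $ j) * wave q \<xi>)"
      by (simp only: sum_distrib_left test_field_def vec_lambda_beta complex_cnj_mult complex_cnj_complex_of_real wave_minus(2) minus_minus mult_ac)
    finally show ?thesis .
  qed
  then have "(LINT \<xi>|lborel. m \<xi> * (a \<xi> \<bullet> test_field q i \<xi>))
      = (LINT \<xi>|lborel. Re (\<Sum>j\<in>UNIV. of_real (proj \<xi> i j) * (of_real (m \<xi>) * a \<xi> $ j) * wave q \<xi>))" by simp
  also have "\<dots> = Re (LINT \<xi>|lborel. (\<Sum>j\<in>UNIV. of_real (proj \<xi> i j) * (of_real (m \<xi>) * a \<xi> $ j) * wave q \<xi>))"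
    by (rule integral_Re) (intro Bochner_Integration.integrable_sum I)
  also have "(LINT \<xi>|lborel. (\<Sum>j\<in>UNIV. of_real (proj \<xi> i j) * (of_real (m \<xi>) * a \<xi> $ j) * wave q \<xi>))
      = (\<Sum>j\<in>UNIV. LINT \<xi>|lborel. of_real (proj \<xi> i j) * (of_real (m \<xi>) * a \<xi> $ j) * wave q \<xi>)"
    by (rule Bochner_Integration.integral_sum) (rule I)
  finally show ?thesis .
qed

lemma convection_test_field:
  assumes U: "\<And>j. sq_integrable lborel (U j)"
  shows "integrable lborel (\<lambda>\<xi>. of_real (proj \<xi> i j) * (\<i> * of_real (\<xi> $ k) * flux U j k \<xi>) * wave q \<xi>)"
    and "(LINT x|lborel. U j x * U k x * phys_partial k (test_field q i) j x)
    = - Re (LINT \<xi>|lborel. of_real (proj \<xi> i j) * (\<i> * of_real (\<xi> $ k) * flux U j k \<xi>) * wave q \<xi>)"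
proof -
  have r: "rapid (\<lambda>\<xi>. of_real (proj \<xi> i j) * (\<i> * of_real (\<xi> $ k) * wave q \<xi>))" for q
    by (intro rapid_proj rapid_mult_component rapid_wave)
  show "integrable lborel (\<lambda>\<xi>. of_real (proj \<xi> i j) * (\<i> * of_real (\<xi> $ k) * flux U j k \<xi>) * wave q \<xi>)"
    using integrable_rapid_flux[where U=U and j=j and k=k, OF U r[of q]] by (simp add: mult_ac)
  let ?H = "\<lambda>\<xi>. \<i> * of_real (\<xi> $ k) * test_field q i \<xi> $ j"
  have H: "integrable lborel ?H"
    by (intro rapid_integrable admissible_partial_rapid admissible_test_field)
  have b: "integrable lborel (\<lambda>x. of_real (U j x * U k x) * ift ?H x)"
  proof (rule Bochner_Integration.integrable_bound)
    let ?C = "LINT \<xi>|lborel. cmod (?H \<xi>)"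
    show "integrable lborel (\<lambda>x. of_real ?C * complex_of_real (U j x * U k x))"
      by (intro integrable_mult_right flux_integrable U)
    show "(\<lambda>x. of_real (U j x * U k x) * ift ?H x) \<in> borel_measurable lborel"
      using borel_measurable_integrable[OF flux_integrable[where U=U and j=j and k=k, OF U]] ift_measurable[OF H] by simp
    have "?C \<ge> 0" by simp
    then show "AE x in lborel. norm (of_real (U j x * U k x) * ift ?H x) \<le> norm (of_real ?C * complex_of_real (U j x * U k x))"
      using mult_left_mono[OF norm_ift_le[of ?H] norm_ge_zero, of "complex_of_real (U j _ * U k _)"]
      by (intro AE_I2) (simp add: norm_mult mult.commute)
  qed
  have "(LINT x|lborel. U j x * U k x * phys_partial k (test_field q i) j x)
      = (LINT x|lborel. Re (of_real (U j x * U k x) * ift ?H x))"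
    by (simp add: phys_partial_def)
  also have "\<dots> = Re (LINT x|lborel. of_real (U j x * U k x) * ift ?H x)" by (rule integral_Re[OF b])
  also have "\<dots> = Re (LINT \<xi>|lborel. ?H (- \<xi>) * flux U j k \<xi>)" unfolding flux_pairing[where U=U, OF U H] ..
  \<comment> \<open>The reflection in \<open>flux_pairing\<close> reverses the sign of \<xi>_k and
    turns \<open>wave (- q)\<close> into \<open>wave q\<close>; this is the minus sign of the
    integration by parts.\<close>
  also have "(\<lambda>\<xi>. ?H (- \<xi>) * flux U j k \<xi>) = (\<lambda>\<xi>. - (of_real (proj \<xi> i j) * (\<i> * of_real (\<xi> $ k) * flux U j k \<xi>) * wave q \<xi>))"
    by (rule ext) (simp add: test_field_def wave_minus(1) mult_ac)
  finally show "(LINT x|lborel. U j x * U k x * phys_partial k (test_field q i) j x)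
    = - Re (LINT \<xi>|lborel. of_real (proj \<xi> i j) * (\<i> * of_real (\<xi> $ k) * flux U j k \<xi>) * wave q \<xi>)" by simp
qed

context stationary
begin

text \<open>The residual of the projected equation, multiplied by \<open>w\<close>, is integrable
  against all waves. The tests make these integrals vanish for a dense set of \<open>q\<close>;
  injectivity of the transform turns this into a pointwise identity.\<close>

theorem fourier_solution:
  assumes herm: "AE \<xi> in lborel. \<forall>j. gf (- \<xi>) $ j = cnj (gf \<xi> $ j)"
    and sol: "AE \<xi> in lborel. (\<Sum>j\<in>UNIV. of_real (\<xi> $ j) * gf \<xi> $ j) = 0"
  shows "\<exists>g U. sq_integrable lborel (\<lambda>\<xi>. h \<xi> *\<^sub>R g \<xi>) \<and> norm (abs_l2 (\<lambda>\<xi>. h \<xi> *\<^sub>R g \<xi>)) \<le> \<rho> \<and>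
    (AE \<xi> in lborel. (\<Sum>j\<in>UNIV. of_real (\<xi> $ j) * g \<xi> $ j) = 0) \<and>
    (\<forall>j. inverse_transform (U j) (\<lambda>\<xi>. g \<xi> $ j / of_real c0)) \<and>
    (\<forall>i. AE \<xi> in lborel. of_real (\<nu> * norm \<xi> powr \<alpha> + \<gamma>) * g \<xi> $ i
       + of_real (inverse (w \<xi>)) * (\<Sum>j\<in>UNIV. \<Sum>k\<in>UNIV. of_real (proj \<xi> i j) * (\<i> * of_real (\<xi> $ k) * flux U j k \<xi>))
       = gf \<xi> $ i)"
proof -
  obtain D :: "(real^3) set" where D: "countable D" "\<And>X. open X \<Longrightarrow> X \<noteq> {} \<Longrightarrow> \<exists>d\<in>D. d \<in> X"
    using countable_dense_exists by blast
  let ?N = "D \<times> (UNIV :: 3 set)"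
  have N: "countable ?N" "?N \<noteq> {}" using D(1) D(2)[of UNIV] by auto
  \<comment> \<open>A single enumeration of all pairs of a wave vector and a component provides the
    increasing sequence of Galerkin spaces.\<close>
  let ?e = "\<lambda>l. case from_nat_into ?N l of (q, i) \<Rightarrow> test_field q i"
  have "admissible (?e l)" for l by (simp add: admissible_test_field split: prod.split)
  from galerkin_limit[of ?e, OF this] obtain g U where
    sg: "sq_integrable lborel (\<lambda>\<xi>. h \<xi> *\<^sub>R g \<xi>)" and ng: "norm (abs_l2 (\<lambda>\<xi>. h \<xi> *\<^sub>R g \<xi>)) \<le> \<rho>"
    and hg: "AE \<xi> in lborel. \<forall>j. g (- \<xi>) $ j = cnj (g \<xi> $ j)"
    and dg: "AE \<xi> in lborel. (\<Sum>j\<in>UNIV. of_real (\<xi> $ j) * g \<xi> $ j) = 0"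
    and U: "\<forall>j. inverse_transform (U j) (\<lambda>\<xi>. g \<xi> $ j / of_real c0)"
    and eq: "\<forall>l. energy g (?e l) - (\<Sum>j\<in>UNIV. \<Sum>k\<in>UNIV. LINT x|lborel. U j x * U k x * phys_partial k (?e l) j x) = force (?e l)"
    by (elim exE conjE) (rule that; assumption)
  have sU: "sq_integrable lborel (U j)" for j using U by (simp add: inverse_transform_def)
  have sgj: "sq_integrable lborel (\<lambda>\<xi>. g \<xi> $ j)" for j
    by (rule sq_integrable_unweighted[OF sg moderate_measurable[OF moderate_h] h_ge_1])
  have sgf: "sq_integrable lborel (\<lambda>\<xi>. gf \<xi> $ j)" for j
    by (rule sq_integrable_unweighted[OF gf]) (use \<beta> in \<open>auto intro!: ge_one_powr_ge_zero\<close>)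
  define R where "R i \<xi> = (\<Sum>j\<in>UNIV. of_real (proj \<xi> i j) * (of_real (W \<xi>) * g \<xi> $ j)
    - of_real (proj \<xi> i j) * (of_real (w \<xi>) * gf \<xi> $ j)
    + (\<Sum>k\<in>UNIV. of_real (proj \<xi> i j) * (\<i> * of_real (\<xi> $ k) * flux U j k \<xi>)))" for i \<xi>
  note I1 = integrable_proj_wave[OF sgj moderate_W] and I2 = integrable_proj_wave[OF sgf moderate_w]
    and I3 = convection_test_field(1)[where U=U, OF sU]
  have Rw: "R i \<xi> * wave q \<xi> = (\<Sum>j\<in>UNIV. of_real (proj \<xi> i j) * (of_real (W \<xi>) * g \<xi> $ j) * wave q \<xi>
    - of_real (proj \<xi> i j) * (of_real (w \<xi>) * gf \<xi> $ j) * wave q \<xi>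
    + (\<Sum>k\<in>UNIV. of_real (proj \<xi> i j) * (\<i> * of_real (\<xi> $ k) * flux U j k \<xi>) * wave q \<xi>))" for i q \<xi>
    unfolding R_def by (simp only: sum_distrib_right distrib_right left_diff_distrib)
  have iR: "integrable lborel (\<lambda>\<xi>. R i \<xi> * wave q \<xi>)" for i q
    unfolding Rw by (intro Bochner_Integration.integrable_sum Bochner_Integration.integrable_add Bochner_Integration.integrable_diff I1 I2 I3)
  have ReR: "Re (LINT \<xi>|lborel. R i \<xi> * wave q \<xi>) = 0" if q: "q \<in> D" for i q
  proof -
    obtain l where "from_nat_into ?N l = (q, i)" using q from_nat_into_surj[OF N(1), of "(q, i)"] by auto
    then have "energy g (test_field q i) - (\<Sum>j\<in>UNIV. \<Sum>k\<in>UNIV. LINT x|lborel. U j x * U k x * phys_partial k (test_field q i) j x)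
        - force (test_field q i) = 0" using eq[rule_format, of l] by simp
    moreover have "(LINT \<xi>|lborel. R i \<xi> * wave q \<xi>) = (\<Sum>j\<in>UNIV.
        (LINT \<xi>|lborel. of_real (proj \<xi> i j) * (of_real (W \<xi>) * g \<xi> $ j) * wave q \<xi>)
        - (LINT \<xi>|lborel. of_real (proj \<xi> i j) * (of_real (w \<xi>) * gf \<xi> $ j) * wave q \<xi>)
        + (\<Sum>k\<in>UNIV. LINT \<xi>|lborel. of_real (proj \<xi> i j) * (\<i> * of_real (\<xi> $ k) * flux U j k \<xi>) * wave q \<xi>))"
      unfolding Rw
      by (subst Bochner_Integration.integral_sum Bochner_Integration.integral_add Bochner_Integration.integral_diff;
          (intro Bochner_Integration.integrable_sum Bochner_Integration.integrable_add Bochner_Integration.integrable_diff I1 I2 I3)?)+ (rule refl)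
    ultimately show ?thesis
      unfolding energy_def force_def pairing_test_field[OF sgj moderate_W] pairing_test_field[OF sgf moderate_w]
        convection_test_field(2)[where U=U, OF sU]
      by (simp add: sum.distrib sum_subtractf sum_negf)
  qed
  have hR: "AE \<xi> in lborel. R i (- \<xi>) = cnj (R i \<xi>)" for i
    using hg herm
  proof eventually_elim
    case (elim \<xi>)
    have "W (- \<xi>) = W \<xi>" "w (- \<xi>) = w \<xi>" by (simp_all add: W_def w_def)
    with elim show ?case unfolding R_def by (simp add: flux_minus)
  qed
  \<comment> \<open>The Galerkin equations are real and give only the real part of the integral. The
    residual is Hermitian, as is \<open>wave q\<close>, so the integral is real.\<close>
  have realR: "Im (LINT \<xi>|lborel. R i \<xi> * wave q \<xi>) = 0" for i q
  proof -
    have "(LINT \<xi>|lborel. R i \<xi> * wave q \<xi>) = (LINT \<xi>|lborel. R i (- \<xi>) * wave q (- \<xi>))"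
      by (rule integral_lborel_reflect[symmetric])
    also have "\<dots> = (LINT \<xi>|lborel. cnj (R i \<xi> * wave q \<xi>))"
    proof (rule integral_cong_AE)
      have [measurable]: "(\<lambda>\<xi>. R i \<xi> * wave q \<xi>) \<in> borel_measurable borel" using borel_measurable_integrable[OF iR] by simp
      have "(\<lambda>\<xi>. R i (- \<xi>) * wave q (- \<xi>)) = (\<lambda>\<xi>. R i \<xi> * wave q \<xi>) \<circ> uminus" by auto
      then show "(\<lambda>\<xi>. R i (- \<xi>) * wave q (- \<xi>)) \<in> borel_measurable lborel" by (auto intro!: measurable_comp[of uminus borel borel])
      show "(\<lambda>\<xi>. cnj (R i \<xi> * wave q \<xi>)) \<in> borel_measurable lborel"
        by (rule borel_measurable_cnj[OF borel_measurable_integrable[OF iR]])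
      show "AE \<xi> in lborel. R i (- \<xi>) * wave q (- \<xi>) = cnj (R i \<xi> * wave q \<xi>)"
        using hR[of i] by eventually_elim (simp add: wave_minus)
    qed
    also have "\<dots> = cnj (LINT \<xi>|lborel. R i \<xi> * wave q \<xi>)" by (rule Bochner_Integration.integral_cnj)
    finally have "(LINT \<xi>|lborel. R i \<xi> * wave q \<xi>) = cnj (LINT \<xi>|lborel. R i \<xi> * wave q \<xi>)" .
    then show ?thesis by (simp add: complex_eq_iff)
  qed
  have R0: "AE \<xi> in lborel. R i \<xi> * wave 0 \<xi> = 0" for i
  proof (rule ift_eq_0_imp_AE_eq_0[OF iR])
    let ?F = "ift (\<lambda>\<xi>. R i \<xi> * wave 0 \<xi>)"
    have F: "?F q = (LINT \<xi>|lborel. R i \<xi> * wave q \<xi>)" for q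
      unfolding ift_def wave_def by (simp add: mult_ac)
    \<comment> \<open>The transform is continuous, so vanishing on the dense set extends to all
      \<open>q\<close>.\<close>
    have "open {q. ?F q \<noteq> 0}"
      using continuous_ift[OF iR, of UNIV i 0] by (intro open_Collect_neq continuous_on_const)
    moreover have "?F q = 0" if "q \<in> D" for q
      unfolding F using ReR[OF that] realR by (simp add: complex_eq_iff)
    ultimately show "?F x = 0" for x using D(2)[of "{q. ?F q \<noteq> 0}"] by blast
  qed
  have "AE \<xi> in lborel. of_real (\<nu> * norm \<xi> powr \<alpha> + \<gamma>) * g \<xi> $ i
       + of_real (inverse (w \<xi>)) * (\<Sum>j\<in>UNIV. \<Sum>k\<in>UNIV. of_real (proj \<xi> i j) * (\<i> * of_real (\<xi> $ k) * flux U j k \<xi>))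
       = gf \<xi> $ i" for i
    using R0[of i] dg sol
  proof eventually_elim
    case (elim \<xi>)
    let ?S = "\<Sum>j\<in>UNIV. \<Sum>k\<in>UNIV. of_real (proj \<xi> i j) * (\<i> * of_real (\<xi> $ k) * flux U j k \<xi>)"
    \<comment> \<open>The projection acts as the identity on the linear term and on the force, both
      solenoidal; it remains only in the convection term.\<close>
    have "R i \<xi> = of_real (W \<xi>) * (\<Sum>j\<in>UNIV. of_real (proj \<xi> i j) * g \<xi> $ j)
        - of_real (w \<xi>) * (\<Sum>j\<in>UNIV. of_real (proj \<xi> i j) * gf \<xi> $ j) + ?S"
      unfolding R_def sum.distrib sum_subtractf by (simp only: sum_distrib_left mult.left_commute)
    also have "\<dots> = of_real (W \<xi>) * g \<xi> $ i - of_real (w \<xi>) * gf \<xi> $ i + ?S"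
      unfolding proj_apply_solenoidal[OF elim(2)] proj_apply_solenoidal[OF elim(3)] ..
    finally have "of_real (W \<xi>) * g \<xi> $ i - of_real (w \<xi>) * gf \<xi> $ i + ?S = 0"
      using elim(1) by (auto simp: wave_def)
    moreover have "of_real (W \<xi>) * g \<xi> $ i - of_real (w \<xi>) * gf \<xi> $ i + ?S
      = of_real (w \<xi>) * ((of_real (\<nu> * norm \<xi> powr \<alpha> + \<gamma>) * g \<xi> $ i + of_real (inverse (w \<xi>)) * ?S) - gf \<xi> $ i)"
    proof -
      have "of_real (w \<xi>) * (of_real (inverse (w \<xi>)) * ?S) = ?S" using w_pos[of \<xi>] by simp
      then show ?thesis unfolding W_def right_diff_distrib distrib_left[of _ _ "of_real (inverse (w \<xi>)) * ?S"] of_real_mult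
        by (simp only: mult.assoc) (rule diff_add_eq)
    qed
    ultimately show ?case using w_pos[of \<xi>] by simp
  qed
  with sg ng dg U show ?thesis by blast
qed

end

section \<open>Fourier transforms of square-integrable fields\<close>

text \<open>The definitions of the spaces use \<open>lebesgue\<close>, while Fubini's theorem and
  the type \<open>l2\<close> are used over \<open>lborel\<close>; passing to a Borel version
  connects the two.\<close>

lemma lebesgue_borel_version:
  fixes g :: "'a::euclidean_space \<Rightarrow> 'b::euclidean_space"
  assumes "g \<in> borel_measurable lebesgue"
  shows "\<exists>g'\<in>borel_measurable lborel. AE x in lborel. g x = g' x"
proof -
  have "\<forall>b. \<exists>t. t \<in> borel_measurable lborel \<and> (AE x in lborel. g x \<bullet> b = t x)"
    using completion_ex_borel_measurable_real[OF borel_measurable_inner[OF assms borel_measurable_const]] by blast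
  then obtain t where t: "\<And>b. t b \<in> borel_measurable lborel" "\<And>b. AE x in lborel. g x \<bullet> b = t b x" by metis
  have "AE x in lborel. \<forall>b\<in>Basis. g x \<bullet> b = t b x" by (rule AE_finite_allI) (auto intro: t)
  then have "AE x in lborel. g x = (\<Sum>b\<in>Basis. t b x *\<^sub>R b)"
  proof eventually_elim
    case (elim x)
    then show ?case using euclidean_representation[of "g x"] by simp
  qed
  moreover have "(\<lambda>x. \<Sum>b\<in>Basis. t b x *\<^sub>R b) \<in> borel_measurable lborel"
    by (intro borel_measurable_sum borel_measurable_scaleR t borel_measurable_const)
  ultimately show ?thesis by (rule bexI)
qed

lemma integral_lebesgue_eq_lborel_if_AE:
  fixes f :: "'a::euclidean_space \<Rightarrow> 'b::{banach, second_countable_topology}"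
  assumes "f \<in> borel_measurable lebesgue" "f' \<in> borel_measurable lborel" "AE x in lborel. f x = f' x"
  shows "(LINT x|lebesgue. f x) = (LINT x|lborel. f' x)"
proof -
  have "(LINT x|lebesgue. f x) = (LINT x|lebesgue. f' x)"
    using assms by (intro integral_cong_AE) (auto intro: measurable_completion AE_completion)
  then show ?thesis using integral_completion[OF assms(2)] by simp
qed

lemma in_L2_if_sq_integrable: "sq_integrable lborel g \<Longrightarrow> in_L2 g"
proof -
  assume g: "sq_integrable lborel g"
  have "(\<lambda>x. (norm (g x))\<^sup>2) \<in> borel_measurable lborel"
    by (intro borel_measurable_power measurable_compose[OF sq_integrable_measurable[OF g] borel_measurable_norm])
  then have "integrable lebesgue (\<lambda>x. (norm (g x))\<^sup>2)"
    using g by (intro integrable_completion[THEN iffD2]) (auto simp only: sq_integrable_def)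
  then show "in_L2 g"
    unfolding in_L2_def using measurable_completion[OF sq_integrable_measurable[OF g]] by (intro conjI)
qed

lemma L2_norm_eq:
  fixes g g' :: "real^3 \<Rightarrow> complex^3"
  assumes g: "g \<in> borel_measurable lebesgue" and g': "sq_integrable lborel g'" and ae: "AE x in lborel. g x = g' x"
  shows "L2_norm g = norm (abs_l2 g')"
proof -
  have "(LINT x|lebesgue. (norm (g x))\<^sup>2) = (LINT x|lborel. (norm (g' x))\<^sup>2)"
  proof (rule integral_lebesgue_eq_lborel_if_AE)
    show "AE x in lborel. (norm (g x))\<^sup>2 = (norm (g' x))\<^sup>2" using ae by eventually_elim simp
  qed (use g sq_integrable_measurable[OF g'] in measurable)
  also have "\<dots> = (norm (abs_l2 g'))\<^sup>2" by (rule norm_abs_l2_square[OF g', symmetric])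
  finally show ?thesis by (simp add: L2_norm_def)
qed

lemma in_L2_version:
  fixes g :: "real^3 \<Rightarrow> complex^3"
  assumes g: "in_L2 g" and g': "g' \<in> borel_measurable lborel" and ae: "AE x in lborel. g x = g' x"
  shows "sq_integrable lborel g'"
proof -
  have "integrable lebesgue (\<lambda>x. (norm (g' x))\<^sup>2)"
  proof (rule integrable_cong_AE_imp)
    show "integrable lebesgue (\<lambda>x. (norm (g x))\<^sup>2)" using g by (simp add: in_L2_def)
    show "(\<lambda>x. (norm (g' x))\<^sup>2) \<in> borel_measurable lebesgue" by (intro measurable_completion borel_measurable_power measurable_compose[OF g' borel_measurable_norm])
    show "AE x in lebesgue. (norm (g x))\<^sup>2 = (norm (g' x))\<^sup>2"
      using AE_completion[OF ae] by eventually_elim simp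
  qed
  moreover have "(\<lambda>x. (norm (g' x))\<^sup>2) \<in> borel_measurable lborel"
    by (intro borel_measurable_power measurable_compose[OF g' borel_measurable_norm])
  ultimately have "integrable lborel (\<lambda>x. (norm (g' x))\<^sup>2)" by (simp only: integrable_completion)
  then show ?thesis using g' by (simp only: sq_integrable_def)
qed

text \<open>The Borel form of \<open>is_fourier_L2\<close>. Only the transform is required to be
  Borel; the field itself stays Lebesgue measurable, hence the two different measures.\<close>

definition transform_of :: "(real^3 \<Rightarrow> real^3) \<Rightarrow> (real^3 \<Rightarrow> complex^3) \<Rightarrow> bool" where
  "transform_of u g \<longleftrightarrow> sq_integrable lborel g \<and>
     (\<forall>i \<phi>. schwartz \<phi> \<longrightarrow>
        (LINT \<xi>|lborel. g \<xi> $ i * \<phi> \<xi>) = (LINT x|lebesgue. of_real (u x $ i) * fourier \<phi> x))"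

lemma is_fourier_L2_version:
  assumes g: "is_fourier_L2 u g" and g': "g' \<in> borel_measurable lborel" and ae: "AE \<xi> in lborel. g \<xi> = g' \<xi>"
  shows "transform_of u g'"
  unfolding transform_of_def
proof (intro conjI allI impI)
  show s: "sq_integrable lborel g'" using in_L2_version[OF _ g' ae] g by (simp add: is_fourier_L2_def)
  fix i \<phi> assume \<phi>: "schwartz \<phi>"
  have m: "g \<in> borel_measurable lebesgue" using g by (simp add: is_fourier_L2_def in_L2_def)
  have "(LINT \<xi>|lebesgue. g \<xi> $ i * \<phi> \<xi>) = (LINT \<xi>|lborel. g' \<xi> $ i * \<phi> \<xi>)"
  proof (rule integral_lebesgue_eq_lborel_if_AE)
    show "(\<lambda>\<xi>. g \<xi> $ i * \<phi> \<xi>) \<in> borel_measurable lebesgue"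
      using schwartz_measurable[OF \<phi>] by (intro borel_measurable_times measurable_vec3_nth[OF m] measurable_completion) simp
    show "(\<lambda>\<xi>. g' \<xi> $ i * \<phi> \<xi>) \<in> borel_measurable lborel"
      using schwartz_measurable[OF \<phi>] by (intro borel_measurable_times measurable_vec3_nth[OF g']) simp
    show "AE \<xi> in lborel. g \<xi> $ i * \<phi> \<xi> = g' \<xi> $ i * \<phi> \<xi>" using ae by eventually_elim simp
  qed
  then show "(LINT \<xi>|lborel. g' \<xi> $ i * \<phi> \<xi>) = (LINT x|lebesgue. of_real (u x $ i) * fourier \<phi> x)"
    using g \<phi> by (simp add: is_fourier_L2_def)
qed

lemma is_fourier_L2_if_transform_of:
  assumes u: "in_L2 u" and g: "transform_of u g" shows "is_fourier_L2 u g"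
  unfolding is_fourier_L2_def
proof (intro conjI allI impI u)
  have s: "sq_integrable lborel g" using g by (simp add: transform_of_def)
  then show "in_L2 g" by (rule in_L2_if_sq_integrable)
  fix i \<phi> assume \<phi>: "schwartz \<phi>"
  have "(\<lambda>\<xi>. g \<xi> $ i * \<phi> \<xi>) \<in> borel_measurable lborel"
    using schwartz_measurable[OF \<phi>] by (intro borel_measurable_times measurable_vec3_nth sq_integrable_measurable[OF s]) simp
  then show "(LINT \<xi>|lebesgue. g \<xi> $ i * \<phi> \<xi>) = (LINT x|lebesgue. of_real (u x $ i) * fourier \<phi> x)"
    using g \<phi> by (simp add: transform_of_def integral_completion)
qed

lemma AE_eq_if_schwartz_integrals_eq:
  assumes a: "sq_integrable lborel a" and b: "sq_integrable lborel b"
    and eq: "\<And>\<phi>. schwartz \<phi> \<Longrightarrow> (LINT \<xi>|lborel. a \<xi> * \<phi> \<xi>) = (LINT \<xi>|lborel. b \<xi> * \<phi> \<xi>)"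
  shows "AE \<xi> in lborel. a \<xi> = (b \<xi> :: complex)"
proof -
  have "AE \<xi> in lborel. a \<xi> - b \<xi> = 0"
  proof (rule AE_eq_0_if_schwartz_integrals_eq_0)
    show "integrable lborel (\<lambda>\<xi>. wave 0 \<xi> * (a \<xi> - b \<xi>))"
      by (rule norm_integral_mult_le(1)[OF rapid_sq_integrable[OF rapid_wave] sq_integrable_diff[OF a b]])
    fix \<phi> :: "real^3 \<Rightarrow> complex" assume \<phi>: "schwartz \<phi>"
    note s = rapid_sq_integrable[OF schwartz_rapid[OF \<phi>]]
    show "(LINT \<xi>|lborel. (a \<xi> - b \<xi>) * \<phi> \<xi>) = 0"
      using eq[OF \<phi>] norm_integral_mult_le(1)[OF a s] norm_integral_mult_le(1)[OF b s]
      by (simp add: left_diff_distrib)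
  qed
  then show ?thesis by eventually_elim simp
qed

lemma transform_of_unique:
  assumes a: "transform_of u a" and b: "transform_of u b"
  shows "AE \<xi> in lborel. a \<xi> = b \<xi>"
proof -
  have "AE \<xi> in lborel. a \<xi> $ j = b \<xi> $ j" for j
    using a b by (intro AE_eq_if_schwartz_integrals_eq sq_integrable_vec3_nth) (auto simp: transform_of_def)
  then have "AE \<xi> in lborel. \<forall>j\<in>UNIV. a \<xi> $ j = b \<xi> $ j" by (intro AE_finite_allI) auto
  then show ?thesis by eventually_elim (simp add: vec_eq_iff)
qed

text \<open>\<open>fourier_L2\<close> is an arbitrary choice, but two transforms of the same field
  agree almost everywhere, so any transform computes the norm.\<close>

lemma sobolev_transform:
  fixes g :: "real^3 \<Rightarrow> complex^3"
  assumes u: "in_L2 u" and g: "transform_of u g"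
    and w: "sq_integrable lborel (\<lambda>\<xi>. (1 + (norm \<xi>)\<^sup>2) powr (s / 2) *\<^sub>R g \<xi>)"
  shows "sobolev s u"
    and "sobolev_norm s u = (2 * pi) powr (- 3 / 2) * norm (abs_l2 (\<lambda>\<xi>. (1 + (norm \<xi>)\<^sup>2) powr (s / 2) *\<^sub>R g \<xi>))"
proof -
  note f = is_fourier_L2_if_transform_of[OF u g]
  show "sobolev s u"
    unfolding sobolev_def using u f in_L2_if_sq_integrable[OF w] unfolding bessel_weight_def by blast
  have F: "is_fourier_L2 u (fourier_L2 u)" unfolding fourier_L2_def by (rule someI[of "is_fourier_L2 u", OF f])
  have m: "fourier_L2 u \<in> borel_measurable lebesgue" using F by (simp add: is_fourier_L2_def in_L2_def)
  obtain g' where g': "g' \<in> borel_measurable lborel" "AE \<xi> in lborel. fourier_L2 u \<xi> = g' \<xi>"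
    using lebesgue_borel_version[OF m] by blast
  have "L2_norm (bessel_weight s (fourier_L2 u)) = norm (abs_l2 (\<lambda>\<xi>. (1 + (norm \<xi>)\<^sup>2) powr (s / 2) *\<^sub>R g \<xi>))"
  proof (rule L2_norm_eq[OF _ w])
    have "(\<lambda>\<xi>::real^3. (1 + (norm \<xi>)\<^sup>2) powr (s / 2)) \<in> borel_measurable lborel" by measurable
    then show "bessel_weight s (fourier_L2 u) \<in> borel_measurable lebesgue"
      unfolding bessel_weight_def by (intro borel_measurable_scaleR m measurable_completion)
    show "AE x in lborel. bessel_weight s (fourier_L2 u) x = (1 + (norm x)\<^sup>2) powr (s / 2) *\<^sub>R g x"
      using g'(2) transform_of_unique[OF is_fourier_L2_version[OF F g'] g]
      by eventually_elim (simp add: bessel_weight_def)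
  qed
  then show "sobolev_norm s u = (2 * pi) powr (- 3 / 2) * norm (abs_l2 (\<lambda>\<xi>. (1 + (norm \<xi>)\<^sup>2) powr (s / 2) *\<^sub>R g \<xi>))"
    by (simp add: sobolev_norm_def)
qed

lemma sobolev_transform_exists:
  assumes "sobolev s u"
  shows "\<exists>g. transform_of u g \<and> sq_integrable lborel (\<lambda>\<xi>. (1 + (norm \<xi>)\<^sup>2) powr (s / 2) *\<^sub>R g \<xi>)"
proof -
  obtain g where g: "is_fourier_L2 u g" "in_L2 (bessel_weight s g)" using assms by (auto simp: sobolev_def)
  then have "g \<in> borel_measurable lebesgue" by (simp add: is_fourier_L2_def in_L2_def)
  then obtain g' where g': "g' \<in> borel_measurable lborel" "AE \<xi> in lborel. g \<xi> = g' \<xi>"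
    using lebesgue_borel_version by blast
  have "sq_integrable lborel (\<lambda>\<xi>. (1 + (norm \<xi>)\<^sup>2) powr (s / 2) *\<^sub>R g' \<xi>)"
  proof (rule in_L2_version[OF g(2)])
    show "(\<lambda>\<xi>. (1 + (norm \<xi>)\<^sup>2) powr (s / 2) *\<^sub>R g' \<xi>) \<in> borel_measurable lborel" using g'(1) by measurable
    show "AE \<xi> in lborel. bessel_weight s g \<xi> = (1 + (norm \<xi>)\<^sup>2) powr (s / 2) *\<^sub>R g' \<xi>"
      using g'(2) by eventually_elim (simp add: bessel_weight_def)
  qed
  then show ?thesis using is_fourier_L2_version[OF g(1) g'] by blast
qed

section \<open>Reality and divergence on the Fourier side\<close>

lemma fourier_reflect_cnj:
  assumes "schwartz \<phi>" shows "fourier (\<lambda>\<xi>. cnj (\<phi> (- \<xi>))) x = cnj (fourier \<phi> x)"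
proof -
  have "schwartz (\<lambda>\<xi>. cnj (\<phi> (- \<xi>)))" by (intro schwartz_cnj schwartz_reflect assms)
  then show ?thesis
    using ift_cnj[of "\<lambda>\<xi>. \<phi> (- \<xi>)" "- x"] ift_reflect[of \<phi> x]
    by (simp add: fourier_eq_ift schwartz_measurable assms)
qed

text \<open>The field is real-valued, so conjugating its pairing with a test function amounts to
  conjugating and reflecting the test function on the Fourier side.\<close>

lemma transform_of_hermitian:
  assumes g: "transform_of u g"
  shows "AE \<xi> in lborel. \<forall>j. g (- \<xi>) $ j = cnj (g \<xi> $ j)"
proof -
  have s: "sq_integrable lborel (\<lambda>\<xi>. g \<xi> $ j)" for j
    using g by (auto simp: transform_of_def intro: sq_integrable_vec3_nth)
  have cm: "(\<lambda>\<xi>. cnj (g \<xi> $ j)) \<in> borel_measurable lborel" for j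
    by (rule borel_measurable_cnj[OF sq_integrable_measurable[OF s]])
  have "AE \<xi> in lborel. g (- \<xi>) $ j = cnj (g \<xi> $ j)" for j
  proof (rule AE_eq_if_schwartz_integrals_eq)
    show "sq_integrable lborel (\<lambda>\<xi>. g (- \<xi>) $ j)"
      using s[of j] integrable_lborel_reflect_iff[of "\<lambda>\<xi>. (cmod (g \<xi> $ j))\<^sup>2"]
        measurable_compose[of uminus borel borel "\<lambda>\<xi>. g \<xi> $ j" borel]
      by (simp add: sq_integrable_def)
    show "sq_integrable lborel (\<lambda>\<xi>. cnj (g \<xi> $ j))" using s[of j] cm[of j] by (simp add: sq_integrable_def)
    fix \<phi> :: "real^3 \<Rightarrow> complex" assume \<phi>: "schwartz \<phi>"
    have \<phi>': "schwartz (\<lambda>\<xi>. cnj (\<phi> (- \<xi>)))" by (intro schwartz_cnj schwartz_reflect \<phi>)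
    have "(LINT \<xi>|lborel. g (- \<xi>) $ j * \<phi> \<xi>) = (LINT \<xi>|lborel. g \<xi> $ j * \<phi> (- \<xi>))"
      using integral_lborel_reflect[of "\<lambda>\<xi>. g \<xi> $ j * \<phi> (- \<xi>)"] by simp
    also have "\<dots> = (LINT x|lebesgue. of_real (u x $ j) * fourier (\<lambda>\<xi>. \<phi> (- \<xi>)) x)"
      using g schwartz_reflect[OF \<phi>] by (simp add: transform_of_def)
    also have "\<dots> = (LINT x|lebesgue. cnj (of_real (u x $ j) * fourier (\<lambda>\<xi>. cnj (\<phi> \<xi>)) x))"
      using fourier_reflect_cnj[OF schwartz_cnj[OF \<phi>]] by simp
    also have "\<dots> = cnj (LINT x|lebesgue. of_real (u x $ j) * fourier (\<lambda>\<xi>. cnj (\<phi> \<xi>)) x)"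
      by (rule Bochner_Integration.integral_cnj)
    also have "\<dots> = cnj (LINT \<xi>|lborel. g \<xi> $ j * cnj (\<phi> \<xi>))"
      using g schwartz_cnj[OF \<phi>] by (simp add: transform_of_def)
    also have "\<dots> = (LINT \<xi>|lborel. cnj (g \<xi> $ j) * \<phi> \<xi>)"
      by (subst Bochner_Integration.integral_cnj[symmetric]) simp
    finally show "(LINT \<xi>|lborel. g (- \<xi>) $ j * \<phi> \<xi>) = (LINT \<xi>|lborel. cnj (g \<xi> $ j) * \<phi> \<xi>)" .
  qed
  then have "AE \<xi> in lborel. \<forall>j\<in>UNIV. g (- \<xi>) $ j = cnj (g \<xi> $ j)" by (intro AE_finite_allI) auto
  then show ?thesis by simp
qed

lemma partial_fourier:
  assumes \<phi>: "schwartz \<phi>"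
  shows "partial j (fourier \<phi>) = fourier (\<lambda>\<xi>. - \<i> * (of_real (\<xi> $ j) * \<phi> \<xi>))"
proof -
  have s: "schwartz (\<lambda>\<xi>. - \<i> * (of_real (\<xi> $ j) * \<phi> \<xi>))" by (intro schwartz_cmult schwartz_component \<phi>)
  have r: "rapid (\<lambda>\<xi>. \<phi> (- \<xi>))" by (intro schwartz_rapid schwartz_reflect \<phi>)
  have "fourier \<phi> = ift (\<lambda>\<xi>. \<phi> (- \<xi>))"
    using ift_reflect[of \<phi>] by (auto simp: fourier_eq_ift schwartz_measurable \<phi>)
  then have "partial j (fourier \<phi>) = ift (\<lambda>\<xi>. \<i> * of_real (\<xi> $ j) * \<phi> (- \<xi>))"
    by (simp only: partial_ift[OF rapid_integrable[OF r] rapid_norm_power_integrable[OF r]])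
  also have "\<dots> = fourier (\<lambda>\<xi>. - \<i> * (of_real (\<xi> $ j) * \<phi> \<xi>))"
  proof
    show "ift (\<lambda>\<xi>. \<i> * of_real (\<xi> $ j) * \<phi> (- \<xi>)) x = fourier (\<lambda>\<xi>. - \<i> * (of_real (\<xi> $ j) * \<phi> \<xi>)) x" for x
      unfolding fourier_eq_ift[OF schwartz_measurable[OF s]]
      using ift_reflect[of "\<lambda>\<xi>. - \<i> * (of_real (\<xi> $ j) * \<phi> \<xi>)" x] by (simp add: mult.assoc)
  qed
  finally show ?thesis .
qed

lemma div_transform:
  assumes g: "transform_of u g" and \<phi>: "schwartz \<phi>"
  shows "div_distr (vdistr_of u) (fourier \<phi>) = (LINT \<xi>|lborel. (\<Sum>j\<in>UNIV. of_real (\<xi> $ j) * g \<xi> $ j) * (\<i> * \<phi> \<xi>))"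
proof -
  have s: "schwartz (\<lambda>\<xi>. - \<i> * (of_real (\<xi> $ j) * \<phi> \<xi>))" for j by (intro schwartz_cmult schwartz_component \<phi>)
  have i: "integrable lborel (\<lambda>\<xi>. g \<xi> $ j * (- \<i> * (of_real (\<xi> $ j) * \<phi> \<xi>)))" for j
    using g by (intro norm_integral_mult_le(1) rapid_sq_integrable schwartz_rapid s sq_integrable_vec3_nth)
      (simp add: transform_of_def)
  have "div_distr (vdistr_of u) (fourier \<phi>) = (\<Sum>j\<in>UNIV. - (LINT \<xi>|lborel. g \<xi> $ j * (- \<i> * (of_real (\<xi> $ j) * \<phi> \<xi>))))"
  proof -
    have "(LINT x|lebesgue. of_real (u x $ j) * fourier (\<lambda>\<xi>. - \<i> * (of_real (\<xi> $ j) * \<phi> \<xi>)) x)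
        = (LINT \<xi>|lborel. g \<xi> $ j * (- \<i> * (of_real (\<xi> $ j) * \<phi> \<xi>)))" for j
      by (rule conjunct2[OF g[unfolded transform_of_def], rule_format, OF s, symmetric])
    then show ?thesis
      unfolding div_distr_def partial_distr_def vdistr_of_def distr_of_def partial_fourier[OF \<phi>] vec_lambda_beta by simp
  qed
  also have "\<dots> = (LINT \<xi>|lborel. (\<Sum>j\<in>UNIV. - (g \<xi> $ j * (- \<i> * (of_real (\<xi> $ j) * \<phi> \<xi>)))))"
    using i by (subst Bochner_Integration.integral_sum) auto
  also have "(\<lambda>\<xi>. \<Sum>j\<in>UNIV. - (g \<xi> $ j * (- \<i> * (of_real (\<xi> $ j) * \<phi> \<xi>))))
      = (\<lambda>\<xi>. (\<Sum>j\<in>UNIV. of_real (\<xi> $ j) * g \<xi> $ j) * (\<i> * \<phi> \<xi>))"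
    unfolding sum_distrib_right by (simp add: mult_ac)
  finally show ?thesis .
qed

text \<open>The transform maps the Schwartz functions onto themselves, so testing the divergence in
  space is testing \<xi> . g on the Fourier side, and Schwartz functions separate.\<close>

lemma divergence_free_iff:
  assumes g: "transform_of u g"
  shows "divergence_free u \<longleftrightarrow> (AE \<xi> in lborel. (\<Sum>j\<in>UNIV. of_real (\<xi> $ j) * g \<xi> $ j) = 0)"
proof
  have s: "sq_integrable lborel (\<lambda>\<xi>. g \<xi> $ j)" for j
    using g by (auto simp: transform_of_def intro: sq_integrable_vec3_nth)
  have m: "(\<lambda>\<xi>. \<Sum>j\<in>UNIV. of_real (\<xi> $ j) * g \<xi> $ j) \<in> borel_measurable lborel"
  proof -
    have "(\<lambda>\<xi>::real^3. \<xi> $ j) \<in> borel_measurable lborel" for j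
      using borel_measurable_continuous_onI[of "\<lambda>\<xi>::real^3. \<xi> $ j"] by (auto intro: continuous_intros)
    from measurable_compose[OF this borel_measurable_of_real] show ?thesis
      by (intro borel_measurable_sum borel_measurable_times sq_integrable_measurable[OF s])
  qed
  show "divergence_free u" if ae: "AE \<xi> in lborel. (\<Sum>j\<in>UNIV. of_real (\<xi> $ j) * g \<xi> $ j) = 0"
    unfolding divergence_free_def
  proof (intro allI impI)
    fix \<psi> assume \<psi>: "schwartz \<psi>"
    then obtain \<phi> where \<phi>: "schwartz \<phi>" "fourier \<phi> = \<psi>" by (rule fourier_surj)
    have "(LINT \<xi>|lborel. (\<Sum>j\<in>UNIV. of_real (\<xi> $ j) * g \<xi> $ j) * (\<i> * \<phi> \<xi>)) = (LINT (\<xi>::real^3)|lborel. 0)"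
    proof (rule integral_cong_AE)
      show "(\<lambda>\<xi>. (\<Sum>j\<in>UNIV. of_real (\<xi> $ j) * g \<xi> $ j) * (\<i> * \<phi> \<xi>)) \<in> borel_measurable lborel"
        using schwartz_measurable[OF \<phi>(1)] m by (intro borel_measurable_times borel_measurable_const) auto
      show "AE \<xi> in lborel. (\<Sum>j\<in>UNIV. of_real (\<xi> $ j) * g \<xi> $ j) * (\<i> * \<phi> \<xi>) = 0"
        using ae by eventually_elim simp
    qed simp
    then show "div_distr (vdistr_of u) \<psi> = 0" using div_transform[OF g \<phi>(1)] \<phi>(2) by simp
  qed
  assume df: "divergence_free u"
  show "AE \<xi> in lborel. (\<Sum>j\<in>UNIV. of_real (\<xi> $ j) * g \<xi> $ j) = 0"
  proof (rule AE_eq_0_if_schwartz_integrals_eq_0)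
    have "integrable lborel (\<lambda>\<xi>. of_real (\<xi> $ j) * wave 0 \<xi> * g \<xi> $ j)" for j
      by (intro norm_integral_mult_le(1) rapid_sq_integrable schwartz_rapid schwartz_component schwartz_wave s)
    then have "integrable lborel (\<lambda>\<xi>. \<Sum>j\<in>UNIV. of_real (\<xi> $ j) * wave 0 \<xi> * g \<xi> $ j)"
      by (intro Bochner_Integration.integrable_sum)
    then show "integrable lborel (\<lambda>\<xi>. wave 0 \<xi> * (\<Sum>j\<in>UNIV. of_real (\<xi> $ j) * g \<xi> $ j))"
      by (simp add: sum_distrib_left mult_ac)
    fix \<phi> :: "real^3 \<Rightarrow> complex" assume \<phi>: "schwartz \<phi>"
    have c: "schwartz (\<lambda>\<xi>. - \<i> * \<phi> \<xi>)" by (intro schwartz_cmult \<phi>)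
    have "div_distr (vdistr_of u) (fourier (\<lambda>\<xi>. - \<i> * \<phi> \<xi>)) = 0"
      using df schwartz_fourier[OF c] by (simp add: divergence_free_def)
    then show "(LINT \<xi>|lborel. (\<Sum>j\<in>UNIV. of_real (\<xi> $ j) * g \<xi> $ j) * \<phi> \<xi>) = 0"
      using div_transform[OF g c] by simp
  qed
qed

section \<open>Fourier multipliers and the weak formulation\<close>

lemma fourier_multiplier_ift:
  assumes \<phi>: "schwartz \<phi>" and m: "m \<in> borel_measurable borel"
  shows "fourier_multiplier m (ift \<phi>) = ift (\<lambda>\<xi>. of_real (m \<xi>) * \<phi> \<xi>)"
proof
  fix x
  have "fourier (ift \<phi>) \<xi> = of_real ((2 * pi) ^ 3) * \<phi> \<xi>" for \<xi>
    using schwartz_inversion[OF \<phi>, of \<xi>] by (simp add: fourier_eq_ift schwartz_measurable schwartz_ift \<phi>)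
  then have "fourier_multiplier m (ift \<phi>) x
      = of_real (1 / (2 * pi) ^ 3) * ift (\<lambda>\<xi>. of_real ((2 * pi) ^ 3) * (of_real (m \<xi>) * \<phi> \<xi>)) x"
    unfolding fourier_multiplier_eq_ift[OF schwartz_ift[OF \<phi>] m] by (simp only: mult.left_commute)
  also have "\<dots> = ift (\<lambda>\<xi>. of_real (m \<xi>) * \<phi> \<xi>) x"
    unfolding ift_cmult by simp
  finally show "fourier_multiplier m (ift \<phi>) x = ift (\<lambda>\<xi>. of_real (m \<xi>) * \<phi> \<xi>) x" .
qed

lemma partial_ift_rapid: "rapid G \<Longrightarrow> partial j (ift G) = ift (\<lambda>\<xi>. \<i> * of_real (\<xi> $ j) * G \<xi>)"
  by (intro partial_ift rapid_integrable rapid_norm_power_integrable)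

text \<open>The second moment of \<open>G\<close> is the first moment of |\<xi>| G; a singularity
  like 1 / |\<xi>| at the origin therefore does not hinder differentiation.\<close>

lemma partial_ift_singular:
  fixes G :: "real^3 \<Rightarrow> complex"
  assumes "G \<in> borel_measurable borel" and r: "rapid (\<lambda>\<xi>. of_real (norm \<xi>) * G \<xi>)"
  shows "partial j (ift G) = ift (\<lambda>\<xi>. \<i> * of_real (\<xi> $ j) * G \<xi>)"
proof (rule partial_ift)
  show "integrable lborel G" using assms by (rule integrable_if_norm_mult_rapid)
  show "integrable lborel (\<lambda>\<xi>. (norm \<xi>)\<^sup>2 * cmod (G \<xi>))"
    using rapid_norm_power_integrable[OF r, of 1] by (simp add: norm_mult power2_eq_square mult.assoc)
qed

lemma tensor_div_apply:
  "(tensor_div_distr (tensor_distr V V) $ j) \<theta> = (\<Sum>k\<in>UNIV. - (LINT x|lebesgue. of_real (V x $ j * V x $ k) * partial k \<theta> x))"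
  by (simp add: tensor_div_distr_def div_distr_def partial_distr_def tensor_distr_def distr_of_def)

lemma integral_lebesgue_flux:
  assumes U: "\<And>j. sq_integrable lborel (U j)" and V: "\<And>x j. V x $ j = U j x" and H: "integrable lborel H"
  shows "(LINT x|lebesgue. of_real (V x $ j * V x $ k) * ift H x) = (LINT \<xi>|lborel. H (- \<xi>) * flux U j k \<xi>)"
proof -
  have "(\<lambda>x. of_real (U j x * U k x) * ift H x) \<in> borel_measurable lborel"
    using borel_measurable_integrable[OF flux_integrable[where U=U and j=j and k=k, OF U]] ift_measurable[OF H] by simp
  then show ?thesis unfolding V flux_pairing[where U=U, OF U H, symmetric] by (rule integral_completion)
qed

text \<open>By duality the operators act on the test function, outermost first. After the inverse
  Laplacian its transform is singular like 1 / |\<xi>| and thus no longer rapid, but it is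
  integrable, and the next derivative restores rapid decrease.\<close>

lemma leray_apply:
  assumes U: "\<And>j. sq_integrable lborel (U j)" and V: "\<And>x j. V x $ j = U j x" and \<phi>: "schwartz \<phi>"
  shows "(leray (tensor_div_distr (tensor_distr V V)) $ i) (ift \<phi>)
    = (\<Sum>j\<in>UNIV. \<Sum>k\<in>UNIV. LINT \<xi>|lborel. of_real (proj \<xi> i j) * (\<i> * of_real (\<xi> $ k) * flux U j k \<xi>) * \<phi> (- \<xi>))"
proof -
  note r = schwartz_rapid[OF \<phi>]
  note pairing = integral_lebesgue_flux[where U=U and V=V, OF U V]
  \<comment> \<open>The symbol of the gradient part: i \<xi>_j (- 1 / |\<xi>|^2) i \<xi>_i = \<xi>_i
    \<xi>_j / |\<xi>|^2.\<close>
  define q where "q j \<xi> = \<xi> $ i * \<xi> $ j / (norm \<xi>)\<^sup>2" for j and \<xi> :: "real^3"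
  have q: "q j \<xi> = (if i = j then 1 else 0) - proj \<xi> i j" for j \<xi> by (simp add: q_def proj_def)
  have qr: "rapid (\<lambda>\<xi>. of_real (q j \<xi>) * \<phi> \<xi>)" for j
  proof (rule rapid_bounded_mult[OF r])
    show "q j \<in> borel_measurable borel" unfolding q by measurable
    show "\<bar>q j \<xi>\<bar> \<le> 1 + 2" for \<xi>
      unfolding q by (rule order_trans[OF abs_triangle_ineq4]) (intro add_mono abs_proj_le, simp)
  qed
  have ikr: "rapid (\<lambda>\<xi>. \<i> * of_real (\<xi> $ k) * \<phi> \<xi>)" for k by (rule rapid_mult_component[OF r])
  have iqr: "rapid (\<lambda>\<xi>. \<i> * of_real (\<xi> $ k) * (of_real (q j \<xi>) * \<phi> \<xi>))" for j k by (rule rapid_mult_component[OF qr])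
  let ?G = "\<lambda>\<xi>. of_real (- 1 / (norm \<xi>)\<^sup>2) * (\<i> * of_real (\<xi> $ i) * \<phi> \<xi>)"
  have m: "(\<lambda>\<xi>::real^3. - 1 / (norm \<xi>)\<^sup>2) \<in> borel_measurable borel" by measurable
  have s: "schwartz (\<lambda>\<xi>. \<i> * of_real (\<xi> $ i) * \<phi> \<xi>)"
    using schwartz_cmult[OF schwartz_component[OF \<phi>, of i], of \<i>] by (simp only: mult.assoc)
  have \<eta>: "fourier_multiplier (\<lambda>\<xi>. - 1 / (norm (- \<xi>))\<^sup>2) (partial i (ift \<phi>)) = ift ?G"
    unfolding partial_ift_rapid[OF r] norm_minus_cancel by (rule fourier_multiplier_ift[OF s m])
  have d\<eta>: "partial j (ift ?G) = ift (\<lambda>\<xi>. of_real (q j \<xi>) * \<phi> \<xi>)" for j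
  proof -
    have "partial j (ift ?G) = ift (\<lambda>\<xi>. \<i> * of_real (\<xi> $ j) * ?G \<xi>)"
    proof (rule partial_ift_singular)
      have "(\<lambda>\<xi>. complex_of_real (- 1 / (norm \<xi>)\<^sup>2)) \<in> borel_measurable (borel :: (real^3) measure)"
        by (rule measurable_compose[OF m borel_measurable_of_real])
      then show "?G \<in> borel_measurable borel"
        by (rule borel_measurable_times[OF _ rapid_measurable[OF ikr]])
      have "rapid (\<lambda>\<xi>. of_real (- (\<xi> $ i) / norm \<xi>) * (\<i> * \<phi> \<xi>))"
      proof (rule rapid_bounded_mult[OF rapid_cmult[OF r]])
        show "(\<lambda>\<xi>::real^3. - (\<xi> $ i) / norm \<xi>) \<in> borel_measurable borel" by measurable
        show "\<bar>- (\<xi> $ i) / norm \<xi>\<bar> \<le> 1" for \<xi>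
          using component_le_norm_cart[of \<xi> i] by (simp add: abs_div divide_le_eq)
      qed
      moreover have "(\<lambda>\<xi>. of_real (- (\<xi> $ i) / norm \<xi>) * (\<i> * \<phi> \<xi>)) = (\<lambda>\<xi>. of_real (norm \<xi>) * ?G \<xi>)"
        by (auto simp: power2_eq_square)
      ultimately show "rapid (\<lambda>\<xi>. of_real (norm \<xi>) * ?G \<xi>)" by simp
    qed
    also have "(\<lambda>\<xi>. \<i> * of_real (\<xi> $ j) * ?G \<xi>) = (\<lambda>\<xi>. of_real (q j \<xi>) * \<phi> \<xi>)"
      by (rule ext) (simp add: q_def mult_ac)
    finally show ?thesis .
  qed
  define E where "E j k \<xi> = \<i> * of_real (\<xi> $ k) * flux U j k \<xi> * \<phi> (- \<xi>)" for j k \<xi>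
  have iE: "integrable lborel (E j k)" and iqE: "integrable lborel (\<lambda>\<xi>. of_real (q j \<xi>) * E j k \<xi>)" for j k
  proof -
    have qm: "q j (- \<xi>) = q j \<xi>" for \<xi> by (simp add: q_def)
    have "rapid (\<lambda>\<xi>. \<i> * of_real (\<xi> $ k) * \<phi> (- \<xi>))" by (intro rapid_mult_component rapid_reflect r)
    from integrable_rapid_flux[where U=U and j=j and k=k, OF U this] show "integrable lborel (E j k)"
      by (simp add: E_def[abs_def] mult_ac)
    have "rapid (\<lambda>\<xi>. \<i> * of_real (\<xi> $ k) * (of_real (q j \<xi>) * \<phi> (- \<xi>)))"
      using rapid_mult_component[OF rapid_reflect[OF qr[of j]]] by (simp add: qm)
    from integrable_rapid_flux[where U=U and j=j and k=k, OF U this] show "integrable lborel (\<lambda>\<xi>. of_real (q j \<xi>) * E j k \<xi>)"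
      by (simp add: E_def[abs_def] mult_ac)
  qed
  have E1: "(LINT \<xi>|lborel. \<i> * of_real ((- \<xi>) $ k) * \<phi> (- \<xi>) * flux U j k \<xi>) = - (LINT \<xi>|lborel. E j k \<xi>)" for j k
    unfolding Bochner_Integration.integral_minus[symmetric]
    by (intro Bochner_Integration.integral_cong refl) (simp add: E_def mult_ac)
  have E2: "(LINT \<xi>|lborel. \<i> * of_real ((- \<xi>) $ k) * (of_real (q j (- \<xi>)) * \<phi> (- \<xi>)) * flux U j k \<xi>)
      = - (LINT \<xi>|lborel. of_real (q j \<xi>) * E j k \<xi>)" for j k
    unfolding Bochner_Integration.integral_minus[symmetric]
    by (intro Bochner_Integration.integral_cong refl) (simp add: E_def q_def mult_ac)
  have 1: "(tensor_div_distr (tensor_distr V V) $ i) (ift \<phi>) = (\<Sum>k\<in>UNIV. LINT \<xi>|lborel. E i k \<xi>)"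
    unfolding tensor_div_apply partial_ift_rapid[OF r] pairing[OF rapid_integrable[OF ikr]]
    by (simp only: E1 minus_minus)
  have 2: "(grad_distr (inv_laplacian (div_distr (tensor_div_distr (tensor_distr V V)))) $ i) (ift \<phi>)
      = (\<Sum>j\<in>UNIV. \<Sum>k\<in>UNIV. LINT \<xi>|lborel. of_real (q j \<xi>) * E j k \<xi>)"
  proof -
    have "(grad_distr (inv_laplacian (div_distr (tensor_div_distr (tensor_distr V V)))) $ i) (ift \<phi>)
        = (\<Sum>j\<in>UNIV. (tensor_div_distr (tensor_distr V V) $ j) (partial j (ift ?G)))"
      unfolding \<eta>[symmetric]
      by (simp add: grad_distr_def partial_distr_def inv_laplacian_def multiplier_distr_def div_distr_def sum_negf)
    also have "\<dots> = (\<Sum>j\<in>UNIV. \<Sum>k\<in>UNIV. LINT \<xi>|lborel. of_real (q j \<xi>) * E j k \<xi>)"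
      unfolding d\<eta> tensor_div_apply partial_ift_rapid[OF qr] pairing[OF rapid_integrable[OF iqr]]
      by (simp only: E2 minus_minus)
    finally show ?thesis .
  qed
  have "(LINT \<xi>|lborel. of_real (proj \<xi> i j) * (\<i> * of_real (\<xi> $ k) * flux U j k \<xi>) * \<phi> (- \<xi>))
      = (if i = j then LINT \<xi>|lborel. E j k \<xi> else 0) - (LINT \<xi>|lborel. of_real (q j \<xi>) * E j k \<xi>)" for j k
  proof -
    have "(\<lambda>\<xi>. of_real (proj \<xi> i j) * (\<i> * of_real (\<xi> $ k) * flux U j k \<xi>) * \<phi> (- \<xi>))
        = (\<lambda>\<xi>. (if i = j then E j k \<xi> else 0) - of_real (q j \<xi>) * E j k \<xi>)"
      by (auto simp: E_def q algebra_simps)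
    then show ?thesis using iE[of j k] iqE[of j k] by simp
  qed
  moreover have "(\<Sum>j\<in>UNIV. \<Sum>k\<in>UNIV. if i = j then LINT \<xi>|lborel. E j k \<xi> else 0) = (\<Sum>k\<in>UNIV. LINT \<xi>|lborel. E i k \<xi>)"
    by (subst sum.swap) simp
  ultimately show ?thesis
    unfolding leray_def vec_lambda_beta 1 2 by (simp add: sum_subtractf)
qed

lemma in_L2_vec3:
  fixes V :: "real^3 \<Rightarrow> real^3"
  assumes "\<And>j. sq_integrable lborel (\<lambda>x. V x $ j)" shows "in_L2 V"
proof (rule in_L2_if_sq_integrable)
  have "(norm (V x))\<^sup>2 = (\<Sum>j\<in>UNIV. (norm (V x $ j))\<^sup>2)" for x
    unfolding power2_norm_eq_inner inner_vec_def by simp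
  moreover have "V \<in> borel_measurable lborel"
  proof (rule borel_measurable_euclidean_space[THEN iffD2], rule ballI)
    fix b :: "real^3" assume "b \<in> Basis"
    then obtain j where "b = axis j 1" by (auto simp: Basis_vec_def)
    then show "(\<lambda>x. V x \<bullet> b) \<in> borel_measurable lborel"
      using sq_integrable_measurable[OF assms[of j]] by (simp add: inner_axis)
  qed
  ultimately show "sq_integrable lborel V"
    using assms by (simp add: sq_integrable_def)
qed

lemma inverse_transform_pairing:
  fixes u :: "real^3 \<Rightarrow> real"
  assumes U: "inverse_transform u (\<lambda>\<xi>. g \<xi> / of_real ((2 * pi) ^ 3))"
    and g: "sq_integrable lborel g" and \<phi>: "rapid \<phi>" "continuous_on UNIV \<phi>"
  shows "(LINT x|lebesgue. of_real (u x) * ift \<phi> (- x)) = (LINT \<xi>|lborel. g \<xi> * \<phi> \<xi>)"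
proof -
  obtain B where B: "\<And>\<xi>. cmod (\<phi> \<xi>) \<le> B" using rapid_bounded[OF \<phi>(1)] by blast
  have g': "sq_integrable lborel (\<lambda>\<xi>. g \<xi> / of_real ((2 * pi) ^ 3))"
    using sq_integrable_measurable[OF g]
    by (intro sq_integrable_bound[OF g, of _ "1 / (2 * pi) ^ 3"]) (auto simp: norm_divide norm_power)
  have "u \<in> borel_measurable lborel" using U by (simp add: inverse_transform_def sq_integrable_def)
  moreover have "(\<lambda>x. ift \<phi> (- x)) \<in> borel_measurable lborel"
    using ift_measurable[OF rapid_integrable[OF \<phi>(1)]] by simp
  ultimately have "(\<lambda>x. of_real (u x) * ift \<phi> (- x)) \<in> borel_measurable lborel" by simp
  then have "(LINT x|lebesgue. of_real (u x) * ift \<phi> (- x)) = (LINT x|lborel. of_real (u x) * ift \<phi> (- x))"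
    by (rule integral_completion)
  also have "\<dots> = of_real ((2 * pi) ^ 3) * (LINT \<xi>|lborel. g \<xi> / of_real ((2 * pi) ^ 3) * \<phi> \<xi>)"
    using inverse_transform_parseval[OF U g' rapid_integrable[OF \<phi>(1)] rapid_sq_integrable[OF \<phi>(1)] \<phi>(2) B] by simp
  also have "\<dots> = (LINT \<xi>|lborel. of_real ((2 * pi) ^ 3) * (g \<xi> / of_real ((2 * pi) ^ 3) * \<phi> \<xi>))"
    by (simp only: integral_mult_right_zero)
  also have "\<dots> = (LINT \<xi>|lborel. g \<xi> * \<phi> \<xi>)" by simp
  finally show ?thesis .
qed

context stationary
begin

text \<open>Each test function is \<open>fourier \<psi>\<close>, and each term of the equation
  becomes an integral over frequencies against \<open>\<psi>\<close>, the symbols acting by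
  multiplication. It then remains to integrate the pointwise identity.\<close>

lemma weak_equation:
  assumes sU: "\<And>j. sq_integrable lborel (U j)" and V: "\<And>x j. V x $ j = U j x"
    and sg: "\<And>j. sq_integrable lborel (\<lambda>\<xi>. g \<xi> $ j)"
    and U: "\<And>j. inverse_transform (U j) (\<lambda>\<xi>. g \<xi> $ j / of_real c0)"
    and f: "transform_of f gf"
    and eq: "\<And>i. AE \<xi> in lborel. of_real (\<nu> * norm \<xi> powr \<alpha> + \<gamma>) * g \<xi> $ i
       + of_real (inverse (w \<xi>)) * (\<Sum>j\<in>UNIV. \<Sum>k\<in>UNIV. of_real (proj \<xi> i j) * (\<i> * of_real (\<xi> $ k) * flux U j k \<xi>))
       = gf \<xi> $ i"
  shows "stationary_equation \<alpha> \<beta> \<gamma> \<delta> \<nu> f V"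
  unfolding stationary_equation_def
proof (intro allI impI)
  fix i \<phi> assume \<phi>: "schwartz \<phi>"
  obtain \<psi> where \<psi>: "schwartz \<psi>" "fourier \<psi> = \<phi>" using \<phi> by (rule fourier_surj)
  \<comment> \<open>Two forms of the test function are needed: \<open>ift \<psi> (- x)\<close> fits
    the pairings with square-integrable fields, and \<open>ift \<chi>'\<close> fits the facts on
    multipliers and on the projector.\<close>
  define \<chi>' where "\<chi>' \<xi> = \<psi> (- \<xi>)" for \<xi>
  have \<chi>: "schwartz \<chi>'" unfolding \<chi>'_def by (rule schwartz_reflect[OF \<psi>(1)])
  have \<phi>\<psi>: "\<phi> = (\<lambda>x. ift \<psi> (- x))" using \<psi> fourier_eq_ift[OF schwartz_measurable[OF \<psi>(1)]] by auto
  have \<phi>\<chi>: "\<phi> = ift \<chi>'" unfolding \<phi>\<psi> \<chi>'_def[abs_def] using ift_reflect[of \<psi>] by auto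
  note r = schwartz_rapid[OF \<psi>(1)]
  note pairing = inverse_transform_pairing[OF U[unfolded c0_def] sg]
  have F: "(vdistr_of f $ i) \<phi> = (LINT \<xi>|lborel. gf \<xi> $ i * \<psi> \<xi>)"
    using f \<psi> by (auto simp: vdistr_of_def distr_of_def transform_of_def)
  have P: "(vdistr_of V $ i) \<phi> = (LINT \<xi>|lborel. g \<xi> $ i * \<psi> \<xi>)"
    using pairing[OF r schwartz_continuous[OF \<psi>(1)], of i] by (simp add: vdistr_of_def distr_of_def V \<phi>\<psi>)
  let ?a = "\<lambda>\<xi>. of_real (norm \<xi> powr \<alpha>) * \<psi> \<xi>"
  have ra: "rapid ?a" using \<alpha> by (intro rapid_moderate r moderate_norm_powr) simp
  have L: "(frac_laplacian (\<alpha> / 2) (vdistr_of V) $ i) \<phi> = (LINT \<xi>|lborel. g \<xi> $ i * ?a \<xi>)"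
  proof -
    have m: "(\<lambda>\<xi>::real^3. norm (- \<xi>) powr (2 * (\<alpha> / 2))) \<in> borel_measurable borel" by measurable
    have "fourier_multiplier (\<lambda>\<xi>. norm (- \<xi>) powr (2 * (\<alpha> / 2))) \<phi> = (\<lambda>x. ift ?a (- x))"
      unfolding \<phi>\<chi> fourier_multiplier_ift[OF \<chi> m] using ift_reflect[of ?a] by (auto simp: \<chi>'_def)
    moreover have "continuous_on UNIV ?a"
      using \<alpha> by (intro continuous_intros schwartz_continuous[OF \<psi>(1)] continuous_on_powr') auto
    ultimately show ?thesis
      using pairing[OF ra, of i] by (simp add: frac_laplacian_def multiplier_distr_def vdistr_of_def distr_of_def V)
  qed
  define b where "b \<xi> = (1 + \<delta>\<^sup>2 * (norm \<xi>)\<^sup>2) powr (- \<beta> / 2)" for \<xi> :: "real^3"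
  define T where "T j k \<xi> = of_real (proj \<xi> i j) * (\<i> * of_real (\<xi> $ k) * flux U j k \<xi>)" for j k \<xi>
  have bw: "b \<xi> = inverse (w \<xi>)" for \<xi>
    unfolding b_def w_def powr_minus[symmetric] by simp
  have sb: "schwartz (\<lambda>\<xi>. of_real (b \<xi>) * \<chi>' \<xi>)" unfolding b_def by (rule schwartz_bessel[OF \<chi>])
  have N: "(bessel_op \<delta> (- \<beta> / 2) (leray (tensor_div_distr (tensor_distr V V))) $ i) \<phi>
      = (\<Sum>j\<in>UNIV. \<Sum>k\<in>UNIV. LINT \<xi>|lborel. of_real (b \<xi>) * T j k \<xi> * \<psi> \<xi>)"
  proof -
    have m: "(\<lambda>\<xi>::real^3. (1 + \<delta>\<^sup>2 * (norm (- \<xi>))\<^sup>2) powr (- \<beta> / 2)) \<in> borel_measurable borel" by measurable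
    have "fourier_multiplier (\<lambda>\<xi>. (1 + \<delta>\<^sup>2 * (norm (- \<xi>))\<^sup>2) powr (- \<beta> / 2)) \<phi> = ift (\<lambda>\<xi>. of_real (b \<xi>) * \<chi>' \<xi>)"
      unfolding \<phi>\<chi> fourier_multiplier_ift[OF \<chi> m] by (simp add: b_def)
    then have "(bessel_op \<delta> (- \<beta> / 2) (leray (tensor_div_distr (tensor_distr V V))) $ i) \<phi>
        = (leray (tensor_div_distr (tensor_distr V V)) $ i) (ift (\<lambda>\<xi>. of_real (b \<xi>) * \<chi>' \<xi>))"
      by (simp only: bessel_op_def multiplier_distr_def vec_lambda_beta)
    also have "\<dots> = (\<Sum>j\<in>UNIV. \<Sum>k\<in>UNIV. LINT \<xi>|lborel. of_real (b \<xi>) * T j k \<xi> * \<psi> \<xi>)"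
      unfolding leray_apply[where U=U and V=V, OF sU V sb] by (simp add: T_def b_def \<chi>'_def mult_ac)
    finally show ?thesis .
  qed
  have i1: "integrable lborel (\<lambda>\<xi>. g \<xi> $ i * ?a \<xi>)" by (rule norm_integral_mult_le(1)[OF sg rapid_sq_integrable[OF ra]])
  have i2: "integrable lborel (\<lambda>\<xi>. g \<xi> $ i * \<psi> \<xi>)" by (rule norm_integral_mult_le(1)[OF sg rapid_sq_integrable[OF r]])
  have i3: "integrable lborel (\<lambda>\<xi>. of_real (b \<xi>) * T j k \<xi> * \<psi> \<xi>)" for j k
  proof -
    have "rapid (\<lambda>\<xi>. of_real (proj \<xi> i j) * (\<i> * of_real (\<xi> $ k) * (of_real (b \<xi>) * \<psi> \<xi>)))"
      unfolding b_def by (intro rapid_proj rapid_mult_component rapid_bessel r)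
    from integrable_rapid_flux[where U=U and j=j and k=k, OF sU this] show ?thesis
      by (simp add: T_def mult_ac)
  qed
  have "of_real \<nu> * (LINT \<xi>|lborel. g \<xi> $ i * ?a \<xi>) + (\<Sum>j\<in>UNIV. \<Sum>k\<in>UNIV. LINT \<xi>|lborel. of_real (b \<xi>) * T j k \<xi> * \<psi> \<xi>)
      + of_real \<gamma> * (LINT \<xi>|lborel. g \<xi> $ i * \<psi> \<xi>)
    = (LINT \<xi>|lborel. of_real \<nu> * (g \<xi> $ i * ?a \<xi>) + (\<Sum>j\<in>UNIV. \<Sum>k\<in>UNIV. of_real (b \<xi>) * T j k \<xi> * \<psi> \<xi>)
      + of_real \<gamma> * (g \<xi> $ i * \<psi> \<xi>))"
    using i1 i2 i3 by simp
  also have "\<dots> = (LINT \<xi>|lborel. gf \<xi> $ i * \<psi> \<xi>)"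
  proof (rule integral_cong_AE)
    have "integrable lborel (\<lambda>\<xi>. of_real \<nu> * (g \<xi> $ i * ?a \<xi>) + (\<Sum>j\<in>UNIV. \<Sum>k\<in>UNIV. of_real (b \<xi>) * T j k \<xi> * \<psi> \<xi>)
      + of_real \<gamma> * (g \<xi> $ i * \<psi> \<xi>))" using i1 i2 i3 by simp
    then show "(\<lambda>\<xi>. of_real \<nu> * (g \<xi> $ i * ?a \<xi>) + (\<Sum>j\<in>UNIV. \<Sum>k\<in>UNIV. of_real (b \<xi>) * T j k \<xi> * \<psi> \<xi>)
      + of_real \<gamma> * (g \<xi> $ i * \<psi> \<xi>)) \<in> borel_measurable lborel" by (rule borel_measurable_integrable)
    have "sq_integrable lborel (\<lambda>\<xi>. gf \<xi> $ i)" using f by (intro sq_integrable_vec3_nth) (simp add: transform_of_def)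
    then show "(\<lambda>\<xi>. gf \<xi> $ i * \<psi> \<xi>) \<in> borel_measurable lborel"
      using norm_integral_mult_le(1)[OF _ rapid_sq_integrable[OF r]] by (intro borel_measurable_integrable)
    show "AE \<xi> in lborel. of_real \<nu> * (g \<xi> $ i * ?a \<xi>) + (\<Sum>j\<in>UNIV. \<Sum>k\<in>UNIV. of_real (b \<xi>) * T j k \<xi> * \<psi> \<xi>)
      + of_real \<gamma> * (g \<xi> $ i * \<psi> \<xi>) = gf \<xi> $ i * \<psi> \<xi>"
      using eq[of i]
    proof eventually_elim
      case (elim \<xi>)
      have "(\<Sum>j\<in>UNIV. \<Sum>k\<in>UNIV. of_real (b \<xi>) * T j k \<xi> * \<psi> \<xi>)
          = of_real (inverse (w \<xi>)) * (\<Sum>j\<in>UNIV. \<Sum>k\<in>UNIV. T j k \<xi>) * \<psi> \<xi>"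
        by (simp only: sum_distrib_left sum_distrib_right bw)
      then show ?case
        unfolding elim[symmetric] T_def[symmetric] by (simp add: algebra_simps)
    qed
  qed
  finally show "of_real \<nu> * (frac_laplacian (\<alpha> / 2) (vdistr_of V) $ i) \<phi>
        + (bessel_op \<delta> (- \<beta> / 2) (leray (tensor_div_distr (tensor_distr V V))) $ i) \<phi>
        = (vdistr_of f $ i) \<phi> - of_real \<gamma> * (vdistr_of V $ i) \<phi>"
    unfolding F P L N by (simp add: algebra_simps)
qed

theorem stationary_solution:
  assumes f: "transform_of f gf" and df: "divergence_free f"
  shows "\<exists>V. sobolev ((\<alpha> + \<beta>) / 2) V \<and> stationary_equation \<alpha> \<beta> \<gamma> \<delta> \<nu> f V \<and> divergence_free V \<and>
    sobolev_norm ((\<alpha> + \<beta>) / 2) V \<le> (2 * pi) powr (- 3 / 2) * \<rho>"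
proof -
  obtain g U where sg: "sq_integrable lborel (\<lambda>\<xi>. h \<xi> *\<^sub>R g \<xi>)" and ng: "norm (abs_l2 (\<lambda>\<xi>. h \<xi> *\<^sub>R g \<xi>)) \<le> \<rho>"
    and dg: "AE \<xi> in lborel. (\<Sum>j\<in>UNIV. of_real (\<xi> $ j) * g \<xi> $ j) = 0"
    and U: "\<forall>j. inverse_transform (U j) (\<lambda>\<xi>. g \<xi> $ j / of_real c0)"
    and eq: "\<forall>i. AE \<xi> in lborel. of_real (\<nu> * norm \<xi> powr \<alpha> + \<gamma>) * g \<xi> $ i
       + of_real (inverse (w \<xi>)) * (\<Sum>j\<in>UNIV. \<Sum>k\<in>UNIV. of_real (proj \<xi> i j) * (\<i> * of_real (\<xi> $ k) * flux U j k \<xi>))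
       = gf \<xi> $ i"
    using fourier_solution[OF transform_of_hermitian[OF f] divergence_free_iff[OF f, THEN iffD1, OF df]]
    by (elim exE conjE) (rule that; assumption)
  define V where "V x = (\<chi> j. U j x)" for x
  have V: "V x $ j = U j x" for x j by (simp add: V_def)
  have sU: "sq_integrable lborel (U j)" for j using U by (simp add: inverse_transform_def)
  have sgj: "sq_integrable lborel (\<lambda>\<xi>. g \<xi> $ j)" for j
    by (rule sq_integrable_unweighted[OF sg moderate_measurable[OF moderate_h] h_ge_1])
  have tV: "transform_of V g"
    unfolding transform_of_def
  proof (intro conjI allI impI sq_integrable_vec3I sgj)
    fix i \<phi> assume \<phi>: "schwartz \<phi>"
    show "(LINT \<xi>|lborel. g \<xi> $ i * \<phi> \<xi>) = (LINT x|lebesgue. of_real (V x $ i) * fourier \<phi> x)"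
      using inverse_transform_pairing[OF U[rule_format, unfolded c0_def] sgj schwartz_rapid[OF \<phi>] schwartz_continuous[OF \<phi>], of i]
      by (simp add: V fourier_eq_ift schwartz_measurable \<phi>)
  qed
  have L2: "in_L2 V" by (rule in_L2_vec3) (simp add: V sU)
  have w: "(\<lambda>\<xi>. (1 + (norm \<xi>)\<^sup>2) powr ((\<alpha> + \<beta>) / 2 / 2) *\<^sub>R g \<xi>) = (\<lambda>\<xi>. h \<xi> *\<^sub>R g \<xi>)"
    by (simp add: h_def)
  note S = sobolev_transform[OF L2 tV, of "(\<alpha> + \<beta>) / 2", unfolded w, OF sg]
  have "stationary_equation \<alpha> \<beta> \<gamma> \<delta> \<nu> f V"
    by (rule weak_equation[OF sU V sgj U[rule_format] f eq[rule_format]])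
  moreover have "divergence_free V" using divergence_free_iff[OF tV] dg by simp
  moreover have "sobolev_norm ((\<alpha> + \<beta>) / 2) V \<le> (2 * pi) powr (- 3 / 2) * \<rho>"
    unfolding S(2) by (intro mult_left_mono ng) simp
  ultimately show ?thesis using S(1) by blast
qed

end

theorem theorem2p3:
  fixes \<alpha> \<beta> \<gamma> \<delta> \<nu> :: real and f :: "real^3 \<Rightarrow> real^3"
  assumes "\<alpha> > 0" and "\<beta> \<ge> 0" and "\<gamma> > 0" and "\<delta> > 0" and "\<nu> > 0"
    and "sobolev (\<beta> / 2) f" and "divergence_free f"
  shows "\<exists>U :: real^3 \<Rightarrow> real^3.
    sobolev ((\<alpha> + \<beta>) / 2) U \<and>
    stationary_equation \<alpha> \<beta> \<gamma> \<delta> \<nu> f U \<and>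
    divergence_free U \<and>
    sobolev_norm ((\<alpha> + \<beta>) / 2) U
      \<le> max 1 (\<delta> powr \<beta>) / (min 1 (\<delta> powr \<beta>) * (m_const \<alpha> * min \<gamma> \<nu>))
        * sobolev_norm (\<beta> / 2) f"
proof -
  obtain g where g: "transform_of f g" "sq_integrable lborel (\<lambda>\<xi>. (1 + (norm \<xi>)\<^sup>2) powr (\<beta> / 2 / 2) *\<^sub>R g \<xi>)"
    using sobolev_transform_exists[OF assms(6)] by blast
  interpret stationary \<alpha> \<beta> \<gamma> \<delta> \<nu> g
    using assms g(2) by unfold_locales simp_all
  have "in_L2 f" using assms(6) by (simp add: sobolev_def)
  from sobolev_transform(2)[OF this g] have "sobolev_norm (\<beta> / 2) f = (2 * pi) powr (- 3 / 2) * norm load"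
    by (simp add: load_def)
  \<comment> \<open>Both Sobolev norms carry the same normalising factor (2 pi)^(-3/2), so the bound
    on the Fourier side transfers with its constant unchanged.\<close>
  then have "(2 * pi) powr (- 3 / 2) * \<rho>
      = max 1 (\<delta> powr \<beta>) / (min 1 (\<delta> powr \<beta>) * (m_const \<alpha> * min \<gamma> \<nu>)) * sobolev_norm (\<beta> / 2) f"
    by (simp add: \<rho>_def \<kappa>_def)
  then show ?thesis using stationary_solution[OF g(1) assms(7)] by simp
qed

end
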